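(* Let $X$ be a locally compact second countable space and $\alpha\in(0,1]$. A point process $\Phi$ on $X$ is discrete $\alpha$-stable if and only if its probability generating functional has the form $$G_\Phi[u]=\exp\Bigl\{-\int_{\mathbb{S}}\langle 1-u,\mu\rangle^\alpha\,\sigma(d\mu)\Bigr\},\qquad 1-u\in\mathrm{BM}(X),$$ for some locally finite measure $\sigma$ on $\mathbb{S}$ (the spectral measure) that satisfies $$\int_{\mathbb{S}}\mu(B)^\alpha\,\sigma(d\mu)<\infty\quad\text{for all relatively compact Borel sets } B\subset X.$$
   Context: $X$ is a locally compact second countable (Hausdorff) space with its Borel $\sigma$-algebra. $\mathbb{M}$ is the space of (non-negative) Radon measures on $X$ (finite on relatively compact Borel sets), with the $\sigma$-algebra generated by evaluations on Borel sets (and the vague topology). A point process is a random element of $\mathbb{M}$ whose realisations are locally finite counting measures $\phi=\sum_i\delta_{x_i}$ (multiple points allowed). $\mathrm{BM}(X)$ is the set of non-negative bounded measurable functions on $X$ with compact support; $\langle h,\mu\rangle=\int_X h\,d\mu$. The probability generating functional of $\Phi$ is $G_\Phi[u]=\mathbf{E}\exp\{\langle\log u,\Phi\rangle\}$ for measurable $u:X\to(0,1]$ with $1-u\in\mathrm{BM}(X)$. Thinning: for $t\in[0,1]$, $t\circ\Phi$ is obtained by retaining each unit mass of $\Phi$ with probability $t$ and removing it with probability $1-t$, independently of the other masses. $\Phi$ is discrete $\alpha$-stable if $t^{1/\alpha}\circ\Phi'+(1-t)^{1/\alpha}\circ\Phi''\overset{\mathcal D}{=}\Phi$ for all $t\in[0,1]$,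 where $\Phi',\Phi''$ are independent copies of $\Phi$ (and the two thinnings are independent). Sphere $\mathbb{S}$: fix a countable base $B_1,B_2,\dots$ of the topology of $X$ consisting of relatively compact sets and put $B_0=X$. For $\mu\in\mathbb{M}\setminus\{0\}$ let $i(\mu)$ be the smallest $i\ge0$ with $0<\mu(B_i)<\infty$, and let $\mathbb{S}=\{\mu\in\mathbb{M}\setminus\{0\}:\mu(B_{i(\mu)})=1\}$. Every $\mu\in\mathbb{M}\setminus\{0\}$ is uniquely $t\hat\mu$ with $t>0$, $\hat\mu\in\mathbb{S}$. *)

theory Defs
  imports "HOL-Probability.Probability"
begin

section \<open>Radon measures\<close>

definition rel_compact :: "'a::topological_space set \<Rightarrow> bool" where
  "rel_compact B \<longleftrightarrow> compact (closure B)"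

definition radon_measures :: "'a::topological_space measure set" where
  "radon_measures =
     {\<mu>. sets \<mu> = sets borel \<and> (\<forall>B\<in>sets borel. rel_compact B \<longrightarrow> emeasure \<mu> B < \<infinity>)}"

definition radon_algebra :: "'a::topological_space measure measure" where
  "radon_algebra =
     (SUP B\<in>sets borel. vimage_algebra radon_measures (\<lambda>\<mu>. emeasure \<mu> B) borel)"

lemma space_radon_algebra [simp]: "space radon_algebra = radon_measures"
  by (subst radon_algebra_def, subst space_Sup_eq_UN) auto

definition vague_topology :: "'a::topological_space measure topology" where
  "vague_topology = topology_generated_by
     {{\<mu>\<in>radon_measures. (LINT x|\<mu>. f x) \<in> U} | (f :: 'a \<Rightarrow> real) U.
        continuous_on UNIV f \<and> compact (closure {x. f x \<noteq> 0}) \<and> open U}"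

lemma topspace_vague_topology [simp]: "topspace vague_topology = radon_measures"
proof -
  have "radon_measures = {\<mu>\<in>radon_measures. (LINT x|\<mu>. (\<lambda>_. 0 :: real) x) \<in> UNIV}"
    by simp
  moreover have "continuous_on UNIV (\<lambda>_. 0 :: real)" "open (UNIV :: real set)"
    "compact (closure {x. (\<lambda>_. 0 :: real) x \<noteq> 0})"
    by auto
  ultimately show ?thesis
    unfolding vague_topology_def topology_generated_by_topspace by blast
qed

definition superpose :: "'a measure \<Rightarrow> 'a measure \<Rightarrow> 'a measure" where
  "superpose \<mu> \<nu> = measure_of (space \<mu>) (sets \<mu>) (\<lambda>A. emeasure \<mu> A + emeasure \<nu> A)"

lemma emeasure_superpose:
  assumes "sets \<mu> = sets \<nu>" "A \<in> sets \<mu>"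
  shows "emeasure (superpose \<mu> \<nu>) A = emeasure \<mu> A + emeasure \<nu> A"
proof (rule emeasure_measure_of[OF superpose_def])
  show "countably_additive (sets (superpose \<mu> \<nu>)) (\<lambda>A. emeasure \<mu> A + emeasure \<nu> A)"
    unfolding superpose_def sets.sets_measure_of_eq
  proof (rule countably_additiveI)
    fix F :: "nat \<Rightarrow> 'a set"
    assume F: "range F \<subseteq> sets \<mu>" "disjoint_family F"
    then have "range F \<subseteq> sets \<nu>"
      using assms(1) by simp
    with F show "(\<Sum>i. emeasure \<mu> (F i) + emeasure \<nu> (F i)) =
        emeasure \<mu> (\<Union> (range F)) + emeasure \<nu> (\<Union> (range F))"
      by (simp add: suminf_add[symmetric] suminf_emeasure)
  qed
next
  show "A \<in> sets (superpose \<mu> \<nu>)"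
    using assms(2) by (simp add: superpose_def)
qed (simp_all add: sets.space_closed positive_def)

section \<open>Point processes and thinning\<close>

text \<open>
  The measure \<open>distr (count_space I) borel x\<close> is the sum of the unit masses at \<open>x i\<close>
  over \<open>i \<in> I\<close>; repetitions among the \<open>x i\<close> give multiple points.
\<close>

definition counting_measure :: "'a::topological_space measure \<Rightarrow> bool" where
  "counting_measure \<phi> \<longleftrightarrow>
     (\<exists>(I :: nat set) (x :: nat \<Rightarrow> 'a). \<phi> = distr (count_space I) borel x)"

definition point_process :: "'w measure \<Rightarrow> ('w \<Rightarrow> 'a::topological_space measure) \<Rightarrow> bool" where
  "point_process P \<Phi> \<longleftrightarrow>
     \<Phi> \<in> P \<rightarrow>\<^sub>M radon_algebra \<and> (\<forall>\<omega>\<in>space P. counting_measure (\<Phi> \<omega>))"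

text \<open>
  A point carrying mass \<open>n\<close> contributes the \<open>n\<close> labelled unit masses
  \<open>(x, 0), \<dots>, (x, n - 1)\<close>, so each unit mass can be kept or removed individually.
\<close>

definition unit_masses :: "'a::topological_space measure \<Rightarrow> ('a \<times> nat) set" where
  "unit_masses \<phi> = {(x, k). of_nat k < emeasure \<phi> {x}}"

definition thin :: "real \<Rightarrow> 'a::topological_space measure \<Rightarrow> 'a measure measure" where
  "thin t \<phi> = distr (\<Pi>\<^sub>M p\<in>unit_masses \<phi>. measure_pmf (bernoulli_pmf t)) radon_algebra
     (\<lambda>\<beta>. distr (count_space {p \<in> unit_masses \<phi>. \<beta> p}) borel fst)"

definition thinned_law ::
  "'w measure \<Rightarrow> ('w \<Rightarrow> 'a::topological_space measure) \<Rightarrow> real \<Rightarrow> 'a measure measure" where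
  "thinned_law P \<Phi> t = P \<bind> (\<lambda>\<omega>. thin t (\<Phi> \<omega>))"

text \<open>
  Thinning independent copies of \<open>\<Phi>\<close> independently of each other yields an independent
  pair, whence the product of the two laws below.
\<close>

definition discrete_stable ::
  "'w measure \<Rightarrow> ('w \<Rightarrow> 'a::topological_space measure) \<Rightarrow> real \<Rightarrow> bool" where
  "discrete_stable P \<Phi> \<alpha> \<longleftrightarrow>
     (\<forall>t\<in>{0..1}.
        distr (thinned_law P \<Phi> (t powr (1 / \<alpha>)) \<Otimes>\<^sub>M thinned_law P \<Phi> ((1 - t) powr (1 / \<alpha>)))
          radon_algebra (\<lambda>(\<mu>, \<nu>). superpose \<mu> \<nu>)
        = distr P radon_algebra \<Phi>)"

section \<open>Probability generating functional\<close>

definition BM :: "('a::topological_space \<Rightarrow> real) set" where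
  "BM = {h \<in> borel_measurable borel.
     (\<forall>x. 0 \<le> h x) \<and> bounded (range h) \<and> compact (closure {x. h x \<noteq> 0})}"

definition pgfl ::
  "'w measure \<Rightarrow> ('w \<Rightarrow> 'a::topological_space measure) \<Rightarrow> ('a \<Rightarrow> real) \<Rightarrow> real" where
  "pgfl P \<Phi> u = (LINT \<omega>|P. exp (LINT x|\<Phi> \<omega>. ln (u x)))"

section \<open>The sphere\<close>

definition base_seq :: "(nat \<Rightarrow> 'a::topological_space set) \<Rightarrow> bool" where
  "base_seq B \<longleftrightarrow>
     B 0 = UNIV \<and> topological_basis (B ` {1..}) \<and> (\<forall>i\<ge>1. rel_compact (B i))"

definition first_index :: "(nat \<Rightarrow> 'a set) \<Rightarrow> 'a measure \<Rightarrow> nat" where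
  "first_index B \<mu> = (LEAST i. 0 < emeasure \<mu> (B i) \<and> emeasure \<mu> (B i) < \<infinity>)"

definition sphere :: "(nat \<Rightarrow> 'a::topological_space set) \<Rightarrow> 'a measure set" where
  "sphere B = {\<mu> \<in> radon_measures - {null_measure borel}. emeasure \<mu> (B (first_index B \<mu>)) = 1}"

definition locally_finite_on_sphere ::
  "(nat \<Rightarrow> 'a::topological_space set) \<Rightarrow> 'a measure measure \<Rightarrow> bool" where
  "locally_finite_on_sphere B \<sigma> \<longleftrightarrow>
     sets \<sigma> = sets (restrict_space radon_algebra (sphere B)) \<and>
     (\<forall>\<mu>\<in>sphere B. \<exists>U. openin (subtopology vague_topology (sphere B)) U \<and> \<mu> \<in> U \<and>
        U \<in> sets \<sigma> \<and> emeasure \<sigma> U < \<infinity>)"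

end

theory Submission
  imports Defs
begin

text \<open>
  Discrete stability says \<open>G[1 - t\<^sup>1\<^sup>/\<^sup>\<alpha> k] G[1 - (1 - t)\<^sup>1\<^sup>/\<^sup>\<alpha> k] = G[1 - k]\<close>, so \<open>t \<mapsto> - ln G[1 - t\<^sup>1\<^sup>/\<^sup>\<alpha> k]\<close>
  is additive and monotone, hence linear. Thus \<open>- ln G[1 - k] = \<psi> k\<close> for a functional \<open>\<psi>\<close> that is homogeneous
  of degree \<open>\<alpha>\<close>, and \<open>\<psi> k\<close> is the limit of \<open>N\<^sup>\<alpha> (1 - E exp (- \<langle>k, \<Phi>\<rangle> / N))\<close>.

  Let \<open>\<alpha> < 1\<close> and fix a strictly positive \<open>h0\<close> with \<open>\<langle>h0, \<Phi>\<rangle> < \<infinity>\<close> almost surely. The laws of \<open>\<Phi> / N\<close>, weighted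
  by \<open>N\<^sup>\<alpha> (exp (- \<langle>h0, \<Phi>\<rangle> / N) - exp (- 2 \<langle>h0, \<Phi>\<rangle> / N))\<close>, have converging total masses; along a subsequence they
  converge to a multiple of the law of a random measure \<open>\<mu>\<close> with \<open>\<delta> E exp (- \<langle>g, \<mu>\<rangle>) = \<psi> (g + 2 h0) - \<psi> (g + h0)\<close>. Integrating
  \<open>1 - exp (- s \<langle>h, \<mu>\<rangle>)\<close> against \<open>s\<^sup>-\<^sup>\<alpha>\<^sup>-\<^sup>1 ds\<close> turns the right-hand side into a Frullani integral that
  evaluates to a multiple of \<open>\<psi> h\<close>; hence \<open>E \<langle>h, \<mu>\<rangle>\<^sup>\<alpha>\<close> is proportional to \<open>\<psi> h\<close>. For \<open>\<alpha> = 1\<close> one has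
  \<open>\<psi> h = E \<langle>h, \<Phi>\<rangle>\<close>, and the intensity measure takes the place of \<open>\<mu>\<close>. Normalising \<open>\<mu>\<close> to the sphere with a
  homogeneous density gives the spectral measure.
\<close>

text \<open>Formally \<psi> h is the integral of 1 - exp (- <h, m>) over Radon measures m, against a
  measure that is homogeneous of order -\<alpha> and has infinite mass near m = 0. The weight w s =
  exp (- s) - exp (- 2 s), taken at s = <h0, m>, vanishes at 0 and at infinity. It makes that
  measure finite, and by homogeneity the \<alpha>-moments of the weighted measure are a constant
  times \<psi>, the constant containing the integral of w s / s, which is ln 2. The simpler weight 1
  - exp (- s) also gives finite mass, but its \<alpha>-moments diverge. For \<alpha> = 1 the
  integral of (1 - exp (- s)) s^(-2) diverges at 0, hence the separate treatment. The limit has to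
  be a random measure on the original space, not just a family of numbers. Compactness is therefore
  moved to the line: points are coded by reals, and \<Phi> / N by its values on rational intervals
  of codes. The coding is not continuous, so the limit is identified by the continuity of \<psi>
  under almost everywhere convergence rather than by vague convergence.\<close>

section \<open>A monotone class theorem for multiplicative families\<close>

text \<open>Stone-Weierstrass turns products of members of \<open>C\<close> into continuous
  functions of them, bounded limits of these are indicators of the level sets
  \<open>f x > c\<close>, and a Dynkin argument reaches the generated \<sigma>-algebra. The
  functions are total on the type, so the unit \<open>e\<close> and all bounds are only required on
  \<Omega>.\<close>

lemma functional_monotone_class:
  fixes C V :: "('a \<Rightarrow> real) set" and \<Omega> :: "'a set"
  assumes one: "e \<in> C" "\<And>x. x \<in> \<Omega> \<Longrightarrow> e x = 1"
    and mult: "\<And>f g. f \<in> C \<Longrightarrow> g \<in> C \<Longrightarrow> (\<lambda>x. f x * g x) \<in> C"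
    and bnd: "\<And>f x. f \<in> C \<Longrightarrow> x \<in> \<Omega> \<Longrightarrow> 0 \<le> f x \<and> f x \<le> 1"
    and CV: "C \<subseteq> V"
    and add: "\<And>f g. f \<in> V \<Longrightarrow> g \<in> V \<Longrightarrow> (\<lambda>x. f x + g x) \<in> V"
    and scale: "\<And>f c. f \<in> V \<Longrightarrow> (\<lambda>x. c * f x) \<in> V"
    and lim: "\<And>f F K. (\<And>n. F n \<in> V) \<Longrightarrow> (\<And>n x. x \<in> \<Omega> \<Longrightarrow> \<bar>F n x\<bar> \<le> K) \<Longrightarrow>
        (\<And>x. x \<in> \<Omega> \<Longrightarrow> (\<lambda>n. F n x) \<longlonglongrightarrow> f x) \<Longrightarrow> f \<in> V"
    and A: "A \<in> sigma_sets \<Omega> {{x \<in> \<Omega>. f x > c} | f c. f \<in> C}"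
  shows "indicator A \<in> V"
proof -
  \<comment> \<open>\<open>W\<close> collects the multipliers that carry \<open>C\<close> into
    \<open>V\<close>. Unlike \<open>V\<close>, its members with values in [0, 1] can be multiplied
    again by continuous functions of members of \<open>C\<close>, which is how finite intersections
    of level sets are reached.\<close>
  define W where "W = {G. \<forall>g\<in>C. (\<lambda>x. g x * G x) \<in> V}"
  have zero: "(\<lambda>_. 0) \<in> V"
    using scale[of e 0] one CV by auto
  have sumV: "(\<lambda>x. \<Sum>i\<in>I. F i x) \<in> V" if "finite I" "\<And>i. i \<in> I \<Longrightarrow> F i \<in> V" for I :: "nat set" and F
    using that by (induction I) (auto intro: zero add)
  have Wcont: "(\<lambda>x. p (f x) * G x) \<in> W"
    if f: "f \<in> C" and G: "G \<in> W" and Gb: "\<And>x. x \<in> \<Omega> \<Longrightarrow> 0 \<le> G x \<and> G x \<le> 1"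
      and p: "continuous_on {0..1} p" for f G and p :: "real \<Rightarrow> real"
    unfolding W_def
  proof (intro CollectI ballI)
    fix g assume g: "g \<in> C"
    have pow: "(\<lambda>x. g x * f x ^ k) \<in> C" for k
    proof (induction k)
      case (Suc k)
      from mult[OF this f] show ?case by (simp add: mult_ac)
    qed (use g in simp)
    have "\<exists>q. real_polynomial_function q \<and> (\<forall>x\<in>{0..1}. \<bar>p x - q x\<bar> < 1 / Suc n)" for n
    proof -
      have "0 < 1 / real (Suc n)" by simp
      from Stone_Weierstrass_real_polynomial_function[OF compact_Icc p this] show ?thesis
        by metis
    qed
    then obtain q where q: "\<And>n. real_polynomial_function (q n)"
      "\<And>n x. x \<in> {0..1} \<Longrightarrow> \<bar>p x - q n x\<bar> < 1 / Suc n"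
      by metis
    have qV: "(\<lambda>x. g x * (q n (f x) * G x)) \<in> V" for n
    proof -
      obtain a m where am: "q n = (\<lambda>x. \<Sum>i\<le>m. a i * x ^ i)"
        using q(1)[of n] unfolding real_polynomial_function_iff_sum by blast
      have "(\<lambda>x. \<Sum>i\<in>{..m}. a i * ((g x * f x ^ i) * G x)) \<in> V"
        using pow G unfolding W_def by (intro sumV scale) auto
      then show ?thesis
        by (simp add: am sum_distrib_left sum_distrib_right mult_ac)
    qed
    have "bounded (p ` {0..1})"
      by (intro compact_imp_bounded compact_continuous_image p compact_Icc)
    then obtain K where K: "\<And>x. x \<in> {0..1} \<Longrightarrow> \<bar>p x\<bar> \<le> K"
      unfolding bounded_iff ball_simps real_norm_def by blast
    show "(\<lambda>x. g x * (p (f x) * G x)) \<in> V"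
    proof (rule lim[OF qV])
      fix n x assume x: "x \<in> \<Omega>"
      have fx: "f x \<in> {0..1}" using bnd[OF f x] by auto
      have "\<bar>q n (f x)\<bar> \<le> K + 1"
      proof -
        have "\<bar>q n (f x)\<bar> \<le> \<bar>p (f x)\<bar> + \<bar>p (f x) - q n (f x)\<bar>" by linarith
        also have "\<dots> \<le> K + 1 / Suc n" using K[OF fx] q(2)[OF fx, of n] by linarith
        also have "\<dots> \<le> K + 1" by simp
        finally show ?thesis .
      qed
      moreover have "\<bar>g x\<bar> \<le> 1" "\<bar>G x\<bar> \<le> 1" using bnd[OF g x] Gb[OF x] by auto
      ultimately have "\<bar>g x\<bar> * (\<bar>q n (f x)\<bar> * \<bar>G x\<bar>) \<le> 1 * ((K+1) * 1)"
        using K[OF fx] by (intro mult_mono) auto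
      then show "\<bar>g x * (q n (f x) * G x)\<bar> \<le> K + 1"
        by (simp add: abs_mult)
    next
      fix x assume x: "x \<in> \<Omega>"
      have fx: "f x \<in> {0..1}" using bnd[OF f x] by auto
      have "(\<lambda>n. p (f x) - q n (f x)) \<longlonglongrightarrow> 0"
      proof (rule Lim_null_comparison)
        show "\<forall>\<^sub>F n in sequentially. norm (p (f x) - q n (f x)) \<le> 1 / real (Suc n)"
          using q(2)[OF fx] by (intro always_eventually allI) (auto intro: less_imp_le)
        show "(\<lambda>n. 1 / real (Suc n)) \<longlonglongrightarrow> 0"
          using LIMSEQ_inverse_real_of_nat by (simp add: inverse_eq_divide)
      qed
      then have "(\<lambda>n. p (f x) - (p (f x) - q n (f x))) \<longlonglongrightarrow> p (f x) - 0"
        by (intro tendsto_intros)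
      then have "(\<lambda>n. q n (f x)) \<longlonglongrightarrow> p (f x)" by simp
      then show "(\<lambda>n. g x * (q n (f x) * G x)) \<longlonglongrightarrow> g x * (p (f x) * G x)"
        by (intro tendsto_intros)
    qed
  qed
  have Wind: "(\<lambda>x. indicator {x\<in>\<Omega>. f x > c} x * G x) \<in> W"
    if f: "f \<in> C" and G: "G \<in> W" and Gb: "\<And>x. x \<in> \<Omega> \<Longrightarrow> 0 \<le> G x \<and> G x \<le> 1" for f G c
    unfolding W_def
  proof (intro CollectI ballI)
    fix g assume g: "g \<in> C"
    \<comment> \<open>Ramps of slope \<open>n\<close>. At \<open>x = c\<close> they vanish, so their
      limit is the indicator of the strict inequality.\<close>
    define p where "p n x = min 1 (max 0 (real n * (x - c)))" for n :: nat and x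
    have pV: "(\<lambda>x. g x * (p n (f x) * G x)) \<in> V" for n
    proof -
      have "continuous_on {0..1} (p n)" unfolding p_def by (intro continuous_intros)
      from Wcont[OF f G Gb this] g show ?thesis unfolding W_def by auto
    qed
    show "(\<lambda>x. g x * (indicator {x\<in>\<Omega>. f x > c} x * G x)) \<in> V"
    proof (rule lim[OF pV])
      fix n x assume x: "x \<in> \<Omega>"
      have "\<bar>g x\<bar> * (\<bar>p n (f x)\<bar> * \<bar>G x\<bar>) \<le> 1 * (1 * 1)"
        using bnd[OF g x] Gb[OF x] by (intro mult_mono) (auto simp: p_def)
      then show "\<bar>g x * (p n (f x) * G x)\<bar> \<le> 1" by (simp add: abs_mult)
    next
      fix x assume x: "x \<in> \<Omega>"
      have "(\<lambda>n. p n (f x)) \<longlonglongrightarrow> indicator {x\<in>\<Omega>. f x > c} x"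
      proof (cases "f x > c")
        case True
        then obtain N where N: "real N * (f x - c) > 1"
          using reals_Archimedean3[of "f x - c"] by auto
        have "\<forall>\<^sub>F n in sequentially. p n (f x) = 1"
          using eventually_ge_at_top[of N]
        proof eventually_elim
          case (elim n)
          have "real N * (f x - c) \<le> real n * (f x - c)"
            using elim True by (intro mult_right_mono) auto
          then show ?case using N by (auto simp: p_def)
        qed
        then show ?thesis using True x by (simp add: tendsto_eventually)
      next
        case False
        then have "real n * (f x - c) \<le> 0" for n by (intro mult_nonneg_nonpos) auto
        then have "p n (f x) = 0" for n by (simp add: p_def max_absorb1)
        then show ?thesis using False by simp
      qed
      then show "(\<lambda>n. g x * (p n (f x) * G x)) \<longlonglongrightarrow> g x * (indicator {x\<in>\<Omega>. f x > c} x * G x)"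
        by (intro tendsto_intros)
    qed
  qed
  define E where "E = {D. D \<subseteq> \<Omega> \<and> indicator D \<in> W}"
  define \<G> where "\<G> = {\<Omega> \<inter> \<Inter>F | F. finite F \<and> F \<subseteq> {{x \<in> \<Omega>. f x > c} | f c. f \<in> C}}"
  have "indicator \<Omega> \<in> W"
    unfolding W_def
  proof (intro CollectI ballI)
    fix g assume g: "g \<in> C"
    show "(\<lambda>x. g x * indicator \<Omega> x) \<in> V"
      by (rule lim[of "\<lambda>_. g" 1]) (use g CV bnd[OF g] in auto)
  qed
  then have \<Omega>W: "indicator \<Omega> \<in> W" .
  have GE: "\<Omega> \<inter> \<Inter>F \<in> E" if "finite F" "F \<subseteq> {{x \<in> \<Omega>. f x > c} | f c. f \<in> C}" for F
    using that
  proof (induction F rule: finite_induct)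
    case (insert D F)
    then obtain f c where D: "D = {x \<in> \<Omega>. f x > c}" "f \<in> C" by auto
    have "(\<lambda>x. indicator D x * indicator (\<Omega> \<inter> \<Inter>F) x) \<in> W"
      unfolding D(1)
    proof (rule Wind[OF D(2)])
      show "indicator (\<Omega> \<inter> \<Inter>F) \<in> W" using insert by (simp add: E_def)
    qed (auto simp: indicator_def)
    moreover have "(\<lambda>x. indicator D x * indicator (\<Omega> \<inter> \<Inter>F) x) = (indicator (\<Omega> \<inter> \<Inter>(insert D F)) :: 'a \<Rightarrow> real)"
      by (auto simp: indicator_def)
    ultimately show ?case by (auto simp: E_def)
  qed (use \<Omega>W in \<open>auto simp: E_def\<close>)
  have "Int_stable \<G>"
    unfolding Int_stable_def \<G>_def
  proof safe
    fix F F' assume *: "finite F" "finite F'" "F \<subseteq> {{x \<in> \<Omega>. f x > c} | f c. f \<in> C}"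
      "F' \<subseteq> {{x \<in> \<Omega>. f x > c} | f c. f \<in> C}"
    show "\<exists>F''. \<Omega> \<inter> \<Inter>F \<inter> (\<Omega> \<inter> \<Inter>F') = \<Omega> \<inter> \<Inter>F'' \<and> finite F'' \<and> F'' \<subseteq> {{x \<in> \<Omega>. f x > c} | f c. f \<in> C}"
      by (rule exI[of _ "F \<union> F'"]) (use * in auto)
  qed
  moreover have "\<G> \<subseteq> Pow \<Omega>" by (auto simp: \<G>_def)
  moreover have "A \<in> sigma_sets \<Omega> \<G>"
  proof -
    have "{{x \<in> \<Omega>. f x > c} | f c. f \<in> C} \<subseteq> \<G>"
    proof
      fix D assume D: "D \<in> {{x \<in> \<Omega>. f x > c} | f c. f \<in> C}"
      then have "D = \<Omega> \<inter> \<Inter>{D}" by auto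
      then show "D \<in> \<G>" unfolding \<G>_def using D by blast
    qed
    then show ?thesis using A sigma_sets_mono' by blast
  qed
  ultimately have "A \<in> E"
  proof (induction A rule: sigma_sets_induct_disjoint)
    case (basic A)
    then show ?case using GE by (auto simp: \<G>_def)
  next
    case empty
    show ?case using zero by (auto simp: E_def W_def)
  next
    case (compl A)
    have "(\<lambda>x. g x * indicator (\<Omega> - A) x) \<in> V" if g: "g \<in> C" for g
    proof (rule lim[where K=1])
      have "(\<lambda>x. g x + (-1) * (g x * indicator A x)) \<in> V"
        using compl g CV by (intro add scale) (auto simp: E_def W_def)
      then show "\<And>n::nat. (\<lambda>x. g x + (-1) * (g x * indicator A x)) \<in> V" by simp
    qed (use bnd[OF g] in \<open>auto simp: indicator_def\<close>)
    then show ?case by (auto simp: E_def W_def)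
  next
    case (union A)
    have "(\<lambda>x. g x * indicator (\<Union>i. A i) x) \<in> V" if g: "g \<in> C" for g
    proof (rule lim[where K=1])
      show "(\<lambda>x. \<Sum>i\<in>{..<n}. g x * indicator (A i) x) \<in> V" for n
        using union g by (intro sumV) (auto simp: E_def W_def)
      have eq: "(\<Sum>i\<in>{..<n}. g x * indicator (A i) x) = g x * indicator (\<Union>i<n. A i) x" for n x
        using union(1) by (subst indicator_UN_disjoint)
          (auto simp: sum_distrib_left disjoint_family_on_def)
      show "\<bar>\<Sum>i\<in>{..<n}. g x * indicator (A i) x\<bar> \<le> 1" if "x \<in> \<Omega>" for n x
        unfolding eq using bnd[OF g that] by (auto simp: indicator_def)
      show "(\<lambda>n. \<Sum>i\<in>{..<n}. g x * indicator (A i) x) \<longlonglongrightarrow> g x * indicator (\<Union>i. A i) x" for x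
        unfolding eq by (intro tendsto_intros LIMSEQ_indicator_UN)
    qed
    then show ?case using union by (auto simp: E_def W_def)
  qed
  then have eA: "(\<lambda>x. e x * indicator A x) \<in> V" and "A \<subseteq> \<Omega>"
    using one unfolding E_def W_def by auto
  show ?thesis
  proof (rule lim)
    show "(\<lambda>x. e x * indicator A x) \<in> V" for n :: nat by (rule eA)
    show "\<bar>e x * indicator A x\<bar> \<le> 1" if "x \<in> \<Omega>" for n :: nat and x
      using one(2)[OF that] by (auto simp: indicator_def)
    show "(\<lambda>n. e x * indicator A x) \<longlonglongrightarrow> indicator A x" if "x \<in> \<Omega>" for x
      using one(2)[OF that] by simp
  qed
qed

section \<open>Cauchy's equation on the unit interval\<close>

text \<open>Additivity gives linearity at rationals; monotonicity squeezes \<open>f s\<close>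
  between the values at m / n and (m + 1) / n, with an error of at most
  \<open>f 1 / n\<close>.\<close>

lemma additive_mono_linear:
  fixes f :: "real \<Rightarrow> real"
  assumes add: "\<And>a b. 0 \<le> a \<Longrightarrow> 0 \<le> b \<Longrightarrow> a + b \<le> 1 \<Longrightarrow> f a + f b = f (a + b)"
    and mono: "\<And>a b. 0 \<le> a \<Longrightarrow> a \<le> b \<Longrightarrow> b \<le> 1 \<Longrightarrow> f a \<le> f b"
    and s: "0 \<le> s" "s \<le> 1"
  shows "f s = s * f 1"
proof -
  have f0: "f 0 = 0" using add[of 0 0] by simp
  have f1: "f 1 \<ge> 0" using mono[of 0 1] f0 by simp
  have nat: "real m * a \<le> 1 \<Longrightarrow> f (real m * a) = real m * f a" if "0 \<le> a" for a m
  proof (induction m)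
    case (Suc m)
    have "real m * a \<le> 1" using Suc.prems that by (simp add: algebra_simps)
    then show ?case using Suc add[of "real m * a" a] that by (simp add: algebra_simps)
  qed (simp add: f0)
  have rat: "f (real m / real n) = real m / real n * f 1" if "n > 0" "m \<le> n" for m n
  proof -
    have "f 1 = real n * f (1 / real n)" using nat[of "1/real n" n] that by simp
    moreover have "f (real m / real n) = real m * f (1 / real n)"
      using nat[of "1/real n" m] that by simp
    ultimately show ?thesis using that by (simp add: field_simps)
  qed
  have bnd: "\<bar>f s - s * f 1\<bar> \<le> f 1 / real n" if n: "n > 0" for n
  proof (cases "s = 1")
    case True then show ?thesis using f1 by simp
  next
    \<comment> \<open>With s < 1 the upper grid point (m + 1) / n still lies in [0, 1].\<close>
    case False
    define m where "m = nat \<lfloor>s * real n\<rfloor>"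
    have m: "real m \<le> s * real n" "s * real n < real m + 1"
      using s n by (auto simp: m_def)
    have "s * real n < real n" using False s n by simp
    then have mn: "m + 1 \<le> n" using m by linarith
    have le: "real m / real n \<le> s" "s \<le> real (m+1) / real n"
      using m n by (auto simp: field_simps)
    have "f (real m / real n) \<le> f s" using le s by (intro mono) auto
    moreover have "f s \<le> f (real (m + 1) / real n)" using le s mn n by (intro mono) auto
    ultimately have 1: "real m / real n * f 1 \<le> f s" "f s \<le> real (m+1) / real n * f 1"
      using rat[of n m] rat[of n "m+1"] mn n by auto
    have 2: "real m / real n * f 1 \<le> s * f 1" "s * f 1 \<le> real (m+1) / real n * f 1"
      using mult_right_mono[OF le(1) f1] mult_right_mono[OF le(2) f1] by simp_all
    have "real (m+1) / real n * f 1 = real m / real n * f 1 + f 1 / real n"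
      by (simp add: add_divide_distrib algebra_simps)
    then show ?thesis using 1 2 by linarith
  qed
  have "\<bar>f s - s * f 1\<bar> \<le> 0"
  proof (rule LIMSEQ_le_const)
    show "(\<lambda>n. f 1 / real n) \<longlonglongrightarrow> 0" by (rule lim_const_over_n)
    show "\<exists>N. \<forall>n\<ge>N. \<bar>f s - s * f 1\<bar> \<le> f 1 / real n"
      using bnd by (intro exI[of _ 1]) auto
  qed
  then show ?thesis by simp
qed

section \<open>A space-filling curve and weak limits on the cube\<close>

text \<open>The usual point of the middle-third Cantor set: bits become ternary digits 0 and
  2.\<close>

definition cantor_code :: "(nat \<Rightarrow> bool) \<Rightarrow> real" where
  "cantor_code b = (\<Sum>n. of_bool (b n) * 2 / 3 ^ Suc n)"

text \<open>Continuous, and of period 2 in \<open>3 ^ n * x\<close>. Since the cosine is 1/2 at pi/3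
  and -1/2 at 2 pi/3, clipping makes the function 0 on [0, 1/3] and 1 on [2/3, 1]; on the Cantor set
  it therefore reads off bit \<open>n\<close>.\<close>

definition cantor_bit :: "nat \<Rightarrow> real \<Rightarrow> real" where
  "cantor_bit n x = max 0 (min 1 (1/2 - cos (pi * (3 ^ n * x))))"

lemma continuous_cantor_bit: "continuous_on UNIV (cantor_bit n)"
  unfolding cantor_bit_def by (intro continuous_intros)

lemma cantor_bit_bounds: "0 \<le> cantor_bit n x" "cantor_bit n x \<le> 1"
  by (auto simp: cantor_bit_def)

lemma geometric_thirds: "(\<lambda>n. 2 / 3 ^ Suc n :: real) sums 1"
proof -
  have "(\<lambda>n. 2 / 3 * (1/3) ^ n :: real) sums (2 / 3 * (1 / (1 - 1/3)))"
    by (intro sums_mult geometric_sums) simp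
  then show ?thesis by (simp add: power_one_over field_simps)
qed

lemma summable_cantor: "summable (\<lambda>n. of_bool (b n) * 2 / 3 ^ Suc n :: real)"
  by (rule summable_comparison_test'[OF sums_summable[OF geometric_thirds]]) auto

lemma cantor_code_bounds: "0 \<le> cantor_code b" "cantor_code b \<le> 1"
proof -
  show "0 \<le> cantor_code b"
    unfolding cantor_code_def by (intro suminf_nonneg summable_cantor) auto
  have "cantor_code b \<le> (\<Sum>n. 2 / 3 ^ Suc n)"
    unfolding cantor_code_def
    by (intro suminf_le summable_cantor sums_summable[OF geometric_thirds]) auto
  then show "cantor_code b \<le> 1" using sums_unique[OF geometric_thirds] by simp
qed

text \<open>Multiplying the code by \<open>3 ^ n\<close> leaves an even integer, because all earlier
  digits are 0 or 2, plus one third of twice bit \<open>n\<close> plus \<open>c\<close>, where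
  \<open>c\<close> in [0, 1] is the code of the remaining bits. The period of the cosine absorbs the
  even integer.\<close>

lemma cantor_bit_code: "cantor_bit n (cantor_code b) = of_bool (b n)"
proof -
  define x where "x = cantor_code b"
  define c where "c = cantor_code (\<lambda>k. b (k + Suc n))"
  have c: "0 \<le> c" "c \<le> 1" using cantor_code_bounds by (auto simp: c_def)
  have split: "x = (\<Sum>k. of_bool (b (k + Suc n)) * 2 / 3 ^ Suc (k + Suc n)) + (\<Sum>k<Suc n. of_bool (b k) * 2 / 3 ^ Suc k)"
    unfolding x_def cantor_code_def by (rule suminf_split_initial_segment[OF summable_cantor])
  have "(\<Sum>k. of_bool (b (k + Suc n)) * 2 / 3 ^ Suc (k + Suc n)) =
      (\<Sum>k. (1 / 3 ^ Suc n) * (of_bool (b (k + Suc n)) * 2 / 3 ^ Suc k :: real))"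
    by (simp add: power_add field_simps)
  also have "\<dots> = (1 / 3 ^ Suc n) * c"
    unfolding c_def cantor_code_def using summable_cantor[of "\<lambda>k. b (k + Suc n)"]
    by (rule suminf_mult)
  finally have x: "x = c / 3 ^ Suc n + (\<Sum>k<n. of_bool (b k) * 2 / 3 ^ Suc k) + of_bool (b n) * 2 / 3 ^ Suc n"
    using split by simp
  define z :: int where "z = (\<Sum>k<n. of_bool (b k) * 3 ^ (n - Suc k))"
  have "3 ^ n * (\<Sum>k<n. of_bool (b k) * 2 / 3 ^ Suc k :: real) = 2 * of_int z"
  proof -
    have "3 ^ n * (of_bool (b k) * 2 / 3 ^ Suc k :: real) = 2 * (of_bool (b k) * 3 ^ (n - Suc k))"
      if "k < n" for k
    proof -
      have "(3::real) ^ n = 3 ^ (n - Suc k) * 3 ^ Suc k"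
        using that by (subst power_add[symmetric]) simp
      then show ?thesis by simp
    qed
    then have "(\<Sum>k<n. 3 ^ n * (of_bool (b k) * 2 / 3 ^ Suc k) :: real) = (\<Sum>k<n. 2 * (of_bool (b k) * 3 ^ (n - Suc k)))"
      by (intro sum.cong) auto
    then show ?thesis
      by (simp only: sum_distrib_left z_def of_int_sum of_int_mult of_int_power of_int_numeral of_int_of_bool)
  qed
  then have "3 ^ n * x = 2 * of_int z + (c / 3 + of_bool (b n) * 2 / 3)"
    unfolding x by (simp add: distrib_left)
  then have "cos (pi * (3 ^ n * x)) = cos (pi * (c / 3 + of_bool (b n) * 2 / 3) + of_int z * (2 * pi))"
    by (simp add: algebra_simps)
  also have "\<dots> = cos (pi * (c / 3 + of_bool (b n) * 2 / 3))"
    using cos.plus_of_int[of "pi * (c / 3 + of_bool (b n) * 2 / 3)" z] by simp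
  finally have *: "cos (pi * (3 ^ n * x)) = cos (pi * (c / 3 + of_bool (b n) * 2 / 3))" .
  show ?thesis
  proof (cases "b n")
    case True
    have "cos (pi * (c / 3 + 2 / 3)) \<le> cos (2 * pi / 3)"
    proof (rule cos_monotone_0_pi_le)
      show "2 * pi / 3 \<le> pi * (c / 3 + 2 / 3)" using c by (simp add: algebra_simps)
      have "pi * (c / 3 + 2 / 3) \<le> pi * 1" using c by (intro mult_left_mono) auto
      then show "pi * (c / 3 + 2 / 3) \<le> pi" by simp
    qed simp
    also have "cos (2 * pi / 3) = - 1 / 2" using cos_120 by simp
    finally show ?thesis using True * by (simp add: cantor_bit_def x_def)
  next
    case False
    have "cos (pi / 3) \<le> cos (pi * (c / 3))"
    proof (rule cos_monotone_0_pi_le)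
      show "pi * (c / 3) \<le> pi / 3" using c by simp
    qed (use c in auto)
    then show ?thesis using False * by (simp add: cantor_bit_def x_def cos_60)
  qed
qed

lemma measurable_cantor_code:
  assumes "\<And>n. Measurable.pred M (\<lambda>x. b x n)"
  shows "(\<lambda>x. cantor_code (b x)) \<in> borel_measurable M"
proof -
  have [measurable]: "Measurable.pred M (\<lambda>x. b x n)" for n by (rule assms)
  show ?thesis unfolding cantor_code_def by measurable
qed

text \<open>The partial sums are the dyadic roundings of \<open>y\<close> from below. The expansion
  starts at \<open>j = 0\<close>, whose digit is nonzero only for \<open>y = 1\<close>; this is how
  the closed interval is covered.\<close>

lemma binary_expansion:
  fixes y :: real
  assumes "0 \<le> y" "y \<le> 1"
  shows "(\<lambda>j. of_bool (odd \<lfloor>2 ^ j * y\<rfloor>) / 2 ^ j) sums y"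
proof -
  have step: "\<lfloor>2 ^ Suc n * y\<rfloor> = 2 * \<lfloor>2 ^ n * y\<rfloor> + of_bool (odd \<lfloor>2 ^ Suc n * y\<rfloor>)" for n
  proof -
    have "\<lfloor>2 ^ Suc n * y\<rfloor> div 2 = \<lfloor>2 ^ n * y\<rfloor>"
      using floor_divide_real_eq_div[of 2 "2 ^ Suc n * y"] by simp
    moreover have "\<lfloor>2 ^ Suc n * y\<rfloor> = 2 * (\<lfloor>2 ^ Suc n * y\<rfloor> div 2) + \<lfloor>2 ^ Suc n * y\<rfloor> mod 2" by simp
    moreover have "\<lfloor>2 ^ Suc n * y\<rfloor> mod 2 = of_bool (odd \<lfloor>2 ^ Suc n * y\<rfloor>)"
      by (simp add: mod_2_eq_odd)
    ultimately show ?thesis by linarith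
  qed
  have part: "(\<Sum>j<Suc n. of_bool (odd \<lfloor>2 ^ j * y\<rfloor>) / 2 ^ j) = \<lfloor>2 ^ n * y\<rfloor> / 2 ^ n" for n
  proof (induction n)
    case 0
    have "\<lfloor>y\<rfloor> = 0 \<or> \<lfloor>y\<rfloor> = 1" using assms by linarith
    then show ?case by auto
  next
    case (Suc n)
    have "real_of_int \<lfloor>2 ^ Suc n * y\<rfloor> = 2 * \<lfloor>2 ^ n * y\<rfloor> + of_bool (odd \<lfloor>2 ^ Suc n * y\<rfloor>)"
      by (subst step) simp
    then show ?case using Suc by (simp add: field_simps)
  qed
  have "(\<lambda>n. \<Sum>j<Suc n. of_bool (odd \<lfloor>2 ^ j * y\<rfloor>) / 2 ^ j) \<longlonglongrightarrow> y"
    unfolding part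
  proof (rule real_tendsto_sandwich)
    show "\<forall>\<^sub>F n in sequentially. y - (1/2) ^ n \<le> \<lfloor>2 ^ n * y\<rfloor> / 2 ^ n"
    proof (intro always_eventually allI)
      fix n
      have "2 ^ n * y - 1 \<le> \<lfloor>2 ^ n * y\<rfloor>" by linarith
      then have "(2 ^ n * y - 1) / 2 ^ n \<le> \<lfloor>2 ^ n * y\<rfloor> / 2 ^ n" by (rule divide_right_mono) simp
      moreover have "(2 ^ n * y - 1) / 2 ^ n = y - (1/2) ^ n" by (simp add: diff_divide_distrib power_one_over)
      ultimately show "y - (1/2) ^ n \<le> \<lfloor>2 ^ n * y\<rfloor> / 2 ^ n" by simp
    qed
    show "\<forall>\<^sub>F n in sequentially. \<lfloor>2 ^ n * y\<rfloor> / 2 ^ n \<le> y"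
      by (intro always_eventually allI) (simp add: divide_le_eq mult.commute)
    have "(\<lambda>n. y - (1/2) ^ n) \<longlonglongrightarrow> y - 0"
      by (intro tendsto_intros LIMSEQ_power_zero) simp
    then show "(\<lambda>n. y - (1/2) ^ n) \<longlonglongrightarrow> y" by simp
  qed simp
  then show ?thesis unfolding sums_def by (rule LIMSEQ_imp_Suc)
qed

text \<open>
  A space-filling curve \<open>\<real> \<rightarrow> [0,1]\<^sup>\<nat>\<close> in the manner of Schoenberg, with a measurable right inverse
  \<open>fill_inv\<close>; it reduces the compactness of laws on \<open>[0,1]\<^sup>\<nat>\<close> to Helly's theorem on the line.
\<close>

definition fill :: "nat \<Rightarrow> real \<Rightarrow> real" where
  "fill i x = min 1 (\<Sum>j. cantor_bit (prod_encode (i, j)) x / 2 ^ j)"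

definition fill_inv :: "(nat \<Rightarrow> real) \<Rightarrow> real" where
  "fill_inv y = cantor_code (\<lambda>n. case prod_decode n of (i, j) \<Rightarrow> odd \<lfloor>2 ^ j * y i\<rfloor>)"

lemma summable_halves: "summable (\<lambda>j. 1 / 2 ^ j :: real)"
  using summable_geometric[of "1/2::real"] by (simp add: power_one_over)

lemma summable_fill: "summable (\<lambda>j. cantor_bit (h j) x / 2 ^ j)"
  by (rule summable_comparison_test'[OF summable_halves])
     (use cantor_bit_bounds in \<open>auto simp: divide_right_mono\<close>)

lemma continuous_fill: "continuous_on UNIV (fill i)"
proof -
  have "uniform_limit UNIV (\<lambda>n x. \<Sum>j<n. cantor_bit (prod_encode (i, j)) x / 2 ^ j)
      (\<lambda>x. \<Sum>j. cantor_bit (prod_encode (i, j)) x / 2 ^ j) sequentially"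
    by (rule Weierstrass_m_test[OF _ summable_halves])
       (use cantor_bit_bounds in \<open>auto simp: divide_right_mono\<close>)
  then have "continuous_on UNIV (\<lambda>x. \<Sum>j. cantor_bit (prod_encode (i, j)) x / 2 ^ j)"
    by (rule uniform_limit_theorem[rotated])
       (auto intro!: always_eventually continuous_intros continuous_cantor_bit)
  then show ?thesis unfolding fill_def by (intro continuous_intros)
qed

lemma fill_bounds: "0 \<le> fill i x" "fill i x \<le> 1"
  unfolding fill_def by (auto intro!: suminf_nonneg summable_fill simp: cantor_bit_bounds)

text \<open>On a Cantor code every bit is exactly 0 or 1, and \<open>prod_decode\<close> sorts the
  bits into the binary expansions of the coordinates. Off the Cantor set the series in
  \<open>fill\<close> may exceed 1, which explains its cut-off.\<close>

lemma fill_fill_inv: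
  assumes "0 \<le> y i" "y i \<le> 1"
  shows "fill i (fill_inv y) = y i"
  using binary_expansion[OF assms] assms
  by (simp add: fill_def fill_inv_def cantor_bit_code sums_iff)

text \<open>The codes \<open>fill_inv\<close> of the sequences are random variables in [0, 1], so
  Helly's theorem yields a weakly convergent subsequence of their laws; \<open>fill\<close> is
  continuous and recovers the coordinates. The limit \<open>Q\<close> stays a law on the line, and
  test functions need only be continuous along the curve.\<close>

lemma weak_limit_unit_sequences:
  fixes P :: "nat \<Rightarrow> 'w measure" and Y :: "nat \<Rightarrow> nat \<Rightarrow> 'w \<Rightarrow> real"
  assumes P: "\<And>n. prob_space (P n)"
    and Y[measurable]: "\<And>n i. Y n i \<in> borel_measurable (P n)"
    and Yb: "\<And>n i \<omega>. 0 \<le> Y n i \<omega>" "\<And>n i \<omega>. Y n i \<omega> \<le> 1"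
  obtains Q r where "real_distribution Q" "strict_mono r"
    "\<And>(f :: (nat \<Rightarrow> real) \<Rightarrow> real) K. continuous_on UNIV (\<lambda>x. f (\<lambda>i. fill i x)) \<Longrightarrow> (\<And>x. \<bar>f (\<lambda>i. fill i x)\<bar> \<le> K) \<Longrightarrow>
       (\<lambda>n. LINT \<omega>|P (r n). f (\<lambda>i. Y (r n) i \<omega>)) \<longlonglongrightarrow> (LINT x|Q. f (\<lambda>i. fill i x))"
proof -
  define S where "S n \<omega> = fill_inv (\<lambda>i. Y n i \<omega>)" for n \<omega>
  have S[measurable]: "S n \<in> borel_measurable (P n)" for n
  proof -
    have "Measurable.pred (P n) (\<lambda>\<omega>. odd \<lfloor>2 ^ j * Y n i \<omega>\<rfloor>)" for i j by measurable
    then show ?thesis unfolding S_def fill_inv_def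
      by (intro measurable_cantor_code) (auto split: prod.split)
  qed
  have Sb: "0 \<le> S n \<omega>" "S n \<omega> \<le> 1" for n \<omega>
    using cantor_code_bounds by (auto simp: S_def fill_inv_def)
  define \<mu> where "\<mu> n = distr (P n) borel (S n)" for n
  have rd: "real_distribution (\<mu> n)" for n
    unfolding \<mu>_def using P[of n] S by (rule prob_space.real_distribution_distr)
  have "tight \<mu>"
    unfolding tight_def
  proof (intro conjI allI impI)
    fix e :: real assume e: "e > 0"
    \<comment> \<open>Tightness is stated with left-open intervals; the endpoint -1 keeps the code 0
      inside.\<close>
    have "measure (\<mu> n) {-1<..1} = 1" for n
    proof -
      have "S n -` {-1<..1} \<inter> space (P n) = space (P n)" using Sb by (force simp: less_le_trans[of "-1" 0])
      then show ?thesis unfolding \<mu>_def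
        by (subst measure_distr) (auto simp: prob_space.prob_space[OF P])
    qed
    then show "\<exists>a b::real. a < b \<and> (\<forall>n. measure (\<mu> n) {a<..b} > 1 - e)"
      using e by (intro exI[of _ "-1"] exI[of _ 1]) auto
  qed (rule rd)
  from tight_imp_convergent_subsubsequence[OF this strict_mono_id]
  obtain r Q where r: "strict_mono (r :: nat \<Rightarrow> nat)" and Q: "real_distribution Q"
    and wc: "weak_conv_m (\<mu> \<circ> r) Q" by auto
  show thesis
  proof (rule that[OF Q r])
    fix f :: "(nat \<Rightarrow> real) \<Rightarrow> real" and K
    assume c: "continuous_on UNIV (\<lambda>x. f (\<lambda>i. fill i x))" and b: "\<And>x. \<bar>f (\<lambda>i. fill i x)\<bar> \<le> K"
    have cm[measurable]: "(\<lambda>x. f (\<lambda>i. fill i x)) \<in> borel_measurable borel"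
      using c by (rule borel_measurable_continuous_onI)
    have "(\<lambda>n. integral\<^sup>L ((\<mu> \<circ> r) n) (\<lambda>x. f (\<lambda>i. fill i x))) \<longlonglongrightarrow> (LINT x|Q. f (\<lambda>i. fill i x))"
    proof (rule weak_conv_imp_integral_bdd_continuous_conv[OF _ Q wc])
      show "real_distribution ((\<mu> \<circ> r) n)" for n using rd by simp
      show "isCont (\<lambda>x. f (\<lambda>i. fill i x)) x" for x
        using c by (simp add: continuous_on_eq_continuous_at)
      show "norm (f (\<lambda>i. fill i x)) \<le> K" for x using b by simp
    qed
    moreover have "integral\<^sup>L ((\<mu> \<circ> r) n) (\<lambda>x. f (\<lambda>i. fill i x)) = (LINT \<omega>|P (r n). f (\<lambda>i. Y (r n) i \<omega>))" for n
    proof -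
      have "(\<lambda>i. fill i (S (r n) \<omega>)) = (\<lambda>i. Y (r n) i \<omega>)" for \<omega>
        unfolding S_def using Yb by (auto intro!: ext fill_fill_inv)
      then show ?thesis unfolding comp_def \<mu>_def
        by (subst integral_distr) auto
    qed
    ultimately show "(\<lambda>n. LINT \<omega>|P (r n). f (\<lambda>i. Y (r n) i \<omega>)) \<longlonglongrightarrow> (LINT x|Q. f (\<lambda>i. fill i x))"
      by simp
  qed
qed

section \<open>Density of dyadic step functions in L1\<close>

text \<open>The cells on which \<open>\<lceil>2 ^ n * x\<rceil>\<close> is constant are left-open
  and right-closed, like the intervals on which an interval measure is given explicitly. Half-lines
  are approximated by hand; the approximable functions are closed under sums, multiples and
  L1-limits, so Borel sets and then all integrable functions follow.\<close>

lemma dyadic_step_approx_L1: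
  fixes f :: "real \<Rightarrow> real"
  assumes M: "finite_measure M" "sets M = sets borel"
    and f: "f \<in> borel_measurable borel" "\<And>x. 0 \<le> f x" "\<And>x. f x \<le> K"
    and e: "0 < e"
  shows "\<exists>n c. integrable M (\<lambda>x. c \<lceil>2 ^ n * x\<rceil>) \<and> (LINT x|M. \<bar>f x - c \<lceil>2 ^ n * x\<rceil>\<bar>) < e"
proof -
  interpret finite_measure M by fact
  note [measurable_cong] = M(2)
  have sp: "space M = UNIV" using sets_eq_imp_space_eq[OF M(2)] by simp
  have cm: "(\<lambda>x :: real. c \<lceil>2 ^ n * x\<rceil>) \<in> borel_measurable borel" for c :: "int \<Rightarrow> real" and n
    by (rule measurable_compose[of _ _ "count_space UNIV"]) measurable
  define appr where "appr u \<longleftrightarrow> (\<forall>e>0. \<exists>n (c :: int \<Rightarrow> real) . integrable M (\<lambda>x. c \<lceil>2 ^ n * x\<rceil>) \<and> (LINT x|M. \<bar>u x - c \<lceil>2 ^ n * x\<rceil>\<bar>) < e)" for u :: "real \<Rightarrow> real"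
  \<comment> \<open>The coarser ceiling is the finer one divided by \<open>2 ^ k\<close> and rounded
    up; the two negations turn \<open>div\<close>, which rounds down, into that.\<close>
  have refine: "\<exists>c' :: int \<Rightarrow> real. \<forall>x :: real. c \<lceil>2 ^ n * x\<rceil> = c' \<lceil>2 ^ (n + k) * x\<rceil>" for c n k
  proof -
    have "c \<lceil>2 ^ n * x\<rceil> = c (- (- \<lceil>2 ^ (n+k) * x\<rceil> div 2 ^ k))" for x :: real
    proof -
      have "\<lfloor>(2 ^ (n + k) * (- x)) / real_of_int (2^k)\<rfloor> = \<lfloor>2 ^ (n+k) * (-x)\<rfloor> div 2 ^ k"
        by (rule floor_divide_real_eq_div) simp
      moreover have "(2 ^ (n + k) * (- x)) / real_of_int (2^k) = - (2 ^ n * x)" by (simp add: power_add)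
      ultimately show ?thesis by (simp add: ceiling_def)
    qed
    then show ?thesis by (intro exI[of _ "\<lambda>z. c (- (- z div 2 ^ k))"]) blast
  qed
  have appr_add: "appr (\<lambda>x. u x + v x)" if "appr u" "appr v" "integrable M u" "integrable M v" for u v
    unfolding appr_def
  proof (intro allI impI)
    fix e :: real assume "e > 0"
    then have e2: "e / 2 > 0" by simp
    from that(1) e2 obtain n c where c: "integrable M (\<lambda>x. c \<lceil>2 ^ n * x\<rceil>)" "(LINT x|M. \<bar>u x - c \<lceil>2 ^ n * x\<rceil>\<bar>) < e/2"
      unfolding appr_def by blast
    from that(2) e2 obtain m d where d: "integrable M (\<lambda>x. d \<lceil>2 ^ m * x\<rceil>)" "(LINT x|M. \<bar>v x - d \<lceil>2 ^ m * x\<rceil>\<bar>) < e/2"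
      unfolding appr_def by blast
    obtain c' where c': "\<And>x :: real. c \<lceil>2 ^ n * x\<rceil> = c' \<lceil>2 ^ (n+m) * x\<rceil>" using refine by metis
    obtain d' where d': "\<And>x :: real. d \<lceil>2 ^ m * x\<rceil> = d' \<lceil>2 ^ (n+m) * x\<rceil>" using refine[of d m n] by (metis add.commute)
    have "integrable M (\<lambda>x. c' \<lceil>2 ^ (n+m) * x\<rceil> + d' \<lceil>2 ^ (n+m) * x\<rceil>)"
      using c d by (simp flip: c' d')
    moreover have "(LINT x|M. \<bar>(u x + v x) - (c' \<lceil>2 ^ (n+m) * x\<rceil> + d' \<lceil>2 ^ (n+m) * x\<rceil>)\<bar>) < e"
    proof -
      have "(LINT x|M. \<bar>(u x + v x) - (c' \<lceil>2 ^ (n+m) * x\<rceil> + d' \<lceil>2 ^ (n+m) * x\<rceil>)\<bar>)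
         \<le> (LINT x|M. \<bar>u x - c \<lceil>2 ^ n * x\<rceil>\<bar> + \<bar>v x - d \<lceil>2 ^ m * x\<rceil>\<bar>)"
        using that(3,4) c(1) d(1) unfolding c' d' by (intro integral_mono) auto
      also have "\<dots> < e" using c d that(3,4) by (subst Bochner_Integration.integral_add) auto
      finally show ?thesis .
    qed
    ultimately show "\<exists>n c. integrable M (\<lambda>x. c \<lceil>2 ^ n * x\<rceil>) \<and> (LINT x|M. \<bar>(u x + v x) - c \<lceil>2 ^ n * x\<rceil>\<bar>) < e"
      by (intro exI[of _ "n+m"] exI[of _ "\<lambda>z. c' z + d' z"]) auto
  qed
  have appr_scale: "appr (\<lambda>x. a * u x)" if "appr u" for u a
    unfolding appr_def
  proof (intro allI impI)
    fix e :: real assume e: "e > 0"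
    then have "e / (\<bar>a\<bar> + 1) > 0" by simp
    from that[unfolded appr_def, rule_format, OF this] obtain n c where
      c: "integrable M (\<lambda>x. c \<lceil>2 ^ n * x\<rceil>)" "(LINT x|M. \<bar>u x - c \<lceil>2 ^ n * x\<rceil>\<bar>) < e/(\<bar>a\<bar>+1)"
      by blast
    have "(LINT x|M. \<bar>a * u x - a * c \<lceil>2 ^ n * x\<rceil>\<bar>) = \<bar>a\<bar> * (LINT x|M. \<bar>u x - c \<lceil>2 ^ n * x\<rceil>\<bar>)"
      by (simp flip: right_diff_distrib add: abs_mult)
    also have "\<dots> \<le> \<bar>a\<bar> * (e / (\<bar>a\<bar> + 1))" using c by (intro mult_left_mono) auto
    also have "\<dots> < e" using e by (simp add: field_simps)
    finally show "\<exists>n c. integrable M (\<lambda>x. c \<lceil>2 ^ n * x\<rceil>) \<and> (LINT x|M. \<bar>a * u x - c \<lceil>2 ^ n * x\<rceil>\<bar>) < e"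
      using c(1) by (intro exI[of _ n] exI[of _ "\<lambda>z. a * c z"]) auto
  qed
  have appr_lim: "appr u" if U: "\<And>i. appr (U i)" "\<And>i. integrable M (U i)" "integrable M u"
    and conv: "(\<lambda>i. LINT x|M. \<bar>u x - U i x\<bar>) \<longlonglongrightarrow> 0" for U :: "nat \<Rightarrow> real \<Rightarrow> real" and u
    unfolding appr_def
  proof (intro allI impI)
    fix e :: real assume "e > 0"
    then have e2: "e / 2 > 0" by simp
    obtain i where i: "(LINT x|M. \<bar>u x - U i x\<bar>) < e/2"
      using order_tendstoD(2)[OF conv e2] eventually_happens trivial_limit_sequentially by blast
    from U(1)[of i] e2 obtain n c where c: "integrable M (\<lambda>x. c \<lceil>2 ^ n * x\<rceil>)" "(LINT x|M. \<bar>U i x - c \<lceil>2 ^ n * x\<rceil>\<bar>) < e/2"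
      unfolding appr_def by blast
    have "(LINT x|M. \<bar>u x - c \<lceil>2 ^ n * x\<rceil>\<bar>) \<le> (LINT x|M. \<bar>u x - U i x\<bar> + \<bar>U i x - c \<lceil>2 ^ n * x\<rceil>\<bar>)"
      using U c by (intro integral_mono) auto
    also have "\<dots> < e" using c i U by (subst Bochner_Integration.integral_add) auto
    finally show "\<exists>n c. integrable M (\<lambda>x. c \<lceil>2 ^ n * x\<rceil>) \<and> (LINT x|M. \<bar>u x - c \<lceil>2 ^ n * x\<rceil>\<bar>) < e"
      using c(1) by blast
  qed
  have appr_set: "appr (indicator A)" if "A \<in> sets borel" for A
  proof -
    have "Int_stable (range (\<lambda>a::real. {..a}))"
      by (auto simp: Int_stable_def)
    moreover have "range (\<lambda>a::real. {..a}) \<subseteq> Pow UNIV" by simp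
    moreover have "A \<in> sigma_sets UNIV (range (\<lambda>a::real. {..a}))"
      using that unfolding borel_eq_atMost by simp
    ultimately show ?thesis
    proof (induction A rule: sigma_sets_induct_disjoint)
      case (basic A)
      then obtain a where A: "A = {..a}" by auto
      \<comment> \<open>The endpoint \<open>a\<close> is rounded up to the grid, so the
        approximating set contains {..a}; a point x > a drops out as soon as 2^n (x - a) >
        1.\<close>
      define c where "c n z = (if z \<le> \<lceil>2 ^ n * a\<rceil> then 1 else 0 :: real)" for n :: nat and z
      show ?case
      proof (rule appr_lim[of "\<lambda>n x. c n \<lceil>2 ^ n * x\<rceil>"])
        have int: "integrable M (\<lambda>x. c n \<lceil>2 ^ n * x\<rceil>)" for n
          using cm[of "c n" n] by (intro integrable_const_bound[of _ 1]) (auto simp: c_def)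
        then show "integrable M (\<lambda>x. c n \<lceil>2 ^ n * x\<rceil>)" for n .
        show "appr (\<lambda>x. c n \<lceil>2 ^ n * x\<rceil>)" for n
          unfolding appr_def using int by (intro allI impI exI[of _ n] exI[of _ "c n"]) auto
        show "integrable M (indicator A :: real \<Rightarrow> real)"
          by (intro integrable_const_bound[of _ 1]) (auto simp: A)
        have "(\<lambda>i. LINT x|M. \<bar>indicator A x - c i \<lceil>2 ^ i * x\<rceil>\<bar>) \<longlonglongrightarrow> (LINT x|M. 0)"
        proof (rule integral_dominated_convergence[where w="\<lambda>_. 1"])
          show "(\<lambda>x. \<bar>indicator A x - c i \<lceil>2 ^ i * x\<rceil>\<bar>) \<in> borel_measurable M" for i
            using cm[of "c i" i] by (auto simp: A)
          show "AE x in M. norm \<bar>indicator A x - c i \<lceil>2 ^ i * x\<rceil>\<bar> \<le> 1" for i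
            by (auto simp: c_def indicator_def)
          show "AE x in M. (\<lambda>i. \<bar>indicator A x - c i \<lceil>2 ^ i * x\<rceil>\<bar>) \<longlonglongrightarrow> 0"
          proof (rule AE_I2)
            fix x
            have "\<forall>\<^sub>F i in sequentially. \<bar>indicator A x - c i \<lceil>2 ^ i * x\<rceil>\<bar> = 0"
            proof (cases "x \<le> a")
              case True
              then have "\<lceil>2 ^ i * x\<rceil> \<le> \<lceil>2 ^ i * a\<rceil>" for i by (intro ceiling_mono) simp
              then show ?thesis using True by (simp add: A c_def)
            next
              case False
              then obtain N where N: "1 / (x - a) < 2 ^ N"
                using real_arch_pow[of 2 "1 / (x - a)"] by auto
              show ?thesis using eventually_ge_at_top[of N]
              proof eventually_elim
                case (elim i)
                have "(2::real) ^ N \<le> 2 ^ i" using elim by simp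
                with N have "1 / (x - a) < 2 ^ i" by linarith
                then have "2 ^ i * a + 1 < 2 ^ i * x" using False by (simp add: field_simps)
                then have "\<lceil>2 ^ i * a\<rceil> < \<lceil>2 ^ i * x\<rceil>" by linarith
                then show ?case using False by (simp add: A c_def)
              qed
            qed
            then show "(\<lambda>i. \<bar>indicator A x - c i \<lceil>2 ^ i * x\<rceil>\<bar>) \<longlonglongrightarrow> 0" by (rule tendsto_eventually)
          qed
        qed auto
        then show "(\<lambda>i. LINT x|M. \<bar>indicator A x - c i \<lceil>2 ^ i * x\<rceil>\<bar>) \<longlonglongrightarrow> 0" by simp
      qed
    next
      case empty
      show ?case unfolding appr_def by (intro allI impI exI[of _ 0] exI[of _ "\<lambda>_. 0"]) auto
    next
      case (compl A)
      have A: "A \<in> sets borel" using compl(1) unfolding borel_eq_atMost by simp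
      have "appr (\<lambda>x. 1)" unfolding appr_def by (intro allI impI exI[of _ 0] exI[of _ "\<lambda>_. 1"]) auto
      then have "appr (\<lambda>x. 1 + (-1) * indicator A x)"
        using A compl by (intro appr_add appr_scale) (auto intro!: integrable_real_indicator simp: M(2) less_top[symmetric])
      moreover have "(\<lambda>x. 1 + (-1) * indicator A x) = (indicator (UNIV - A) :: real \<Rightarrow> real)"
        by (auto simp: indicator_def)
      ultimately show ?case by simp
    next
      case (union A)
      have A: "A i \<in> sets borel" for i using union(2) unfolding borel_eq_atMost by auto
      have int: "integrable M (indicator B :: real \<Rightarrow> real)" if "B \<in> sets borel" for B
        using that by (intro integrable_real_indicator) (auto simp: M(2) less_top[symmetric])
      have eq: "(\<Sum>i<n. indicator (A i) x) = (indicator (\<Union>i<n. A i) x :: real)" for n x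
        using union(1) by (subst indicator_UN_disjoint) (auto simp: disjoint_family_on_def)
      show ?case
      proof (rule appr_lim[of "\<lambda>n x. \<Sum>i<n. indicator (A i) x"])
        show "appr (\<lambda>x. \<Sum>i<n. indicator (A i) x)" for n
        proof (induction n)
          case 0
          show ?case unfolding appr_def by (intro allI impI exI[of _ 0] exI[of _ "\<lambda>_. 0"]) auto
        next
          case (Suc n)
          have "appr (\<lambda>x. (\<Sum>i<n. indicator (A i) x) + indicator (A n) x)"
            using Suc union(3) A by (intro appr_add) (auto intro!: int Bochner_Integration.integrable_sum)
          then show ?case by simp
        qed
        show "integrable M (\<lambda>x. \<Sum>i<n. indicator (A i) x :: real)" for n
          using A by (auto intro!: int Bochner_Integration.integrable_sum)
        show "integrable M (indicator (\<Union>i. A i) :: real \<Rightarrow> real)" using A by (intro int) auto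
        have "(\<lambda>n. LINT x|M. \<bar>indicator (\<Union>i. A i) x - (\<Sum>i<n. indicator (A i) x :: real)\<bar>) \<longlonglongrightarrow> (LINT x|M. 0)"
        proof (rule integral_dominated_convergence[where w="\<lambda>_. 1"])
          show "(\<lambda>x. \<bar>indicator (\<Union>i. A i) x - (\<Sum>i<n. indicator (A i) x :: real)\<bar>) \<in> borel_measurable M" for n
            using A by measurable
          show "AE x in M. norm \<bar>indicator (\<Union>i. A i) x - (\<Sum>i<n. indicator (A i) x :: real)\<bar> \<le> 1" for n
            unfolding eq by (auto simp: indicator_def)
          show "AE x in M. (\<lambda>n. \<bar>indicator (\<Union>i. A i) x - (\<Sum>i<n. indicator (A i) x :: real)\<bar>) \<longlonglongrightarrow> 0"
          proof (rule AE_I2)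
            fix x
            have "(\<lambda>n. (indicator (\<Union>i. A i) x :: real) - indicator (\<Union>i<n. A i) x) \<longlonglongrightarrow> indicator (\<Union>i. A i) x - indicator (\<Union>i. A i) x"
              by (intro tendsto_intros LIMSEQ_indicator_UN)
            then show "(\<lambda>n. \<bar>indicator (\<Union>i. A i) x - (\<Sum>i<n. indicator (A i) x :: real)\<bar>) \<longlonglongrightarrow> 0"
              unfolding eq by (simp add: tendsto_rabs_zero)
          qed
        qed auto
        then show "(\<lambda>n. LINT x|M. \<bar>indicator (\<Union>i. A i) x - (\<Sum>i<n. indicator (A i) x :: real)\<bar>) \<longlonglongrightarrow> 0" by simp
      qed
    qed
  qed
  have "integrable M f"
    using f by (intro integrable_const_bound[of _ K]) auto
  then have "appr f"
  proof (induction rule: integrable_induct)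
    case (base A c)
    have "A \<in> sets borel" using base M(2) by simp
    from appr_scale[OF appr_set[OF this], of c] show ?case by (simp add: mult.commute)
  next
    case (add u v)
    then show ?case by (intro appr_add)
  next
    case (lim u U)
    show ?case
    proof (rule appr_lim[of U])
      have "(\<lambda>i. LINT x|M. \<bar>u x - U i x\<bar>) \<longlonglongrightarrow> (LINT x|M. 0)"
      proof (rule integral_dominated_convergence[where w="\<lambda>x. 3 * norm (u x)"])
        show "AE x in M. (\<lambda>i. \<bar>u x - U i x\<bar>) \<longlonglongrightarrow> 0"
        proof (rule AE_I2)
          fix x assume "x \<in> space M"
          from lim(2)[OF this] have "(\<lambda>i. u x - U i x) \<longlonglongrightarrow> u x - u x" by (intro tendsto_intros)
          then show "(\<lambda>i. \<bar>u x - U i x\<bar>) \<longlonglongrightarrow> 0" by (simp add: tendsto_rabs_zero)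
        qed
        show "AE x in M. norm \<bar>u x - U i x\<bar> \<le> 3 * norm (u x)" for i
        proof (rule AE_I2)
          fix x assume "x \<in> space M"
          from lim(3)[OF this, of i] show "norm \<bar>u x - U i x\<bar> \<le> 3 * norm (u x)" by simp
        qed
      qed (use lim in auto)
      then show "(\<lambda>i. LINT x|M. \<bar>u x - U i x\<bar>) \<longlonglongrightarrow> 0" by simp
    qed (use lim in auto)
  qed
  then show ?thesis using e unfolding appr_def by blast
qed

section \<open>Laplace functionals of Radon measures\<close>

text \<open>The value 0 at infinity makes this continuous on all of [0, \<infinity>]. A Bochner
  integral would return its default 0 on a function that is not integrable, and so the Laplace
  functional 1 in place of 0.\<close>

definition exp_neg :: "ennreal \<Rightarrow> real" where
  "exp_neg a = (if a = \<infinity> then 0 else exp (- enn2real a))"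

definition lap :: "('a \<Rightarrow> real) \<Rightarrow> 'a measure \<Rightarrow> real" where
  "lap g \<mu> = exp_neg (\<integral>\<^sup>+ x. ennreal (g x) \<partial>\<mu>)"

lemma exp_neg_0 [simp]: "exp_neg 0 = 1"
  by (simp add: exp_neg_def)

lemma exp_neg_ennreal: "0 \<le> a \<Longrightarrow> exp_neg (ennreal a) = exp (- a)"
  by (simp add: exp_neg_def)

lemma exp_neg_bounds: "0 \<le> exp_neg a" "exp_neg a \<le> 1"
  by (auto simp: exp_neg_def)

lemma exp_neg_pos: "a < \<infinity> \<Longrightarrow> 0 < exp_neg a"
  by (auto simp: exp_neg_def)

lemma exp_neg_add: "exp_neg (a + b) = exp_neg a * exp_neg b"
proof (cases "a = \<infinity> \<or> b = \<infinity>")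
  case True
  then show ?thesis by (auto simp: exp_neg_def)
next
  case False
  then have "a < top" "b < top" by (auto simp: less_top)
  then show ?thesis using False
    by (auto simp: exp_neg_def enn2real_plus exp_add[symmetric] ennreal_add_eq_top)
qed

lemma exp_neg_mono: "a \<le> b \<Longrightarrow> exp_neg b \<le> exp_neg a"
  using enn2real_mono[of a b] by (auto simp: exp_neg_def top_unique less_top)

lemma measurable_exp_neg [measurable]: "exp_neg \<in> borel_measurable borel"
  unfolding exp_neg_def by measurable

lemma tendsto_exp_neg:
  assumes "(f \<longlongrightarrow> a) F"
  shows "((\<lambda>n. exp_neg (f n)) \<longlongrightarrow> exp_neg a) F"
proof (cases "a = \<infinity>")
  case False
  have fin: "\<forall>\<^sub>F n in F. f n < \<infinity>"
    using assms False by (intro order_tendstoD) (auto simp: less_top)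
  have "((\<lambda>n. enn2real (f n)) \<longlongrightarrow> enn2real a) F"
  proof (rule tendsto_enn2real)
    show "(f \<longlongrightarrow> ennreal (enn2real a)) F" using assms False by (simp add: less_top)
  qed simp
  then have "((\<lambda>n. exp (- enn2real (f n))) \<longlongrightarrow> exp (- enn2real a)) F"
    by (intro tendsto_exp tendsto_minus)
  moreover have "\<forall>\<^sub>F n in F. exp_neg (f n) = exp (- enn2real (f n))"
    using fin by eventually_elim (auto simp: exp_neg_def)
  ultimately show ?thesis using False by (simp add: tendsto_cong exp_neg_def)
next
  case True
  show ?thesis
  proof (rule tendstoI)
    fix e :: real assume e: "e > 0"
    \<comment> \<open>Chosen so that exp (- K) is at most e / 2.\<close>
    define K where "K = max 0 (- ln (e / 2))"
    have K: "exp (- K) < e"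
    proof -
      have "exp (- K) \<le> exp (ln (e / 2))" by (simp add: K_def)
      then show ?thesis using e by simp
    qed
    have "\<forall>\<^sub>F n in F. ennreal K < f n"
      using assms True by (intro order_tendstoD) auto
    then show "\<forall>\<^sub>F n in F. dist (exp_neg (f n)) (exp_neg a) < e"
    proof eventually_elim
      case (elim n)
      have "exp_neg (f n) \<le> exp_neg (ennreal K)" using elim by (intro exp_neg_mono) simp
      also have "\<dots> = exp (- K)" by (rule exp_neg_ennreal) (simp add: K_def)
      finally show ?case using K True exp_neg_bounds(1)[of "f n"] by (simp add: exp_neg_def dist_real_def)
    qed
  qed
qed

lemma lap_bounds: "0 \<le> lap g \<mu>" "lap g \<mu> \<le> 1"
  by (auto simp: lap_def exp_neg_bounds)

lemma lap_zero [simp]: "lap (\<lambda>_. 0) \<mu> = 1"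
  by (simp add: lap_def)

lemma lap_add:
  assumes "sets \<mu> = sets borel" "g \<in> borel_measurable borel" "h \<in> borel_measurable borel"
    "\<And>x. 0 \<le> g x" "\<And>x. 0 \<le> h x"
  shows "lap (\<lambda>x. g x + h x) \<mu> = lap g \<mu> * lap h \<mu>"
proof -
  note [measurable_cong] = assms(1)
  note [measurable] = assms(2,3)
  show ?thesis using assms by (simp add: lap_def nn_integral_add exp_neg_add)
qed

lemma lap_mono: "(\<And>x. g x \<le> h x) \<Longrightarrow> lap h \<mu> \<le> lap g \<mu>"
  unfolding lap_def by (intro exp_neg_mono nn_integral_mono ennreal_leI)

lemma lap_incseq:
  assumes "sets \<mu> = sets borel" "\<And>n. g n \<in> borel_measurable borel"
    "\<And>n x. g n x \<le> g (Suc n) x" "\<And>x. (\<lambda>n. g n x) \<longlonglongrightarrow> h x"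
  shows "(\<lambda>n. lap (g n) \<mu>) \<longlonglongrightarrow> lap h \<mu>"
proof -
  note [measurable_cong] = assms(1)
  note [measurable] = assms(2)
  have "(\<lambda>n. \<integral>\<^sup>+x. ennreal (g n x) \<partial>\<mu>) \<longlonglongrightarrow> (\<integral>\<^sup>+x. ennreal (h x) \<partial>\<mu>)"
  proof (rule nn_integral_LIMSEQ)
    show "incseq (\<lambda>n x. ennreal (g n x))"
      using assms(3) by (intro incseq_SucI) (auto simp: le_fun_def intro: ennreal_leI)
  qed (auto intro: tendsto_ennrealI assms)
  then show ?thesis unfolding lap_def by (rule tendsto_exp_neg)
qed

section \<open>Measurability and superposition on the space of Radon measures\<close>

text \<open>The kernel may have infinite mass; measurability is carried over from evaluations on
  sets by approximation with simple functions.\<close>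

lemma nn_integral_measurable_kernel:
  assumes K: "\<And>\<omega>. \<omega> \<in> space N \<Longrightarrow> sets (K \<omega>) = sets S"
    and em: "\<And>A. A \<in> sets S \<Longrightarrow> (\<lambda>\<omega>. emeasure (K \<omega>) A) \<in> borel_measurable N"
    and g: "g \<in> borel_measurable S"
  shows "(\<lambda>\<omega>. \<integral>\<^sup>+ x. g x \<partial>K \<omega>) \<in> borel_measurable N"
  using g
proof (induction rule: borel_measurable_induct)
  case (cong f g)
  then show ?case
    using K by (subst measurable_cong[where g="\<lambda>\<omega>. \<integral>\<^sup>+ x. g x \<partial>K \<omega>"])
      (auto intro!: nn_integral_cong dest!: sets_eq_imp_space_eq)
next
  case (set A)
  then show ?case
    using em[OF set] K by (subst measurable_cong[where g="\<lambda>\<omega>. emeasure (K \<omega>) A"]) auto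
next
  case (mult u c)
  have "(\<lambda>\<omega>. c * (\<integral>\<^sup>+ x. u x \<partial>K \<omega>)) \<in> borel_measurable N" using mult by measurable
  then show ?case
    using K mult
    by (subst measurable_cong[where g="\<lambda>\<omega>. c * (\<integral>\<^sup>+ x. u x \<partial>K \<omega>)"])
       (auto intro!: nn_integral_cmult simp: measurable_cong_sets[OF K refl])
next
  case (add u v)
  have "(\<lambda>\<omega>. (\<integral>\<^sup>+ x. v x \<partial>K \<omega>) + (\<integral>\<^sup>+ x. u x \<partial>K \<omega>)) \<in> borel_measurable N" using add by measurable
  then show ?case
    using K add
    by (subst measurable_cong[where g="\<lambda>\<omega>. (\<integral>\<^sup>+ x. v x \<partial>K \<omega>) + (\<integral>\<^sup>+ x. u x \<partial>K \<omega>)"])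
       (auto intro!: nn_integral_add simp: measurable_cong_sets[OF K refl])
next
  case (seq U)
  have eq: "(\<integral>\<^sup>+ x. (SUP i. U i) x \<partial>K \<omega>) = (SUP i. \<integral>\<^sup>+ x. U i x \<partial>K \<omega>)" if "\<omega> \<in> space N" for \<omega>
  proof -
    have U: "U i \<in> borel_measurable (K \<omega>)" for i
      using seq(1)[of i] by (simp only: measurable_cong_sets[OF K[OF that] refl])
    show ?thesis
    proof -
      have "(SUP i. U i) x = (SUP i. U i x)" for x
        unfolding Sup_apply image_image by (rule refl)
      then show ?thesis
        using nn_integral_monotone_convergence_SUP[OF seq(3) U] by simp
    qed
  qed
  have "(\<lambda>\<omega>. SUP i. \<integral>\<^sup>+ x. U i x \<partial>K \<omega>) \<in> borel_measurable N" using seq by measurable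
  then have "(\<lambda>\<omega>. \<integral>\<^sup>+ x. (SUP i. U i) x \<partial>K \<omega>) \<in> borel_measurable N"
    by (rule measurable_cong[THEN iffD1, rotated]) (rule eq[symmetric])
  then show ?case unfolding seq(4) .
qed

lemma sets_radon: "\<mu> \<in> radon_measures \<Longrightarrow> sets \<mu> = sets borel"
  by (simp add: radon_measures_def)

lemma space_radon: "\<mu> \<in> radon_measures \<Longrightarrow> space \<mu> = UNIV"
  using sets_eq_imp_space_eq[OF sets_radon] by simp

lemma measurable_emeasure_radon:
  assumes "A \<in> sets borel"
  shows "(\<lambda>\<mu>. emeasure \<mu> A) \<in> borel_measurable radon_algebra"
  unfolding radon_algebra_def
  using assms by (intro measurable_SUP1[of A] measurable_vimage_algebra1) auto

lemma measurable_radonI: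
  assumes "\<And>x. x \<in> space N \<Longrightarrow> f x \<in> radon_measures"
    and "\<And>A. A \<in> sets borel \<Longrightarrow> (\<lambda>x. emeasure (f x) A) \<in> borel_measurable N"
  shows "f \<in> N \<rightarrow>\<^sub>M radon_algebra"
  unfolding radon_algebra_def
  using assms by (intro measurable_SUP2 measurable_vimage_algebra2) auto

lemma measurable_nn_integral_radon:
  assumes "g \<in> borel_measurable borel"
  shows "(\<lambda>\<mu>. \<integral>\<^sup>+ x. g x \<partial>\<mu>) \<in> borel_measurable radon_algebra"
  by (rule nn_integral_measurable_kernel[where S=borel])
     (auto simp: sets_radon assms intro: measurable_emeasure_radon)

lemma measurable_lap:
  assumes "g \<in> borel_measurable borel"
  shows "lap g \<in> borel_measurable radon_algebra"
  unfolding lap_def using assms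
  by (intro measurable_compose[OF measurable_nn_integral_radon measurable_exp_neg]) measurable

lemma sets_superpose [simp]: "sets (superpose \<mu> \<nu>) = sets \<mu>"
  by (simp add: superpose_def sets.sets_measure_of_eq)

lemma space_superpose [simp]: "space (superpose \<mu> \<nu>) = space \<mu>"
  by (simp add: superpose_def)

lemma nn_integral_superpose:
  assumes "sets \<mu> = sets \<nu>" "g \<in> borel_measurable \<mu>"
  shows "(\<integral>\<^sup>+ x. g x \<partial>superpose \<mu> \<nu>) = (\<integral>\<^sup>+ x. g x \<partial>\<mu>) + (\<integral>\<^sup>+ x. g x \<partial>\<nu>)"
  using assms(2)
proof (induction rule: borel_measurable_induct)
  case (cong f g)
  have "integral\<^sup>N M f = integral\<^sup>N M g" if "space M = space \<mu>" for M
    using cong that by (intro nn_integral_cong) auto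
  from this[of \<mu>] this[of \<nu>] this[of "superpose \<mu> \<nu>"] show ?case
    using cong sets_eq_imp_space_eq[OF assms(1)] by simp
next
  case (set A)
  then show ?case using assms(1) by (simp add: emeasure_superpose)
next
  case (mult u c)
  then show ?case using assms(1)
    by (simp add: nn_integral_cmult distrib_left measurable_cong_sets[OF assms(1) refl]
        measurable_cong_sets[OF sets_superpose refl])
next
  case (add u v)
  then show ?case using assms(1)
    by (simp add: nn_integral_add add_ac measurable_cong_sets[OF assms(1) refl]
        measurable_cong_sets[OF sets_superpose refl])
next
  case (seq U)
  have "(\<integral>\<^sup>+ x. (SUP i. U i x) \<partial>M) = (SUP i. \<integral>\<^sup>+ x. U i x \<partial>M)" if "sets M = sets \<mu>" for M
    using seq that by (intro nn_integral_monotone_convergence_SUP)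
      (auto simp: measurable_cong_sets[OF that refl])
  moreover have "incseq (\<lambda>i. \<integral>\<^sup>+ x. U i x \<partial>M)" for M
    using seq by (auto simp: incseq_def le_fun_def intro!: nn_integral_mono)
  ultimately show ?case using seq assms(1)
    by (simp add: image_comp ennreal_SUP_add)
qed

lemma superpose_radon:
  assumes "\<mu> \<in> radon_measures" "\<nu> \<in> radon_measures"
  shows "superpose \<mu> \<nu> \<in> radon_measures"
  using assms by (auto simp: radon_measures_def emeasure_superpose)

lemma lap_superpose:
  assumes "\<mu> \<in> radon_measures" "\<nu> \<in> radon_measures" "g \<in> borel_measurable borel"
  shows "lap g (superpose \<mu> \<nu>) = lap g \<mu> * lap g \<nu>"
  using assms
  by (simp add: lap_def exp_neg_add nn_integral_superpose sets_radon
      measurable_cong_sets[OF sets_radon refl])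

lemma measurable_superpose:
  "(\<lambda>(\<mu>, \<nu>). superpose \<mu> \<nu>) \<in> radon_algebra \<Otimes>\<^sub>M radon_algebra \<rightarrow>\<^sub>M radon_algebra"
proof (rule measurable_radonI)
  fix A :: "'a set" assume A: "A \<in> sets borel"
  note [measurable] = measurable_emeasure_radon[OF A]
  have "(\<lambda>p. emeasure (fst p) A + emeasure (snd p) A) \<in> borel_measurable (radon_algebra \<Otimes>\<^sub>M radon_algebra)"
    by measurable
  then show "(\<lambda>x. emeasure (case x of (\<mu>, \<nu>) \<Rightarrow> superpose \<mu> \<nu>) A) \<in> borel_measurable (radon_algebra \<Otimes>\<^sub>M radon_algebra)"
    by (rule measurable_cong[THEN iffD1, rotated])
       (auto simp: space_pair_measure emeasure_superpose sets_radon A)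
qed (auto simp: space_pair_measure superpose_radon)

text \<open>Unlike in \<open>BM\<close>, boundedness is not required: \<open>- ln u\<close> may be unbounded for \<open>1 - u\<close> in \<open>BM\<close>.\<close>

definition rcfun :: "('a::topological_space \<Rightarrow> real) \<Rightarrow> bool" where
  "rcfun g \<longleftrightarrow> g \<in> borel_measurable borel \<and> (\<forall>x. 0 \<le> g x) \<and> rel_compact {x. g x \<noteq> 0}"

lemma rel_compact_subset: "rel_compact A \<Longrightarrow> C \<subseteq> A \<Longrightarrow> rel_compact C"
  unfolding rel_compact_def
  by (metis closure_mono closed_closure closed_Int_compact inf.absorb_iff1)

lemma rel_compact_Un: "rel_compact A \<Longrightarrow> rel_compact C \<Longrightarrow> rel_compact (A \<union> C)"
  by (simp add: rel_compact_def compact_Un)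

lemma rcfun_add: "rcfun g \<Longrightarrow> rcfun h \<Longrightarrow> rcfun (\<lambda>x. g x + h x)"
  unfolding rcfun_def by (auto intro: rel_compact_subset[OF rel_compact_Un])

section \<open>Exhaustion of the space and uniqueness of Laplace functionals\<close>

locale lcsc_base =
  fixes B :: "nat \<Rightarrow> 'a::{t2_space, second_countable_topology} set"
  assumes base: "base_seq B"
begin

text \<open>An increasing exhaustion by relatively compact open sets. The index 0 is left out
  because \<open>B 0\<close> is the whole space.\<close>

definition "V n = (\<Union>i\<in>{1..n}. B i)" for n

lemma open_B: "open (B i)"
  using base unfolding base_seq_def by (cases i) (auto intro: topological_basis_open)

lemma rel_compact_B: "1 \<le> i \<Longrightarrow> rel_compact (B i)"
  using base unfolding base_seq_def by blast

lemma basis: "topological_basis (B ` {1..})"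
  using base by (simp add: base_seq_def)

lemma basisE:
  assumes "open U" "x \<in> U"
  obtains i where "1 \<le> i" "x \<in> B i" "B i \<subseteq> U"
  using topological_basisE[OF basis assms] by (metis (no_types, lifting) atLeast_iff image_iff)

lemma open_V [simp]: "open (V n)"
  unfolding V_def by (auto intro: open_B)

lemma sets_V [measurable, simp]: "V n \<in> sets borel"
  by (rule borel_open) simp

lemma rel_compact_V: "rel_compact (V n)"
proof (induction n)
  case 0 show ?case by (simp add: V_def rel_compact_def)
next
  case (Suc n)
  have "V (Suc n) = V n \<union> B (Suc n)" unfolding V_def
    by (subst atLeastAtMostSuc_conv) auto
  then show ?case using Suc rel_compact_B[of "Suc n"] by (simp add: rel_compact_Un)
qed

lemma V_mono: "m \<le> n \<Longrightarrow> V m \<subseteq> V n"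
  by (fastforce simp: V_def)

lemma V_cover: "\<exists>n. x \<in> V n"
proof -
  obtain i where "1 \<le> i" "x \<in> B i" using basisE[of UNIV x] by auto
  then show ?thesis by (intro exI[of _ i]) (auto simp: V_def)
qed

lemma rel_compact_subset_V:
  assumes "rel_compact A"
  obtains n where "A \<subseteq> V n"
proof -
  have "compact (closure A)" "closure A \<subseteq> \<Union>(range V)" "\<And>T. T \<in> range V \<Longrightarrow> open T"
    using assms V_cover by (auto simp: rel_compact_def)
  then obtain D where D: "D \<subseteq> range V" "finite D" "closure A \<subseteq> \<Union>D"
    by (metis compactE)
  then obtain F where F: "finite F" "D = V ` F" by (metis finite_subset_image)
  have "V i \<subseteq> V (Max F)" if "i \<in> F" for i using F that by (intro V_mono) auto
  then have "A \<subseteq> V (Max F)" using D F closure_subset[of A] by blast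
  then show thesis by (rule that)
qed

lemma V_indicator_tendsto: "(\<lambda>n. indicator (V n) x * c) \<longlonglongrightarrow> (c :: real)"
proof -
  obtain n where n: "x \<in> V n" using V_cover by blast
  have "\<forall>\<^sub>F m in sequentially. indicator (V m) x * c = c"
    using eventually_ge_at_top[of n] by eventually_elim (use V_mono n in fastforce)
  then show ?thesis by (rule tendsto_eventually)
qed

lemma lap_V_tendsto:
  assumes "sets \<mu> = sets borel" and g[measurable]: "g \<in> borel_measurable borel" "\<And>x. 0 \<le> g x"
  shows "(\<lambda>n. lap (\<lambda>x. indicator (V n) x * g x) \<mu>) \<longlonglongrightarrow> lap g \<mu>"
proof (rule lap_incseq[OF assms(1)])
  show "indicator (V n) x * g x \<le> indicator (V (Suc n)) x * g x" for n x
    using V_mono[of n "Suc n"] g(2)[of x] by (auto simp: indicator_def)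
qed (auto intro: V_indicator_tendsto)

lemma rcfun_V: "g \<in> borel_measurable borel \<Longrightarrow> (\<And>x. 0 \<le> g x) \<Longrightarrow> rcfun (\<lambda>x. indicator (V n) x * g x)"
  unfolding rcfun_def by (auto intro: rel_compact_subset[OF rel_compact_V[of n]] simp: indicator_def)

lemma rcfun_indicator:
  assumes "A \<in> sets borel" "rel_compact A"
  shows "rcfun (indicator A)"
  using assms unfolding rcfun_def by (auto intro: rel_compact_subset[OF assms(2)] simp: indicator_def)

text \<open>The cut-off by \<open>indicator radon_measures\<close> makes the class closed under products.\<close>

definition lap_class :: "('a measure \<Rightarrow> real) set" where
  "lap_class = {\<lambda>\<mu>. indicator radon_measures \<mu> * lap g \<mu> | g. rcfun g}"

text \<open>The mass of \<open>A \<inter> V n\<close> is minus the logarithm of the Laplace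
  functional of its indicator, and the mass of \<open>A\<close> is the supremum over
  \<open>n\<close>. Laplace functionals therefore generate the \<sigma>-algebra of
  evaluations.\<close>

lemma sets_radon_lap_class:
  assumes "A \<in> sets radon_algebra"
  shows "A \<in> sigma_sets radon_measures {{\<mu> \<in> radon_measures. f \<mu> > c} | f c. f \<in> lap_class}"
proof -
  let ?G = "{{\<mu> \<in> radon_measures. f \<mu> > c} | f c. f \<in> lap_class}"
  define N where "N = sigma radon_measures ?G"
  have sub: "?G \<subseteq> Pow radon_measures" by auto
  have sN: "space N = radon_measures" "sets N = sigma_sets radon_measures ?G"
    unfolding N_def using sub by (simp_all add: space_measure_of sets_measure_of)
  have lapN: "lap g \<in> borel_measurable N" if "rcfun g" for g
    unfolding borel_measurable_iff_greater
  proof (intro allI)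
    fix c
    have "(\<lambda>\<mu>. indicator radon_measures \<mu> * lap g \<mu>) \<in> lap_class"
      using that unfolding lap_class_def by blast
    then have "{\<mu> \<in> radon_measures. indicator radon_measures \<mu> * lap g \<mu> > c} \<in> ?G"
      unfolding mem_Collect_eq by (intro exI conjI) (rule refl)
    moreover have "{\<mu> \<in> radon_measures. indicator radon_measures \<mu> * lap g \<mu> > c} = {\<mu> \<in> space N. c < lap g \<mu>}"
      by (auto simp: sN)
    ultimately show "{\<mu> \<in> space N. c < lap g \<mu>} \<in> sets N"
      unfolding sN(2) by (intro sigma_sets.Basic) simp
  qed
  have "(\<lambda>\<mu>. \<mu>) \<in> N \<rightarrow>\<^sub>M radon_algebra"
  proof (rule measurable_radonI)
    fix A :: "'a set" assume A[measurable]: "A \<in> sets borel"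
    have 1: "(\<lambda>\<mu>. SUP n. ennreal (- ln (lap (indicator (A \<inter> V n)) \<mu>))) \<in> borel_measurable N"
    proof -
      have "rcfun (indicator (A \<inter> V n))" for n
        by (intro rcfun_indicator) (auto intro: rel_compact_subset[OF rel_compact_V[of n]])
      note [measurable] = lapN[OF this]
      show ?thesis by measurable
    qed
    have 2: "emeasure \<mu> A = (SUP n. ennreal (- ln (lap (indicator (A \<inter> V n)) \<mu>)))" if "\<mu> \<in> radon_measures" for \<mu>
    proof -
      have s: "sets \<mu> = sets borel" by (rule sets_radon[OF that])
      have fin: "emeasure \<mu> (A \<inter> V n) < \<infinity>" for n
        using that rel_compact_subset[OF rel_compact_V[of n], of "A \<inter> V n"] by (auto simp: radon_measures_def)
      have "ennreal (- ln (lap (indicator (A \<inter> V n)) \<mu>)) = emeasure \<mu> (A \<inter> V n)" for n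
        using fin[of n] by (simp add: lap_def ennreal_indicator s exp_neg_def less_top)
      moreover have "(SUP n. emeasure \<mu> (A \<inter> V n)) = emeasure \<mu> (\<Union>n. A \<inter> V n)"
        using V_mono by (intro SUP_emeasure_incseq) (auto simp: s incseq_def)
      moreover have "(\<Union>n. A \<inter> V n) = A" using V_cover by auto
      ultimately show ?thesis by simp
    qed
    show "(\<lambda>\<mu>. emeasure \<mu> A) \<in> borel_measurable N"
      using 1 by (rule measurable_cong[THEN iffD1, rotated]) (simp add: 2 sN)
  qed (simp add: sN)
  then have "(\<lambda>\<mu>. \<mu>) -` A \<inter> space N \<in> sets N" using assms by (rule measurable_sets)
  moreover have "A \<subseteq> radon_measures" using sets.sets_into_space[OF assms] by simp
  then have "(\<lambda>\<mu>. \<mu>) -` A \<inter> space N = A" by (auto simp: sN)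
  ultimately show ?thesis using sN by simp
qed

text \<open>Products of Laplace functionals are Laplace functionals of sums, so
  \<open>lap_class\<close> is multiplicative; its unit comes from g = 0.\<close>

lemma radon_monotone_class:
  assumes CV: "\<And>g. rcfun g \<Longrightarrow> (\<lambda>\<mu>. indicator radon_measures \<mu> * lap g \<mu>) \<in> W"
    and add: "\<And>f g. f \<in> W \<Longrightarrow> g \<in> W \<Longrightarrow> (\<lambda>x. f x + g x) \<in> W"
    and scale: "\<And>f c. f \<in> W \<Longrightarrow> (\<lambda>x. c * f x) \<in> W"
    and lim: "\<And>f F (K :: real). (\<And>n. F n \<in> W) \<Longrightarrow> (\<And>n x. x \<in> radon_measures \<Longrightarrow> \<bar>F n x\<bar> \<le> K) \<Longrightarrow>
        (\<And>x. x \<in> radon_measures \<Longrightarrow> (\<lambda>n. F n x) \<longlonglongrightarrow> f x) \<Longrightarrow> f \<in> W"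
    and A: "A \<in> sets (radon_algebra :: 'a measure measure)"
  shows "indicator A \<in> W"
proof (rule functional_monotone_class[where C=lap_class and \<Omega>=radon_measures and e="\<lambda>\<mu>. indicator radon_measures \<mu> * lap (\<lambda>_. 0) \<mu>"])
  have "rcfun (\<lambda>_. 0)" by (simp add: rcfun_def rel_compact_def)
  then show "(\<lambda>\<mu>. indicator radon_measures \<mu> * lap (\<lambda>_. 0) \<mu>) \<in> lap_class"
    unfolding lap_class_def by blast
  show "(\<lambda>x. f x * g x) \<in> lap_class" if "f \<in> lap_class" "g \<in> lap_class" for f g
  proof -
    from that obtain g1 g2 where *: "rcfun g1" "rcfun g2"
      "f = (\<lambda>\<mu>. indicator radon_measures \<mu> * lap g1 \<mu>)" "g = (\<lambda>\<mu>. indicator radon_measures \<mu> * lap g2 \<mu>)"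
      unfolding lap_class_def by blast
    have "(\<lambda>x. f x * g x) = (\<lambda>\<mu>. indicator radon_measures \<mu> * lap (\<lambda>x. g1 x + g2 x) \<mu>)"
    proof
      fix \<mu>
      show "f \<mu> * g \<mu> = indicator radon_measures \<mu> * lap (\<lambda>x. g1 x + g2 x) \<mu>"
        using * by (cases "\<mu> \<in> radon_measures") (auto simp: lap_add sets_radon rcfun_def)
    qed
    then show ?thesis unfolding lap_class_def using rcfun_add[OF *(1,2)] by blast
  qed
  show "lap_class \<subseteq> W" unfolding lap_class_def using CV by auto
  show "A \<in> sigma_sets radon_measures {{x \<in> radon_measures. c < f x} |f c. f \<in> lap_class}"
    by (rule sets_radon_lap_class[OF A])
  show "0 \<le> f x \<and> f x \<le> 1" if "f \<in> lap_class" "x \<in> radon_measures" for f x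
    using that lap_bounds by (auto simp: lap_class_def)
  show "f \<in> W" if "\<And>n. F n \<in> W" "\<And>n x. x \<in> radon_measures \<Longrightarrow> \<bar>F n x\<bar> \<le> K"
    "\<And>x. x \<in> radon_measures \<Longrightarrow> (\<lambda>n. F n x) \<longlonglongrightarrow> f x" for f F K
    using that by (rule lim)
qed (simp_all add: add scale)

text \<open>The bounded measurable functions with equal integrals under \<open>M\<close> and
  \<open>N\<close> satisfy the closure conditions of the monotone class theorem.\<close>

lemma radon_measure_eqI:
  assumes M: "finite_measure M" "sets M = sets radon_algebra"
    and N: "finite_measure N" "sets N = sets radon_algebra"
    and eq: "\<And>g. rcfun g \<Longrightarrow> (LINT \<mu>|M. lap g \<mu>) = (LINT \<mu>|N. lap g (\<mu> :: 'a measure))"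
  shows "M = N"
proof -
  interpret M: finite_measure M by fact
  interpret N: finite_measure N by fact
  have sp: "space M = radon_measures" "space N = radon_measures"
    using sets_eq_imp_space_eq[OF M(2)] sets_eq_imp_space_eq[OF N(2)] by auto
  note mc = measurable_cong_sets[OF M(2) refl] measurable_cong_sets[OF N(2) refl]
  define W :: "('a measure \<Rightarrow> real) set" where "W = {f \<in> borel_measurable radon_algebra. (\<exists>K. \<forall>\<mu>\<in>radon_measures. \<bar>f \<mu>\<bar> \<le> K) \<and>
     (LINT \<mu>|M. f \<mu>) = (LINT \<mu>|N. f \<mu>)}"
  have intM: "integrable M f" if "f \<in> W" for f
  proof -
    from that obtain K where "\<forall>\<mu>\<in>radon_measures. \<bar>f \<mu>\<bar> \<le> K" by (auto simp: W_def)
    then show ?thesis using that sp by (intro M.integrable_const_bound[of _ K]) (auto simp: W_def mc)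
  qed
  have intN: "integrable N f" if "f \<in> W" for f
  proof -
    from that obtain K where "\<forall>\<mu>\<in>radon_measures. \<bar>f \<mu>\<bar> \<le> K" by (auto simp: W_def)
    then show ?thesis using that sp by (intro N.integrable_const_bound[of _ K]) (auto simp: W_def mc)
  qed
  have ind: "indicator A \<in> W" if "A \<in> sets radon_algebra" for A
    using that
  proof (rule radon_monotone_class[rotated 4])
    fix g :: "'a \<Rightarrow> real" assume g: "rcfun g"
    have "(\<lambda>\<mu>. indicator radon_measures \<mu> * lap g \<mu>) \<in> borel_measurable radon_algebra"
      using measurable_lap[of g] g
      by (subst measurable_cong[where g="lap g"]) (auto simp: rcfun_def)
    moreover have "(LINT \<mu>|M. indicator radon_measures \<mu> * lap g \<mu>) = (LINT \<mu>|M. lap g \<mu>)"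
      by (intro Bochner_Integration.integral_cong) (auto simp: sp)
    moreover have "(LINT \<mu>|N. indicator radon_measures \<mu> * lap g \<mu>) = (LINT \<mu>|N. lap g \<mu>)"
      by (intro Bochner_Integration.integral_cong) (auto simp: sp)
    moreover have "\<forall>\<mu>\<in>radon_measures. \<bar>indicator radon_measures \<mu> * lap g \<mu>\<bar> \<le> 1"
      using lap_bounds[of g] by auto
    ultimately show "(\<lambda>\<mu>. indicator radon_measures \<mu> * lap g \<mu>) \<in> W"
      using eq[OF g] unfolding W_def by auto
  next
    fix f g assume fg: "f \<in> W" "g \<in> W"
    then obtain K L where "\<forall>\<mu>\<in>radon_measures. \<bar>f \<mu>\<bar> \<le> K" "\<forall>\<mu>\<in>radon_measures. \<bar>g \<mu>\<bar> \<le> L"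
      by (auto simp: W_def)
    then have "\<forall>\<mu>\<in>radon_measures. \<bar>f \<mu> + g \<mu>\<bar> \<le> K + L"
      by (intro ballI order_trans[OF abs_triangle_ineq] add_mono) auto
    moreover have "(\<lambda>x. f x + g x) \<in> borel_measurable radon_algebra"
      using fg by (intro borel_measurable_add) (simp_all add: W_def)
    moreover have "(LINT \<mu>|M. f \<mu> + g \<mu>) = (LINT \<mu>|N. f \<mu> + g \<mu>)"
      using fg intM[OF fg(1)] intM[OF fg(2)] intN[OF fg(1)] intN[OF fg(2)] by (simp add: W_def)
    ultimately show "(\<lambda>x. f x + g x) \<in> W"
      unfolding W_def mem_Collect_eq by blast
  next
    fix f and c :: real assume f: "f \<in> W"
    then obtain K where "\<forall>\<mu>\<in>radon_measures. \<bar>f \<mu>\<bar> \<le> K" by (auto simp: W_def)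
    then have "\<forall>\<mu>\<in>radon_measures. \<bar>c * f \<mu>\<bar> \<le> \<bar>c\<bar> * K" by (intro ballI) (simp add: abs_mult mult_left_mono)
    moreover have "(\<lambda>x. c * f x) \<in> borel_measurable radon_algebra"
      using f by (intro borel_measurable_times borel_measurable_const) (simp add: W_def)
    moreover have "(LINT \<mu>|M. c * f \<mu>) = (LINT \<mu>|N. c * f \<mu>)" using f by (simp add: W_def)
    ultimately show "(\<lambda>x. c * f x) \<in> W" unfolding W_def mem_Collect_eq by blast
  next
    fix f F K assume F: "\<And>n::nat. F n \<in> W" "\<And>n x. x \<in> radon_measures \<Longrightarrow> \<bar>F n x\<bar> \<le> K"
      "\<And>x. x \<in> radon_measures \<Longrightarrow> (\<lambda>n. F n x) \<longlonglongrightarrow> f x"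
    have Fm: "F n \<in> borel_measurable radon_algebra" for n using F(1)[of n] by (simp add: W_def)
    have fm: "f \<in> borel_measurable radon_algebra"
      by (rule borel_measurable_LIMSEQ_real[of _ F]) (simp_all add: F(3) Fm)
    have "\<bar>f \<mu>\<bar> \<le> K" if "\<mu> \<in> radon_measures" for \<mu>
      using F(2)[OF that] by (intro LIMSEQ_le_const2[OF tendsto_rabs[OF F(3)[OF that]]]) auto
    moreover have lM: "(\<lambda>n. LINT \<mu>|M. F n \<mu>) \<longlonglongrightarrow> (LINT \<mu>|M. f \<mu>)"
      by (rule integral_dominated_convergence[where w="\<lambda>_. K"]) (auto intro!: AE_I2 simp: mc fm Fm F(2,3) sp)
    moreover have lN: "(\<lambda>n. LINT \<mu>|N. F n \<mu>) \<longlonglongrightarrow> (LINT \<mu>|N. f \<mu>)"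
      by (rule integral_dominated_convergence[where w="\<lambda>_. K"]) (auto intro!: AE_I2 simp: mc fm Fm F(2,3) sp)
    moreover have "(LINT \<mu>|M. F n \<mu>) = (LINT \<mu>|N. F n \<mu>)" for n using F(1)[of n] by (simp add: W_def)
    then have "(LINT \<mu>|M. f \<mu>) = (LINT \<mu>|N. f \<mu>)"
      using LIMSEQ_unique[OF lM] lN by simp
    ultimately show "f \<in> W" unfolding W_def mem_Collect_eq using fm by blast
  qed
  show ?thesis
  proof (rule measure_eqI)
    show "sets M = sets N" using M N by simp
    fix A assume A: "A \<in> sets M"
    then have "indicator A \<in> W" using ind M by simp
    then have "(LINT \<mu>|M. indicator A \<mu> :: real) = (LINT \<mu>|N. indicator A \<mu>)"
      by (simp add: W_def)
    then show "emeasure M A = emeasure N A"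
      using A M N sets.sets_into_space[OF A] sp by (simp add: M.emeasure_eq_measure N.emeasure_eq_measure Int_absorb2)
  qed
qed

end

section \<open>Thinning\<close>

text \<open>In terms of u = exp (- g), thinning with retention probability \<open>t\<close> replaces
  1 - u by t (1 - u); \<open>thin_fun\<close> is this substitution carried out on the
  exponent.\<close>

definition thin_fun :: "real \<Rightarrow> ('a \<Rightarrow> real) \<Rightarrow> 'a \<Rightarrow> real" where
  "thin_fun t g x = - ln (1 - t * (1 - exp (- g x)))"

lemma thin_arg:
  assumes "0 \<le> t" "t \<le> 1" "0 \<le> (y::real)"
  shows "0 < 1 - t * (1 - exp (- y))" "1 - t * (1 - exp (- y)) \<le> 1"
proof -
  have "t * (1 - exp (- y)) \<le> 1 * (1 - exp (- y))" using assms by (intro mult_right_mono) auto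
  also have "\<dots> < 1" by simp
  finally show "0 < 1 - t * (1 - exp (- y))" by simp
  show "1 - t * (1 - exp (- y)) \<le> 1" using assms by simp
qed

lemma thin_fun_nonneg: "0 \<le> t \<Longrightarrow> t \<le> 1 \<Longrightarrow> 0 \<le> g x \<Longrightarrow> 0 \<le> thin_fun t g x"
  using thin_arg[of t "g x"] by (simp add: thin_fun_def)

lemma measurable_thin_fun [measurable]: "g \<in> borel_measurable M \<Longrightarrow> thin_fun t g \<in> borel_measurable M"
  unfolding thin_fun_def[abs_def] by measurable

text \<open>The last clause says that atoms have integer or infinite mass: exactly such a mass
  equals the number of naturals below it. This is what makes the labels in
  \<open>unit_masses\<close> count correctly.\<close>

lemma counting_measure_atoms:
  assumes "counting_measure \<phi>"
  shows "\<exists>D. countable D \<and> (\<forall>A\<in>sets borel. emeasure \<phi> A = emeasure \<phi> (A \<inter> D)) \<and> sets \<phi> = sets borel \<and>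
     (\<forall>y. y \<notin> D \<longrightarrow> emeasure \<phi> {y} = 0) \<and>
     (\<forall>y :: 'a::{t2_space,second_countable_topology}. emeasure \<phi> {y} = emeasure (count_space UNIV) {k. of_nat k < emeasure \<phi> {y}})"
proof -
  from assms obtain I and x :: "nat \<Rightarrow> 'a" where \<phi>: "\<phi> = distr (count_space I) borel x"
    unfolding counting_measure_def by blast
  have em: "emeasure \<phi> A = emeasure (count_space I) (x -` A \<inter> I)" if "A \<in> sets borel" for A
    unfolding \<phi> using that by (subst emeasure_distr) auto
  have cD: "countable (x ` I)" by simp
  then have D: "x ` I \<in> sets borel" by (rule sets.countable[rotated]) auto
  show ?thesis
  proof (intro exI[of _ "x ` I"] conjI ballI allI impI)
    fix A :: "'a set" assume A: "A \<in> sets borel"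
    have "x -` A \<inter> I = x -` (A \<inter> x ` I) \<inter> I" by auto
    then show "emeasure \<phi> A = emeasure \<phi> (A \<inter> x ` I)" using A D by (simp add: em)
  next
    fix y :: 'a assume "y \<notin> x ` I"
    then have "x -` {y} \<inter> I = {}" by auto
    then show "emeasure \<phi> {y} = 0" by (simp add: em)
  next
    fix y :: 'a
    show "emeasure \<phi> {y} = emeasure (count_space UNIV) {k. of_nat k < emeasure \<phi> {y}}"
    proof (cases "finite (x -` {y} \<inter> I)")
      case True
      then have *: "emeasure \<phi> {y} = of_nat (card (x -` {y} \<inter> I))" by (simp add: em)
      have "{k. of_nat k < emeasure \<phi> {y}} = {..<card (x -` {y} \<inter> I)}"
        unfolding * by auto
      then show ?thesis by (simp add: *)
    next
      case False
      then have *: "emeasure \<phi> {y} = \<infinity>" by (simp add: em)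
      have "{k. of_nat k < emeasure \<phi> {y}} = UNIV"
        unfolding * by (auto simp: of_nat_less_top)
      then show ?thesis using * by simp
    qed
  qed (auto simp: cD \<phi>)
qed

text \<open>Both measures are carried by one countable set, so they agree as soon as their atoms do;
  the labels over a point \<open>y\<close> are the naturals below the mass of
  \<open>y\<close>.\<close>

lemma
  fixes \<phi> :: "'a::{t2_space,second_countable_topology} measure"
  assumes "counting_measure \<phi>"
  shows counting_measure_unit_masses: "\<phi> = distr (count_space (unit_masses \<phi>)) borel fst"
    and countable_unit_masses: "countable (unit_masses \<phi>)"
proof -
  from counting_measure_atoms[OF assms] obtain D where
    cD: "countable D" and restr: "\<And>A. A \<in> sets borel \<Longrightarrow> emeasure \<phi> A = emeasure \<phi> (A \<inter> D)"
    and s: "sets \<phi> = sets borel" and off: "\<And>y. y \<notin> D \<Longrightarrow> emeasure \<phi> {y} = 0"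
    and atom: "\<And>y. emeasure \<phi> {y} = emeasure (count_space UNIV) {k. of_nat k < emeasure \<phi> {y}}"
    by blast
  have D: "D \<in> sets borel" using cD by (rule sets.countable[rotated]) auto
  have sub: "unit_masses \<phi> \<subseteq> D \<times> UNIV"
    using off by (force simp: unit_masses_def)
  then show "countable (unit_masses \<phi>)"
    by (rule countable_subset) (intro countable_SIGMA cD uncountable_def, auto)
  define \<psi> where "\<psi> = distr (count_space (unit_masses \<phi>)) borel fst"
  have em: "emeasure \<psi> A = emeasure (count_space (unit_masses \<phi>)) (fst -` A \<inter> unit_masses \<phi>)" if "A \<in> sets borel" for A
    unfolding \<psi>_def using that by (subst emeasure_distr) auto
  have at: "emeasure \<psi> {y} = emeasure \<phi> {y}" for y
  proof -
    have "emeasure \<psi> {y} = emeasure (count_space UNIV) (fst -` {y} \<inter> unit_masses \<phi>)"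
      by (simp add: em emeasure_count_space)
    also have "fst -` {y} \<inter> unit_masses \<phi> = Pair y ` {k. of_nat k < emeasure \<phi> {y}}"
      by (auto simp: unit_masses_def)
    also have "emeasure (count_space UNIV) \<dots> = emeasure (count_space UNIV) {k. of_nat k < emeasure \<phi> {y}}"
      by (simp add: emeasure_count_space card_image inj_on_def finite_image_iff)
    finally show ?thesis using atom by simp
  qed
  have restr': "emeasure \<psi> A = emeasure \<psi> (A \<inter> D)" if "A \<in> sets borel" for A
  proof -
    have "fst -` A \<inter> unit_masses \<phi> = fst -` (A \<inter> D) \<inter> unit_masses \<phi>" using sub by auto
    then show ?thesis using that D by (simp add: em)
  qed
  have "\<phi> = \<psi>"
  proof (rule measure_eqI)
    show "sets \<phi> = sets \<psi>" by (simp add: s \<psi>_def)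
    fix A assume "A \<in> sets \<phi>"
    then have A: "A \<in> sets borel" by (simp add: s)
    have c: "countable (A \<inter> D)" using cD by auto
    have "emeasure \<phi> (A \<inter> D) = (\<integral>\<^sup>+y. emeasure \<phi> {y} \<partial>count_space (A \<inter> D))"
      by (rule emeasure_countable_singleton[OF _ c]) (simp add: s)
    also have "\<dots> = (\<integral>\<^sup>+y. emeasure \<psi> {y} \<partial>count_space (A \<inter> D))" by (simp add: at)
    also have "\<dots> = emeasure \<psi> (A \<inter> D)"
      by (rule emeasure_countable_singleton[OF _ c, symmetric]) (simp add: \<psi>_def)
    finally show "emeasure \<phi> A = emeasure \<psi> A" using restr[OF A] restr'[OF A] by simp
  qed
  then show "\<phi> = distr (count_space (unit_masses \<phi>)) borel fst" by (simp add: \<psi>_def)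
qed

definition kept :: "('a::topological_space \<times> nat) set \<Rightarrow> ('a \<times> nat \<Rightarrow> bool) \<Rightarrow> 'a measure" where
  "kept U \<beta> = distr (count_space {p \<in> U. \<beta> p}) borel fst"

lemma emeasure_distr_fst:
  assumes "A \<in> sets borel"
  shows "emeasure (distr (count_space U) borel fst) A = emeasure (count_space UNIV) (fst -` A \<inter> U)"
  using assms by (subst emeasure_distr) (auto simp: emeasure_count_space)

lemma nn_integral_distr_fst:
  assumes "g \<in> borel_measurable borel"
  shows "(\<integral>\<^sup>+x. g x \<partial>distr (count_space U) borel fst) = (\<integral>\<^sup>+p. g (fst p) \<partial>count_space U)"
  using assms by (subst nn_integral_distr) auto

locale thinning =
  fixes \<phi> :: "'a::{t2_space,second_countable_topology} measure" and t :: real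
  assumes count: "counting_measure \<phi>" and radon: "\<phi> \<in> radon_measures" and t01: "0 \<le> t" "t \<le> 1"
begin

abbreviation "U \<equiv> unit_masses \<phi>"

definition "T = (\<Pi>\<^sub>M p\<in>U. measure_pmf (bernoulli_pmf t))"

lemma finite_unit_masses:
  assumes "A \<in> sets borel" "rel_compact A"
  shows "finite {p \<in> U. fst p \<in> A}"
proof -
  have "emeasure \<phi> A < \<infinity>" using radon assms by (auto simp: radon_measures_def)
  then have "emeasure (count_space UNIV) (fst -` A \<inter> U) < \<infinity>"
    by (subst (asm) counting_measure_unit_masses[OF count]) (simp add: emeasure_distr_fst assms)
  then have "finite (fst -` A \<inter> U)" by (auto simp: emeasure_count_space split: if_splits)
  then show ?thesis by (rule rev_finite_subset) auto
qed

sublocale TP: product_prob_space "\<lambda>_. measure_pmf (bernoulli_pmf t)" U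
  by (rule product_prob_spaceI) (rule prob_space_measure_pmf)

lemma nn_integral_rcfun_finite:
  assumes g: "rcfun g"
  shows "(\<integral>\<^sup>+x. ennreal (g x) \<partial>\<phi>) < \<infinity>"
proof -
  have gm[measurable]: "g \<in> borel_measurable borel" using g by (auto simp: rcfun_def)
  define J where "J = {p \<in> U. fst p \<in> {x. g x \<noteq> 0}}"
  have J: "finite J" "J \<subseteq> U"
    unfolding J_def using g finite_unit_masses[of "{x. g x \<noteq> 0}"] by (auto simp: rcfun_def)
  have "(\<integral>\<^sup>+x. ennreal (g x) \<partial>\<phi>) = (\<integral>\<^sup>+p. ennreal (g (fst p)) \<partial>count_space U)"
    by (subst counting_measure_unit_masses[OF count]) (rule nn_integral_distr_fst, measurable)
  also have "\<dots> = (\<Sum>p\<in>J. ennreal (g (fst p)))"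
    using J by (intro nn_integral_count_space') (auto simp: J_def)
  also have "\<dots> = ennreal (\<Sum>p\<in>J. g (fst p))" using g by (intro sum_ennreal) (auto simp: rcfun_def)
  finally show ?thesis by simp
qed

lemma kept_radon: "kept U \<beta> \<in> radon_measures"
proof -
  have "emeasure (kept U \<beta>) A \<le> emeasure \<phi> A" if "A \<in> sets borel" for A
    by (subst (2) counting_measure_unit_masses[OF count])
       (auto simp: kept_def emeasure_distr_fst that intro!: emeasure_mono)
  then show ?thesis
    using radon by (auto simp: radon_measures_def kept_def intro: le_less_trans)
qed

lemma measurable_kept: "kept U \<in> T \<rightarrow>\<^sub>M radon_algebra"
proof (rule measurable_radonI)
  fix A :: "'a set" assume A: "A \<in> sets borel"
  have pred: "Measurable.pred T (\<lambda>\<beta>. \<beta> p)" if "p \<in> U" for p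
  proof -
    have "(\<lambda>\<beta>. \<beta> p) \<in> T \<rightarrow>\<^sub>M measure_pmf (bernoulli_pmf t)"
      unfolding T_def by (rule measurable_component_singleton[OF that])
    then show ?thesis by (simp add: measurable_cong_sets[OF refl sets_measure_pmf_count_space])
  qed
  \<comment> \<open>The number of retained masses in \<open>A\<close> is written as a series over an
    enumeration of \<open>U\<close>, so that each term depends on a single coordinate of
    \<beta>.\<close>
  define h where "h \<beta> n = (if n \<in> to_nat_on U ` U \<and> \<beta> (from_nat_into U n) \<and> fst (from_nat_into U n) \<in> A then 1 else 0 :: ennreal)" for \<beta> n
  have inj: "inj_on (to_nat_on U) U" by (rule inj_on_to_nat_on[OF countable_unit_masses[OF count]])
  have "emeasure (kept U \<beta>) A = (\<Sum>n. h \<beta> n)" for \<beta>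
  proof -
    have "(\<Sum>n. h \<beta> n) = (\<integral>\<^sup>+n. h \<beta> n \<partial>count_space UNIV)" by (simp add: nn_integral_count_space_nat)
    also have "\<dots> = (\<integral>\<^sup>+n. indicator (to_nat_on U ` {p \<in> U. \<beta> p \<and> fst p \<in> A}) n \<partial>count_space UNIV)"
      using countable_unit_masses[OF count] inj
      by (intro nn_integral_cong) (auto simp: h_def indicator_def)
    also have "\<dots> = emeasure (count_space UNIV) (to_nat_on U ` {p \<in> U. \<beta> p \<and> fst p \<in> A})" by simp
    also have "\<dots> = emeasure (count_space UNIV) {p \<in> U. \<beta> p \<and> fst p \<in> A}"
    proof -
      have "inj_on (to_nat_on U) {p \<in> U. \<beta> p \<and> fst p \<in> A}" by (rule inj_on_subset[OF inj]) auto
      then show ?thesis by (simp add: emeasure_count_space card_image finite_image_iff)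
    qed
    also have "{p \<in> U. \<beta> p \<and> fst p \<in> A} = fst -` A \<inter> {p \<in> U. \<beta> p}" by auto
    finally show ?thesis by (simp add: kept_def emeasure_distr_fst A)
  qed
  moreover have "(\<lambda>\<beta>. \<Sum>n. h \<beta> n) \<in> borel_measurable T"
  proof -
    have "(\<lambda>\<beta>. h \<beta> n) \<in> borel_measurable T" for n
    proof (cases "n \<in> to_nat_on U ` U")
      case True
      then have "from_nat_into U n \<in> U" using countable_unit_masses[OF count] by auto
      from pred[OF this] have [measurable]: "Measurable.pred T (\<lambda>\<beta>. \<beta> (from_nat_into U n))" .
      show ?thesis unfolding h_def by measurable
    next
      case False
      then show ?thesis unfolding h_def by simp
    qed
    then show ?thesis by measurable
  qed
  ultimately show "(\<lambda>\<beta>. emeasure (kept U \<beta>) A) \<in> borel_measurable T" by simp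
qed (rule kept_radon)

lemma thin_eq: "thin t \<phi> = distr T radon_algebra (kept U)"
  by (simp add: thin_def T_def kept_def[abs_def])

lemma prob_space_T: "prob_space T"
  unfolding T_def by unfold_locales

lemma prob_space_thin: "prob_space (thin t \<phi>)"
  unfolding thin_eq by (rule prob_space.prob_space_distr[OF prob_space_T measurable_kept])

text \<open>Only finitely many unit masses lie where \<open>g\<close> is nonzero, so the infinite
  product measure reduces to a finite one. By independence each mass at x contributes a factor t exp
  (- g x) + 1 - t, which is \<open>exp (- thin_fun t g x)\<close>.\<close>

lemma lap_thin:
  assumes g: "rcfun g"
  shows "(LINT \<mu>|thin t \<phi>. lap g \<mu>) = lap (thin_fun t g) \<phi>"
proof -
  have gm[measurable]: "g \<in> borel_measurable borel" and g0: "\<And>x. 0 \<le> g x"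
    using g by (auto simp: rcfun_def)
  define J where "J = {p \<in> U. fst p \<in> {x. g x \<noteq> 0}}"
  have J: "finite J" "J \<subseteq> U"
    unfolding J_def using g finite_unit_masses[of "{x. g x \<noteq> 0}"] by (auto simp: rcfun_def)
  have off: "g (fst p) = 0" if "p \<in> U" "p \<notin> J" for p using that by (auto simp: J_def)
  define h where "h p b = (if b then exp (- g (fst p)) else 1)" for p :: "'a \<times> nat" and b
  have lapk: "lap g (kept U \<beta>) = (\<Prod>p\<in>J. h p (\<beta> p))" for \<beta>
  proof -
    have "(\<integral>\<^sup>+x. ennreal (g x) \<partial>kept U \<beta>) = (\<integral>\<^sup>+p. ennreal (g (fst p)) \<partial>count_space {p \<in> U. \<beta> p})"
      unfolding kept_def by (rule nn_integral_distr_fst) measurable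
    also have "\<dots> = (\<Sum>p\<in>{p\<in>J. \<beta> p}. ennreal (g (fst p)))"
      using J off by (intro nn_integral_count_space') auto
    also have "\<dots> = ennreal (\<Sum>p\<in>{p\<in>J. \<beta> p}. g (fst p))" using g0 by (intro sum_ennreal) auto
    finally have "lap g (kept U \<beta>) = exp (- (\<Sum>p\<in>{p\<in>J. \<beta> p}. g (fst p)))"
      unfolding lap_def using g0 by (simp add: exp_neg_ennreal sum_nonneg)
    also have "(\<Sum>p\<in>{p\<in>J. \<beta> p}. g (fst p)) = (\<Sum>p\<in>J. if \<beta> p then g (fst p) else 0)"
      using J by (subst sum.inter_filter) auto
    also have "exp (- \<dots>) = (\<Prod>p\<in>J. h p (\<beta> p))"
      unfolding sum_negf[symmetric] using J by (subst exp_sum) (auto simp: h_def intro!: prod.cong)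
    finally show ?thesis .
  qed
  have hm: "(\<lambda>\<beta>. \<Prod>p\<in>J. h p (\<beta> p)) \<in> borel_measurable (\<Pi>\<^sub>M p\<in>J. measure_pmf (bernoulli_pmf t))"
  proof (intro borel_measurable_prod)
    fix p assume "p \<in> J"
    then have "(\<lambda>\<beta>. \<beta> p) \<in> (\<Pi>\<^sub>M p\<in>J. measure_pmf (bernoulli_pmf t)) \<rightarrow>\<^sub>M measure_pmf (bernoulli_pmf t)"
      by (rule measurable_component_singleton)
    then show "(\<lambda>\<beta>. h p (\<beta> p)) \<in> borel_measurable (\<Pi>\<^sub>M p\<in>J. measure_pmf (bernoulli_pmf t))"
      by (rule measurable_compose) simp
  qed
  have "(LINT \<mu>|thin t \<phi>. lap g \<mu>) = (LINT \<beta>|T. lap g (kept U \<beta>))"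
    unfolding thin_eq by (rule integral_distr[OF measurable_kept measurable_lap[OF gm]])
  also have "\<dots> = (LINT \<beta>|T. (\<Prod>p\<in>J. h p (restrict \<beta> J p)))"
    by (simp add: lapk)
  also have "\<dots> = (LINT \<beta>|distr T (\<Pi>\<^sub>M p\<in>J. measure_pmf (bernoulli_pmf t)) (\<lambda>\<beta>. restrict \<beta> J). (\<Prod>p\<in>J. h p (\<beta> p)))"
    unfolding T_def by (rule integral_distr[symmetric, OF measurable_restrict_subset[OF J(2)] hm])
  also have "\<dots> = (LINT \<beta>|(\<Pi>\<^sub>M p\<in>J. measure_pmf (bernoulli_pmf t)). (\<Prod>p\<in>J. h p (\<beta> p)))"
    unfolding T_def by (subst TP.distr_PiM_restrict_finite[OF J]) simp
  also have "\<dots> = (\<Prod>p\<in>J. LINT b|measure_pmf (bernoulli_pmf t). h p b)"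
    by (rule TP.product_integral_prod[OF J(1)]) (auto intro!: integrable_measure_pmf_finite)
  also have "\<dots> = (\<Prod>p\<in>J. exp (- thin_fun t g (fst p)))"
  proof (intro prod.cong refl)
    fix p
    have "(LINT b|measure_pmf (bernoulli_pmf t). h p b) = t * exp (- g (fst p)) + (1 - t)"
      using t01 by (subst integral_bernoulli_pmf) (auto simp: h_def)
    also have "\<dots> = exp (- thin_fun t g (fst p))"
      using thin_arg(1)[OF t01 g0[of "fst p"]] by (simp add: thin_fun_def algebra_simps)
    finally show "(LINT b|measure_pmf (bernoulli_pmf t). h p b) = exp (- thin_fun t g (fst p))" .
  qed
  also have "\<dots> = exp (- (\<Sum>p\<in>J. thin_fun t g (fst p)))"
    unfolding sum_negf[symmetric] using J by (simp add: exp_sum)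
  also have "\<dots> = lap (thin_fun t g) \<phi>"
  proof -
    have "(\<integral>\<^sup>+x. ennreal (thin_fun t g x) \<partial>\<phi>) = (\<integral>\<^sup>+p. ennreal (thin_fun t g (fst p)) \<partial>count_space U)"
      by (subst counting_measure_unit_masses[OF count]) (rule nn_integral_distr_fst, measurable)
    also have "\<dots> = (\<Sum>p\<in>J. ennreal (thin_fun t g (fst p)))"
      using J off by (intro nn_integral_count_space') (auto simp: thin_fun_def)
    also have "\<dots> = ennreal (\<Sum>p\<in>J. thin_fun t g (fst p))"
      using thin_fun_nonneg[OF t01, of g] g0 by (intro sum_ennreal) auto
    finally show ?thesis
      unfolding lap_def using thin_fun_nonneg[OF t01, of g] g0 by (simp add: exp_neg_ennreal sum_nonneg)
  qed
  finally show ?thesis .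
qed

end

section \<open>The stability equation\<close>

locale lcsc_process = lcsc_base B + prob_space P
  for B :: "nat \<Rightarrow> 'a::{t2_space, second_countable_topology} set" and P :: "'w measure" +
  fixes \<Phi> :: "'w \<Rightarrow> 'a measure"
  assumes process: "point_process P \<Phi>"
begin

definition Lf :: "('a \<Rightarrow> real) \<Rightarrow> real" where
  "Lf g = (LINT \<omega>|P. lap g (\<Phi> \<omega>))"

lemma measurable_\<Phi>: "\<Phi> \<in> P \<rightarrow>\<^sub>M radon_algebra"
  using process by (simp add: point_process_def)

lemma \<Phi>_radon: "\<omega> \<in> space P \<Longrightarrow> \<Phi> \<omega> \<in> radon_measures"
  using measurable_space[OF measurable_\<Phi>] by simp

lemma \<Phi>_counting: "\<omega> \<in> space P \<Longrightarrow> counting_measure (\<Phi> \<omega>)"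
  using process by (simp add: point_process_def)

lemma measurable_lap_\<Phi> [measurable]:
  "g \<in> borel_measurable borel \<Longrightarrow> (\<lambda>\<omega>. lap g (\<Phi> \<omega>)) \<in> borel_measurable P"
  by (rule measurable_compose[OF measurable_\<Phi> measurable_lap])

lemma thinning_\<Phi>: "\<omega> \<in> space P \<Longrightarrow> 0 \<le> t \<Longrightarrow> t \<le> 1 \<Longrightarrow> thinning (\<Phi> \<omega>) t"
  by unfold_locales (auto simp: \<Phi>_counting \<Phi>_radon)

lemma sets_thin: "sets (thin t \<phi>) = sets radon_algebra"
  by (simp add: thin_def)

text \<open>The index set of the product measure in \<open>thin\<close> varies with \<omega>, so
  measurability cannot be read off the definition. On Laplace functionals the kernel gives
  \<open>lap (thin_fun t g) (\<Phi> \<omega>)\<close>, which is measurable in \<omega>; the monotone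
  class theorem does the rest.\<close>

lemma measurable_thin:
  assumes t: "0 \<le> t" "t \<le> 1"
  shows "(\<lambda>\<omega>. thin t (\<Phi> \<omega>)) \<in> P \<rightarrow>\<^sub>M subprob_algebra radon_algebra"
proof (rule measurable_subprob_algebra)
  fix \<omega> assume \<omega>: "\<omega> \<in> space P"
  then interpret thinning "\<Phi> \<omega>" t by (intro thinning_\<Phi> t)
  show "subprob_space (thin t (\<Phi> \<omega>))"
    by (rule prob_space_imp_subprob_space[OF prob_space_thin])
  show "sets (thin t (\<Phi> \<omega>)) = sets radon_algebra" by (rule sets_thin)
next
  fix A :: "'a measure set" assume A: "A \<in> sets radon_algebra"
  define W :: "('a measure \<Rightarrow> real) set" where
    "W = {f \<in> borel_measurable radon_algebra. (\<exists>K. \<forall>\<mu>\<in>radon_measures. \<bar>f \<mu>\<bar> \<le> K) \<and>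
       (\<lambda>\<omega>. LINT \<mu>|thin t (\<Phi> \<omega>). f \<mu>) \<in> borel_measurable P}"
  have prob: "prob_space (thin t (\<Phi> \<omega>))" if "\<omega> \<in> space P" for \<omega>
    using thinning.prob_space_thin[OF thinning_\<Phi>[OF that t]] .
  note mc = measurable_cong_sets[OF sets_thin refl]
  have sp: "space (thin t \<phi>) = radon_measures" for \<phi> :: "'a measure"
    using sets_eq_imp_space_eq[OF sets_thin, of t \<phi>] by simp
  have int: "integrable (thin t (\<Phi> \<omega>)) f"
    if "\<omega> \<in> space P" "f \<in> borel_measurable radon_algebra" "\<forall>\<mu>\<in>radon_measures. \<bar>f \<mu>\<bar> \<le> K" for \<omega> f and K :: real
  proof -
    interpret T: prob_space "thin t (\<Phi> \<omega>)" by (rule prob[OF that(1)])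
    show ?thesis
      by (rule T.integrable_const_bound[of _ K]) (use that in \<open>auto intro!: AE_I2 simp: sp mc\<close>)
  qed
  have "indicator A \<in> W"
  proof (rule radon_monotone_class[OF _ _ _ _ A])
    fix g :: "'a \<Rightarrow> real" assume g: "rcfun g"
    then have gm: "g \<in> borel_measurable borel" by (simp add: rcfun_def)
    have "(\<lambda>\<mu>. indicator radon_measures \<mu> * lap g \<mu>) \<in> borel_measurable radon_algebra"
      using measurable_lap[OF gm] by (subst measurable_cong[where g="lap g"]) auto
    moreover have "\<forall>\<mu>\<in>radon_measures. \<bar>indicator radon_measures \<mu> * lap g \<mu>\<bar> \<le> 1"
      using lap_bounds[of g] by auto
    moreover have "(LINT \<mu>|thin t (\<Phi> \<omega>). indicator radon_measures \<mu> * lap g \<mu>) = lap (thin_fun t g) (\<Phi> \<omega>)"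
      if "\<omega> \<in> space P" for \<omega>
    proof -
      have "(LINT \<mu>|thin t (\<Phi> \<omega>). indicator radon_measures \<mu> * lap g \<mu>) = (LINT \<mu>|thin t (\<Phi> \<omega>). lap g \<mu>)"
        by (intro Bochner_Integration.integral_cong) (auto simp: sp)
      then show ?thesis using thinning.lap_thin[OF thinning_\<Phi>[OF that t] g] by simp
    qed
    then have "(\<lambda>\<omega>. LINT \<mu>|thin t (\<Phi> \<omega>). indicator radon_measures \<mu> * lap g \<mu>) \<in> borel_measurable P"
      using measurable_lap_\<Phi>[OF measurable_thin_fun[OF gm]] by (subst measurable_cong) auto
    ultimately show "(\<lambda>\<mu>. indicator radon_measures \<mu> * lap g \<mu>) \<in> W"
      unfolding W_def mem_Collect_eq by blast
  next
    fix f g assume "f \<in> W" "g \<in> W"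
    then obtain K L where f: "f \<in> borel_measurable radon_algebra" "\<forall>\<mu>\<in>radon_measures. \<bar>f \<mu>\<bar> \<le> K"
        "(\<lambda>\<omega>. LINT \<mu>|thin t (\<Phi> \<omega>). f \<mu>) \<in> borel_measurable P"
      and g: "g \<in> borel_measurable radon_algebra" "\<forall>\<mu>\<in>radon_measures. \<bar>g \<mu>\<bar> \<le> L"
        "(\<lambda>\<omega>. LINT \<mu>|thin t (\<Phi> \<omega>). g \<mu>) \<in> borel_measurable P"
      unfolding W_def by blast
    have "\<forall>\<mu>\<in>radon_measures. \<bar>f \<mu> + g \<mu>\<bar> \<le> K + L"
      using f g by (intro ballI order_trans[OF abs_triangle_ineq] add_mono) auto
    moreover have "(\<lambda>\<omega>. (LINT \<mu>|thin t (\<Phi> \<omega>). f \<mu> + g \<mu>)) \<in> borel_measurable P"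
      using borel_measurable_add[OF f(3) g(3)]
      by (rule measurable_cong[THEN iffD1, rotated])
         (simp add: Bochner_Integration.integral_add[OF int[OF _ f(1,2)] int[OF _ g(1,2)]])
    ultimately show "(\<lambda>x. f x + g x) \<in> W"
      unfolding W_def mem_Collect_eq using borel_measurable_add[OF f(1) g(1)] by blast
  next
    fix f and c :: real assume "f \<in> W"
    then obtain K where f: "f \<in> borel_measurable radon_algebra" "\<forall>\<mu>\<in>radon_measures. \<bar>f \<mu>\<bar> \<le> K"
        "(\<lambda>\<omega>. LINT \<mu>|thin t (\<Phi> \<omega>). f \<mu>) \<in> borel_measurable P"
      unfolding W_def by blast
    have "\<forall>\<mu>\<in>radon_measures. \<bar>c * f \<mu>\<bar> \<le> \<bar>c\<bar> * K"
      using f by (intro ballI) (simp add: abs_mult mult_left_mono)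
    moreover have "(\<lambda>x. c * f x) \<in> borel_measurable radon_algebra"
      using f by (intro borel_measurable_times borel_measurable_const)
    moreover have "(\<lambda>\<omega>. LINT \<mu>|thin t (\<Phi> \<omega>). c * f \<mu>) \<in> borel_measurable P"
      using f(3) by simp
    ultimately show "(\<lambda>x. c * f x) \<in> W" unfolding W_def mem_Collect_eq by blast
  next
    fix f F K assume F: "\<And>n::nat. F n \<in> W" "\<And>n x. x \<in> radon_measures \<Longrightarrow> \<bar>F n x\<bar> \<le> K"
      "\<And>x. x \<in> radon_measures \<Longrightarrow> (\<lambda>n. F n x) \<longlonglongrightarrow> f x"
    have Fm: "F n \<in> borel_measurable radon_algebra"
      "(\<lambda>\<omega>. LINT \<mu>|thin t (\<Phi> \<omega>). F n \<mu>) \<in> borel_measurable P" for n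
      using F(1)[of n] by (simp_all add: W_def)
    have fm: "f \<in> borel_measurable radon_algebra"
      by (rule borel_measurable_LIMSEQ_real[of _ F]) (simp_all add: F(3) Fm)
    have "\<bar>f \<mu>\<bar> \<le> K" if "\<mu> \<in> radon_measures" for \<mu>
      using F(2)[OF that] by (intro LIMSEQ_le_const2[OF tendsto_rabs[OF F(3)[OF that]]]) auto
    moreover have "(\<lambda>\<omega>. LINT \<mu>|thin t (\<Phi> \<omega>). f \<mu>) \<in> borel_measurable P"
    proof (rule borel_measurable_LIMSEQ_real[of _ "\<lambda>n \<omega>. LINT \<mu>|thin t (\<Phi> \<omega>). F n \<mu>"])
      fix \<omega> assume \<omega>: "\<omega> \<in> space P"
      interpret T: prob_space "thin t (\<Phi> \<omega>)" by (rule prob[OF \<omega>])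
      show "(\<lambda>n. LINT \<mu>|thin t (\<Phi> \<omega>). F n \<mu>) \<longlonglongrightarrow> (LINT \<mu>|thin t (\<Phi> \<omega>). f \<mu>)"
        by (rule integral_dominated_convergence[where w="\<lambda>_. K"]) (auto intro!: AE_I2 simp: mc fm Fm F(2,3) sp)
    qed (rule Fm(2))
    ultimately show "f \<in> W" unfolding W_def mem_Collect_eq using fm by blast
  qed
  then have "(\<lambda>\<omega>. LINT \<mu>|thin t (\<Phi> \<omega>). indicator A \<mu> :: real) \<in> borel_measurable P"
    by (simp add: W_def)
  then have "(\<lambda>\<omega>. ennreal (LINT \<mu>|thin t (\<Phi> \<omega>). indicator A \<mu> :: real)) \<in> borel_measurable P"
    by measurable
  then show "(\<lambda>\<omega>. emeasure (thin t (\<Phi> \<omega>)) A) \<in> borel_measurable P"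
  proof (rule measurable_cong[THEN iffD1, rotated])
    fix \<omega> assume \<omega>: "\<omega> \<in> space P"
    interpret T: prob_space "thin t (\<Phi> \<omega>)" by (rule prob[OF \<omega>])
    have "A \<inter> space (thin t (\<Phi> \<omega>)) = A" using sets.sets_into_space[OF A] by (auto simp: sp)
    then show "ennreal (LINT \<mu>|thin t (\<Phi> \<omega>). indicator A \<mu> :: real) = emeasure (thin t (\<Phi> \<omega>)) A"
      using A by (simp add: T.emeasure_eq_measure)
  qed
qed

lemma space_P_nonempty: "space P \<noteq> {}"
  by (rule not_empty)

lemma
  assumes t: "0 \<le> t" "t \<le> 1"
  shows sets_thinned_law: "sets (thinned_law P \<Phi> t) = sets radon_algebra"
    and prob_space_thinned_law: "prob_space (thinned_law P \<Phi> t)"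
    and lap_thinned_law: "rcfun g \<Longrightarrow> (LINT \<mu>|thinned_law P \<Phi> t. lap g \<mu>) = Lf (thin_fun t g)"
proof -
  show s: "sets (thinned_law P \<Phi> t) = sets radon_algebra"
    unfolding thinned_law_def by (rule sets_bind[OF sets_thin space_P_nonempty])
  show "prob_space (thinned_law P \<Phi> t)"
    unfolding thinned_law_def
    by (rule prob_space_bind[OF _ measurable_thin[OF t]])
       (auto intro!: AE_I2 thinning.prob_space_thin thinning_\<Phi> t)
  show "(LINT \<mu>|thinned_law P \<Phi> t. lap g \<mu>) = Lf (thin_fun t g)" if g: "rcfun g"
  proof -
    have gm: "g \<in> borel_measurable borel" using g by (simp add: rcfun_def)
    have "(LINT \<mu>|thinned_law P \<Phi> t. lap g \<mu>) = (LINT \<omega>|P. LINT \<mu>|thin t (\<Phi> \<omega>). lap g \<mu>)"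
      unfolding thinned_law_def
    proof (rule integral_bind[where B'=1 and B=1, OF measurable_lap[OF gm] _ measurable_thin[OF t]])
      show "AE \<omega> in P. emeasure (thin t (\<Phi> \<omega>)) (space (thin t (\<Phi> \<omega>))) \<le> ennreal 1"
        by (auto intro!: AE_I2 prob_space.measure_le_1 thinning.prob_space_thin thinning_\<Phi> t)
    qed (use lap_bounds[of g] in \<open>auto intro: finite_measure_axioms\<close>)
    also have "\<dots> = Lf (thin_fun t g)"
      unfolding Lf_def by (intro Bochner_Integration.integral_cong refl thinning.lap_thin[OF thinning_\<Phi> g] t)
    finally show ?thesis .
  qed
qed

text \<open>Laplace functionals determine laws and turn the superposition of independent processes
  into products, while thinning acts through \<open>thin_fun\<close>. The equality of laws thus
  becomes a functional equation for \<open>Lf\<close>.\<close>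

lemma discrete_stable_iff:
  assumes "0 < \<alpha>"
  shows "discrete_stable P \<Phi> \<alpha> \<longleftrightarrow> (\<forall>t g. 0 \<le> t \<longrightarrow> t \<le> 1 \<longrightarrow> rcfun g \<longrightarrow>
     Lf (thin_fun (t powr (1/\<alpha>)) g) * Lf (thin_fun ((1 - t) powr (1/\<alpha>)) g) = Lf g)"
proof -
  have main: "distr (thinned_law P \<Phi> r \<Otimes>\<^sub>M thinned_law P \<Phi> s) radon_algebra (\<lambda>(\<mu>, \<nu>). superpose \<mu> \<nu>) = distr P radon_algebra \<Phi>
      \<longleftrightarrow> (\<forall>g. rcfun g \<longrightarrow> Lf (thin_fun r g) * Lf (thin_fun s g) = Lf g)"
    if r: "0 \<le> r" "r \<le> 1" and s: "0 \<le> s" "s \<le> 1" for r s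
  proof -
    interpret R: prob_space "thinned_law P \<Phi> r" by (rule prob_space_thinned_law[OF r])
    interpret S: prob_space "thinned_law P \<Phi> s" by (rule prob_space_thinned_law[OF s])
    interpret RS: pair_prob_space "thinned_law P \<Phi> r" "thinned_law P \<Phi> s" ..
    note [measurable_cong] = sets_thinned_law[OF r] sets_thinned_law[OF s]
    have spR: "space (thinned_law P \<Phi> r) = radon_measures" "space (thinned_law P \<Phi> s) = radon_measures"
      using sets_eq_imp_space_eq[OF sets_thinned_law[OF r]] sets_eq_imp_space_eq[OF sets_thinned_law[OF s]] by auto
    have sup: "(\<lambda>(\<mu>, \<nu>). superpose \<mu> \<nu>) \<in> thinned_law P \<Phi> r \<Otimes>\<^sub>M thinned_law P \<Phi> s \<rightarrow>\<^sub>M radon_algebra"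
      using measurable_superpose
      by (simp add: measurable_cong_sets[OF sets_pair_measure_cong[OF sets_thinned_law[OF r] sets_thinned_law[OF s]] refl])
    let ?M = "distr (thinned_law P \<Phi> r \<Otimes>\<^sub>M thinned_law P \<Phi> s) radon_algebra (\<lambda>(\<mu>, \<nu>). superpose \<mu> \<nu>)"
    have L1: "(LINT \<mu>|?M. lap g \<mu>) = Lf (thin_fun r g) * Lf (thin_fun s g)" if g: "rcfun g" for g
    proof -
      have gm: "g \<in> borel_measurable borel" using g by (simp add: rcfun_def)
      note [measurable] = measurable_lap[OF gm]
      have "(LINT \<mu>|?M. lap g \<mu>) = (LINT p|(thinned_law P \<Phi> r \<Otimes>\<^sub>M thinned_law P \<Phi> s). lap g (case p of (\<mu>, \<nu>) \<Rightarrow> superpose \<mu> \<nu>))"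
        by (rule integral_distr[OF sup]) measurable
      also have "\<dots> = (LINT p|(thinned_law P \<Phi> r \<Otimes>\<^sub>M thinned_law P \<Phi> s). lap g (fst p) * lap g (snd p))"
        by (intro Bochner_Integration.integral_cong)
           (auto simp: space_pair_measure spR lap_superpose gm)
      also have "\<dots> = (LINT \<mu>|thinned_law P \<Phi> r. LINT \<nu>|thinned_law P \<Phi> s. lap g \<mu> * lap g \<nu>)"
      proof (subst RS.integral_fst'[symmetric])
        show "integrable (thinned_law P \<Phi> r \<Otimes>\<^sub>M thinned_law P \<Phi> s) (\<lambda>p. lap g (fst p) * lap g (snd p))"
          by (rule RS.P.integrable_const_bound[of _ 1])
             (auto intro!: AE_I2 mult_le_one lap_bounds simp: lap_bounds)
      qed simp
      also have "\<dots> = (LINT \<mu>|thinned_law P \<Phi> r. lap g \<mu>) * (LINT \<nu>|thinned_law P \<Phi> s. lap g \<nu>)"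
        by simp
      finally show ?thesis using lap_thinned_law[OF r g] lap_thinned_law[OF s g] by simp
    qed
    have L2: "(LINT \<mu>|distr P radon_algebra \<Phi>. lap g \<mu>) = Lf g" if g: "rcfun g" for g
      unfolding Lf_def using g by (intro integral_distr[OF measurable_\<Phi> measurable_lap]) (simp add: rcfun_def)
    have fin: "finite_measure ?M" "finite_measure (distr P radon_algebra \<Phi>)"
      using RS.P.prob_space_distr[OF sup] prob_space_distr[OF measurable_\<Phi>]
      by (auto dest: prob_space.finite_measure)
    show ?thesis
    proof
      assume eq: "?M = distr P radon_algebra \<Phi>"
      then show "\<forall>g. rcfun g \<longrightarrow> Lf (thin_fun r g) * Lf (thin_fun s g) = Lf g"
        using L1 L2 by metis
    next
      assume "\<forall>g. rcfun g \<longrightarrow> Lf (thin_fun r g) * Lf (thin_fun s g) = Lf g"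
      then show "?M = distr P radon_algebra \<Phi>"
        using L1 L2 by (intro radon_measure_eqI fin) auto
    qed
  qed
  have pw: "0 \<le> t powr (1/\<alpha>)" "t powr (1/\<alpha>) \<le> 1" if "0 \<le> t" "t \<le> 1" for t
    using that assms powr_mono2[of "1/\<alpha>" t 1] by auto
  have "discrete_stable P \<Phi> \<alpha> \<longleftrightarrow> (\<forall>t\<in>{0..1}. \<forall>g. rcfun g \<longrightarrow>
     Lf (thin_fun (t powr (1/\<alpha>)) g) * Lf (thin_fun ((1 - t) powr (1/\<alpha>)) g) = Lf g)"
    unfolding discrete_stable_def using main pw by (intro ball_cong refl) auto
  then show ?thesis by auto
qed

lemma nn_integral_\<Phi>_finite:
  assumes "\<omega> \<in> space P" "rcfun g"
  shows "(\<integral>\<^sup>+x. ennreal (g x) \<partial>\<Phi> \<omega>) < \<infinity>"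
  using thinning.nn_integral_rcfun_finite[OF thinning_\<Phi>[of \<omega> 0]] assms by simp

lemma lap_eq_exp:
  assumes "sets \<mu> = sets borel" "g \<in> borel_measurable borel" "\<And>x. 0 \<le> g x"
    "(\<integral>\<^sup>+x. ennreal (g x) \<partial>\<mu>) < \<infinity>"
  shows "lap g \<mu> = exp (- (LINT x|\<mu>. g x))"
proof -
  have "(LINT x|\<mu>. g x) = enn2real (\<integral>\<^sup>+x. ennreal (g x) \<partial>\<mu>)"
    using assms by (intro integral_eq_nn_integral) (auto simp: measurable_cong_sets[OF assms(1) refl])
  then show ?thesis using assms(4) by (auto simp: lap_def exp_neg_def)
qed

text \<open>Although - ln u may be unbounded, its integral is finite, because each realisation has
  only finitely many unit masses where u differs from 1. The Bochner integral in \<open>pgfl\<close>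
  is therefore the true one and not a default value.\<close>

lemma pgfl_eq_Lf:
  assumes u: "\<And>x. 0 < u x" "\<And>x. u x \<le> 1" "u \<in> borel_measurable borel" "(\<lambda>x. 1 - u x) \<in> BM"
  shows "pgfl P \<Phi> u = Lf (\<lambda>x. - ln (u x))" "rcfun (\<lambda>x. - ln (u x))"
proof -
  have eq: "{x. - ln (u x) \<noteq> 0} = {x. 1 - u x \<noteq> 0}"
    using u(1) by auto
  show r: "rcfun (\<lambda>x. - ln (u x))"
    unfolding rcfun_def eq using u by (auto simp: BM_def rel_compact_def)
  have "exp (LINT x|\<Phi> \<omega>. ln (u x)) = lap (\<lambda>x. - ln (u x)) (\<Phi> \<omega>)" if "\<omega> \<in> space P" for \<omega>
    using lap_eq_exp[OF sets_radon[OF \<Phi>_radon[OF that]] _ _ nn_integral_\<Phi>_finite[OF that r]] r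
    by (simp add: rcfun_def)
  then show "pgfl P \<Phi> u = Lf (\<lambda>x. - ln (u x))"
    unfolding pgfl_def Lf_def by (intro Bochner_Integration.integral_cong) auto
qed

lemma rcfun_imp_BM:
  assumes "rcfun g" "\<And>x. g x \<le> K"
  shows "g \<in> BM"
  unfolding BM_def using assms
  by (auto simp: rcfun_def rel_compact_def bounded_iff intro!: exI[of _ K])

lemma BM_imp_rcfun: "g \<in> BM \<Longrightarrow> rcfun g"
  by (auto simp: BM_def rcfun_def rel_compact_def)

text \<open>Thinning with probability \<open>s\<close> multiplies 1 - u by \<open>s\<close> and
  hence the exponent by \<open>s powr \<alpha>\<close>. For the two thinning probabilities in the
  stability equation these factors are t and 1 - t, which add up to one.\<close>

lemma stable_if_pgfl:
  assumes \<alpha>: "0 < \<alpha>"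
    and G: "\<And>u. (\<And>x. 0 < u x \<and> u x \<le> 1) \<Longrightarrow> u \<in> borel_measurable borel \<Longrightarrow> (\<lambda>x. 1 - u x) \<in> BM \<Longrightarrow>
          pgfl P \<Phi> u = exp (- (LINT \<mu>|\<sigma>. (LINT x|\<mu>. 1 - u x) powr \<alpha>))"
  shows "discrete_stable P \<Phi> \<alpha>"
  unfolding discrete_stable_iff[OF \<alpha>]
proof (intro allI impI)
  fix t :: real and g :: "'a \<Rightarrow> real"
  assume t: "0 \<le> t" "t \<le> 1" and g: "rcfun g"
  have gm[measurable]: "g \<in> borel_measurable borel" and g0: "\<And>x. 0 \<le> g x"
    using g by (auto simp: rcfun_def)
  define I where "I = (LINT \<mu>|\<sigma>. (LINT x|\<mu>. 1 - exp (- g x)) powr \<alpha>)"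
  have L: "Lf (thin_fun s g) = exp (- (s powr \<alpha> * I))" if s: "0 \<le> s" "s \<le> 1" for s
  proof -
    define u where "u x = 1 - s * (1 - exp (- g x))" for x
    have u: "0 < u x" "u x \<le> 1" for x
      using thin_arg[OF s g0[of x]] by (auto simp: u_def)
    have um: "u \<in> borel_measurable borel" unfolding u_def[abs_def] by measurable
    have BM: "(\<lambda>x. 1 - u x) \<in> BM"
    proof (rule rcfun_imp_BM[where K=1])
      show "rcfun (\<lambda>x. 1 - u x)"
        unfolding rcfun_def using u um g by (auto simp: u_def rcfun_def elim!: rel_compact_subset)
      show "1 - u x \<le> 1" for x using u(1)[of x] by simp
    qed
    have "thin_fun s g = (\<lambda>x. - ln (u x))" by (auto simp: thin_fun_def u_def)
    then have "Lf (thin_fun s g) = pgfl P \<Phi> u" using pgfl_eq_Lf(1)[OF u um BM] by simp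
    also have "\<dots> = exp (- (LINT \<mu>|\<sigma>. (LINT x|\<mu>. 1 - u x) powr \<alpha>))" using u um BM by (intro G) auto
    also have "(LINT \<mu>|\<sigma>. (LINT x|\<mu>. 1 - u x) powr \<alpha>) = s powr \<alpha> * I"
      unfolding I_def u_def by (simp add: powr_mult)
    finally show ?thesis .
  qed
  have pw: "0 \<le> t powr (1/\<alpha>)" "t powr (1/\<alpha>) \<le> 1" "(t powr (1/\<alpha>)) powr \<alpha> = t" if "0 \<le> t" "t \<le> 1" for t
    using that \<alpha> powr_mono2[of "1/\<alpha>" t 1] by (auto simp: powr_powr)
  have "thin_fun 1 g = g" by (auto simp: thin_fun_def)
  then have "Lf g = exp (- I)" using L[of 1] by simp
  moreover have "Lf (thin_fun (t powr (1/\<alpha>)) g) = exp (- (t * I))"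
    using L[OF pw(1,2)[OF t]] pw(3)[OF t] by simp
  moreover have "Lf (thin_fun ((1-t) powr (1/\<alpha>)) g) = exp (- ((1-t) * I))"
    using L[OF pw(1,2)[of "1-t"]] pw(3)[of "1-t"] t by simp
  ultimately show "Lf (thin_fun (t powr (1/\<alpha>)) g) * Lf (thin_fun ((1 - t) powr (1/\<alpha>)) g) = Lf g"
    by (simp add: exp_add[symmetric] algebra_simps)
qed

lemma integrable_lap: "g \<in> borel_measurable borel \<Longrightarrow> integrable P (\<lambda>\<omega>. lap g (\<Phi> \<omega>))"
  by (rule integrable_const_bound[of _ 1]) (auto simp: lap_bounds)

lemma Lf_bounds: "0 \<le> Lf g" "g \<in> borel_measurable borel \<Longrightarrow> Lf g \<le> 1"
proof -
  show "0 \<le> Lf g" unfolding Lf_def by (intro integral_nonneg_AE AE_I2 lap_bounds)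
  assume "g \<in> borel_measurable borel"
  then have "Lf g \<le> (LINT \<omega>|P. 1)"
    unfolding Lf_def by (intro integral_mono integrable_lap) (auto simp: lap_bounds)
  then show "Lf g \<le> 1" by (simp add: prob_space)
qed

lemma Lf_antimono:
  assumes "g \<in> borel_measurable borel" "h \<in> borel_measurable borel" "\<And>x. g x \<le> h x"
  shows "Lf h \<le> Lf g"
  unfolding Lf_def using assms by (intro integral_mono integrable_lap lap_mono) auto

lemma Lf_tendsto:
  assumes "\<And>n. g n \<in> borel_measurable borel" "h \<in> borel_measurable borel"
    "AE \<omega> in P. (\<lambda>n. lap (g n) (\<Phi> \<omega>)) \<longlonglongrightarrow> lap h (\<Phi> \<omega>)"
  shows "(\<lambda>n. Lf (g n)) \<longlonglongrightarrow> Lf h"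
  unfolding Lf_def using assms
  by (intro integral_dominated_convergence[where w="\<lambda>_. 1"]) (auto simp: lap_bounds)

lemma Lf_pos:
  assumes [measurable]: "g \<in> borel_measurable borel"
    and fin: "AE \<omega> in P. (\<integral>\<^sup>+x. ennreal (g x) \<partial>\<Phi> \<omega>) < \<infinity>"
  shows "0 < Lf g"
proof -
  have "Lf g \<noteq> 0"
  proof
    assume "Lf g = 0"
    then have "AE \<omega> in P. lap g (\<Phi> \<omega>) = 0"
      unfolding Lf_def by (subst (asm) integral_nonneg_eq_0_iff_AE) (auto simp: integrable_lap lap_bounds)
    with fin have "AE \<omega> in P. False"
    proof eventually_elim
      case (elim \<omega>)
      then show ?case using exp_neg_pos[OF elim(1)] by (simp add: lap_def)
    qed
    then show False using AE_False by simp
  qed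
  then show ?thesis using Lf_bounds(1)[of g] by simp
qed

text \<open>
  The weights of \<open>h0\<close> decrease fast enough for \<open>\<integral> h0 d\<Phi>\<close> to be almost surely finite (Borel--Cantelli),
  while \<open>h0\<close> is bounded below on every relatively compact set.
\<close>

lemma exists_reference:
  obtains h0 :: "'a \<Rightarrow> real" where "h0 \<in> borel_measurable borel" "\<And>x. 0 < h0 x" "\<And>x. h0 x \<le> 1"
    "AE \<omega> in P. (\<integral>\<^sup>+x. ennreal (h0 x) \<partial>\<Phi> \<omega>) < \<infinity>"
    "\<And>A. rel_compact A \<Longrightarrow> \<exists>c>0. \<forall>x\<in>A. c \<le> h0 x"
proof -
  define Bs where "Bs i = B (Suc i)" for i
  have Bs[measurable]: "Bs i \<in> sets borel" for i unfolding Bs_def by (intro borel_open open_B)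
  have cnt[measurable]: "(\<lambda>\<omega>. emeasure (\<Phi> \<omega>) (Bs i)) \<in> borel_measurable P" for i
    by (rule measurable_compose[OF measurable_\<Phi> measurable_emeasure_radon[OF Bs]])
  have fin: "emeasure (\<Phi> \<omega>) (Bs i) < \<infinity>" if "\<omega> \<in> space P" for \<omega> i
    using \<Phi>_radon[OF that] Bs[of i] rel_compact_B[of "Suc i"] by (auto simp: radon_measures_def Bs_def)
  \<comment> \<open>Each count is finite, so the probability that it exceeds \<open>M\<close> tends
    to 0 as \<open>M\<close> grows; the levels (1/2)^i are summable, as Borel-Cantelli
    requires.\<close>
  have "\<exists>M::nat. measure P {\<omega> \<in> space P. of_nat M < emeasure (\<Phi> \<omega>) (Bs i)} \<le> (1/2) ^ i" for i
  proof -
    define E where "E M = {\<omega> \<in> space P. of_nat M < emeasure (\<Phi> \<omega>) (Bs i)}" for M :: nat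
    have "(\<lambda>M. measure P (E M)) \<longlonglongrightarrow> measure P (\<Inter>M. E M)"
    proof (rule finite_Lim_measure_decseq)
      show "range E \<subseteq> sets P" unfolding E_def by auto
      show "decseq E" unfolding E_def decseq_def
        by (auto intro: le_less_trans[rotated] simp: of_nat_le_iff)
    qed
    moreover have "(\<Inter>M. E M) = {}"
    proof (rule ccontr)
      assume "(\<Inter>M. E M) \<noteq> {}"
      then obtain \<omega> where \<omega>: "\<omega> \<in> space P" "\<And>M. of_nat M < emeasure (\<Phi> \<omega>) (Bs i)"
        by (auto simp: E_def)
      obtain r where r: "0 \<le> r" "emeasure (\<Phi> \<omega>) (Bs i) = ennreal r"
        using fin[OF \<omega>(1), of i] by (cases "emeasure (\<Phi> \<omega>) (Bs i)") auto
      obtain M where "r < real M" using reals_Archimedean2 by blast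
      then have "ennreal r < of_nat M" using r by (simp add: ennreal_of_nat_eq_real_of_nat ennreal_lessI)
      then show False using \<omega>(2)[of M] r by simp
    qed
    ultimately have "(\<lambda>M. measure P (E M)) \<longlonglongrightarrow> 0" by simp
    then have "\<forall>\<^sub>F M in sequentially. measure P (E M) < (1/2) ^ i"
      by (rule order_tendstoD) simp
    then obtain M where "measure P (E M) < (1/2) ^ i"
      using eventually_happens trivial_limit_sequentially by blast
    then show ?thesis unfolding E_def by (intro exI[of _ M]) simp
  qed
  then obtain M :: "nat \<Rightarrow> nat" where
    M: "\<And>i. measure P {\<omega> \<in> space P. of_nat (M i) < emeasure (\<Phi> \<omega>) (Bs i)} \<le> (1/2) ^ i"
    by metis
  \<comment> \<open>Division by \<open>1 + M i\<close> bounds \<open>c i\<close> times the count by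
    (1/2)^i off the exceptional event; the factor (1/2)^(i + 1) makes all the weights together at
    most 1.\<close>
  define c where "c i = (1/2) ^ Suc i / (1 + real (M i))" for i
  have c: "0 < c i" "c i \<le> (1/2) ^ Suc i" "c i * real (M i) \<le> (1/2) ^ i" for i
  proof -
    show "0 < c i" by (simp add: c_def)
    have "c i \<le> (1/2) ^ Suc i / 1" unfolding c_def by (intro divide_left_mono) auto
    then show "c i \<le> (1/2) ^ Suc i" by simp
    have "c i * real (M i) = (1/2) ^ Suc i * (real (M i) / (1 + real (M i)))" by (simp add: c_def)
    also have "\<dots> \<le> (1/2) ^ Suc i * 1" by (intro mult_left_mono) auto
    finally show "c i * real (M i) \<le> (1/2) ^ i" by (simp add: field_simps)
  qed
  have half: "(\<lambda>i. (1/2::real) ^ Suc i) sums 1" using power_half_series .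
  define h0 where "h0 x = (\<Sum>i. c i * indicator (Bs i) x)" for x
  have le: "norm (c i * indicator (Bs i) x) \<le> (1/2) ^ Suc i" for i x
    using c[of i] by (auto simp: indicator_def)
  have summ: "summable (\<lambda>i. c i * indicator (Bs i) x)" for x
    by (rule summable_comparison_test'[OF sums_summable[OF half] le])
  have nn: "0 \<le> c i * indicator (Bs i) x" for i x using c[of i] by auto
  have lower: "c i \<le> h0 x" if "x \<in> Bs i" for i x
  proof -
    have "(\<Sum>j\<in>{i}. c j * indicator (Bs j) x) \<le> h0 x"
      unfolding h0_def by (intro sum_le_suminf summ nn) auto
    then show ?thesis using that by simp
  qed
  show thesis
  proof (rule that[of h0])
    show "h0 \<in> borel_measurable borel" unfolding h0_def[abs_def] by measurable
    show "0 < h0 x" for x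
    proof -
      obtain i where "1 \<le> i" "x \<in> B i" using basisE[of UNIV x] by auto
      then have "x \<in> Bs (i - 1)" by (simp add: Bs_def)
      from lower[OF this] show ?thesis using c(1)[of "i-1"] by simp
    qed
    show "h0 x \<le> 1" for x
    proof -
      have "h0 x \<le> (\<Sum>i. (1/2) ^ Suc i)" unfolding h0_def
        using le[of _ x] nn by (intro suminf_le summ sums_summable[OF half]) (auto simp: abs_le_iff)
      then show ?thesis using sums_unique[OF half] by simp
    qed
    show "\<exists>d>0. \<forall>x\<in>A. d \<le> h0 x" if rc: "rel_compact A" for A
    proof -
      obtain n where n: "A \<subseteq> V n" using rel_compact_subset_V[OF rc] .
      define d where "d = Min (insert 1 (c ` {..<n}))"
      have "d > 0" unfolding d_def using c(1) by (subst Min_gr_iff) auto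
      moreover have "d \<le> h0 x" if "x \<in> A" for x
      proof -
        have "x \<in> V n" using that n by (rule rev_subsetD)
        then obtain i where i: "1 \<le> i" "i \<le> n" "x \<in> B i" unfolding V_def by auto
        then have "x \<in> Bs (i - 1)" by (simp add: Bs_def)
        from lower[OF this] have "c (i - 1) \<le> h0 x" .
        moreover have "d \<le> c (i - 1)" unfolding d_def using i by (intro Min_le) auto
        ultimately show ?thesis by simp
      qed
      ultimately show ?thesis by blast
    qed
    have "AE \<omega> in P. eventually (\<lambda>i. \<omega> \<in> space P - {\<omega> \<in> space P. of_nat (M i) < emeasure (\<Phi> \<omega>) (Bs i)}) sequentially"
    proof (rule borel_cantelli_AE1)
      show "summable (\<lambda>i. measure P {\<omega> \<in> space P. of_nat (M i) < emeasure (\<Phi> \<omega>) (Bs i)})"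
        by (rule summable_comparison_test'[OF summable_geometric[of "1/2::real"]]) (use M in auto)
    qed (auto simp: less_top[symmetric])
    then show "AE \<omega> in P. (\<integral>\<^sup>+x. ennreal (h0 x) \<partial>\<Phi> \<omega>) < \<infinity>"
    proof (rule AE_mp, intro AE_I2 impI)
      fix \<omega> assume \<omega>: "\<omega> \<in> space P"
        and ev: "eventually (\<lambda>i. \<omega> \<in> space P - {\<omega> \<in> space P. of_nat (M i) < emeasure (\<Phi> \<omega>) (Bs i)}) sequentially"
      have s: "sets (\<Phi> \<omega>) = sets borel" by (rule sets_radon[OF \<Phi>_radon[OF \<omega>]])
      define b where "b i = enn2real (emeasure (\<Phi> \<omega>) (Bs i))" for i
      have b: "emeasure (\<Phi> \<omega>) (Bs i) = ennreal (b i)" "0 \<le> b i" for i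
        using fin[OF \<omega>, of i] by (auto simp: b_def less_top)
      have "(\<integral>\<^sup>+x. ennreal (h0 x) \<partial>\<Phi> \<omega>) = (\<integral>\<^sup>+x. (\<Sum>i. ennreal (c i) * indicator (Bs i) x) \<partial>\<Phi> \<omega>)"
      proof (intro nn_integral_cong)
        fix x
        have "ennreal (h0 x) = (\<Sum>i. ennreal (c i * indicator (Bs i) x))"
          unfolding h0_def using summ nn by (simp add: suminf_ennreal2)
        also have "\<dots> = (\<Sum>i. ennreal (c i) * indicator (Bs i) x)"
          using c(1) by (simp add: ennreal_mult less_imp_le ennreal_indicator)
        finally show "ennreal (h0 x) = (\<Sum>i. ennreal (c i) * indicator (Bs i) x)" .
      qed
      also have "\<dots> = (\<Sum>i. \<integral>\<^sup>+x. ennreal (c i) * indicator (Bs i) x \<partial>\<Phi> \<omega>)"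
        by (intro nn_integral_suminf) (auto simp: measurable_cong_sets[OF s refl])
      also have "\<dots> = (\<Sum>i. ennreal (c i * b i))"
        using c(1) b by (simp add: nn_integral_cmult_indicator s ennreal_mult less_imp_le)
      also have "\<dots> < \<infinity>"
      proof -
        have "summable (\<lambda>i. c i * b i)"
        proof (rule summable_comparison_test_ev[OF _ summable_geometric[of "1/2::real"]])
          show "\<forall>\<^sub>F i in sequentially. norm (c i * b i) \<le> (1/2) ^ i"
            using ev
          proof eventually_elim
            case (elim i)
            then have "ennreal (b i) \<le> of_nat (M i)" using b \<omega> by (simp add: not_less)
            then have "b i \<le> real (M i)" by (simp add: ennreal_of_nat_eq_real_of_nat)
            then have "c i * b i \<le> c i * real (M i)" using c(1)[of i] by (intro mult_left_mono) auto
            then have "c i * b i \<le> (1/2) ^ i" using c(3)[of i] by (rule order_trans)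
            then show ?case using c(1)[of i] b(2)[of i] by (simp add: abs_mult)
          qed
        qed simp
        then show ?thesis using c b by (subst suminf_ennreal2) (auto simp: less_imp_le)
      qed
      finally show "(\<integral>\<^sup>+x. ennreal (h0 x) \<partial>\<Phi> \<omega>) < \<infinity>" .
    qed
  qed
qed

end

section \<open>Homogeneity of the generating functional\<close>

locale stable_process = lcsc_process B P \<Phi>
  for B :: "nat \<Rightarrow> 'a::{t2_space, second_countable_topology} set" and P :: "'w measure" and \<Phi> +
  fixes \<alpha> :: real and h0 :: "'a \<Rightarrow> real"
  assumes \<alpha>: "0 < \<alpha>" "\<alpha> \<le> 1" and stable: "discrete_stable P \<Phi> \<alpha>"
    and h0m [measurable]: "h0 \<in> borel_measurable borel" and h0_pos: "\<And>x. 0 < h0 x" and h0_le: "\<And>x. h0 x \<le> 1"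
    and h0_fin: "AE \<omega> in P. (\<integral>\<^sup>+x. ennreal (h0 x) \<partial>\<Phi> \<omega>) < \<infinity>"
    and h0_lower: "\<And>A. rel_compact A \<Longrightarrow> \<exists>c>0. \<forall>x\<in>A. c \<le> h0 x"
begin

text \<open>\<open>q k\<close> is the paper's \<open>G\<^sub>\<Phi>[1 - k]\<close>.\<close>

definition q :: "('a \<Rightarrow> real) \<Rightarrow> real" where
  "q k = Lf (\<lambda>x. - ln (1 - k x))"

text \<open>For bounded k the division by n brings the argument below 1, where G[1 - k / n] makes
  sense. By homogeneity the sequence is eventually constant (\<open>\<psi>_eq\<close>), so the limit
  only serves to select that value without mentioning a bound for k.\<close>

definition \<psi> :: "('a \<Rightarrow> real) \<Rightarrow> real" where
  "\<psi> k = lim (\<lambda>n. real n powr \<alpha> * - ln (q (\<lambda>x. k x / real n)))"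

lemma pw: "0 \<le> t \<Longrightarrow> t \<le> 1 \<Longrightarrow> 0 \<le> t powr (1/\<alpha>) \<and> t powr (1/\<alpha>) \<le> 1"
  using \<alpha> powr_mono2[of "1/\<alpha>" t 1] by auto

text \<open>Stability is available for relatively compact supports only. Cutting off with
  \<open>V n\<close> and passing to the limit extends it to functions of full support, such as small
  multiples of \<open>h0\<close>.\<close>

lemma q_stable:
  assumes k[measurable]: "k \<in> borel_measurable borel" "\<And>x. 0 \<le> k x" "\<And>x. k x < 1"
    and t: "0 \<le> t" "t \<le> 1"
  shows "q (\<lambda>x. t powr (1/\<alpha>) * k x) * q (\<lambda>x. (1 - t) powr (1/\<alpha>) * k x) = q k"
proof -
  have le1: "s * k x < 1" if "0 \<le> s" "s \<le> 1" for s x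
    using mult_left_le_one_le[of "k x" s] that k(2,3)[of x] by simp
  have fin: "q (\<lambda>x. t powr (1/\<alpha>) * (indicator (V n) x * k x)) * q (\<lambda>x. (1 - t) powr (1/\<alpha>) * (indicator (V n) x * k x))
      = q (\<lambda>x. indicator (V n) x * k x)" for n
  proof -
    define g where "g x = - ln (1 - indicator (V n) x * k x)" for x
    have k': "0 \<le> indicator (V n) x * k x" "indicator (V n) x * k x < 1" for x
      using k(2,3)[of x] by (auto simp: indicator_def)
    have gm: "g \<in> borel_measurable borel" unfolding g_def[abs_def] by measurable
    have "rcfun g"
      unfolding rcfun_def using k' gm
      by (auto simp: g_def intro!: rel_compact_subset[OF rel_compact_V[of n]] simp: indicator_def)
    moreover have "thin_fun s g = (\<lambda>x. - ln (1 - s * (indicator (V n) x * k x)))" for s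
      using k' by (auto simp: thin_fun_def g_def)
    moreover have "Lf (thin_fun (t powr (1/\<alpha>)) g) * Lf (thin_fun ((1 - t) powr (1/\<alpha>)) g) = Lf g"
      using stable t \<open>rcfun g\<close> unfolding discrete_stable_iff[OF \<alpha>(1)] by blast
    ultimately show ?thesis by (simp add: q_def g_def[abs_def])
  qed
  have lim: "(\<lambda>n. q (\<lambda>x. s * (indicator (V n) x * k x))) \<longlonglongrightarrow> q (\<lambda>x. s * k x)" if s: "0 \<le> s" "s \<le> 1" for s
    unfolding q_def
  proof (rule Lf_tendsto)
    show "(\<lambda>x. - ln (1 - s * (indicator (V n) x * k x))) \<in> borel_measurable borel" for n by measurable
    show m: "(\<lambda>x. - ln (1 - s * k x)) \<in> borel_measurable borel" by measurable
    have eq: "(\<lambda>x. - ln (1 - s * (indicator (V n) x * k x))) = (\<lambda>x. indicator (V n) x * - ln (1 - s * k x))" for n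
      by (auto simp: indicator_def)
    have nn: "0 \<le> - ln (1 - s * k x)" for x
      using le1[OF s, of x] k(2)[of x] s by simp
    show "AE \<omega> in P. (\<lambda>n. lap (\<lambda>x. - ln (1 - s * (indicator (V n) x * k x))) (\<Phi> \<omega>)) \<longlonglongrightarrow> lap (\<lambda>x. - ln (1 - s * k x)) (\<Phi> \<omega>)"
      unfolding eq by (intro AE_I2 lap_V_tendsto sets_radon \<Phi>_radon m nn)
  qed
  have "(\<lambda>n. q (\<lambda>x. t powr (1/\<alpha>) * (indicator (V n) x * k x)) * q (\<lambda>x. (1 - t) powr (1/\<alpha>) * (indicator (V n) x * k x)))
      \<longlonglongrightarrow> q (\<lambda>x. t powr (1/\<alpha>) * k x) * q (\<lambda>x. (1 - t) powr (1/\<alpha>) * k x)"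
    using pw[of t] pw[of "1-t"] t by (intro tendsto_mult lim) auto
  moreover have "(\<lambda>n. q (\<lambda>x. indicator (V n) x * k x)) \<longlonglongrightarrow> q k" using lim[of 1] by simp
  ultimately show ?thesis unfolding fin using LIMSEQ_unique by blast
qed

lemma q_antimono:
  assumes [measurable]: "k \<in> borel_measurable borel" "l \<in> borel_measurable borel"
    and "\<And>x. 0 \<le> k x" "\<And>x. k x \<le> l x" "\<And>x. l x < 1"
  shows "q l \<le> q k"
  unfolding q_def
proof (rule Lf_antimono)
  show "- ln (1 - k x) \<le> - ln (1 - l x)" for x
    using assms(3-5)[of x] assms(4)[of x] by simp
qed measurable

lemma q_le_1: "k \<in> borel_measurable borel \<Longrightarrow> q k \<le> 1"
  unfolding q_def by (rule Lf_bounds) measurable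

text \<open>With the factor s^(1/\<alpha>) in front of k, minus the logarithm of \<open>q\<close> is
  additive and monotone in s on [0, 1], hence linear; s = c^\<alpha> gives the claim. Positivity of
  \<open>q k\<close> is inherited by smaller arguments and keeps the logarithms meaningful.\<close>

lemma ln_q_scale:
  assumes k[measurable]: "k \<in> borel_measurable borel" "\<And>x. 0 \<le> k x" "\<And>x. k x < 1"
    and pos: "0 < q k" and c: "0 \<le> c" "c \<le> 1"
  shows "ln (q (\<lambda>x. c * k x)) = c powr \<alpha> * ln (q k)" "0 < q (\<lambda>x. c * k x)"
proof -
  have le1: "0 \<le> s * k x" "s * k x \<le> k x" if "0 \<le> s" "s \<le> 1" for s x
    using mult_left_le_one_le[of "k x" s] that k(2,3)[of x] by auto
  have posq: "0 < q (\<lambda>x. s * k x)" if "0 \<le> s" "s \<le> 1" for s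
  proof -
    have "q k \<le> q (\<lambda>x. s * k x)" using le1[OF that] k by (intro q_antimono) auto
    then show ?thesis using pos by simp
  qed
  show "0 < q (\<lambda>x. c * k x)" by (rule posq[OF c])
  define f where "f s = - ln (q (\<lambda>x. s powr (1/\<alpha>) * k x))" for s
  have "f (c powr \<alpha>) = c powr \<alpha> * f 1"
  proof (rule additive_mono_linear)
    fix a b :: real assume ab: "0 \<le> a" "0 \<le> b" "a + b \<le> 1"
    show "f a + f b = f (a + b)"
    proof (cases "a + b = 0")
      case True
      then have "a = 0" "b = 0" using ab by auto
      then show ?thesis by (simp add: f_def q_def Lf_def prob_space)
    next
      case False
      \<comment> \<open>Stability splits the number 1, here as a/s + b/s. Applied to the rescaled
        \<open>k'\<close> it gives additivity for every total s = a + b up to 1.\<close>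
      define s where "s = a + b"
      have s: "0 < s" "s \<le> 1" using False ab by (auto simp: s_def)
      define k' where "k' x = s powr (1/\<alpha>) * k x" for x
      have k': "0 \<le> k' x" "k' x < 1" for x
        using le1[of "s powr (1/\<alpha>)" x] pw[of s] s k(3)[of x] unfolding k'_def by auto
      have k'm[measurable]: "k' \<in> borel_measurable borel" unfolding k'_def[abs_def] by measurable
      have "q (\<lambda>x. (a/s) powr (1/\<alpha>) * k' x) * q (\<lambda>x. (1 - a/s) powr (1/\<alpha>) * k' x) = q k'"
        using s ab by (intro q_stable k' k'm) (auto simp: s_def)
      moreover have "(a/s) powr (1/\<alpha>) * k' x = a powr (1/\<alpha>) * k x" for x
        using s by (simp add: k'_def powr_divide)
      moreover have "(1 - a/s) powr (1/\<alpha>) * k' x = b powr (1/\<alpha>) * k x" for x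
      proof -
        have "1 - a/s = b / s" using s by (simp add: s_def field_simps)
        then show ?thesis using s by (simp add: k'_def powr_divide)
      qed
      ultimately have "q (\<lambda>x. a powr (1/\<alpha>) * k x) * q (\<lambda>x. b powr (1/\<alpha>) * k x) = q k'" by simp
      moreover have "0 < q (\<lambda>x. a powr (1/\<alpha>) * k x)" "0 < q (\<lambda>x. b powr (1/\<alpha>) * k x)"
        using ab pw[of a] pw[of b] by (auto intro!: posq)
      ultimately have "ln (q k') = ln (q (\<lambda>x. a powr (1/\<alpha>) * k x)) + ln (q (\<lambda>x. b powr (1/\<alpha>) * k x))"
        by (metis ln_mult_pos)
      then show ?thesis unfolding f_def s_def[symmetric] by (simp add: k'_def[abs_def])
    qed
  next
    fix a b :: real assume ab: "0 \<le> a" "a \<le> b" "b \<le> 1"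
    have "a powr (1/\<alpha>) \<le> b powr (1/\<alpha>)" using ab \<alpha> by (intro powr_mono2) auto
    then have "q (\<lambda>x. b powr (1/\<alpha>) * k x) \<le> q (\<lambda>x. a powr (1/\<alpha>) * k x)"
    proof (intro q_antimono)
      show "b powr (1/\<alpha>) * k x < 1" for x
        using le_less_trans[OF le1(2) k(3)] pw[of b] ab by simp
    qed (use le1 pw[of a] ab k in \<open>auto intro!: mult_right_mono\<close>)
    then show "f a \<le> f b" using posq[of "b powr (1/\<alpha>)"] pw[of b] ab by (simp add: f_def)
  qed (use c \<alpha> powr_mono2[of \<alpha> c 1] in auto)
  then show "ln (q (\<lambda>x. c * k x)) = c powr \<alpha> * ln (q k)"
    using c \<alpha> by (simp add: f_def powr_powr)
qed

lemma \<psi>_eq: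
  assumes k[measurable]: "k \<in> borel_measurable borel" "\<And>x. 0 \<le> k x" "\<And>x. k x < N"
    and pos: "0 < q (\<lambda>x. k x / N)"
  shows "\<psi> k = N powr \<alpha> * - ln (q (\<lambda>x. k x / N))"
proof -
  have N: "0 < N" using k(2,3) le_less_trans by blast
  have "\<forall>\<^sub>F n in sequentially. real n powr \<alpha> * - ln (q (\<lambda>x. k x / real n)) = N powr \<alpha> * - ln (q (\<lambda>x. k x / N))"
    using eventually_ge_at_top[of "nat \<lceil>N\<rceil>"]
  proof eventually_elim
    case (elim n)
    then have n: "N \<le> real n" by linarith
    have "ln (q (\<lambda>x. (N / real n) * (k x / N))) = (N / real n) powr \<alpha> * ln (q (\<lambda>x. k x / N))"
      using N n k pos by (intro ln_q_scale) (auto simp: field_simps)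
    moreover have "(\<lambda>x. (N / real n) * (k x / N)) = (\<lambda>x. k x / real n)" using N by auto
    ultimately have e: "ln (q (\<lambda>x. k x / real n)) = (N / real n) powr \<alpha> * ln (q (\<lambda>x. k x / N))" by simp
    have "real n powr \<alpha> * (N / real n) powr \<alpha> = N powr \<alpha>"
      using N n by (simp add: powr_mult[symmetric])
    then show ?case unfolding e by (simp flip: mult.assoc)
  qed
  then have "(\<lambda>n. real n powr \<alpha> * - ln (q (\<lambda>x. k x / real n))) \<longlonglongrightarrow> N powr \<alpha> * - ln (q (\<lambda>x. k x / N))"
    by (rule tendsto_eventually)
  then show ?thesis unfolding \<psi>_def by (rule limI)
qed

section \<open>Functions dominated by the reference function\<close>

text \<open>Domination by a multiple of \<open>h0\<close> makes the integral against \<Phi> almost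
  surely finite, so \<open>q\<close> is positive after scaling down and homogeneity applies. Every
  function in \<open>BM\<close> is of this kind (\<open>tame_BM\<close>), and so is
  \<open>h0\<close> itself, which has full support.\<close>

definition tame :: "real \<Rightarrow> ('a \<Rightarrow> real) \<Rightarrow> bool" where
  "tame C k \<longleftrightarrow> k \<in> borel_measurable borel \<and> (\<forall>x. 0 \<le> k x \<and> k x \<le> C * h0 x)"

lemma tameD:
  assumes "tame C k"
  shows "k \<in> borel_measurable borel" "0 \<le> k x" "k x \<le> C * h0 x" "0 \<le> C" "k x \<le> C"
proof -
  show "k \<in> borel_measurable borel" and 1: "0 \<le> k x" "k x \<le> C * h0 x" using assms by (auto simp: tame_def)
  have "0 \<le> C * h0 x" using 1 by simp
  then show "0 \<le> C" using h0_pos[of x] by (simp add: zero_le_mult_iff)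
  then have "C * h0 x \<le> C * 1" using h0_le by (intro mult_left_mono) auto
  then show "k x \<le> C" using 1 by simp
qed

lemma tame_mono:
  assumes "tame C k" "C \<le> D"
  shows "tame D k"
proof -
  have "C * h0 x \<le> D * h0 x" for x
    using assms(2) h0_pos[of x] by (intro mult_right_mono) auto
  then show ?thesis using assms(1) order_trans unfolding tame_def by blast
qed

lemma tame_add: "tame C k \<Longrightarrow> tame D l \<Longrightarrow> tame (C + D) (\<lambda>x. k x + l x)"
  unfolding tame_def by (auto simp: distrib_right intro: add_mono)

lemma tame_scale: "tame C k \<Longrightarrow> 0 \<le> c \<Longrightarrow> tame (c * C) (\<lambda>x. c * k x)"
  unfolding tame_def by (auto simp: mult.assoc intro: mult_left_mono)

lemma tame_h0: "tame 1 h0"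
  unfolding tame_def using h0_pos by (auto intro: less_imp_le)

lemma tame_rcfun:
  assumes "rcfun g" "\<And>x. g x \<le> K"
  obtains C where "tame C g"
proof -
  obtain c where c: "c > 0" "\<And>x. g x \<noteq> 0 \<Longrightarrow> c \<le> h0 x"
    using h0_lower[of "{x. g x \<noteq> 0}"] assms by (auto simp: rcfun_def)
  have K: "0 \<le> K" using assms(2) assms(1) order_trans unfolding rcfun_def by blast
  have "g x \<le> K / c * h0 x" for x
  proof (cases "g x = 0")
    case True
    then show ?thesis using K c(1) h0_pos[of x] by simp
  next
    case False
    have "K * c \<le> K * h0 x" using c(2)[OF False] K by (intro mult_left_mono) auto
    then have "K \<le> K / c * h0 x" using c(1) by (simp add: field_simps)
    then show ?thesis using assms(2)[of x] by simp
  qed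
  then have "tame (K / c) g" using assms by (auto simp: tame_def rcfun_def)
  then show thesis by (rule that)
qed

lemma neg_ln_le: "- ln (1 - y) \<le> 2 * y" if "0 \<le> y" "y \<le> 1/2" for y :: real
proof -
  have "ln (1 / (1 - y)) \<le> 1 / (1 - y) - 1" using that by (intro ln_le_minus_one) auto
  also have "1 / (1 - y) - 1 = y / (1 - y)" using that by (simp add: field_simps)
  also have "\<dots> \<le> y / (1/2)" using that by (intro divide_left_mono) auto
  finally show ?thesis using that by (simp add: ln_div)
qed

lemma tame_fin:
  assumes "tame C k"
  shows "AE \<omega> in P. (\<integral>\<^sup>+x. ennreal (k x) \<partial>\<Phi> \<omega>) < \<infinity>"
  using h0_fin
proof (rule AE_mp, intro AE_I2 impI)
  fix \<omega> assume \<omega>: "\<omega> \<in> space P" and f: "(\<integral>\<^sup>+x. ennreal (h0 x) \<partial>\<Phi> \<omega>) < \<infinity>"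
  note s = sets_radon[OF \<Phi>_radon[OF \<omega>]]
  have "(\<integral>\<^sup>+x. ennreal (k x) \<partial>\<Phi> \<omega>) \<le> (\<integral>\<^sup>+x. ennreal C * ennreal (h0 x) \<partial>\<Phi> \<omega>)"
    using tameD[OF assms] h0_pos by (intro nn_integral_mono) (simp add: ennreal_mult[symmetric] less_imp_le ennreal_leI)
  also have "\<dots> = ennreal C * (\<integral>\<^sup>+x. ennreal (h0 x) \<partial>\<Phi> \<omega>)"
    by (intro nn_integral_cmult) (simp add: measurable_cong_sets[OF s refl])
  also have "\<dots> < \<infinity>" using f by (simp add: ennreal_mult_less_top)
  finally show "(\<integral>\<^sup>+x. ennreal (k x) \<partial>\<Phi> \<omega>) < \<infinity>" .
qed

lemma tame_neg_ln:
  assumes k: "tame C k" and C: "C \<le> 1/2"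
  shows "tame (2 * C) (\<lambda>x. - ln (1 - k x))"
proof -
  note [measurable] = tameD(1)[OF k]
  have "0 \<le> - ln (1 - k x) \<and> - ln (1 - k x) \<le> 2 * C * h0 x" for x
  proof -
    have "k x \<le> 1/2" using tameD(5)[OF k, of x] C by simp
    then show ?thesis using neg_ln_le[of "k x"] tameD(2,3)[OF k, of x] by simp
  qed
  then show ?thesis unfolding tame_def by auto
qed

lemma q_tame_pos:
  assumes k: "tame C k" and C: "C \<le> 1/2"
  shows "0 < q k"
  unfolding q_def using tame_neg_ln[OF assms] by (intro Lf_pos tame_fin) (auto simp: tame_def)

lemma tame_div:
  assumes "tame C k" "0 < N" "2 * C \<le> N"
  shows "tame (1/2) (\<lambda>x. k x / N)"
proof -
  have "tame ((1/N) * C) (\<lambda>x. (1/N) * k x)" using assms by (intro tame_scale) auto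
  then have "tame ((1/N) * C) (\<lambda>x. k x / N)" by simp
  then show ?thesis by (rule tame_mono) (use assms in \<open>simp add: field_simps\<close>)
qed

text \<open>The condition \<open>2 * C \<le> N\<close> keeps k / N below 1/2, where - ln (1 - y) is
  at most 2 y, so that domination by \<open>h0\<close> survives the logarithm.\<close>

lemma \<psi>_tame:
  assumes k: "tame C k" and N: "0 < N" "2 * C \<le> N"
  shows "\<psi> k = N powr \<alpha> * - ln (q (\<lambda>x. k x / N))" "0 < q (\<lambda>x. k x / N)"
proof -
  show pos: "0 < q (\<lambda>x. k x / N)" using tame_div[OF assms] by (rule q_tame_pos) simp
  show "\<psi> k = N powr \<alpha> * - ln (q (\<lambda>x. k x / N))"
  proof (rule \<psi>_eq[OF _ _ _ pos])
    show "k x < N" for x using tameD(4)[OF k] tameD(5)[OF k, of x] N by linarith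
  qed (use tameD[OF k] in auto)
qed

lemma \<psi>_mono:
  assumes l: "tame C l" and k: "k \<in> borel_measurable borel" "\<And>x. 0 \<le> k x" "\<And>x. k x \<le> l x"
  shows "\<psi> k \<le> \<psi> l"
proof -
  have tk: "tame C k" unfolding tame_def using k tameD(3)[OF l] order_trans by blast
  define N where "N = 2 * C + 1"
  have N: "0 < N" "2 * C \<le> N" using tameD(4)[OF l] by (auto simp: N_def)
  have "q (\<lambda>x. l x / N) \<le> q (\<lambda>x. k x / N)"
  proof (rule q_antimono)
    show "l x / N < 1" for x using tameD(5)[OF tame_div[OF l N], of x] by linarith
  qed (use k tameD[OF l] N in \<open>auto simp: divide_right_mono\<close>)
  then show ?thesis
    using \<psi>_tame[OF tk N] \<psi>_tame[OF l N] N by (simp add: mult_left_mono)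
qed

lemma \<psi>_nonneg:
  assumes k: "tame C k"
  shows "0 \<le> \<psi> k"
proof -
  define N where "N = 2 * C + 1"
  have N: "0 < N" "2 * C \<le> N" using tameD(4)[OF k] by (auto simp: N_def)
  note [measurable] = tameD(1)[OF k]
  have "q (\<lambda>x. k x / N) \<le> 1" by (rule q_le_1) measurable
  then have "ln (q (\<lambda>x. k x / N)) \<le> 0" using \<psi>_tame(2)[OF k N] by simp
  then show ?thesis using \<psi>_tame[OF k N] N by (simp add: mult_nonneg_nonpos)
qed

lemma \<psi>_zero: "\<psi> (\<lambda>_. 0) = 0"
proof -
  have t: "tame 0 (\<lambda>_. 0)" by (simp add: tame_def)
  have "q (\<lambda>_. 0) = 1" by (simp add: q_def Lf_def prob_space)
  then show ?thesis using \<psi>_tame(1)[OF t, of 1] by simp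
qed

lemma \<psi>_scale:
  assumes k: "tame C k" and c: "0 \<le> c"
  shows "\<psi> (\<lambda>x. c * k x) = c powr \<alpha> * \<psi> k"
proof (cases "c = 0")
  case True
  then show ?thesis by (simp add: \<psi>_zero)
next
  case False
  then have c0: "0 < c" using c by simp
  define N where "N = 2 * C + 1"
  have N: "0 < N" "2 * C \<le> N" using tameD(4)[OF k] by (auto simp: N_def)
  have "\<psi> (\<lambda>x. c * k x) = (c * N) powr \<alpha> * - ln (q (\<lambda>x. (c * k x) / (c * N)))"
    using c0 N by (intro \<psi>_tame(1)[OF tame_scale[OF k c]]) auto
  also have "(\<lambda>x. (c * k x) / (c * N)) = (\<lambda>x. k x / N)" using c0 by auto
  finally show ?thesis using \<psi>_tame[OF k N] by (simp add: powr_mult)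
qed

text \<open>Dominated convergence is applied twice, with bound \<open>h0\<close> under each
  realisation and bound 1 under \<open>P\<close>. Convergence is required only almost everywhere
  under \<Phi>, which later admits discontinuous codings and step functions.\<close>

lemma \<psi>_tendsto:
  assumes kn: "\<And>n. tame C (k n)" and l: "tame C l"
    and lim: "AE \<omega> in P. AE x in \<Phi> \<omega>. (\<lambda>n. k n x) \<longlonglongrightarrow> l x"
  shows "(\<lambda>n. \<psi> (k n)) \<longlonglongrightarrow> \<psi> l"
proof -
  define N where "N = 2 * C + 1"
  have N: "0 < N" "2 * C \<le> N" using tameD(4)[OF l] by (auto simp: N_def)
  have t: "tame 1 (\<lambda>x. - ln (1 - k n x / N))" "tame 1 (\<lambda>x. - ln (1 - l x / N))" for n
    using tame_neg_ln[OF tame_div[OF kn N]] tame_neg_ln[OF tame_div[OF l N]] by simp_all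
  have lt: "l x / N \<le> 1/2" for x using tameD(5)[OF tame_div[OF l N], of x] .
  have "(\<lambda>n. q (\<lambda>x. k n x / N)) \<longlonglongrightarrow> q (\<lambda>x. l x / N)"
    unfolding q_def
  proof (rule Lf_tendsto)
    show "AE \<omega> in P. (\<lambda>n. lap (\<lambda>x. - ln (1 - k n x / N)) (\<Phi> \<omega>)) \<longlonglongrightarrow> lap (\<lambda>x. - ln (1 - l x / N)) (\<Phi> \<omega>)"
      using lim h0_fin AE_space
    proof eventually_elim
      case (elim \<omega>)
      note s = sets_radon[OF \<Phi>_radon[OF elim(3)]]
      note mc = measurable_cong_sets[OF s refl]
      show ?case unfolding lap_def
      proof (intro tendsto_exp_neg nn_integral_dominated_convergence[where w="\<lambda>x. ennreal (h0 x)"])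
        show "AE x in \<Phi> \<omega>. (\<lambda>n. ennreal (- ln (1 - k n x / N))) \<longlonglongrightarrow> ennreal (- ln (1 - l x / N))"
          using elim(1)
        proof eventually_elim
          case (elim x)
          have "1 - l x / N \<noteq> 0" using lt[of x] by linarith
          then show ?case using elim N by (intro tendsto_intros) auto
        qed
        show "AE x in \<Phi> \<omega>. ennreal (- ln (1 - k n x / N)) \<le> ennreal (h0 x)" for n
          using tameD(3)[OF t(1)] by (intro AE_I2 ennreal_leI) simp
      qed (use t elim(2) in \<open>auto simp: mc tame_def\<close>)
    qed
  qed (use t in \<open>auto simp: tame_def\<close>)
  then have "(\<lambda>n. N powr \<alpha> * - ln (q (\<lambda>x. k n x / N))) \<longlonglongrightarrow> N powr \<alpha> * - ln (q (\<lambda>x. l x / N))"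
    using \<psi>_tame(2)[OF l N] by (intro tendsto_mult tendsto_const tendsto_minus tendsto_ln) auto
  moreover have "\<psi> (k n) = N powr \<alpha> * - ln (q (\<lambda>x. k n x / N))" for n
    by (rule \<psi>_tame(1)[OF kn N])
  moreover have "\<psi> l = N powr \<alpha> * - ln (q (\<lambda>x. l x / N))"
    by (rule \<psi>_tame(1)[OF l N])
  ultimately show ?thesis by presburger
qed

lemma pgfl_\<psi>:
  assumes u: "\<And>x. 0 < u x" "\<And>x. u x \<le> 1" "u \<in> borel_measurable borel" "(\<lambda>x. 1 - u x) \<in> BM"
  shows "pgfl P \<Phi> u = exp (- \<psi> (\<lambda>x. 1 - u x))"
proof -
  have q: "pgfl P \<Phi> u = q (\<lambda>x. 1 - u x)" using pgfl_eq_Lf(1)[OF u] by (simp add: q_def)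
  have pos: "0 < q (\<lambda>x. 1 - u x)"
    unfolding q_def using pgfl_eq_Lf(2)[OF u] nn_integral_\<Phi>_finite[OF _ pgfl_eq_Lf(2)[OF u]]
    by (intro Lf_pos) (auto simp: rcfun_def)
  have "\<psi> (\<lambda>x. 1 - u x) = 1 powr \<alpha> * - ln (q (\<lambda>x. (1 - u x) / 1))"
    using u pos by (intro \<psi>_eq) auto
  then show ?thesis using q pos by simp
qed

text \<open>The Laplace functional at k / n is \<open>q\<close> at a = 1 - exp (- k / n), and a lies
  between (1 - C / n) k / n and k / n. Monotonicity and homogeneity of \<psi> convert this into the
  two bounds.\<close>

lemma Lf_scaled:
  assumes k: "tame C k" and n: "0 < n" "2 * C < real n"
  shows "0 < Lf (\<lambda>x. k x / real n)"
    "(1 - C / real n) powr \<alpha> * \<psi> k \<le> real n powr \<alpha> * - ln (Lf (\<lambda>x. k x / real n))"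
    "real n powr \<alpha> * - ln (Lf (\<lambda>x. k x / real n)) \<le> \<psi> k"
proof -
  note [measurable] = tameD(1)[OF k]
  have n0: "0 < real n" using n by simp
  have C0: "0 \<le> C" by (rule tameD(4)[OF k])
  define a where "a x = 1 - exp (- (k x / real n))" for x
  have am[measurable]: "a \<in> borel_measurable borel" unfolding a_def[abs_def] by measurable
  have tk: "tame (1/2) (\<lambda>x. k x / real n)" by (rule tame_div[OF k n0]) (use n in simp)
  have a: "0 \<le> a x" "a x < 1" for x using tameD(2)[OF tk, of x] by (auto simp: a_def)
  have a_le: "a x \<le> k x / real n" for x
    using exp_ge_add_one_self[of "- (k x / real n)"] by (simp add: a_def)
  have a_ge: "(1 - C / real n) * (k x / real n) \<le> a x" for x
  proof -
    define y where "y = k x / real n"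
    have y: "0 \<le> y" "y \<le> C / real n" using tameD(2,5)[OF k, of x] n0 by (auto simp: y_def divide_right_mono)
    have "exp (-y) * (1 + y) \<le> exp (-y) * exp y" by (intro mult_left_mono exp_ge_add_one_self) auto
    then have "exp (-y) * (1 + y) \<le> 1" by (simp add: exp_add[symmetric])
    then have "exp (-y) \<le> 1 / (1 + y)" using y by (simp add: field_simps)
    also have "\<dots> \<le> 1 - y + y * y" using y by (simp add: field_simps)
    finally have "y - y * y \<le> 1 - exp (-y)" by simp
    moreover have "(1 - C / real n) * y \<le> y - y * y"
      using mult_right_mono[OF y(2) y(1)] by (simp add: algebra_simps)
    ultimately show ?thesis by (simp add: a_def y_def)
  qed
  have qa: "q a = Lf (\<lambda>x. k x / real n)"
    unfolding q_def by (rule arg_cong[where f=Lf]) (auto simp: a_def)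
  show pos: "0 < Lf (\<lambda>x. k x / real n)"
    using tk tame_fin[OF tk] by (intro Lf_pos) (auto simp: tame_def)
  have \<psi>a: "\<psi> a = - ln (Lf (\<lambda>x. k x / real n))"
    using \<psi>_eq[of a 1] a pos qa by simp
  have k_div: "\<psi> (\<lambda>x. k x / real n) = (1 / real n) powr \<alpha> * \<psi> k"
    using \<psi>_scale[OF k, of "1 / real n"] n0 by simp
  have nn: "real n powr \<alpha> * (1 / real n) powr \<alpha> = 1"
    using n0 by (simp add: powr_mult[symmetric])
  have "\<psi> a \<le> (1 / real n) powr \<alpha> * \<psi> k"
    using \<psi>_mono[OF tk am] a a_le k_div by simp
  then have "real n powr \<alpha> * \<psi> a \<le> real n powr \<alpha> * ((1 / real n) powr \<alpha> * \<psi> k)" by (intro mult_left_mono) auto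
  then show "real n powr \<alpha> * - ln (Lf (\<lambda>x. k x / real n)) \<le> \<psi> k"
    by (simp add: \<psi>a nn mult.assoc[symmetric] del: mult_minus_right)
  have ta: "tame (1/2) a" unfolding tame_def using a a_le tameD(3)[OF tk] order_trans by (blast intro: am)
  have c: "0 \<le> 1 - C / real n" using n C0 by (simp add: field_simps)
  have "\<psi> (\<lambda>x. (1 - C / real n) * (k x / real n)) \<le> \<psi> a"
    by (intro \<psi>_mono[OF ta] a_ge mult_nonneg_nonneg c tameD(2)[OF tk]) measurable
  then have "(1 - C / real n) powr \<alpha> * ((1 / real n) powr \<alpha> * \<psi> k) \<le> \<psi> a"
    using \<psi>_scale[OF tk c] k_div by simp
  then have "real n powr \<alpha> * ((1 - C / real n) powr \<alpha> * ((1 / real n) powr \<alpha> * \<psi> k)) \<le> real n powr \<alpha> * \<psi> a"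
    by (intro mult_left_mono) auto
  moreover have "real n powr \<alpha> * ((1 - C / real n) powr \<alpha> * ((1 / real n) powr \<alpha> * \<psi> k)) = (1 - C / real n) powr \<alpha> * \<psi> k"
    using nn by (metis mult.assoc mult.left_commute mult_1)
  ultimately show "(1 - C / real n) powr \<alpha> * \<psi> k \<le> real n powr \<alpha> * - ln (Lf (\<lambda>x. k x / real n))"
    by (simp add: \<psi>a)
qed

text \<open>Since 1 - L lies between - L ln L and - ln L, and L tends to 1, the bounds for - ln L
  determine the limit. This is the first-order behaviour of the Laplace functional of \<Phi> /
  n.\<close>

lemma Lf_scaling_limit:
  assumes k: "tame C k"
  shows "(\<lambda>n. real n powr \<alpha> * (1 - Lf (\<lambda>x. k x / real n))) \<longlonglongrightarrow> \<psi> k"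
proof -
  note [measurable] = tameD(1)[OF k]
  define L where "L n = Lf (\<lambda>x. k x / real n)" for n :: nat
  have ev: "\<forall>\<^sub>F n in sequentially. 0 < n \<and> 2 * C < real n"
  proof -
    have "\<forall>\<^sub>F n in sequentially. nat \<lceil>2 * C\<rceil> < n" by (rule eventually_gt_at_top)
    then show ?thesis by eventually_elim linarith
  qed
  have lo: "(\<lambda>n. (1 - C / real n) powr \<alpha> * \<psi> k) \<longlonglongrightarrow> (1 - 0) powr \<alpha> * \<psi> k"
    by (intro tendsto_intros lim_const_over_n) auto
  have main: "(\<lambda>n. real n powr \<alpha> * - ln (L n)) \<longlonglongrightarrow> \<psi> k"
  proof (rule real_tendsto_sandwich[OF _ _ _ tendsto_const])
    show "\<forall>\<^sub>F n in sequentially. (1 - C / real n) powr \<alpha> * \<psi> k \<le> real n powr \<alpha> * - ln (L n)"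
      using ev by eventually_elim (use Lf_scaled(2)[OF k] in \<open>auto simp: L_def\<close>)
    show "\<forall>\<^sub>F n in sequentially. real n powr \<alpha> * - ln (L n) \<le> \<psi> k"
      using ev by eventually_elim (use Lf_scaled(3)[OF k] in \<open>auto simp: L_def\<close>)
    show "(\<lambda>n. (1 - C / real n) powr \<alpha> * \<psi> k) \<longlonglongrightarrow> \<psi> k" using lo by simp
  qed
  have L1: "L \<longlonglongrightarrow> 1"
  proof -
    have "(\<lambda>n. Lf (\<lambda>x. k x / real n)) \<longlonglongrightarrow> Lf (\<lambda>_. 0)"
    proof (rule Lf_tendsto)
      show "AE \<omega> in P. (\<lambda>n. lap (\<lambda>x. k x / real n) (\<Phi> \<omega>)) \<longlonglongrightarrow> lap (\<lambda>_. 0) (\<Phi> \<omega>)"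
        using tame_fin[OF k] AE_space
      proof eventually_elim
        case (elim \<omega>)
        note s = sets_radon[OF \<Phi>_radon[OF elim(2)]]
        note mc = measurable_cong_sets[OF s refl]
        show ?case unfolding lap_def
        proof (intro tendsto_exp_neg nn_integral_dominated_convergence[where w="\<lambda>x. ennreal (k x)"])
          show "AE x in \<Phi> \<omega>. (\<lambda>n. ennreal (k x / real n)) \<longlonglongrightarrow> ennreal 0"
            by (intro AE_I2 tendsto_ennrealI lim_const_over_n)
          show "AE x in \<Phi> \<omega>. ennreal (k x / real n) \<le> ennreal (k x)" for n
          proof (intro AE_I2 ennreal_leI)
            fix x
            show "k x / real n \<le> k x" using tameD(2)[OF k, of x]
                mult_right_mono[of 1 "real n" "k x"]
              by (cases "n = 0") (auto simp: divide_le_eq mult.commute)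
          qed
        qed (use elim(1) in \<open>auto simp: mc\<close>)
      qed
    qed auto
    moreover have "Lf (\<lambda>_. 0) = 1" by (simp add: Lf_def prob_space)
    ultimately show ?thesis unfolding L_def by simp
  qed
  have "(\<lambda>n. real n powr \<alpha> * (1 - L n)) \<longlonglongrightarrow> \<psi> k"
  proof (rule real_tendsto_sandwich[OF _ _ _ main])
    have Lpos: "\<forall>\<^sub>F n in sequentially. 0 < L n"
      using ev by eventually_elim (use Lf_scaled(1)[OF k] in \<open>auto simp: L_def\<close>)
    then show "\<forall>\<^sub>F n in sequentially. real n powr \<alpha> * (1 - L n) \<le> real n powr \<alpha> * - ln (L n)"
    proof eventually_elim
      case (elim n)
      have "ln (L n) \<le> L n - 1" using elim by (rule ln_le_minus_one)
      then show ?case by (intro mult_left_mono) auto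
    qed
    show "\<forall>\<^sub>F n in sequentially. L n * (real n powr \<alpha> * - ln (L n)) \<le> real n powr \<alpha> * (1 - L n)"
      using Lpos
    proof eventually_elim
      case (elim n)
      have "ln (1 / L n) \<le> 1 / L n - 1" using elim by (intro ln_le_minus_one) auto
      then have "- ln (L n) \<le> (1 - L n) / L n" using elim by (simp add: ln_div diff_divide_distrib)
      then have "L n * - ln (L n) \<le> 1 - L n" using elim by (simp add: field_simps)
      then have "real n powr \<alpha> * (L n * - ln (L n)) \<le> real n powr \<alpha> * (1 - L n)" by (intro mult_left_mono) auto
      then show ?case by (simp add: mult_ac)
    qed
    have "(\<lambda>n. L n * (real n powr \<alpha> * - ln (L n))) \<longlonglongrightarrow> 1 * \<psi> k" by (intro tendsto_mult L1 main)
    then show "(\<lambda>n. L n * (real n powr \<alpha> * - ln (L n))) \<longlonglongrightarrow> \<psi> k" by simp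
  qed
  then show ?thesis by (simp add: L_def)
qed

end

section \<open>Coding the state space by reals\<close>

context lcsc_base
begin

text \<open>Closures of basic sets are compact neighbourhoods, so the space is locally compact
  Hausdorff, which yields both separation properties.\<close>

lemma regular_euclidean: "regular_space (euclidean :: 'a topology)"
  and completely_regular_euclidean: "completely_regular_space (euclidean :: 'a topology)"
proof -
  have 1: "locally_compact_space (euclidean :: 'a topology)"
    unfolding locally_compact_space_def
  proof
    fix x :: 'a
    obtain i where "1 \<le> i" "x \<in> B i" using basisE[of UNIV x] by auto
    then show "\<exists>U K. openin euclidean U \<and> compactin euclidean K \<and> x \<in> U \<and> U \<subseteq> K"
      using open_B rel_compact_B[of i] closure_subset[of "B i"]
      by (intro exI[of _ "B i"] exI[of _ "closure (B i)"])
         (auto simp: rel_compact_def open_openin[symmetric])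
  qed
  have 2: "Hausdorff_space (euclidean :: 'a topology)"
    unfolding Hausdorff_space_def disjnt_def open_openin[symmetric] using hausdorff by blast
  show "regular_space (euclidean :: 'a topology)"
    by (rule locally_compact_Hausdorff_imp_regular_space[OF 1 2])
  then show "completely_regular_space (euclidean :: 'a topology)"
    using 1 by (intro locally_compact_regular_imp_completely_regular_space) auto
qed

lemma regular_basisE:
  assumes "open U" "x \<in> U"
  obtains i where "1 \<le> i" "x \<in> B i" "closure (B i) \<subseteq> U"
proof -
  have "closedin euclidean (- U) \<and> x \<in> topspace euclidean - (- U)"
    using assms by (simp add: closed_closedin[symmetric] closed_Compl)
  then have "\<exists>U1 U2. openin euclidean U1 \<and> openin euclidean U2 \<and> x \<in> U1 \<and> - U \<subseteq> U2 \<and> disjnt U1 U2"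
    by (rule regular_euclidean[unfolded regular_space_def, rule_format])
  then obtain U1 U2 where U: "open U1" "open U2" "x \<in> U1" "- U \<subseteq> U2" "disjnt U1 U2"
    unfolding open_openin[symmetric] by (elim exE conjE)
  obtain i where i: "1 \<le> i" "x \<in> B i" "B i \<subseteq> U1" using basisE[OF U(1,3)] .
  have "B i \<subseteq> - U2" using i(3) U(5) by (auto simp: disjnt_def)
  moreover have "closed (- U2)" using U(2) by (simp add: closed_Compl)
  ultimately have "closure (B i) \<subseteq> - U2" by (rule closure_minimal)
  then show thesis using U(4) i by (intro that[of i]) auto
qed

text \<open>
  The Cantor code of the sequence of memberships \<open>x \<in> B (Suc n)\<close> determines \<open>x\<close>; the decoder picks the unique
  point of the intersection of the closures \<open>closure (B (Suc n))\<close> over all \<open>n\<close> with bit one.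
\<close>

lemma borel_coding:
  obtains r :: "'a \<Rightarrow> real" and d :: "real \<Rightarrow> 'a"
  where "r \<in> borel_measurable borel" "d \<in> borel_measurable borel" "\<And>x. d (r x) = x"
    "\<And>x. 1/2 \<le> r x" "\<And>x. r x \<le> 1"
proof -
  \<comment> \<open>Cantor codes are moved from [0, 1] to [1/2, 1], away from the open left end of
    (0, 1].\<close>
  define r where "r x = (1 + cantor_code (\<lambda>n. x \<in> B (Suc n))) / 2" for x
  have rm: "r \<in> borel_measurable borel"
  proof -
    have [measurable]: "B (Suc n) \<in> sets borel" for n by (intro borel_open open_B)
    have "(\<lambda>x. cantor_code (\<lambda>n. x \<in> B (Suc n))) \<in> borel_measurable borel"
      by (rule measurable_cantor_code) measurable
    then show ?thesis unfolding r_def[abs_def] by measurable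
  qed
  define bit where "bit n c \<longleftrightarrow> cantor_bit n (2 * c - 1) \<ge> 1/2" for n c
  have bit_r: "bit n (r x) \<longleftrightarrow> x \<in> B (Suc n)" for n x
  proof -
    have "2 * r x - 1 = cantor_code (\<lambda>n. x \<in> B (Suc n))" by (simp add: r_def add_divide_distrib)
    then show ?thesis by (simp add: bit_def cantor_bit_code)
  qed
  have bitm[measurable]: "Measurable.pred borel (bit n)" for n
  proof -
    have [measurable]: "cantor_bit n \<in> borel_measurable borel"
      by (rule borel_measurable_continuous_onI[OF continuous_cantor_bit])
    show ?thesis unfolding bit_def by measurable
  qed
  define cl where "cl n = closure (B (Suc n))" for n
  have cl: "compact (cl n)" "closed (cl n)" for n
    using rel_compact_B[of "Suc n"] by (auto simp: cl_def rel_compact_def)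
  define K where "K c = (\<Inter>n\<in>{n. bit n c}. cl n)" for c
  \<comment> \<open>By compactness \<open>K c\<close> meets \<open>Z\<close> iff every finite stage
    does, and stage \<open>n\<close> involves only the first \<open>n\<close> bits; the set is thus
    a countable intersection of finite unions of bit events.\<close>
  have HB: "{c. K c \<inter> Z \<noteq> {}} \<in> sets borel" if Z: "compact Z" for Z
  proof -
    have "K c \<inter> Z \<noteq> {} \<longleftrightarrow> (\<forall>n. \<exists>S\<in>Pow {..<n}. (\<Inter>i\<in>S. cl i) \<inter> Z \<noteq> {} \<and> (\<forall>i<n. bit i c \<longleftrightarrow> i \<in> S))" (is "?L \<longleftrightarrow> ?R") for c
    proof
      assume ?L
      then obtain x where x: "x \<in> K c" "x \<in> Z" by auto
      show ?R
      proof
        fix n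
        show "\<exists>S\<in>Pow {..<n}. (\<Inter>i\<in>S. cl i) \<inter> Z \<noteq> {} \<and> (\<forall>i<n. bit i c \<longleftrightarrow> i \<in> S)"
          using x by (intro bexI[of _ "{i. i < n \<and> bit i c}"]) (auto simp: K_def)
      qed
    next
      assume R: ?R
      have "Z \<inter> \<Inter>(cl ` {n. bit n c}) \<noteq> {}"
      proof (rule compact_imp_fip[OF Z])
        fix F' assume F: "finite F'" "F' \<subseteq> cl ` {n. bit n c}"
        then obtain S where S: "S \<subseteq> {n. bit n c}" "finite S" "F' = cl ` S"
          by (metis finite_subset_image)
        define n where "n = Suc (Max (insert 0 S))"
        have n: "i < n" if "i \<in> S" for i
          unfolding n_def using S(2) that by (simp add: less_Suc_eq_le)
        obtain S' where S': "(\<Inter>i\<in>S'. cl i) \<inter> Z \<noteq> {}" "\<forall>i<n. bit i c \<longleftrightarrow> i \<in> S'"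
          using R by blast
        have "S \<subseteq> S'" using S(1) S'(2) n by blast
        then show "Z \<inter> \<Inter>F' \<noteq> {}" using S'(1) unfolding S(3) by blast
      qed (use cl in auto)
      then show ?L unfolding K_def by blast
    qed
    then have "{c. K c \<inter> Z \<noteq> {}} = {c \<in> space borel. \<forall>n. \<exists>S\<in>Pow {..<n}. (\<Inter>i\<in>S. cl i) \<inter> Z \<noteq> {} \<and> (\<forall>i<n. bit i c \<longleftrightarrow> i \<in> S)}"
      by simp
    also have "\<dots> \<in> sets borel"
      by (intro sets.sets_Collect_countable_All sets.sets_Collect_finite_Ex sets.sets_Collect_conj
            sets.sets_Collect_finite_All) (auto simp: bitm)
    finally show ?thesis .
  qed
  have Kr: "K (r x) = {x}" for x
  proof
    show "{x} \<subseteq> K (r x)"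
      unfolding K_def cl_def using closure_subset by (auto simp: bit_r)
    show "K (r x) \<subseteq> {x}"
    proof
      fix y assume y: "y \<in> K (r x)"
      show "y \<in> {x}"
      proof (rule ccontr)
        assume "y \<notin> {x}"
        then obtain i where i: "1 \<le> i" "x \<in> B i" "closure (B i) \<subseteq> - {y}"
          using regular_basisE[of "- {y}" x] by (auto simp: open_Compl)
        then have "bit (i - 1) (r x)" by (simp add: bit_r)
        then have "y \<in> cl (i - 1)" using y by (auto simp: K_def)
        then show False using i by (auto simp: cl_def)
      qed
    qed
  qed
  define G where "G = {c. \<exists>x. K c = {x}}"
  \<comment> \<open>\<open>K c\<close> is a single point iff it is nonempty and never meets two
    disjoint basic closures, because two distinct points are separated by such closures.\<close>
  have Geq: "G = (\<Union>n. {c. K c \<inter> cl n \<noteq> {}}) - (\<Union>i. \<Union>j\<in>{j. cl i \<inter> cl j = {}}. {c. K c \<inter> cl i \<noteq> {}} \<inter> {c. K c \<inter> cl j \<noteq> {}})"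
    (is "_ = ?A - ?B")
  proof (intro set_eqI iffI)
    fix c assume "c \<in> G"
    then obtain x where x: "K c = {x}" by (auto simp: G_def)
    obtain i where i: "1 \<le> i" "x \<in> B i" using basisE[of UNIV x] by auto
    then have "x \<in> cl (i - 1)" unfolding cl_def using closure_subset by auto
    then have "c \<in> ?A" using x by auto
    moreover have "c \<notin> ?B" using x by auto
    ultimately show "c \<in> ?A - ?B" by blast
  next
    fix c assume c: "c \<in> ?A - ?B"
    then obtain x where x: "x \<in> K c" by auto
    have "y = x" if y: "y \<in> K c" for y
    proof (rule ccontr)
      assume "y \<noteq> x"
      then obtain U W where UW: "open U" "open W" "x \<in> U" "y \<in> W" "U \<inter> W = {}"
        using hausdorff[of x y] by auto
      obtain i where i: "1 \<le> i" "x \<in> B i" "closure (B i) \<subseteq> U" using regular_basisE[OF UW(1,3)] .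
      obtain j where j: "1 \<le> j" "y \<in> B j" "closure (B j) \<subseteq> W" using regular_basisE[OF UW(2,4)] .
      have "cl (i - 1) \<inter> cl (j - 1) = {}" using i j UW(5) by (auto simp: cl_def)
      moreover have "x \<in> cl (i - 1)" "y \<in> cl (j - 1)"
        using i j closure_subset by (auto simp: cl_def)
      ultimately have "c \<in> ?B" using x y by blast
      then show False using c by blast
    qed
    then have "K c = {x}" using x by blast
    then show "c \<in> G" by (auto simp: G_def)
  qed
  have G: "G \<in> sets borel"
    unfolding Geq by (intro sets.Diff sets.countable_UN'' sets.Int HB cl countableI_type)
  \<comment> \<open>Off the Borel set \<open>G\<close> the decoder is constant, so preimages stay
    Borel.\<close>
  define d where "d c = (if c \<in> G then (THE x. K c = {x}) else undefined)" for c
  have dK: "K c = {d c}" if "c \<in> G" for c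
    using that unfolding d_def G_def by auto
  have "d \<in> borel_measurable borel"
  proof (rule borel_measurableI)
    fix U :: "'a set" assume U: "open U"
    have Ueq: "U = (\<Union>i\<in>{i. cl i \<subseteq> U}. cl i)"
    proof
      show "U \<subseteq> (\<Union>i\<in>{i. cl i \<subseteq> U}. cl i)"
      proof
        fix x assume "x \<in> U"
        then obtain i where "1 \<le> i" "x \<in> B i" "closure (B i) \<subseteq> U" using regular_basisE[OF U] by blast
        then have "x \<in> cl (i - 1)" "cl (i - 1) \<subseteq> U" using closure_subset by (auto simp: cl_def)
        then show "x \<in> (\<Union>i\<in>{i. cl i \<subseteq> U}. cl i)" by blast
      qed
    qed auto
    have "d -` cl i \<in> sets borel" for i
    proof -
      have "d -` cl i = (G \<inter> {c. K c \<inter> cl i \<noteq> {}}) \<union> (if undefined \<in> cl i then - G else {})"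
      proof (intro set_eqI)
        fix c
        show "c \<in> d -` cl i \<longleftrightarrow> c \<in> (G \<inter> {c. K c \<inter> cl i \<noteq> {}}) \<union> (if undefined \<in> cl i then - G else {})"
        proof (cases "c \<in> G")
          case True
          show ?thesis using dK[OF True] True by simp
        next
          case False
          then have "d c = undefined" by (simp add: d_def)
          then show ?thesis using False by simp
        qed
      qed
      moreover have "{c. K c \<inter> cl i \<noteq> {}} \<in> sets borel" by (rule HB[OF cl(1)])
      moreover have "- G \<in> sets borel" using sets.compl_sets[OF G] by (simp add: Compl_eq_Diff_UNIV)
      ultimately show ?thesis using G by auto
    qed
    then have "(\<Union>i\<in>{i. cl i \<subseteq> U}. d -` cl i) \<in> sets borel" by (intro sets.countable_UN'') auto
    moreover have "d -` U = (\<Union>i\<in>{i. cl i \<subseteq> U}. d -` cl i)" by (subst Ueq) auto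
    ultimately show "d -` U \<inter> space borel \<in> sets borel" by simp
  qed
  moreover have "d (r x) = x" for x
  proof -
    have "r x \<in> G" using Kr by (auto simp: G_def)
    then show ?thesis using dK[of "r x"] Kr[of x] by simp
  qed
  moreover have "1/2 \<le> r x" "r x \<le> 1" for x
    using cantor_code_bounds by (auto simp: r_def)
  ultimately show thesis by (rule that[OF rm])
qed

end

section \<open>Control measures and almost everywhere approximation\<close>

text \<open>Weighting by exp of minus the total mass of \<kappa> keeps the average finite, because y
  exp (- y) is at most 1. The weight is positive whenever \<kappa> is finite, so null sets of the
  average are null for almost every finite \<kappa>. One almost everywhere statement under
  \<open>M\<close> then serves all realisations at once.\<close>

lemma control_measure:
  fixes \<kappa> :: "'w \<Rightarrow> real measure"
  assumes Q: "prob_space Q" and s: "\<And>\<omega>. \<omega> \<in> space Q \<Longrightarrow> sets (\<kappa> \<omega>) = sets borel"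
    and em: "\<And>A. A \<in> sets borel \<Longrightarrow> (\<lambda>\<omega>. emeasure (\<kappa> \<omega>) A) \<in> borel_measurable Q"
  obtains M where "finite_measure M" "sets M = sets borel"
    "\<And>p. AE x in M. p x \<Longrightarrow> AE \<omega> in Q. emeasure (\<kappa> \<omega>) UNIV < \<infinity> \<longrightarrow> (AE x in \<kappa> \<omega>. p x)"
proof -
  interpret Q: prob_space Q by fact
  define m where "m A = (\<integral>\<^sup>+\<omega>. ennreal (exp_neg (emeasure (\<kappa> \<omega>) UNIV)) * emeasure (\<kappa> \<omega>) A \<partial>Q)" for A
  have [measurable]: "(\<lambda>\<omega>. emeasure (\<kappa> \<omega>) UNIV) \<in> borel_measurable Q" by (rule em) simp
  define M where "M = measure_of UNIV (sets borel) m"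
  have sM: "sets M = sets borel" unfolding M_def by (simp add: sets.sets_measure_of_eq[of borel, simplified])
  have eM: "emeasure M A = m A" if "A \<in> sets borel" for A
  proof (rule emeasure_measure_of[OF M_def])
    show "positive (sets M) m" by (simp add: positive_def m_def)
    show "countably_additive (sets M) m"
    proof (rule countably_additiveI)
      fix A :: "nat \<Rightarrow> real set" assume A: "range A \<subseteq> sets M" "disjoint_family A"
      then have [measurable]: "(\<lambda>\<omega>. emeasure (\<kappa> \<omega>) (A i)) \<in> borel_measurable Q" for i
        by (intro em) (auto simp: sM)
      have "(\<Sum>i. m (A i)) = (\<integral>\<^sup>+\<omega>. (\<Sum>i. ennreal (exp_neg (emeasure (\<kappa> \<omega>) UNIV)) * emeasure (\<kappa> \<omega>) (A i)) \<partial>Q)"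
        unfolding m_def by (intro nn_integral_suminf[symmetric]) measurable
      also have "\<dots> = m (\<Union>i. A i)"
        unfolding m_def
      proof (intro nn_integral_cong)
        fix \<omega> assume "\<omega> \<in> space Q"
        then have "range A \<subseteq> sets (\<kappa> \<omega>)" using A s sM by auto
        then show "(\<Sum>i. ennreal (exp_neg (emeasure (\<kappa> \<omega>) UNIV)) * emeasure (\<kappa> \<omega>) (A i)) =
            ennreal (exp_neg (emeasure (\<kappa> \<omega>) UNIV)) * emeasure (\<kappa> \<omega>) (\<Union>i. A i)"
          using A(2) by (simp add: suminf_emeasure)
      qed
      finally show "(\<Sum>i. m (A i)) = m (\<Union>i. A i)" .
    qed
  qed (use that sM in auto)
  show thesis
  proof (rule that[of M])
    show "finite_measure M"
    proof
      have "m UNIV \<le> (\<integral>\<^sup>+\<omega>. 1 \<partial>Q)"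
        unfolding m_def
      proof (intro nn_integral_mono)
        fix \<omega>
        show "ennreal (exp_neg (emeasure (\<kappa> \<omega>) UNIV)) * emeasure (\<kappa> \<omega>) UNIV \<le> 1"
        proof (cases "emeasure (\<kappa> \<omega>) UNIV")
          case (real y)
          have "y \<le> exp y" using exp_ge_add_one_self[of y] by linarith
          then have "exp (- y) * y \<le> exp (- y) * exp y" by (intro mult_left_mono) auto
          then have "exp (- y) * y \<le> 1" by (simp add: exp_add[symmetric])
          then show ?thesis using real by (simp add: exp_neg_ennreal ennreal_mult[symmetric])
        next
          case top
          then show ?thesis by (simp add: exp_neg_def)
        qed
      qed
      also have "\<dots> < \<infinity>" by (simp add: Q.emeasure_space_1)
      finally show "emeasure M (space M) \<noteq> \<infinity>"
        using eM[of UNIV] sets_eq_imp_space_eq[OF sM] by (simp add: less_top)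
    qed
    show "sets M = sets borel" by (rule sM)
    fix p assume "AE x in M. p x"
    then obtain N where N: "{x \<in> space M. \<not> p x} \<subseteq> N" "emeasure M N = 0" "N \<in> sets M"
      by (rule AE_E)
    have Nb: "N \<in> sets borel" using N(3) sM by simp
    note [measurable] = em[OF Nb]
    have "m N = 0" using eM[OF Nb] N(2) by simp
    then have "AE \<omega> in Q. ennreal (exp_neg (emeasure (\<kappa> \<omega>) UNIV)) * emeasure (\<kappa> \<omega>) N = 0"
      unfolding m_def by (subst (asm) nn_integral_0_iff_AE) auto
    then show "AE \<omega> in Q. emeasure (\<kappa> \<omega>) UNIV < \<infinity> \<longrightarrow> (AE x in \<kappa> \<omega>. p x)"
      using AE_space
    proof eventually_elim
      case (elim \<omega>)
      show ?case
      proof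
        assume "emeasure (\<kappa> \<omega>) UNIV < \<infinity>"
        then have "0 < exp_neg (emeasure (\<kappa> \<omega>) UNIV)" by (rule exp_neg_pos)
        then have "emeasure (\<kappa> \<omega>) N = 0" using elim(1) by simp
        then show "AE x in \<kappa> \<omega>. p x"
          using N(1) Nb s[OF elim(2)] sets_eq_imp_space_eq[OF s[OF elim(2)]] sets_eq_imp_space_eq[OF sM]
          by (intro AE_I[of _ _ N]) auto
      qed
    qed
  qed
qed

lemma AE_superpose:
  assumes s: "sets M = sets N" and ae: "AE x in superpose M N. p x"
  shows "AE x in M. p x" "AE x in N. p x"
proof -
  obtain Z where Z: "{x \<in> space (superpose M N). \<not> p x} \<subseteq> Z" "emeasure (superpose M N) Z = 0"
    "Z \<in> sets (superpose M N)"
    using ae by (rule AE_E)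
  have ZM: "Z \<in> sets M" using Z(3) by simp
  have z: "emeasure M Z = 0" "emeasure N Z = 0"
    using Z(2) emeasure_superpose[OF s ZM] by auto
  show "AE x in M. p x"
    by (rule AE_I[OF _ z(1) ZM]) (use Z(1) in simp)
  show "AE x in N. p x"
    by (rule AE_I[OF _ z(2)]) (use Z(1) ZM s sets_eq_imp_space_eq[OF s] in simp_all)
qed

text \<open>Density in L1 and a subsequence give almost everywhere convergence. The steps are
  clipped into (0, K + 1]: positivity is needed for their later use as exponents, boundedness for
  dominated convergence.\<close>

lemma step_sequence_AE:
  fixes f :: "real \<Rightarrow> real"
  assumes M: "finite_measure M" "sets M = sets borel"
    and f: "f \<in> borel_measurable borel" "\<And>x. 0 \<le> f x" "\<And>x. f x \<le> K"
  obtains n :: "nat \<Rightarrow> nat" and c :: "nat \<Rightarrow> int \<Rightarrow> real" where "\<And>j z. 0 < c j z" "\<And>j z. c j z \<le> K + 1"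
    "AE x in M. (\<lambda>j. c j \<lceil>2 ^ n j * x\<rceil>) \<longlonglongrightarrow> f x"
proof -
  interpret finite_measure M by fact
  note [measurable_cong] = M(2)
  have K: "0 \<le> K" by (rule order_trans[OF f(2) f(3)])
  define good where "good j p \<longleftrightarrow> integrable M (\<lambda>x. snd p \<lceil>2 ^ fst p * x\<rceil>) \<and>
      (LINT x|M. \<bar>f x - snd p \<lceil>2 ^ fst p * x\<rceil>\<bar>) < 1 / real (Suc j)"
    for j :: nat and p :: "nat \<times> (int \<Rightarrow> real)"
  have "\<exists>p. good j p" for j
  proof -
    have "\<exists>n c. integrable M (\<lambda>x. c \<lceil>2 ^ n * x\<rceil>) \<and> (LINT x|M. \<bar>f x - c \<lceil>2 ^ n * x\<rceil>\<bar>) < 1 / real (Suc j)"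
    proof (rule dyadic_step_approx_L1[where f=f and K=K])
      show "0 \<le> f x" "f x \<le> K" for x by (rule f)+
    qed (use M f(1) in auto)
    then obtain n where
      "\<exists>c. integrable M (\<lambda>x. c \<lceil>2 ^ n * x\<rceil>) \<and> (LINT x|M. \<bar>f x - c \<lceil>2 ^ n * x\<rceil>\<bar>) < 1 / real (Suc j)" ..
    then obtain c where
      "integrable M (\<lambda>x. c \<lceil>2 ^ n * x\<rceil>) \<and> (LINT x|M. \<bar>f x - c \<lceil>2 ^ n * x\<rceil>\<bar>) < 1 / real (Suc j)" ..
    then have "good j (n, c)" by (simp add: good_def)
    then show ?thesis ..
  qed
  then have "\<exists>p. \<forall>j. good j (p j)" by (intro choice allI)
  then obtain p where p: "\<And>j. good j (p j)" by blast
  define n where "n j = fst (p j)" for j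
  define c where "c j = snd (p j)" for j
  have c: "integrable M (\<lambda>x. c j \<lceil>2 ^ n j * x\<rceil>)"
    "(LINT x|M. \<bar>f x - c j \<lceil>2 ^ n j * x\<rceil>\<bar>) < 1 / real (Suc j)" for j
    using p[of j] by (auto simp: good_def n_def c_def)
  \<comment> \<open>Clipping from below at 1 / (j + 1) costs at most that much, and clipping from
    above at K + 1 costs nothing, since \<open>f\<close> takes values in [0, K].\<close>
  define c' where "c' j z = max (1 / real (Suc j)) (min (K + 1) (c j z))" for j z
  have c'_pos: "0 < c' j z" for j z by (simp add: c'_def less_max_iff_disj)
  have c'_le: "c' j z \<le> K + 1" for j z
  proof -
    have "1 / real (Suc j) \<le> 1" by simp
    then show ?thesis using K unfolding c'_def by linarith
  qed
  have near: "\<bar>y - c' j z\<bar> \<le> \<bar>y - c j z\<bar> + 1 / real (Suc j)" if "0 \<le> y" "y \<le> K" for y j z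
  proof -
    define e where "e = 1 / real (Suc j)"
    have "0 < e" "e \<le> 1" by (auto simp: e_def)
    then show ?thesis using that unfolding c'_def e_def[symmetric] by linarith
  qed
  have cm: "(\<lambda>x. c' j \<lceil>2 ^ n j * x\<rceil>) \<in> borel_measurable M" for j
    using borel_measurable_integrable[OF c(1)[of j]] unfolding c'_def by measurable
  have fi: "integrable M f" by (rule integrable_const_bound[of _ K]) (use f in auto)
  have ci: "integrable M (\<lambda>x. c' j \<lceil>2 ^ n j * x\<rceil>)" for j
    by (rule integrable_const_bound[of _ "K + 1"]) (use cm c'_le c'_pos in \<open>auto simp: less_imp_le\<close>)
  have L1: "(\<lambda>j. LINT x|M. norm (f x - c' j \<lceil>2 ^ n j * x\<rceil>)) \<longlonglongrightarrow> 0"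
  proof (rule real_tendsto_sandwich[where f="\<lambda>_. 0"])
    show "\<forall>\<^sub>F j in sequentially. (LINT x|M. norm (f x - c' j \<lceil>2 ^ n j * x\<rceil>)) \<le> (1 + measure M (space M)) * (1 / real (Suc j))"
    proof (intro always_eventually allI)
      fix j
      have "(LINT x|M. norm (f x - c' j \<lceil>2 ^ n j * x\<rceil>)) \<le> (LINT x|M. \<bar>f x - c j \<lceil>2 ^ n j * x\<rceil>\<bar> + 1 / real (Suc j))"
        using fi ci[of j] c(1)[of j] near f by (intro integral_mono) auto
      also have "\<dots> = (LINT x|M. \<bar>f x - c j \<lceil>2 ^ n j * x\<rceil>\<bar>) + measure M (space M) * (1 / real (Suc j))"
        using fi c(1)[of j] by (subst Bochner_Integration.integral_add) auto
      also have "\<dots> \<le> (1 + measure M (space M)) * (1 / real (Suc j))"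
        using c(2)[of j] by (simp add: add_divide_distrib)
      finally show "(LINT x|M. norm (f x - c' j \<lceil>2 ^ n j * x\<rceil>)) \<le> (1 + measure M (space M)) * (1 / real (Suc j))" .
    qed
    have "(\<lambda>j. (1 + measure M (space M)) * (1 / real (Suc j))) \<longlonglongrightarrow> (1 + measure M (space M)) * 0"
      using LIMSEQ_inverse_real_of_nat by (intro tendsto_intros) (simp add: inverse_eq_divide)
    then show "(\<lambda>j. (1 + measure M (space M)) * (1 / real (Suc j))) \<longlonglongrightarrow> 0" by simp
  qed auto
  have "\<exists>s :: nat \<Rightarrow> nat. strict_mono s \<and> (AE x in M. (\<lambda>j. f x - c' (s j) \<lceil>2 ^ n (s j) * x\<rceil>) \<longlonglongrightarrow> 0)"
    by (rule tendsto_L1_AE_subseq[OF Bochner_Integration.integrable_diff[OF fi ci] L1])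
  then obtain s :: "nat \<Rightarrow> nat" where s: "strict_mono s" "AE x in M. (\<lambda>j. f x - c' (s j) \<lceil>2 ^ n (s j) * x\<rceil>) \<longlonglongrightarrow> 0"
    by blast
  show thesis
  proof (rule that[of "\<lambda>j. c' (s j)" "\<lambda>j. n (s j)"])
    show "AE x in M. (\<lambda>j. c' (s j) \<lceil>2 ^ n (s j) * x\<rceil>) \<longlonglongrightarrow> f x"
      using s(2)
    proof eventually_elim
      case (elim x)
      have "(\<lambda>j. f x - (f x - c' (s j) \<lceil>2 ^ n (s j) * x\<rceil>)) \<longlonglongrightarrow> f x - 0"
        by (intro tendsto_diff tendsto_const elim)
      then show ?case by simp
    qed
  qed (use c'_pos c'_le in auto)
qed

section \<open>Limit law of the rescaled process\<close>

text \<open>The right-continuous regularisation of a monotone function known on the rationals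
  only.\<close>

definition right_limit :: "(rat \<Rightarrow> real) \<Rightarrow> real \<Rightarrow> real" where
  "right_limit F t = (INF q\<in>{q. t < of_rat q}. F q)"

text \<open>Rational data for the distribution function of a measure of total mass \<open>m\<close>;
  the thresholds 1/2 and 1 are the bounds of the coding.\<close>

locale rational_df =
  fixes F :: "rat \<Rightarrow> real" and m :: real
  assumes mono: "\<And>p q. p \<le> q \<Longrightarrow> F p \<le> F q"
    and zero: "\<And>q. of_rat q < (1/2 :: real) \<Longrightarrow> F q = 0"
    and top: "\<And>q. 1 \<le> q \<Longrightarrow> F q = m"
begin

lemma nonneg: "0 \<le> F q"
proof -
  have "of_rat (min q 0) < (1/2 :: real)"
    by (rule le_less_trans[of _ "of_rat 0"]) (unfold of_rat_less_eq, simp_all)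
  then have "F (min q 0) = 0" by (rule zero)
  then show ?thesis using mono[of "min q 0" q] by simp
qed

lemma m_nonneg: "0 \<le> m"
  using nonneg[of 1] top[of 1] by simp

lemma nonempty: "{q. (t :: real) < of_rat q} \<noteq> {}"
proof -
  obtain q :: rat where "t < of_rat q" using of_rat_dense[of t "t+1"] by auto
  then show ?thesis by auto
qed

lemma bdd: "bdd_below (F ` A)"
  using nonneg by (auto intro: bdd_belowI[of _ 0])

lemma right_limit_le: "t < of_rat q \<Longrightarrow> right_limit F t \<le> F q"
  unfolding right_limit_def by (intro cINF_lower bdd) auto

lemma right_limit_ge: "(\<And>q. t < of_rat q \<Longrightarrow> y \<le> F q) \<Longrightarrow> y \<le> right_limit F t"
  unfolding right_limit_def using nonempty by (intro cINF_greatest) auto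

lemma right_limit_mono: "s \<le> t \<Longrightarrow> right_limit F s \<le> right_limit F t"
  by (intro right_limit_ge right_limit_le) simp

lemma right_limit_approx:
  assumes "0 < e"
  obtains q where "t < of_rat q" "F q < right_limit F t + e"
proof -
  have "\<exists>q\<in>{q. t < of_rat q}. F q < right_limit F t + e"
    using assms nonempty bdd cINF_less_iff[of "{q. t < of_rat q}" F "right_limit F t + e"]
    by (simp add: right_limit_def)
  then show thesis using that by blast
qed

text \<open>The approach has to be strictly from above: at a rational \<open>t\<close> the value of
  \<open>F\<close> may differ from the right limit.\<close>

lemma right_limit_tendsto:
  assumes "(\<lambda>k. of_rat (q k)) \<longlonglongrightarrow> t" "\<And>k. t < of_rat (q k)"
  shows "(\<lambda>k. F (q k)) \<longlonglongrightarrow> right_limit F t"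
proof (rule LIMSEQ_I)
  fix e :: real assume e: "0 < e"
  obtain p where p: "t < of_rat p" "F p < right_limit F t + e" using right_limit_approx[OF e] .
  have "\<forall>\<^sub>F k in sequentially. of_rat (q k) < (of_rat p :: real)"
    using assms(1) p(1) by (rule order_tendstoD)
  then obtain k0 where k0: "\<And>k. k \<ge> k0 \<Longrightarrow> of_rat (q k) < (of_rat p :: real)"
    unfolding eventually_sequentially by blast
  show "\<exists>k0. \<forall>k\<ge>k0. norm (F (q k) - right_limit F t) < e"
  proof (intro exI allI impI)
    fix k assume "k0 \<le> k"
    then have "q k \<le> p" using k0[of k] by (simp add: of_rat_less)
    then have "F (q k) \<le> F p" by (rule mono)
    then show "norm (F (q k) - right_limit F t) < e"
      using p right_limit_le[OF assms(2)[of k]] by simp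
  qed
qed

lemma right_limit_right_cont: "continuous (at_right t) (right_limit F)"
  unfolding continuous_within
proof (rule tendstoI)
  fix e :: real assume e: "0 < e"
  obtain p where p: "t < of_rat p" "F p < right_limit F t + e" using right_limit_approx[OF e] .
  have "\<forall>\<^sub>F x in at_right t. x \<in> {t<..<of_rat p}" using p(1) by (rule eventually_at_right_real)
  then show "\<forall>\<^sub>F x in at_right t. dist (right_limit F x) (right_limit F t) < e"
  proof eventually_elim
    case (elim x)
    then have "right_limit F t \<le> right_limit F x" "right_limit F x \<le> F p"
      by (auto intro: right_limit_mono right_limit_le)
    then show ?case using p by (simp add: dist_real_def)
  qed
qed

lemma right_limit_zero: "t < 1/2 \<Longrightarrow> right_limit F t = 0"
proof (rule antisym)
  assume "t < 1/2"
  then obtain q where "t < of_rat q" "of_rat q < (1/2::real)" using of_rat_dense[of t "1/2"] by auto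
  then show "right_limit F t \<le> 0" using right_limit_le zero by force
qed (intro right_limit_ge nonneg)

lemma right_limit_top: "1 \<le> t \<Longrightarrow> right_limit F t = m"
proof (rule antisym)
  assume t: "1 \<le> t"
  have "1 \<le> q" if "t < of_rat q" for q
  proof -
    have "1 < real_of_rat q" using t that by linarith
    then show ?thesis by simp
  qed
  then show "m \<le> right_limit F t" using top by (intro right_limit_ge) simp
  obtain q :: rat where q: "t < of_rat q" using of_rat_dense[of t "t+1"] by auto
  then show "right_limit F t \<le> m"
    using right_limit_le[OF q] top \<open>\<And>q. t < of_rat q \<Longrightarrow> 1 \<le> q\<close> by simp
qed

definition "\<nu> = interval_measure (right_limit F)"

lemma sets_\<nu> [simp, measurable_cong]: "sets \<nu> = sets borel"
  by (simp add: \<nu>_def)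

lemma emeasure_\<nu>_Ioc: "a \<le> b \<Longrightarrow> emeasure \<nu> {a<..b} = ennreal (right_limit F b - right_limit F a)"
  unfolding \<nu>_def by (intro emeasure_interval_measure_Ioc right_limit_mono right_limit_right_cont)

lemma emeasure_\<nu>_UNIV: "emeasure \<nu> UNIV = ennreal m"
  unfolding \<nu>_def
proof (intro interval_measure_UNIV right_limit_mono right_limit_right_cont m_nonneg)
  have "\<forall>\<^sub>F t in at_bot. right_limit F t = 0"
    using eventually_gt_at_bot[of "1/2::real"] by eventually_elim (rule right_limit_zero)
  then show "(right_limit F \<longlongrightarrow> 0) at_bot" by (rule tendsto_eventually)
  have "\<forall>\<^sub>F t in at_top. right_limit F t = m"
    using eventually_ge_at_top[of "1::real"] by eventually_elim (rule right_limit_top)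
  then show "(right_limit F \<longlongrightarrow> m) at_top" by (rule tendsto_eventually)
qed

lemma AE_\<nu>_unit: "AE t in \<nu>. 0 < t \<and> t \<le> 1"
proof (rule AE_I)
  have "emeasure \<nu> (UNIV - {0<..1}) = emeasure \<nu> UNIV - emeasure \<nu> {0<..1}"
    by (rule emeasure_Diff) (simp_all add: emeasure_\<nu>_Ioc)
  also have "\<dots> = 0" by (simp add: emeasure_\<nu>_UNIV emeasure_\<nu>_Ioc right_limit_zero right_limit_top)
  finally show "emeasure \<nu> (UNIV - {0<..1}) = 0" .
qed auto

end

text \<open>The ceiling equals k + 1 on the cell from k / 2^n (excluded) to (k + 1) / 2^n
  (included), hence the argument \<open>int k + 1\<close>; the 2^n cells partition (0, 1].\<close>

lemma step_decomposition:
  fixes t :: real and c :: "int \<Rightarrow> real"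
  assumes "0 < t" "t \<le> 1"
  shows "(\<Sum>k<2^n. c (int k + 1) * indicator {real k / 2^n<..real (Suc k) / 2^n} t) = c \<lceil>2 ^ n * t\<rceil>"
proof -
  define k0 where "k0 = nat (\<lceil>2 ^ n * t\<rceil> - 1)"
  have c1: "1 \<le> \<lceil>2 ^ n * t\<rceil>" using assms(1) by (simp add: one_le_ceiling)
  have "2 ^ n * t \<le> 2 ^ n" using assms by simp
  then have c2: "\<lceil>2 ^ n * t\<rceil> \<le> 2 ^ n" by (simp add: ceiling_le_iff)
  have k0: "int k0 + 1 = \<lceil>2 ^ n * t\<rceil>" using c1 by (simp add: k0_def)
  have "int k0 < 2 ^ n" using k0 c2 by linarith
  then have k0n: "k0 < 2 ^ n" by (metis of_nat_less_iff of_nat_numeral of_nat_power)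
  have iff: "t \<in> {real k / 2^n<..real (Suc k) / 2^n} \<longleftrightarrow> k = k0" for k
  proof -
    have "t \<in> {real k / 2^n<..real (Suc k) / 2^n} \<longleftrightarrow> real k < 2^n * t \<and> 2^n * t \<le> real k + 1"
      by (auto simp: field_simps)
    also have "\<dots> \<longleftrightarrow> \<lceil>2^n * t\<rceil> = int k + 1"
      by (subst ceiling_eq_iff) auto
    also have "\<dots> \<longleftrightarrow> k = k0" using k0 by auto
    finally show ?thesis .
  qed
  have "(\<Sum>k<2^n. c (int k + 1) * indicator {real k / 2^n<..real (Suc k) / 2^n} t) = (\<Sum>k<2^n. if k = k0 then c (int k0 + 1) else 0)"
    using iff by (intro sum.cong) (auto simp: indicator_def)
  also have "\<dots> = c \<lceil>2 ^ n * t\<rceil>" using k0n k0 by simp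
  finally show ?thesis .
qed

lemma lap_powr:
  assumes "sets \<mu> = sets borel" "g \<in> borel_measurable borel" "\<And>x. 0 \<le> g x" "0 < c"
  shows "lap g \<mu> powr c = lap (\<lambda>x. c * g x) \<mu>"
proof -
  have "(\<integral>\<^sup>+x. ennreal (c * g x) \<partial>\<mu>) = ennreal c * (\<integral>\<^sup>+x. ennreal (g x) \<partial>\<mu>)"
    using assms by (simp add: ennreal_mult nn_integral_cmult measurable_cong_sets[OF assms(1) refl])
  moreover have "exp_neg a powr c = exp_neg (ennreal c * a)" for a
    using assms(4) by (cases a) (auto simp: exp_neg_def ennreal_mult_top ennreal_mult[symmetric] powr_def mult.commute)
  ultimately show ?thesis by (simp add: lap_def)
qed

lemma lap_sum:
  assumes "sets \<mu> = sets borel" "finite I" "\<And>i. i \<in> I \<Longrightarrow> g i \<in> borel_measurable borel" "\<And>i x. 0 \<le> g i x"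
  shows "lap (\<lambda>x. \<Sum>i\<in>I. g i x) \<mu> = (\<Prod>i\<in>I. lap (g i) \<mu>)"
  using assms(2,3)
proof (induction I)
  case (insert i I)
  have "lap (\<lambda>x. g i x + (\<Sum>i\<in>I. g i x)) \<mu> = lap (g i) \<mu> * lap (\<lambda>x. \<Sum>i\<in>I. g i x) \<mu>"
    using insert assms(1,4) by (intro lap_add) (auto intro: sum_nonneg)
  then show ?case using insert by simp
qed simp

section \<open>Weights, coordinates and their limit law\<close>

locale coded_process = stable_process B P \<Phi> \<alpha> h0
  for B :: "nat \<Rightarrow> 'a::{t2_space, second_countable_topology} set" and P :: "'w measure" and \<Phi> \<alpha> h0 +
  fixes r :: "'a \<Rightarrow> real" and d :: "real \<Rightarrow> 'a"
  assumes rm [measurable]: "r \<in> borel_measurable borel" and dm [measurable]: "d \<in> borel_measurable borel"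
    and dr: "\<And>x. d (r x) = x" and r_ge: "\<And>x. 1/2 \<le> r x" and r_le: "\<And>x. r x \<le> 1"
    and nontrivial: "0 < \<psi> h0" and \<alpha>1: "\<alpha> < 1"
begin

text \<open>A function \<open>f\<close> on the code line stands for \<open>h0 x * f (r x)\<close> on
  the space, so that bounded \<open>f\<close> become tame. \<open>D f\<close> is the value that
  \<delta> times the Laplace functional of the limit has to take at \<open>f\<close>.\<close>

definition D :: "(real \<Rightarrow> real) \<Rightarrow> real" where
  "D f = \<psi> (\<lambda>x. h0 x * f (r x) + 2 * h0 x) - \<psi> (\<lambda>x. h0 x * f (r x) + h0 x)"

text \<open>By homogeneity this is \<psi> (2 h0) - \<psi> h0, the limit of the total weights
  (\<open>w_total\<close>).\<close>

definition "\<delta> = (2 powr \<alpha> - 1) * \<psi> h0"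

lemma \<delta>_pos: "0 < \<delta>"
proof -
  have "1 < (2::real) powr \<alpha>" using \<alpha>(1) by (simp add: gr_one_powr)
  then show ?thesis using nontrivial by (simp add: \<delta>_def)
qed

lemma D_const: "0 \<le> c \<Longrightarrow> D (\<lambda>_. c) = ((c + 2) powr \<alpha> - (c + 1) powr \<alpha>) * \<psi> h0"
proof -
  assume c: "0 \<le> c"
  have "(\<lambda>x. h0 x * c + 2 * h0 x) = (\<lambda>x. (c + 2) * h0 x)" "(\<lambda>x. h0 x * c + h0 x) = (\<lambda>x. (c + 1) * h0 x)"
    by (auto simp: algebra_simps)
  then show ?thesis using \<psi>_scale[OF tame_h0, of "c + 2"] \<psi>_scale[OF tame_h0, of "c + 1"] c
    by (simp add: D_def left_diff_distrib)
qed

lemma tame_coded: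
  assumes "f \<in> borel_measurable borel" "\<And>t. 0 \<le> f t" "\<And>t. f t \<le> K"
  shows "tame K (\<lambda>x. h0 x * f (r x))"
proof -
  note [measurable] = assms(1)
  have "0 \<le> h0 x * f (r x) \<and> h0 x * f (r x) \<le> K * h0 x" for x
    using h0_pos[of x] assms(2,3)[of "r x"] by (simp add: mult.commute)
  then show ?thesis unfolding tame_def by auto
qed

lemma D_tendsto:
  assumes fn: "\<And>n. f n \<in> borel_measurable borel" "\<And>n t. 0 \<le> f n t" "\<And>n t. f n t \<le> K"
    and l: "l \<in> borel_measurable borel" "\<And>t. 0 \<le> l t" "\<And>t. l t \<le> K"
    and lim: "AE \<omega> in P. AE x in \<Phi> \<omega>. (\<lambda>n. f n (r x)) \<longlonglongrightarrow> l (r x)"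
  shows "(\<lambda>n. D (f n)) \<longlonglongrightarrow> D l"
proof -
  have "(\<lambda>n. \<psi> (\<lambda>x. h0 x * f n (r x) + c * h0 x)) \<longlonglongrightarrow> \<psi> (\<lambda>x. h0 x * l (r x) + c * h0 x)" if c: "0 \<le> c" for c
  proof (rule \<psi>_tendsto[where C="K + c * 1"])
    show "tame (K + c * 1) (\<lambda>x. h0 x * f n (r x) + c * h0 x)" for n
      by (intro tame_add tame_coded tame_scale tame_h0 fn c)
    show "tame (K + c * 1) (\<lambda>x. h0 x * l (r x) + c * h0 x)"
      by (intro tame_add tame_coded tame_scale tame_h0 l c)
    show "AE \<omega> in P. AE x in \<Phi> \<omega>. (\<lambda>n. h0 x * f n (r x) + c * h0 x) \<longlonglongrightarrow> h0 x * l (r x) + c * h0 x"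
      using lim
    proof eventually_elim
      case (elim \<omega>)
      then show ?case
        by eventually_elim (intro tendsto_add tendsto_mult tendsto_const)
    qed
  qed
  from tendsto_diff[OF this[of 2] this[of 1]] show ?thesis by (simp add: D_def)
qed

definition w :: "nat \<Rightarrow> 'w \<Rightarrow> real" where
  "w N \<omega> = real N powr \<alpha> * (lap (\<lambda>x. h0 x / real N) (\<Phi> \<omega>) - lap (\<lambda>x. 2 * h0 x / real N) (\<Phi> \<omega>))"

lemma measurable_w [measurable]: "w N \<in> borel_measurable P"
  unfolding w_def[abs_def] by measurable

lemma w_nonneg: "0 \<le> w N \<omega>"
proof -
  have "lap (\<lambda>x. 2 * h0 x / real N) (\<Phi> \<omega>) \<le> lap (\<lambda>x. h0 x / real N) (\<Phi> \<omega>)"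
    using h0_pos by (intro lap_mono divide_right_mono) (auto simp: less_imp_le)
  then show ?thesis by (simp add: w_def)
qed

lemma integrable_w: "integrable P (w N)"
  unfolding w_def[abs_def]
  by (intro integrable_mult_right Bochner_Integration.integrable_diff integrable_lap) measurable

text \<open>Multiplication by the weight merges the exponents: the integral becomes a difference of
  two terms N^\<alpha> (1 - L), at k + 2 h0 and at k + h0, each with a known limit.\<close>

lemma weighted_lap:
  assumes k: "tame C k"
  shows "(\<lambda>N. LINT \<omega>|P. w N \<omega> * lap (\<lambda>x. k x / real N) (\<Phi> \<omega>)) \<longlonglongrightarrow> \<psi> (\<lambda>x. k x + 2 * h0 x) - \<psi> (\<lambda>x. k x + h0 x)"
proof -
  note [measurable] = tameD(1)[OF k]
  have sum: "lap (\<lambda>x. (k x + c * h0 x) / real N) (\<Phi> \<omega>) = lap (\<lambda>x. c * h0 x / real N) (\<Phi> \<omega>) * lap (\<lambda>x. k x / real N) (\<Phi> \<omega>)"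
    if "\<omega> \<in> space P" "0 \<le> c" for c N \<omega>
  proof -
    have "lap (\<lambda>x. c * h0 x / real N + k x / real N) (\<Phi> \<omega>) = lap (\<lambda>x. c * h0 x / real N) (\<Phi> \<omega>) * lap (\<lambda>x. k x / real N) (\<Phi> \<omega>)"
      using that h0_pos tameD(2)[OF k] sets_radon[OF \<Phi>_radon[OF that(1)]]
      by (intro lap_add) (auto simp: less_imp_le)
    then show ?thesis by (simp add: add_divide_distrib add.commute)
  qed
  have "(LINT \<omega>|P. w N \<omega> * lap (\<lambda>x. k x / real N) (\<Phi> \<omega>)) =
      real N powr \<alpha> * (1 - Lf (\<lambda>x. (k x + 2 * h0 x) / real N)) - real N powr \<alpha> * (1 - Lf (\<lambda>x. (k x + h0 x) / real N))" for N
  proof -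
    have "(LINT \<omega>|P. w N \<omega> * lap (\<lambda>x. k x / real N) (\<Phi> \<omega>)) =
       (LINT \<omega>|P. real N powr \<alpha> * (lap (\<lambda>x. (k x + 1 * h0 x) / real N) (\<Phi> \<omega>) - lap (\<lambda>x. (k x + 2 * h0 x) / real N) (\<Phi> \<omega>)))"
      using sum[of _ 1 N] sum[of _ 2 N]
      by (intro Bochner_Integration.integral_cong refl) (simp add: w_def left_diff_distrib right_diff_distrib mult.assoc)
    also have "\<dots> = real N powr \<alpha> * (Lf (\<lambda>x. (k x + 1 * h0 x) / real N) - Lf (\<lambda>x. (k x + 2 * h0 x) / real N))"
      unfolding Lf_def by (subst Bochner_Integration.integral_mult_right_zero, subst Bochner_Integration.integral_diff) (auto intro!: integrable_lap)
    finally show ?thesis by (simp add: algebra_simps)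
  qed
  moreover have "(\<lambda>N. real N powr \<alpha> * (1 - Lf (\<lambda>x. (k x + 2 * h0 x) / real N)) - real N powr \<alpha> * (1 - Lf (\<lambda>x. (k x + h0 x) / real N)))
     \<longlonglongrightarrow> \<psi> (\<lambda>x. k x + 2 * h0 x) - \<psi> (\<lambda>x. k x + h0 x)"
    by (intro tendsto_diff Lf_scaling_limit[OF tame_add[OF k tame_scale[OF tame_h0]]]
          Lf_scaling_limit[OF tame_add[OF k tame_h0]]) simp
  ultimately show ?thesis by simp
qed

lemma w_total: "(\<lambda>N. LINT \<omega>|P. w N \<omega>) \<longlonglongrightarrow> \<delta>"
proof -
  have "tame 0 (\<lambda>_. 0)" by (simp add: tame_def)
  from weighted_lap[OF this] have "(\<lambda>N. LINT \<omega>|P. w N \<omega>) \<longlonglongrightarrow> \<psi> (\<lambda>x. 2 * h0 x) - \<psi> h0" by simp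
  also have "\<psi> (\<lambda>x. 2 * h0 x) - \<psi> h0 = \<delta>"
    using \<psi>_scale[OF tame_h0, of 2] by (simp add: \<delta>_def left_diff_distrib)
  finally show ?thesis .
qed

definition iv :: "rat \<times> rat \<Rightarrow> real \<Rightarrow> real" where
  "iv pq t = indicator {of_rat (fst pq)<..of_rat (snd pq)} t"

lemma iv_bounds: "0 \<le> iv pq t" "iv pq t \<le> 1"
  by (auto simp: iv_def indicator_def)

lemma measurable_iv [measurable]: "iv pq \<in> borel_measurable borel"
  unfolding iv_def[abs_def] by measurable

text \<open>Countably many coordinates with values in [0, 1], one for each rational interval of
  codes. The exponential compactifies the masses: infinite mass becomes the value 0, which is
  excluded only in the limit (\<open>AE_G_pos\<close>).\<close>

definition Y :: "nat \<Rightarrow> rat \<times> rat \<Rightarrow> 'w \<Rightarrow> real" where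
  "Y N pq \<omega> = lap (\<lambda>x. h0 x * iv pq (r x) / real N) (\<Phi> \<omega>)"

text \<open>
  The limit law: \<open>Q\<close> is a weak limit of the laws of \<open>\<Phi>/N\<close> weighted by
  \<open>N\<^sup>\<alpha> (exp (- \<integral> h0 d\<Phi>/N) - exp (- 2 \<integral> h0 d\<Phi>/N))\<close>, read through the coordinates \<open>Y N\<close>.
\<close>

lemma exists_limit_law:
  obtains Q and s :: "nat \<Rightarrow> nat" where "real_distribution Q" "strict_mono s"
    "\<And>(f :: (rat \<times> rat \<Rightarrow> real) \<Rightarrow> real) K. continuous_on UNIV (\<lambda>x. f (\<lambda>pq. fill (to_nat pq) x)) \<Longrightarrow>
       (\<And>x. \<bar>f (\<lambda>pq. fill (to_nat pq) x)\<bar> \<le> K) \<Longrightarrow>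
       (\<lambda>n. LINT \<omega>|P. w (s n) \<omega> * f (\<lambda>pq. Y (s n) pq \<omega>)) \<longlonglongrightarrow> \<delta> * (LINT x|Q. f (\<lambda>pq. fill (to_nat pq) x))"
proof -
  define tot where "tot N = (LINT \<omega>|P. w N \<omega>)" for N
  have "\<forall>\<^sub>F N in sequentially. 0 < tot N"
    using w_total \<delta>_pos unfolding tot_def by (rule order_tendstoD)
  then obtain N0 where N0: "\<And>N. N \<ge> N0 \<Longrightarrow> 0 < tot N"
    unfolding eventually_sequentially by blast
  \<comment> \<open>Dropping the first \<open>N0\<close> indices makes every total weight positive,
    so the weights can be normalised to probability densities.\<close>
  define p where "p n \<omega> = w (n + N0) \<omega> / tot (n + N0)" for n \<omega>
  have pos: "0 < tot (n + N0)" for n by (rule N0) simp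
  have p0: "0 \<le> p n \<omega>" for n \<omega> using w_nonneg pos[of n] by (simp add: p_def)
  have pm[measurable]: "p n \<in> borel_measurable P" for n unfolding p_def[abs_def] by measurable
  define PN where "PN n = density P (\<lambda>\<omega>. ennreal (p n \<omega>))" for n
  have prob: "prob_space (PN n)" for n
  proof
    have "(\<integral>\<^sup>+\<omega>. ennreal (p n \<omega>) \<partial>P) = ennreal (LINT \<omega>|P. p n \<omega>)"
    proof (rule nn_integral_eq_integral)
      show "integrable P (p n)" unfolding p_def[abs_def] by (intro integrable_divide_zero integrable_w)
    qed (simp add: p0)
    also have "(LINT \<omega>|P. p n \<omega>) = 1" using pos[of n] by (simp add: p_def tot_def)
    finally show "emeasure (PN n) (space (PN n)) = 1"
      by (simp add: PN_def emeasure_density cong: nn_integral_cong)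
  qed
  have Ym[measurable]: "Y N pq \<in> borel_measurable P" for N pq
    unfolding Y_def[abs_def] by measurable
  obtain Q s where Q: "real_distribution Q" and s: "strict_mono s" and lim:
    "\<And>(f :: (nat \<Rightarrow> real) \<Rightarrow> real) K. continuous_on UNIV (\<lambda>x. f (\<lambda>i. fill i x)) \<Longrightarrow> (\<And>x. \<bar>f (\<lambda>i. fill i x)\<bar> \<le> K) \<Longrightarrow>
       (\<lambda>n. LINT \<omega>|PN (s n). f (\<lambda>i. Y (s n + N0) (from_nat i) \<omega>)) \<longlonglongrightarrow> (LINT x|Q. f (\<lambda>i. fill i x))"
    using weak_limit_unit_sequences[of PN "\<lambda>n i. Y (n + N0) (from_nat i)"] prob
    by (auto simp: PN_def Y_def lap_bounds)
  show thesis
  proof (rule that[OF Q, of "\<lambda>n. s n + N0"])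
    show "strict_mono (\<lambda>n. s n + N0)" using s by (simp add: strict_mono_def)
    fix f :: "(rat \<times> rat \<Rightarrow> real) \<Rightarrow> real" and K
    assume c: "continuous_on UNIV (\<lambda>x. f (\<lambda>pq. fill (to_nat pq) x))"
      and b: "\<And>x. \<bar>f (\<lambda>pq. fill (to_nat pq) x)\<bar> \<le> K"
    define f' where "f' y = f (\<lambda>pq. y (to_nat pq))" for y :: "nat \<Rightarrow> real"
    \<comment> \<open>The test function is continuous only along the curve, so measurability is
      obtained by inserting \<open>fill\<close> after \<open>fill_inv\<close>.\<close>
    have fY: "(\<lambda>\<omega>. f (\<lambda>pq. Y N pq \<omega>)) \<in> borel_measurable P" for N
    proof -
      have "f (\<lambda>pq. Y N pq \<omega>) = f (\<lambda>pq. fill (to_nat pq) (fill_inv (\<lambda>i. Y N (from_nat i) \<omega>)))" for \<omega>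
        by (simp add: fill_fill_inv Y_def lap_bounds)
      moreover have "(\<lambda>\<omega>. fill_inv (\<lambda>i. Y N (from_nat i) \<omega>)) \<in> borel_measurable P"
      proof -
        have "Measurable.pred P (\<lambda>\<omega>. odd \<lfloor>2 ^ j * Y N (from_nat i) \<omega>\<rfloor>)" for i j :: nat by measurable
        then show ?thesis unfolding fill_inv_def
          by (intro measurable_cantor_code) (auto split: prod.split)
      qed
      ultimately show ?thesis
        using measurable_compose[OF _ borel_measurable_continuous_onI[OF c]] by simp
    qed
    have "(\<lambda>n. LINT \<omega>|PN (s n). f' (\<lambda>i. Y (s n + N0) (from_nat i) \<omega>)) \<longlonglongrightarrow> (LINT x|Q. f' (\<lambda>i. fill i x))"
      using c b by (intro lim) (auto simp: f'_def)
    then have 1: "(\<lambda>n. LINT \<omega>|PN (s n). f (\<lambda>pq. Y (s n + N0) pq \<omega>)) \<longlonglongrightarrow> (LINT x|Q. f (\<lambda>pq. fill (to_nat pq) x))"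
      by (simp add: f'_def)
    have 2: "(\<lambda>n. tot (s n + N0)) \<longlonglongrightarrow> \<delta>"
      using LIMSEQ_subseq_LIMSEQ[OF w_total, of "\<lambda>n. s n + N0"] s
      by (simp add: tot_def strict_mono_def comp_def)
    have "tot (s n + N0) * (LINT \<omega>|PN (s n). f (\<lambda>pq. Y (s n + N0) pq \<omega>)) = (LINT \<omega>|P. w (s n + N0) \<omega> * f (\<lambda>pq. Y (s n + N0) pq \<omega>))" for n
    proof -
      have "(LINT \<omega>|PN (s n). f (\<lambda>pq. Y (s n + N0) pq \<omega>)) = (LINT \<omega>|P. p (s n) \<omega> * f (\<lambda>pq. Y (s n + N0) pq \<omega>))"
        unfolding PN_def using fY by (intro integral_real_density) (auto simp: p0)
      also have "\<dots> = (LINT \<omega>|P. w (s n + N0) \<omega> * f (\<lambda>pq. Y (s n + N0) pq \<omega>) / tot (s n + N0))"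
        by (simp add: p_def)
      finally show ?thesis using pos[of "s n"] by simp
    qed
    then show "(\<lambda>n. LINT \<omega>|P. w (s n + N0) \<omega> * f (\<lambda>pq. Y (s n + N0) pq \<omega>)) \<longlonglongrightarrow> \<delta> * (LINT x|Q. f (\<lambda>pq. fill (to_nat pq) x))"
      using tendsto_mult[OF 2 1] by simp
  qed
qed

end

section \<open>The random measure of the limit law\<close>

locale limit_law = coded_process B P \<Phi> \<alpha> h0 r d
  for B :: "nat \<Rightarrow> 'a::{t2_space, second_countable_topology} set" and P :: "'w measure" and \<Phi> \<alpha> h0 r d +
  fixes Q :: "real measure" and s :: "nat \<Rightarrow> nat"
  assumes Q: "real_distribution Q" and s: "strict_mono s"
    and lim: "\<And>(f :: (rat \<times> rat \<Rightarrow> real) \<Rightarrow> real) K. continuous_on UNIV (\<lambda>x. f (\<lambda>pq. fill (to_nat pq) x)) \<Longrightarrow>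
       (\<And>x. \<bar>f (\<lambda>pq. fill (to_nat pq) x)\<bar> \<le> K) \<Longrightarrow>
       (\<lambda>n. LINT \<omega>|P. w (s n) \<omega> * f (\<lambda>pq. Y (s n) pq \<omega>)) \<longlonglongrightarrow> \<delta> * (LINT x|Q. f (\<lambda>pq. fill (to_nat pq) x))"
begin

sublocale Q: real_distribution Q by (rule Q)

text \<open>The counterpart of the coordinate \<open>Y N pq\<close> under the limit law.\<close>

definition G :: "rat \<times> rat \<Rightarrow> real \<Rightarrow> real" where
  "G pq x = fill (to_nat pq) x"

lemma G_bounds: "0 \<le> G pq x" "G pq x \<le> 1"
  by (simp_all add: G_def fill_bounds)

lemma continuous_G: "continuous_on UNIV (G pq)"
  unfolding G_def[abs_def] by (rule continuous_fill)

lemma measurable_G [measurable]: "G pq \<in> borel_measurable borel"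
  by (rule borel_measurable_continuous_onI[OF continuous_G])

lemma lim_G:
  assumes "continuous_on UNIV (\<lambda>x. f (\<lambda>pq. G pq x))" "\<And>x. \<bar>f (\<lambda>pq. G pq x)\<bar> \<le> K"
  shows "(\<lambda>n. LINT \<omega>|P. w (s n) \<omega> * f (\<lambda>pq. Y (s n) pq \<omega>)) \<longlonglongrightarrow> \<delta> * (LINT x|Q. f (\<lambda>pq. G pq x))"
  using lim[of f K] assms by (simp add: G_def)

text \<open>A product of powers of coordinates is the Laplace functional of the corresponding step
  function, so its weighted mean has a limit known both from \<open>Q\<close> and from
  \<open>weighted_lap\<close>. Positive exponents keep the powers continuous where a coordinate
  vanishes.\<close>

lemma moment:
  assumes I: "finite I" and c: "\<And>k. k \<in> I \<Longrightarrow> 0 < c k"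
  shows "\<delta> * (LINT x|Q. (\<Prod>k\<in>I. G (pq k) x powr c k)) = D (\<lambda>t. \<Sum>k\<in>I. c k * iv (pq k) t)"
proof -
  define g where "g t = (\<Sum>k\<in>I. c k * iv (pq k) t)" for t
  have gm[measurable]: "g \<in> borel_measurable borel" unfolding g_def[abs_def] by measurable
  have g: "0 \<le> g t" "g t \<le> (\<Sum>k\<in>I. c k)" for t
    unfolding g_def
    by (intro sum_nonneg mult_nonneg_nonneg iv_bounds less_imp_le[OF c], assumption)
       (intro sum_mono mult_left_le iv_bounds less_imp_le[OF c])
  have prodeq: "(\<Prod>k\<in>I. Y N (pq k) \<omega> powr c k) = lap (\<lambda>x. h0 x * g (r x) / real N) (\<Phi> \<omega>)" if "\<omega> \<in> space P" for N \<omega>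
  proof -
    note sets = sets_radon[OF \<Phi>_radon[OF that]]
    have "(\<Prod>k\<in>I. Y N (pq k) \<omega> powr c k) = (\<Prod>k\<in>I. lap (\<lambda>x. c k * (h0 x * iv (pq k) (r x) / real N)) (\<Phi> \<omega>))"
      unfolding Y_def using c iv_bounds h0_pos
      by (intro prod.cong refl lap_powr[OF sets]) (auto simp: less_imp_le)
    also have "\<dots> = (\<Prod>k\<in>I. lap (\<lambda>x. if k \<in> I then c k * (h0 x * iv (pq k) (r x) / real N) else 0) (\<Phi> \<omega>))"
      by (intro prod.cong) auto
    also have "\<dots> = lap (\<lambda>x. \<Sum>k\<in>I. if k \<in> I then c k * (h0 x * iv (pq k) (r x) / real N) else 0) (\<Phi> \<omega>)"
      using c iv_bounds h0_pos by (intro lap_sum[symmetric] sets I) (auto simp: less_imp_le)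
    also have "(\<lambda>x. \<Sum>k\<in>I. if k \<in> I then c k * (h0 x * iv (pq k) (r x) / real N) else 0) = (\<lambda>x. h0 x * g (r x) / real N)"
      by (auto simp: g_def sum_distrib_left sum_divide_distrib mult_ac intro!: sum.cong)
    finally show ?thesis .
  qed
  have "(\<lambda>n. LINT \<omega>|P. w (s n) \<omega> * (\<Prod>k\<in>I. Y (s n) (pq k) \<omega> powr c k)) \<longlonglongrightarrow> \<delta> * (LINT x|Q. (\<Prod>k\<in>I. G (pq k) x powr c k))"
  proof (rule lim_G[of "\<lambda>y. \<Prod>k\<in>I. y (pq k) powr c k" 1])
    show "continuous_on UNIV (\<lambda>x. \<Prod>k\<in>I. G (pq k) x powr c k)"
      using c G_bounds by (intro continuous_on_prod continuous_on_powr' continuous_G continuous_on_const) auto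
    have le1: "G (pq k) x powr c k \<le> 1" if "k \<in> I" for k x
      using G_bounds[of "pq k" x] c[OF that] powr_mono2[of "c k" "G (pq k) x" 1] by simp
    have "(\<Prod>k\<in>I. G (pq k) x powr c k) \<le> 1" for x using le1 by (intro prod_le_1) auto
    moreover have "0 \<le> (\<Prod>k\<in>I. G (pq k) x powr c k)" for x by (intro prod_nonneg) auto
    ultimately show "\<bar>\<Prod>k\<in>I. G (pq k) x powr c k\<bar> \<le> 1" for x by simp
  qed
  also have "(\<lambda>n. LINT \<omega>|P. w (s n) \<omega> * (\<Prod>k\<in>I. Y (s n) (pq k) \<omega> powr c k)) =
      (\<lambda>n. LINT \<omega>|P. w (s n) \<omega> * lap (\<lambda>x. h0 x * g (r x) / real (s n)) (\<Phi> \<omega>))"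
    by (intro ext Bochner_Integration.integral_cong refl) (simp add: prodeq)
  finally have 1: "(\<lambda>n. LINT \<omega>|P. w (s n) \<omega> * lap (\<lambda>x. h0 x * g (r x) / real (s n)) (\<Phi> \<omega>)) \<longlonglongrightarrow> \<delta> * (LINT x|Q. (\<Prod>k\<in>I. G (pq k) x powr c k))" .
  have 2: "(\<lambda>n. LINT \<omega>|P. w (s n) \<omega> * lap (\<lambda>x. h0 x * g (r x) / real (s n)) (\<Phi> \<omega>)) \<longlonglongrightarrow> D g"
    using LIMSEQ_subseq_LIMSEQ[OF weighted_lap[OF tame_coded[OF gm g]] s] by (simp add: comp_def D_def)
  show ?thesis using LIMSEQ_unique[OF 1 2] by (simp add: g_def[abs_def])
qed

text \<open>Closed relations between the coordinates survive the weak limit once they are written as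
  the vanishing of a bounded nonnegative continuous function.\<close>

lemma AE_Q_zero:
  assumes c: "continuous_on UNIV (\<lambda>x. f (\<lambda>pq. G pq x))" and b: "\<And>x. 0 \<le> f (\<lambda>pq. G pq x)" "\<And>x. f (\<lambda>pq. G pq x) \<le> K"
    and z: "\<And>N \<omega>. \<omega> \<in> space P \<Longrightarrow> f (\<lambda>pq. Y N pq \<omega>) = 0"
  shows "AE x in Q. f (\<lambda>pq. G pq x) = (0::real)"
proof -
  note [measurable] = borel_measurable_continuous_onI[OF c]
  have "(\<lambda>n. LINT \<omega>|P. w (s n) \<omega> * f (\<lambda>pq. Y (s n) pq \<omega>)) \<longlonglongrightarrow> \<delta> * (LINT x|Q. f (\<lambda>pq. G pq x))"
    using b by (intro lim_G[OF c, of K]) simp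
  moreover have "(LINT \<omega>|P. w (s n) \<omega> * f (\<lambda>pq. Y (s n) pq \<omega>)) = 0" for n
    using z by (subst Bochner_Integration.integral_cong[where g="\<lambda>_. 0"]) auto
  ultimately have "(LINT x|Q. f (\<lambda>pq. G pq x)) = 0"
    using \<delta>_pos LIMSEQ_unique[OF _ tendsto_const[of "0::real"]] by fastforce
  moreover have "integrable Q (\<lambda>x. f (\<lambda>pq. G pq x))"
    by (rule Q.integrable_const_bound[of _ K]) (use b in auto)
  ultimately show ?thesis
    using b by (subst (asm) integral_nonneg_eq_0_iff_AE) auto
qed

text \<open>Adjacent intervals add up, so the coordinates \<open>Y\<close> multiply; this relation
  passes to the limit.\<close>

lemma AE_G_add:
  assumes "p \<le> v" "v \<le> u"
  shows "AE x in Q. G (p, u) x = G (p, v) x * G (v, u) x"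
proof -
  have "AE x in Q. \<bar>G (p, u) x - G (p, v) x * G (v, u) x\<bar> = 0"
  proof (rule AE_Q_zero[where f="\<lambda>y. \<bar>y (p, u) - y (p, v) * y (v, u)\<bar>" and K=1])
    show "continuous_on UNIV (\<lambda>x. \<bar>G (p, u) x - G (p, v) x * G (v, u) x\<bar>)"
      by (intro continuous_intros continuous_G)
    show "\<bar>G (p, u) x - G (p, v) x * G (v, u) x\<bar> \<le> 1" for x
    proof -
      have "0 \<le> G (p, v) x * G (v, u) x" "G (p, v) x * G (v, u) x \<le> 1"
        using G_bounds by (auto intro: mult_le_one)
      then show ?thesis using G_bounds[of "(p, u)" x] by linarith
    qed
    fix N \<omega> assume \<omega>: "\<omega> \<in> space P"
    have iv: "iv (p, u) t = iv (p, v) t + iv (v, u) t" for t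
    proof -
      have "real_of_rat p \<le> of_rat v" "real_of_rat v \<le> of_rat u"
        using assms by (auto simp: of_rat_less_eq)
      then show ?thesis by (auto simp: iv_def indicator_def)
    qed
    have "Y N (p, u) \<omega> = lap (\<lambda>x. h0 x * iv (p, v) (r x) / real N + h0 x * iv (v, u) (r x) / real N) (\<Phi> \<omega>)"
      unfolding Y_def iv by (simp add: distrib_left add_divide_distrib)
    also have "\<dots> = Y N (p, v) \<omega> * Y N (v, u) \<omega>"
      unfolding Y_def using h0_pos iv_bounds
      by (intro lap_add sets_radon \<Phi>_radon \<omega>) (auto simp: less_imp_le)
    finally show "\<bar>Y N (p, u) \<omega> - Y N (p, v) \<omega> * Y N (v, u) \<omega>\<bar> = 0" by simp
  qed simp
  then show ?thesis by simp
qed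

lemma AE_G_low:
  assumes "of_rat u < (1/2 :: real)"
  shows "AE x in Q. G (p, u) x = 1"
proof -
  have "AE x in Q. 1 - G (p, u) x = 0"
  proof (rule AE_Q_zero[where f="\<lambda>y. 1 - y (p, u)" and K=1])
    show "continuous_on UNIV (\<lambda>x. 1 - G (p, u) x)" by (intro continuous_intros continuous_G)
    fix N \<omega> assume \<omega>: "\<omega> \<in> space P"
    have "iv (p, u) (r x) = 0" for x using assms r_ge[of x] by (auto simp: iv_def indicator_def)
    then show "1 - Y N (p, u) \<omega> = 0" by (simp add: Y_def)
  qed (use G_bounds in auto)
  then show ?thesis by simp
qed

lemma AE_G_high:
  assumes "1 \<le> v"
  shows "AE x in Q. G (p, v) x = G (p, 1) x"
proof -
  have "AE x in Q. \<bar>G (p, v) x - G (p, 1) x\<bar> = 0"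
  proof (rule AE_Q_zero[where f="\<lambda>y. \<bar>y (p, v) - y (p, 1)\<bar>" and K=1])
    show "continuous_on UNIV (\<lambda>x. \<bar>G (p, v) x - G (p, 1) x\<bar>)" by (intro continuous_intros continuous_G)
    show "\<bar>G (p, v) x - G (p, 1) x\<bar> \<le> 1" for x
      using G_bounds[of "(p, v)" x] G_bounds[of "(p, 1)" x] by linarith
    fix N \<omega> assume \<omega>: "\<omega> \<in> space P"
    have h: "1 \<le> real_of_rat v" using assms by simp
    have "r x \<le> real_of_rat v" for x using r_le[of x] h by linarith
    then have "iv (p, v) (r x) = iv (p, 1) (r x)" for x
      using r_le[of x] by (simp add: iv_def indicator_def)
    then show "\<bar>Y N (p, v) \<omega> - Y N (p, 1) \<omega>\<bar> = 0" by (simp add: Y_def)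
  qed simp
  then show ?thesis by simp
qed

text \<open>No mass escapes to infinity. Powers with exponent 1 / (n + 1) tend to the indicator of
  \<open>0 < G (-1, 1) x\<close>, while their moments
  \<open>D (\<lambda>_. 1 / real (Suc n))\<close> tend to the full mass \<delta>.\<close>

lemma AE_G_pos: "AE x in Q. 0 < G (-1, 1) x"
proof -
  have iv1: "iv (-1, 1) (r x) = 1" for x
    using r_ge[of x] r_le[of x] by (auto simp: iv_def indicator_def)
  have e: "\<delta> * (LINT x|Q. G (-1, 1) x powr (1 / real (Suc n))) = D (\<lambda>_. 1 / real (Suc n))" for n
  proof -
    have "\<delta> * (LINT x|Q. (\<Prod>k\<in>{()}. G (-1, 1) x powr (1 / real (Suc n)))) = D (\<lambda>t. \<Sum>k\<in>{()}. 1 / real (Suc n) * iv (-1, 1) t)"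
      by (rule moment) auto
    moreover have "D (\<lambda>t. 1 / real (Suc n) * iv (-1, 1) t) = D (\<lambda>_. 1 / real (Suc n))"
      by (simp add: D_def iv1)
    ultimately show ?thesis by simp
  qed
  have "(\<lambda>n. \<delta> * (LINT x|Q. G (-1, 1) x powr (1 / real (Suc n)))) \<longlonglongrightarrow> \<delta> * (LINT x|Q. indicator {x. 0 < G (-1, 1) x} x)"
  proof (intro tendsto_mult tendsto_const integral_dominated_convergence[where w="\<lambda>_. 1"])
    show "AE x in Q. (\<lambda>n. G (-1, 1) x powr (1 / real (Suc n))) \<longlonglongrightarrow> indicator {x. 0 < G (-1, 1) x} x"
    proof (rule AE_I2)
      fix x
      show "(\<lambda>n. G (-1, 1) x powr (1 / real (Suc n))) \<longlonglongrightarrow> indicator {x. 0 < G (-1, 1) x} x"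
      proof (cases "0 < G (-1, 1) x")
        case True
        have "(\<lambda>n. G (-1, 1) x powr (1 / real (Suc n))) \<longlonglongrightarrow> G (-1, 1) x powr 0"
          using True LIMSEQ_inverse_real_of_nat by (intro tendsto_intros) (auto simp: inverse_eq_divide)
        then show ?thesis using True by simp
      next
        case False
        then have "G (-1, 1) x = 0" using G_bounds[of "(-1, 1)" x] by simp
        then show ?thesis by simp
      qed
    qed
    show "AE x in Q. norm (G (-1, 1) x powr (1 / real (Suc n))) \<le> 1" for n
      using G_bounds powr_mono2[of "1 / real (Suc n)" _ 1] by (intro AE_I2) simp
  qed auto
  then have 1: "(\<lambda>n. D (\<lambda>_. 1 / real (Suc n))) \<longlonglongrightarrow> \<delta> * (LINT x|Q. indicator {x. 0 < G (-1, 1) x} x)"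
    by (simp only: e)
  have "(\<lambda>n. ((1 / real (Suc n) + 2) powr \<alpha> - (1 / real (Suc n) + 1) powr \<alpha>) * \<psi> h0) \<longlonglongrightarrow> ((0 + 2) powr \<alpha> - (0 + 1) powr \<alpha>) * \<psi> h0"
    using LIMSEQ_inverse_real_of_nat by (intro tendsto_intros) (auto simp: inverse_eq_divide)
  then have 2: "(\<lambda>n. D (\<lambda>_. 1 / real (Suc n))) \<longlonglongrightarrow> \<delta>"
    by (simp add: D_const \<delta>_def)
  have "\<delta> * (LINT x|Q. indicator {x. 0 < G (-1, 1) x} x) = \<delta>"
    using LIMSEQ_unique[OF 1 2] .
  then have "measure Q {x. 0 < G (-1, 1) x} = 1" using \<delta>_pos by simp
  then have "AE x in Q. x \<in> {x. 0 < G (-1, 1) x}"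
    by (subst Q.prob_eq_1[symmetric]) auto
  then show ?thesis by simp
qed

text \<open>Countably many almost sure relations, enough for - ln G on rational intervals to come
  from a finite measure on the code line.\<close>

definition good :: "real \<Rightarrow> bool" where
  "good x \<longleftrightarrow> 0 < G (-1, 1) x \<and> (\<forall>p v u. p \<le> v \<longrightarrow> v \<le> u \<longrightarrow> G (p, u) x = G (p, v) x * G (v, u) x) \<and>
     (\<forall>u. of_rat u < (1/2 :: real) \<longrightarrow> G (-1, u) x = 1) \<and> (\<forall>v. 1 \<le> v \<longrightarrow> G (-1, v) x = G (-1, 1) x)"

lemma measurable_good [measurable]: "Measurable.pred borel good"
proof -
  have "Measurable.pred borel (\<lambda>x. 0 < G (-1, 1) x)"
    "\<And>p v u. Measurable.pred borel (\<lambda>x. G (p, u) x = G (p, v) x * G (v, u) x)"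
    "\<And>u. Measurable.pred borel (\<lambda>x. G (-1, u) x = 1)"
    "\<And>v. Measurable.pred borel (\<lambda>x. G (-1, v) x = G (-1, 1) x)"
    by measurable
  note preds = this
  show ?thesis unfolding good_def[abs_def]
    by (intro pred_intros_logic(3,4) pred_intros_countable(1) preds) simp_all
qed

lemma AE_good: "AE x in Q. good x"
proof -
  have "AE x in Q. \<forall>p v u. p \<le> v \<longrightarrow> v \<le> u \<longrightarrow> G (p, u) x = G (p, v) x * G (v, u) x"
    by (intro AE_all_countable[THEN iffD2] allI AE_impI AE_G_add)
  moreover have "AE x in Q. \<forall>u. of_rat u < (1/2 :: real) \<longrightarrow> G (-1, u) x = 1"
    by (intro AE_all_countable[THEN iffD2] allI AE_impI AE_G_low)
  moreover have "AE x in Q. \<forall>v. 1 \<le> v \<longrightarrow> G (-1, v) x = G (-1, 1) x"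
    by (intro AE_all_countable[THEN iffD2] allI AE_impI AE_G_high)
  ultimately show ?thesis using AE_G_pos
    unfolding good_def by eventually_elim (intro conjI)
qed

text \<open>The base point -1 lies to the left of all codes. Off the \<open>good\<close> set the
  function is 0, so that every \<open>x\<close> yields a distribution function.\<close>

definition F :: "real \<Rightarrow> rat \<Rightarrow> real" where
  "F x v = (if good x then - ln (G (-1, v) x) else 0)"

lemma measurable_F [measurable]: "(\<lambda>x. F x v) \<in> borel_measurable borel"
  unfolding F_def[abs_def] by measurable

lemma goodD:
  assumes "good x"
  shows "0 < G (-1, 1) x"
    and "p \<le> v \<Longrightarrow> v \<le> u \<Longrightarrow> G (p, u) x = G (p, v) x * G (v, u) x"
    and "of_rat u < (1/2 :: real) \<Longrightarrow> G (-1, u) x = 1"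
    and "1 \<le> v \<Longrightarrow> G (-1, v) x = G (-1, 1) x"
  using assms unfolding good_def by blast+

lemma good_G_pos:
  assumes x: "good x" and v: "-1 \<le> v"
  shows "0 < G (-1, v) x"
proof (cases "v \<le> 1")
  case True
  have "G (-1, v) x \<noteq> 0"
    using goodD(1)[OF x] goodD(2)[OF x v True] by force
  then show ?thesis using G_bounds(1)[of "(-1, v)" x] by linarith
next
  case False
  then show ?thesis using goodD(1)[OF x] goodD(4)[OF x, of v] by simp
qed

lemma good_increment:
  assumes x: "good x" and pq: "-1 \<le> p" "p \<le> v"
  shows "G (p, v) x = exp (- (F x v - F x p))" "F x p \<le> F x v"
proof -
  have e: "G (-1, v) x = G (-1, p) x * G (p, v) x" by (rule goodD(2)[OF x pq])
  have pos: "0 < G (-1, p) x" "0 < G (-1, v) x" using good_G_pos[OF x] pq by auto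
  then have pos3: "0 < G (p, v) x" using e by (simp add: zero_less_mult_iff)
  have "F x v - F x p = - ln (G (p, v) x)"
    using x pos pos3 by (simp add: F_def e ln_mult_pos)
  then show "G (p, v) x = exp (- (F x v - F x p))" using pos3 by simp
  moreover have "ln (G (p, v) x) \<le> 0" using pos3 G_bounds[of "(p, v)" x] by simp
  ultimately show "F x p \<le> F x v" using \<open>F x v - F x p = - ln (G (p, v) x)\<close> by simp
qed

lemma rational_df_F: "rational_df (F x) (F x 1)"
proof (cases "good x")
  case True
  show ?thesis
  proof
    show low: "F x v = 0" if "of_rat v < (1/2::real)" for v
      using goodD(3)[OF True that] by (simp add: F_def)
    show "F x v = F x 1" if "1 \<le> v" for v
      using goodD(4)[OF True that] by (simp add: F_def)
    fix p v :: rat assume pq: "p \<le> v"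
    show "F x p \<le> F x v"
    proof (cases "-1 \<le> p")
      case True
      then show ?thesis using good_increment(2)[OF \<open>good x\<close>] pq by simp
    next
      case False
      then have "p < 0" by linarith
      then have "real_of_rat p < 0" by simp
      then have "F x p = 0" by (intro low) linarith
      moreover have "0 \<le> F x v"
      proof (cases "-1 \<le> v")
        case True
        show ?thesis using good_G_pos[OF \<open>good x\<close> True] G_bounds[of "(-1, v)" x] by (simp add: F_def)
      next
        case False
        then have "v < 0" by linarith
        then have "real_of_rat v < 0" by simp
        then have "F x v = 0" by (intro low) linarith
        then show ?thesis by simp
      qed
      ultimately show ?thesis by simp
    qed
  qed
next
  case False
  then show ?thesis by unfold_locales (auto simp: F_def)
qed

definition \<nu> :: "real \<Rightarrow> real measure" where
  "\<nu> x = interval_measure (right_limit (F x))"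

lemma \<nu>_eq: "\<nu> x = rational_df.\<nu> (F x)"
  by (simp add: \<nu>_def rational_df.\<nu>_def[OF rational_df_F])

lemma sets_\<nu> [simp, measurable_cong]: "sets (\<nu> x) = sets borel"
  by (simp add: \<nu>_def)

lemma emeasure_\<nu>_UNIV: "emeasure (\<nu> x) UNIV = ennreal (F x 1)"
  unfolding \<nu>_eq by (rule rational_df.emeasure_\<nu>_UNIV[OF rational_df_F])

lemma space_\<nu> [simp]: "space (\<nu> x) = UNIV"
  using sets_eq_imp_space_eq[OF sets_\<nu>] by simp

lemma measurable_right_limit_F: "(\<lambda>x. right_limit (F x) t) \<in> borel_measurable borel"
proof -
  have "(\<lambda>x. INF v\<in>{v. t < of_rat v}. F x v) \<in> borel_measurable borel"
    using rational_df.bdd[OF rational_df_F] by (intro borel_measurable_cINF) auto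
  then show ?thesis by (simp add: right_limit_def)
qed

text \<open>Half-open intervals are measured by increments of right limits, which are measurable as
  countable infima; complements use that the total mass \<open>F x 1\<close> is finite.\<close>

lemma measurable_emeasure_\<nu>:
  assumes "A \<in> sets borel"
  shows "(\<lambda>x. emeasure (\<nu> x) A) \<in> borel_measurable borel"
proof -
  have "Int_stable (range (\<lambda>(a, b). {a<..b::real}))"
    by (auto simp: Int_stable_def image_iff)
  moreover have "range (\<lambda>(a, b). {a<..b::real}) \<subseteq> Pow UNIV" by simp
  moreover have "A \<in> sigma_sets UNIV (range (\<lambda>(a, b). {a<..b::real}))"
    using assms unfolding borel_sigma_sets_Ioc by simp
  ultimately show ?thesis
  proof (induction A rule: sigma_sets_induct_disjoint)
    case (basic A)
    then obtain a b where A: "A = {a<..b}" by auto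
    show ?case
    proof (cases "a \<le> b")
      case True
      note [measurable] = measurable_right_limit_F
      have "(\<lambda>x. ennreal (right_limit (F x) b - right_limit (F x) a)) \<in> borel_measurable borel" by measurable
      then show ?thesis using True by (simp add: A \<nu>_eq rational_df.emeasure_\<nu>_Ioc[OF rational_df_F])
    qed (simp add: A)
  next
    case (compl A)
    have A: "A \<in> sets borel" using compl(1) unfolding borel_sigma_sets_Ioc by simp
    have "(\<lambda>x. ennreal (F x 1) - emeasure (\<nu> x) A) \<in> borel_measurable borel" using compl(2) by measurable
    moreover have "emeasure (\<nu> x) (UNIV - A) = ennreal (F x 1) - emeasure (\<nu> x) A" for x
    proof -
      have "emeasure (\<nu> x) A \<le> emeasure (\<nu> x) UNIV" by (rule emeasure_mono) auto
      then have "emeasure (\<nu> x) A \<noteq> \<infinity>" by (auto simp: emeasure_\<nu>_UNIV top_unique)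
      then show ?thesis using A by (subst emeasure_Diff) (auto simp: emeasure_\<nu>_UNIV)
    qed
    ultimately show ?case by simp
  next
    case (union A)
    have A: "A i \<in> sets borel" for i using union(2) unfolding borel_sigma_sets_Ioc by auto
    have "(\<lambda>x. \<Sum>i. emeasure (\<nu> x) (A i)) \<in> borel_measurable borel" using union(3) by measurable
    moreover have "emeasure (\<nu> x) (\<Union>i. A i) = (\<Sum>i. emeasure (\<nu> x) (A i))" for x
      using A union(1) by (intro suminf_emeasure[symmetric]) auto
    ultimately show ?case by simp
  qed simp
qed

lemma measurable_lap_\<nu>:
  assumes [measurable]: "f \<in> borel_measurable borel"
  shows "(\<lambda>x. lap f (\<nu> x)) \<in> borel_measurable borel"
proof -
  have "(\<lambda>x. \<integral>\<^sup>+t. ennreal (f t) \<partial>\<nu> x) \<in> borel_measurable borel"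
    by (rule nn_integral_measurable_kernel[where S=borel])
       (simp_all add: measurable_emeasure_\<nu>)
  from measurable_compose[OF this measurable_exp_neg] show ?thesis
    by (simp add: lap_def)
qed

text \<open>The moment formula at shifted rational endpoints converges on both sides: increments of
  \<open>F x\<close> tend to increments of its right limit, that is, to the \<nu>-masses of the
  dyadic cells, and \<psi> is continuous along the shifted indicators.\<close>

lemma lap_\<nu>_step:
  assumes c: "\<And>z. 0 < c z"
  shows "\<delta> * (LINT x|Q. lap (\<lambda>t. c \<lceil>2 ^ n * t\<rceil>) (\<nu> x)) = D (\<lambda>t. c \<lceil>2 ^ n * t\<rceil>)"
proof -
  \<comment> \<open>Endpoints strictly above the dyadic points, since a right limit sees only such
    rationals.\<close>
  define qq where "qq j k = (of_nat k / 2 ^ n + 1 / of_nat (Suc j) :: rat)" for j k :: nat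
  have qq_real: "of_rat (qq j k) = real k / 2 ^ n + 1 / real (Suc j)" for j k
    by (simp add: qq_def of_rat_add of_rat_divide of_rat_power)
  have qq_mono: "qq j k \<le> qq j (Suc k)" and qq_ge: "-1 \<le> qq j k" for j k
  proof -
    have "(of_rat (qq j k) :: real) \<le> of_rat (qq j (Suc k))" unfolding qq_real by (simp add: divide_right_mono)
    then show "qq j k \<le> qq j (Suc k)" by (simp only: of_rat_less_eq)
    have "0 \<le> qq j k" by (simp add: qq_def)
    then show "-1 \<le> qq j k" by linarith
  qed
  have qq_lim: "(\<lambda>j. of_rat (qq j k)) \<longlonglongrightarrow> real k / 2 ^ n" for k
  proof -
    have "(\<lambda>j. real k / 2 ^ n + 1 / real (Suc j)) \<longlonglongrightarrow> real k / 2 ^ n + 0"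
      using LIMSEQ_inverse_real_of_nat by (intro tendsto_intros) (simp add: inverse_eq_divide)
    then show ?thesis unfolding qq_real by simp
  qed
  have qq_gt: "real k / 2 ^ n < of_rat (qq j k)" for j k
    unfolding qq_real by simp
  define C where "C = (\<Sum>k<2^n. c (int k + 1))"
  have cm: "(\<lambda>t :: real. c \<lceil>2 ^ n * t\<rceil>) \<in> borel_measurable borel"
    by (rule measurable_compose[of _ _ "count_space UNIV"]) measurable
  have E: "\<delta> * (LINT x|Q. (\<Prod>k<2^n. G (qq j k, qq j (Suc k)) x powr c (int k + 1))) =
      D (\<lambda>t. \<Sum>k<2^n. c (int k + 1) * iv (qq j k, qq j (Suc k)) t)" for j
    by (rule moment) (auto simp: c)
  have lim1: "(\<lambda>j. \<delta> * (LINT x|Q. (\<Prod>k<2^n. G (qq j k, qq j (Suc k)) x powr c (int k + 1))))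
      \<longlonglongrightarrow> \<delta> * (LINT x|Q. lap (\<lambda>t. c \<lceil>2 ^ n * t\<rceil>) (\<nu> x))"
  proof (intro tendsto_mult tendsto_const integral_dominated_convergence[where w="\<lambda>_. 1"])
    show "(\<lambda>x. lap (\<lambda>t. c \<lceil>2 ^ n * t\<rceil>) (\<nu> x)) \<in> borel_measurable Q"
      using measurable_lap_\<nu>[OF cm] by simp
    show "AE x in Q. norm (\<Prod>k<2^n. G (qq j k, qq j (Suc k)) x powr c (int k + 1)) \<le> 1" for j
    proof (rule AE_I2)
      fix x
      have "G (qq j k, qq j (Suc k)) x powr c (int k + 1) \<le> 1" for k
        using G_bounds c[of "int k + 1"] powr_mono2[of "c (int k + 1)" "G (qq j k, qq j (Suc k)) x" 1] by simp
      then have "(\<Prod>k<2^n. G (qq j k, qq j (Suc k)) x powr c (int k + 1)) \<le> 1" by (intro prod_le_1) auto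
      moreover have "0 \<le> (\<Prod>k<2^n. G (qq j k, qq j (Suc k)) x powr c (int k + 1))" by (intro prod_nonneg) auto
      ultimately show "norm (\<Prod>k<2^n. G (qq j k, qq j (Suc k)) x powr c (int k + 1)) \<le> 1" by simp
    qed
    show "AE x in Q. (\<lambda>j. \<Prod>k<2^n. G (qq j k, qq j (Suc k)) x powr c (int k + 1)) \<longlonglongrightarrow> lap (\<lambda>t. c \<lceil>2 ^ n * t\<rceil>) (\<nu> x)"
      using AE_good
    proof eventually_elim
      case (elim x)
      interpret X: rational_df "F x" "F x 1" by (rule rational_df_F)
      define R where "R = right_limit (F x)"
      have Rk: "(\<lambda>j. F x (qq j k)) \<longlonglongrightarrow> R (real k / 2 ^ n)" for k
        unfolding R_def by (rule X.right_limit_tendsto[OF qq_lim qq_gt])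
      have Rmono: "R (real k / 2 ^ n) \<le> R (real (Suc k) / 2 ^ n)" for k
        unfolding R_def by (intro X.right_limit_mono divide_right_mono) auto
      have "G (qq j k, qq j (Suc k)) x powr c (int k + 1) = exp (- (c (int k + 1) * (F x (qq j (Suc k)) - F x (qq j k))))" for j k
        using good_increment(1)[OF elim qq_ge qq_mono] by (simp add: exp_powr_real algebra_simps)
      then have "(\<lambda>j. \<Prod>k<2^n. G (qq j k, qq j (Suc k)) x powr c (int k + 1)) =
          (\<lambda>j. exp (- (\<Sum>k<2^n. c (int k + 1) * (F x (qq j (Suc k)) - F x (qq j k)))))"
        by (simp add: exp_sum sum_negf[symmetric])
      also have "\<dots> \<longlonglongrightarrow> exp (- (\<Sum>k<2^n. c (int k + 1) * (R (real (Suc k) / 2 ^ n) - R (real k / 2 ^ n))))"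
        by (intro tendsto_exp tendsto_minus tendsto_sum tendsto_mult tendsto_diff tendsto_const Rk)
      also have "exp (- (\<Sum>k<2^n. c (int k + 1) * (R (real (Suc k) / 2 ^ n) - R (real k / 2 ^ n)))) = lap (\<lambda>t. c \<lceil>2 ^ n * t\<rceil>) (\<nu> x)"
      proof -
        have "(\<integral>\<^sup>+t. ennreal (c \<lceil>2 ^ n * t\<rceil>) \<partial>\<nu> x) =
            (\<integral>\<^sup>+t. (\<Sum>k<2^n. ennreal (c (int k + 1)) * indicator {real k / 2^n<..real (Suc k) / 2^n} t) \<partial>\<nu> x)"
        proof (rule nn_integral_cong_AE)
          have "AE t in \<nu> x. 0 < t \<and> t \<le> 1" unfolding \<nu>_eq by (rule X.AE_\<nu>_unit)
          then show "AE t in \<nu> x. ennreal (c \<lceil>2 ^ n * t\<rceil>) = (\<Sum>k<2^n. ennreal (c (int k + 1)) * indicator {real k / 2^n<..real (Suc k) / 2^n} t)"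
          proof eventually_elim
            case (elim t)
            have "ennreal (c \<lceil>2 ^ n * t\<rceil>) = ennreal (\<Sum>k<2^n. c (int k + 1) * indicator {real k / 2^n<..real (Suc k) / 2^n} t)"
              using elim by (simp only: step_decomposition)
            also have "\<dots> = (\<Sum>k<2^n. ennreal (c (int k + 1) * indicator {real k / 2^n<..real (Suc k) / 2^n} t))"
              using c by (intro sum_ennreal[symmetric]) (auto simp: less_imp_le)
            also have "\<dots> = (\<Sum>k<2^n. ennreal (c (int k + 1)) * indicator {real k / 2^n<..real (Suc k) / 2^n} t)"
              using c by (intro sum.cong refl) (simp add: ennreal_mult less_imp_le ennreal_indicator)
            finally show ?case .
          qed
        qed
        also have "\<dots> = (\<Sum>k<2^n. ennreal (c (int k + 1)) * emeasure (\<nu> x) {real k / 2^n<..real (Suc k) / 2^n})"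
          by (subst nn_integral_sum) (auto simp: nn_integral_cmult_indicator)
        also have "\<dots> = (\<Sum>k<2^n. ennreal (c (int k + 1) * (R (real (Suc k) / 2 ^ n) - R (real k / 2 ^ n))))"
        proof (intro sum.cong refl)
          fix k
          have "emeasure (\<nu> x) {real k / 2^n<..real (Suc k) / 2^n} = ennreal (R (real (Suc k) / 2 ^ n) - R (real k / 2 ^ n))"
            unfolding \<nu>_eq R_def by (intro X.emeasure_\<nu>_Ioc divide_right_mono) auto
          then show "ennreal (c (int k + 1)) * emeasure (\<nu> x) {real k / 2^n<..real (Suc k) / 2^n} =
              ennreal (c (int k + 1) * (R (real (Suc k) / 2 ^ n) - R (real k / 2 ^ n)))"
            using c[of "int k + 1"] Rmono[of k] by (simp add: ennreal_mult less_imp_le)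
        qed
        also have "\<dots> = ennreal (\<Sum>k<2^n. c (int k + 1) * (R (real (Suc k) / 2 ^ n) - R (real k / 2 ^ n)))"
          using c Rmono by (intro sum_ennreal) (simp add: less_imp_le)
        finally show ?thesis
          unfolding lap_def using c Rmono by (simp add: exp_neg_ennreal sum_nonneg less_imp_le)
      qed
      finally show ?case .
    qed
  qed auto
  have Cbound: "(\<Sum>k<2^n. c (int k + 1) * iv (pq k) t) \<le> C" for pq and t
    unfolding C_def using c iv_bounds by (intro sum_mono) (simp add: less_imp_le mult_left_le)
  have "(\<lambda>j. D (\<lambda>t. \<Sum>k<2^n. c (int k + 1) * iv (qq j k, qq j (Suc k)) t)) \<longlonglongrightarrow>
      D (\<lambda>t. \<Sum>k<2^n. c (int k + 1) * indicator {real k / 2^n<..real (Suc k) / 2^n} t)"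
  proof (rule D_tendsto[where K=C])
    show "(\<lambda>t. \<Sum>k<2^n. c (int k + 1) * iv (qq j k, qq j (Suc k)) t) \<in> borel_measurable borel" for j
      by measurable
    show "(\<lambda>t. \<Sum>k<2^n. c (int k + 1) * indicator {real k / 2^n<..real (Suc k) / 2^n} t) \<in> borel_measurable borel"
      by measurable
    show "0 \<le> (\<Sum>k<2^n. c (int k + 1) * iv (qq j k, qq j (Suc k)) t)" for j t
      using c iv_bounds by (intro sum_nonneg mult_nonneg_nonneg) (auto simp: less_imp_le)
    show "0 \<le> (\<Sum>k<2^n. c (int k + 1) * indicator {real k / 2^n<..real (Suc k) / 2^n} t)" for t
      using c by (intro sum_nonneg mult_nonneg_nonneg) (auto simp: less_imp_le)
    show "(\<Sum>k<2^n. c (int k + 1) * indicator {real k / 2^n<..real (Suc k) / 2^n} t) \<le> C" for t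
      unfolding C_def using c by (intro sum_mono) (simp add: less_imp_le indicator_def)
    show "AE \<omega> in P. AE x in \<Phi> \<omega>. (\<lambda>j. \<Sum>k<2^n. c (int k + 1) * iv (qq j k, qq j (Suc k)) (r x)) \<longlonglongrightarrow>
        (\<Sum>k<2^n. c (int k + 1) * indicator {real k / 2^n<..real (Suc k) / 2^n} (r x))"
    proof (intro AE_I2 tendsto_sum tendsto_mult tendsto_const)
      fix x k
      have gt: "\<forall>\<^sub>F j in sequentially. (of_rat (qq j k') < r x) = (real k' / 2 ^ n < r x)" for k'
      proof (cases "real k' / 2 ^ n < r x")
        case True
        have "\<forall>\<^sub>F j in sequentially. of_rat (qq j k') < r x" by (rule order_tendstoD(2)[OF qq_lim True])
        then show ?thesis using True by simp
      next
        case False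
        then have "\<not> of_rat (qq j k') < r x" for j using qq_gt[of k' j] by linarith
        then show ?thesis using False by simp
      qed
      have "\<forall>\<^sub>F j in sequentially. iv (qq j k, qq j (Suc k)) (r x) = indicator {real k / 2^n<..real (Suc k) / 2^n} (r x)"
        using gt[of k] gt[of "Suc k"]
        by eventually_elim (simp add: iv_def indicator_def not_less[symmetric] del: of_nat_Suc)
      then show "(\<lambda>j. iv (qq j k, qq j (Suc k)) (r x)) \<longlonglongrightarrow> indicator {real k / 2^n<..real (Suc k) / 2^n} (r x)"
        by (rule tendsto_eventually)
    qed
  qed (use Cbound in auto)
  also have "D (\<lambda>t. \<Sum>k<2^n. c (int k + 1) * indicator {real k / 2^n<..real (Suc k) / 2^n} t) = D (\<lambda>t. c \<lceil>2 ^ n * t\<rceil>)"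
  proof -
    have "0 < r x" for x using r_ge[of x] by linarith
    then show ?thesis unfolding D_def using r_le by (simp only: step_decomposition)
  qed
  finally have lim2: "(\<lambda>j. D (\<lambda>t. \<Sum>k<2^n. c (int k + 1) * iv (qq j k, qq j (Suc k)) t)) \<longlonglongrightarrow> D (\<lambda>t. c \<lceil>2 ^ n * t\<rceil>)" .
  show ?thesis using LIMSEQ_unique[OF lim1[unfolded E] lim2] .
qed

text \<open>The steps must converge simultaneously under \<nu> x for almost every \<open>x\<close>
  and under almost every realisation of \<Phi>. Two control measures, added together, reduce this to
  one approximation on the line.\<close>

lemma lap_\<nu>:
  assumes f: "f \<in> borel_measurable borel" "\<And>t. 0 \<le> f t" "\<And>t. f t \<le> K"
  shows "\<delta> * (LINT x|Q. lap f (\<nu> x)) = D f"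
proof -
  obtain M1 where M1: "finite_measure M1" "sets M1 = sets borel"
    "\<And>p. AE t in M1. p t \<Longrightarrow> AE x in Q. emeasure (\<nu> x) UNIV < \<infinity> \<longrightarrow> (AE t in \<nu> x. p t)"
    using control_measure[of Q \<nu>] measurable_emeasure_\<nu> by (auto intro: Q.prob_space_axioms)
  \<comment> \<open>The image of h0 \<Phi> on the code line is almost surely finite, and since
    \<open>h0\<close> is positive, what holds almost everywhere under it holds almost everywhere
    under \<Phi>.\<close>
  define \<kappa> where "\<kappa> \<omega> = distr (density (\<Phi> \<omega>) (\<lambda>x. ennreal (h0 x))) borel r" for \<omega>
  have r\<Phi>: "r \<in> density (\<Phi> \<omega>) (\<lambda>x. ennreal (h0 x)) \<rightarrow>\<^sub>M borel" if "\<omega> \<in> space P" for \<omega>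
    by (subst measurable_cong_sets[where M'=borel]) (auto simp: sets_radon[OF \<Phi>_radon[OF that]])
  have h\<Phi>: "(\<lambda>x. ennreal (h0 x)) \<in> borel_measurable (\<Phi> \<omega>)" if "\<omega> \<in> space P" for \<omega>
    by (subst measurable_cong_sets[where M'=borel]) (auto simp: sets_radon[OF \<Phi>_radon[OF that]])
  have em\<kappa>: "emeasure (\<kappa> \<omega>) A = (\<integral>\<^sup>+x. ennreal (h0 x) * indicator (r -` A) x \<partial>\<Phi> \<omega>)"
    if \<omega>: "\<omega> \<in> space P" and A: "A \<in> sets borel" for \<omega> A
  proof -
    have "r -` A \<in> sets (\<Phi> \<omega>)"
      using measurable_sets[OF rm A] sets_radon[OF \<Phi>_radon[OF \<omega>]] by simp
    then show ?thesis
      unfolding \<kappa>_def using A r\<Phi>[OF \<omega>] h\<Phi>[OF \<omega>] space_radon[OF \<Phi>_radon[OF \<omega>]]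
      by (simp add: emeasure_distr emeasure_density)
  qed
  have em\<kappa>m: "(\<lambda>\<omega>. emeasure (\<kappa> \<omega>) A) \<in> borel_measurable P" if A: "A \<in> sets borel" for A
  proof -
    have "r -` A \<in> sets borel" using measurable_sets[OF rm A] by simp
    then have "(\<lambda>x. ennreal (h0 x) * indicator (r -` A) x) \<in> borel_measurable borel" by measurable
    then have "(\<lambda>\<omega>. \<integral>\<^sup>+x. ennreal (h0 x) * indicator (r -` A) x \<partial>\<Phi> \<omega>) \<in> borel_measurable P"
      by (rule measurable_compose[OF measurable_\<Phi> measurable_nn_integral_radon])
    then show ?thesis by (rule measurable_cong[THEN iffD1, rotated]) (simp add: em\<kappa> A)
  qed
  obtain M2 where M2: "finite_measure M2" "sets M2 = sets borel"
    "\<And>p. AE t in M2. p t \<Longrightarrow> AE \<omega> in P. emeasure (\<kappa> \<omega>) UNIV < \<infinity> \<longrightarrow> (AE t in \<kappa> \<omega>. p t)"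
    using control_measure[OF prob_space_axioms _ em\<kappa>m] by (auto simp: \<kappa>_def)
  have sM: "sets M1 = sets M2" using M1 M2 by simp
  have fM: "finite_measure (superpose M1 M2)"
  proof
    have "emeasure (superpose M1 M2) (space M1) = emeasure M1 (space M1) + emeasure M2 (space M1)"
      by (rule emeasure_superpose[OF sM sets.top])
    then show "emeasure (superpose M1 M2) (space (superpose M1 M2)) \<noteq> \<infinity>"
      using finite_measure.emeasure_finite[OF M1(1)] finite_measure.emeasure_finite[OF M2(1)] by simp
  qed
  obtain n c where c: "\<And>j z. 0 < c j z" "\<And>j z. c j z \<le> K + 1"
    and ae: "AE t in superpose M1 M2. (\<lambda>j. c j \<lceil>2 ^ n j * t\<rceil>) \<longlonglongrightarrow> f t"
    by (rule step_sequence_AE[where f=f and K=K and M="superpose M1 M2"])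
       (use fM M1(2) f in auto)
  note AE1 = M1(3)[OF AE_superpose(1)[OF sM ae]]
  note AE2 = M2(3)[OF AE_superpose(2)[OF sM ae]]
  define g where "g j t = c j \<lceil>2 ^ n j * t\<rceil>" for j and t :: real
  have gm[measurable]: "g j \<in> borel_measurable borel" for j
    unfolding g_def[abs_def] by (rule measurable_compose[of _ _ "count_space UNIV"]) measurable
  have g: "0 \<le> g j t" "g j t \<le> K + 1" for j t using c by (auto simp: g_def less_imp_le)
  note [measurable] = f(1)
  have 1: "(\<lambda>j. \<delta> * (LINT x|Q. lap (g j) (\<nu> x))) \<longlonglongrightarrow> \<delta> * (LINT x|Q. lap f (\<nu> x))"
  proof (intro tendsto_mult tendsto_const integral_dominated_convergence[where w="\<lambda>_. 1"])
    show "AE x in Q. (\<lambda>j. lap (g j) (\<nu> x)) \<longlonglongrightarrow> lap f (\<nu> x)"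
      using AE1
    proof eventually_elim
      case (elim x)
      then have lim: "AE t in \<nu> x. (\<lambda>j. g j t) \<longlonglongrightarrow> f t" by (simp add: emeasure_\<nu>_UNIV g_def)
      show ?case unfolding lap_def
      proof (intro tendsto_exp_neg nn_integral_dominated_convergence[where w="\<lambda>_. ennreal (K + 1)"])
        show "(\<integral>\<^sup>+t. ennreal (K + 1) \<partial>\<nu> x) < \<infinity>"
          by (simp add: emeasure_\<nu>_UNIV ennreal_mult_less_top)
        show "AE t in \<nu> x. (\<lambda>j. ennreal (g j t)) \<longlonglongrightarrow> ennreal (f t)"
          using lim by eventually_elim (rule tendsto_ennrealI)
        show "AE t in \<nu> x. ennreal (g j t) \<le> ennreal (K + 1)" for j
          using g by (intro AE_I2 ennreal_leI)
      qed auto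
    qed
  qed (auto simp: lap_bounds measurable_lap_\<nu>)
  have 2: "(\<lambda>j. D (g j)) \<longlonglongrightarrow> D f"
  proof (rule D_tendsto[where K="K + 1"])
    show "AE \<omega> in P. AE x in \<Phi> \<omega>. (\<lambda>j. g j (r x)) \<longlonglongrightarrow> f (r x)"
      using AE2 h0_fin AE_space
    proof eventually_elim
      case (elim \<omega>)
      have "emeasure (\<kappa> \<omega>) UNIV < \<infinity>" using elim(2,3) by (simp add: em\<kappa>)
      with elim(1) have "AE t in \<kappa> \<omega>. (\<lambda>j. g j t) \<longlonglongrightarrow> f t" by (simp add: g_def)
      then have "AE x in density (\<Phi> \<omega>) (\<lambda>x. ennreal (h0 x)). (\<lambda>j. g j (r x)) \<longlonglongrightarrow> f (r x)"
        unfolding \<kappa>_def by (rule AE_distrD[OF r\<Phi>[OF elim(3)]])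
      then show ?case using h0_pos by (subst (asm) AE_density[OF h\<Phi>[OF elim(3)]]) auto
    qed
    show "f t \<le> K + 1" for t using f(3)[of t] by simp
  qed (use g f in auto)
  have e: "\<delta> * (LINT x|Q. lap (g j) (\<nu> x)) = D (g j)" for j
    unfolding g_def[abs_def] using c by (intro lap_\<nu>_step)
  show ?thesis by (rule LIMSEQ_unique[OF 1[unfolded e] 2])
qed

text \<open>\<nu> measures mass weighted by \<open>h0\<close> on the code line, so decoding has to
  divide by \<open>h0\<close>.\<close>

definition \<mu> :: "real \<Rightarrow> 'a measure" where
  "\<mu> x = density (distr (\<nu> x) borel d) (\<lambda>y. ennreal (1 / h0 y))"

lemma nn_integral_\<mu>:
  assumes [measurable]: "g \<in> borel_measurable borel"
  shows "(\<integral>\<^sup>+y. g y \<partial>\<mu> x) = (\<integral>\<^sup>+t. ennreal (1 / h0 (d t)) * g (d t) \<partial>\<nu> x)"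
proof -
  have "(\<integral>\<^sup>+y. g y \<partial>\<mu> x) = (\<integral>\<^sup>+y. ennreal (1 / h0 y) * g y \<partial>distr (\<nu> x) borel d)"
    unfolding \<mu>_def by (rule nn_integral_density) measurable
  also have "\<dots> = (\<integral>\<^sup>+t. ennreal (1 / h0 (d t)) * g (d t) \<partial>\<nu> x)"
    by (rule nn_integral_distr) measurable
  finally show ?thesis .
qed

lemma \<mu>_radon: "\<mu> x \<in> radon_measures"
proof -
  have "emeasure (\<mu> x) A < \<infinity>" if A[measurable]: "A \<in> sets borel" and rc: "rel_compact A" for A
  proof -
    obtain c where c: "0 < c" "\<And>y. y \<in> A \<Longrightarrow> c \<le> h0 y" using h0_lower[OF rc] by blast
    have "emeasure (\<mu> x) A = (\<integral>\<^sup>+y. indicator A y \<partial>\<mu> x)"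
      using A by (simp add: \<mu>_def)
    also have "\<dots> = (\<integral>\<^sup>+t. ennreal (1 / h0 (d t)) * indicator A (d t) \<partial>\<nu> x)"
      by (rule nn_integral_\<mu>) measurable
    also have "\<dots> \<le> (\<integral>\<^sup>+t. ennreal (1 / c) \<partial>\<nu> x)"
    proof (intro nn_integral_mono)
      fix t
      show "ennreal (1 / h0 (d t)) * indicator A (d t) \<le> ennreal (1 / c)"
        using c by (auto simp: indicator_def intro!: ennreal_leI divide_left_mono mult_pos_pos h0_pos)
    qed
    also have "\<dots> < \<infinity>" by (simp add: emeasure_\<nu>_UNIV ennreal_mult_less_top)
    finally show ?thesis .
  qed
  then show ?thesis by (simp add: radon_measures_def \<mu>_def)
qed

lemma measurable_\<mu>: "\<mu> \<in> Q \<rightarrow>\<^sub>M radon_algebra"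
proof (rule measurable_radonI)
  fix A :: "'a set" assume A[measurable]: "A \<in> sets borel"
  have "(\<lambda>x. \<integral>\<^sup>+t. ennreal (1 / h0 (d t)) * indicator A (d t) \<partial>\<nu> x) \<in> borel_measurable Q"
    by (rule nn_integral_measurable_kernel[where S=borel]) (auto simp: measurable_emeasure_\<nu>)
  moreover have "emeasure (\<mu> x) A = (\<integral>\<^sup>+t. ennreal (1 / h0 (d t)) * indicator A (d t) \<partial>\<nu> x)" for x
  proof -
    have "emeasure (\<mu> x) A = (\<integral>\<^sup>+y. indicator A y \<partial>\<mu> x)" by (simp add: \<mu>_def)
    also have "\<dots> = (\<integral>\<^sup>+t. ennreal (1 / h0 (d t)) * indicator A (d t) \<partial>\<nu> x)"
      by (rule nn_integral_\<mu>) measurable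
    finally show ?thesis .
  qed
  ultimately show "(\<lambda>x. emeasure (\<mu> x) A) \<in> borel_measurable Q" by (simp only:)
qed (rule \<mu>_radon)

text \<open>For tame \<open>g\<close> the quotient g / h0 is bounded, so it is an admissible
  function on the code line; read back through \<open>r\<close> and multiplied by \<open>h0\<close>,
  it is \<open>g\<close> again.\<close>

lemma lap_\<mu>:
  assumes g: "tame C g"
  shows "\<delta> * (LINT x|Q. lap g (\<mu> x)) = \<psi> (\<lambda>y. g y + 2 * h0 y) - \<psi> (\<lambda>y. g y + h0 y)"
proof -
  note [measurable] = tameD(1)[OF g]
  define f where "f t = g (d t) / h0 (d t)" for t
  have "lap g (\<mu> x) = lap f (\<nu> x)" for x
  proof -
    have "(\<integral>\<^sup>+y. ennreal (g y) \<partial>\<mu> x) = (\<integral>\<^sup>+t. ennreal (1 / h0 (d t)) * ennreal (g (d t)) \<partial>\<nu> x)"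
      by (rule nn_integral_\<mu>) measurable
    also have "\<dots> = (\<integral>\<^sup>+t. ennreal (f t) \<partial>\<nu> x)"
    proof (intro nn_integral_cong)
      fix t
      have "ennreal (1 / h0 (d t)) * ennreal (g (d t)) = ennreal (1 / h0 (d t) * g (d t))"
        using h0_pos[of "d t"] tameD(2)[OF g, of "d t"] by (intro ennreal_mult[symmetric]) auto
      then show "ennreal (1 / h0 (d t)) * ennreal (g (d t)) = ennreal (f t)" by (simp add: f_def)
    qed
    finally show ?thesis by (simp add: lap_def)
  qed
  moreover have "\<delta> * (LINT x|Q. lap f (\<nu> x)) = D f"
  proof (rule lap_\<nu>)
    show "f \<in> borel_measurable borel" unfolding f_def[abs_def] by measurable
    show "0 \<le> f t" for t using tameD(2)[OF g] h0_pos[of "d t"] by (simp add: f_def)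
    show "f t \<le> C" for t using tameD(3)[OF g, of "d t"] h0_pos[of "d t"] by (simp add: f_def field_simps)
  qed
  moreover have "h0 y * f (r y) = g y" for y using h0_pos[of y] by (simp add: f_def dr)
  ultimately show ?thesis by (simp add: D_def)
qed

end

section \<open>Frullani integrals\<close>

text \<open>For 0 < \<alpha> < 1 and nonnegative a this is a^\<alpha> Gamma (1 - \<alpha>) /
  \<alpha>. Only the homogeneity in a is computed; the constant
  \<open>levy_kernel \<alpha> 1\<close> stays implicit.\<close>

definition levy_kernel :: "real \<Rightarrow> real \<Rightarrow> ennreal" where
  "levy_kernel \<alpha> a = (\<integral>\<^sup>+s. ennreal ((1 - exp (- (s * a))) * s powr (- \<alpha> - 1)) * indicator {0<..} s \<partial>lborel)"

lemma levy_kernel_scale: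
  assumes a: "0 \<le> a" and \<alpha>: "0 < \<alpha>"
  shows "levy_kernel \<alpha> a = ennreal (a powr \<alpha>) * levy_kernel \<alpha> 1"
proof (cases "a = 0")
  case True
  then show ?thesis by (simp add: levy_kernel_def)
next
  case False
  then have a: "0 < a" using a by simp
  define f where "f s = ennreal ((1 - exp (- s)) * s powr (- \<alpha> - 1)) * indicator {0<..} s" for s :: real
  have fm[measurable]: "f \<in> borel_measurable borel" unfolding f_def[abs_def] by measurable
  have "ennreal (a powr \<alpha>) * levy_kernel \<alpha> 1 = ennreal (a powr \<alpha>) * (\<integral>\<^sup>+s. f s \<partial>lborel)"
    by (simp add: levy_kernel_def f_def)
  also have "(\<integral>\<^sup>+s. f s \<partial>lborel) = ennreal a * (\<integral>\<^sup>+s. f (a * s) \<partial>lborel)"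
    using nn_integral_real_affine[of f a 0] a by simp
  also have "ennreal (a powr \<alpha>) * (ennreal a * (\<integral>\<^sup>+s. f (a * s) \<partial>lborel)) = (\<integral>\<^sup>+s. ennreal (a powr \<alpha> * a) * f (a * s) \<partial>lborel)"
    using a by (subst nn_integral_cmult) (auto simp: ennreal_mult mult.assoc)
  also have "\<dots> = levy_kernel \<alpha> a"
    unfolding levy_kernel_def
  proof (intro nn_integral_cong)
    fix s :: real
    show "ennreal (a powr \<alpha> * a) * f (a * s) = ennreal ((1 - exp (- (s * a))) * s powr (- \<alpha> - 1)) * indicator {0<..} s"
    proof (cases "0 < s")
      case True
      have "a powr \<alpha> * a * (a powr (- \<alpha> - 1)) = 1"
        using a powr_add[of a \<alpha> 1] powr_add[of a "\<alpha> + 1" "- \<alpha> - 1"] by simp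
      then have "a powr \<alpha> * a * ((1 - exp (- (a * s))) * (a * s) powr (- \<alpha> - 1)) = (1 - exp (- (s * a))) * s powr (- \<alpha> - 1)"
        by (simp add: powr_mult mult_ac)
      then show ?thesis
        using True a by (simp add: f_def ennreal_mult[symmetric])
    next
      case False
      then show ?thesis using a by (simp add: f_def zero_less_mult_iff)
    qed
  qed
  finally show ?thesis by simp
qed

text \<open>Integration against ds / s, the measure on the half-line that is invariant under
  scaling.\<close>

definition log_integral :: "(real \<Rightarrow> real) \<Rightarrow> real \<Rightarrow> real \<Rightarrow> ennreal" where
  "log_integral q a b = (\<integral>\<^sup>+s. ennreal (q s / s) * indicator {a<..b} s \<partial>lborel)"

lemma log_integral_scale:
  assumes [measurable]: "q \<in> borel_measurable borel" and c: "0 < c" and a: "0 \<le> a"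
  shows "log_integral q (c * a) (c * b) = log_integral (\<lambda>s. q (c * s)) a b"
proof -
  have "log_integral q (c * a) (c * b) = ennreal c * (\<integral>\<^sup>+s. ennreal (q (c * s) / (c * s)) * indicator {c * a<..c * b} (c * s) \<partial>lborel)"
    unfolding log_integral_def using c
    by (subst nn_integral_real_affine[of _ c 0]) auto
  also have "\<dots> = (\<integral>\<^sup>+s. ennreal c * (ennreal (q (c * s) / (c * s)) * indicator {c * a<..c * b} (c * s)) \<partial>lborel)"
    by (rule nn_integral_cmult[symmetric]) measurable
  also have "\<dots> = log_integral (\<lambda>s. q (c * s)) a b"
    unfolding log_integral_def
  proof (intro nn_integral_cong)
    fix s
    have "indicator {c * a<..c * b} (c * s) = (indicator {a<..b} s :: ennreal)" using c by (simp add: indicator_def)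
    moreover have "ennreal c * ennreal (q (c * s) / (c * s)) = ennreal (q (c * s) / s)" if "0 < s"
      using c that by (subst ennreal_mult'[symmetric]) auto
    ultimately show "ennreal c * (ennreal (q (c * s) / (c * s)) * indicator {c * a<..c * b} (c * s)) = ennreal (q (c * s) / s) * indicator {a<..b} s"
      using a by (auto simp: indicator_def)
  qed
  finally show ?thesis .
qed

lemma log_integral_split:
  assumes [measurable]: "q \<in> borel_measurable borel" and "a \<le> b" "b \<le> c"
  shows "log_integral q a c = log_integral q a b + log_integral q b c"
proof -
  have "ennreal (q s / s) * indicator {a<..c} s = ennreal (q s / s) * indicator {a<..b} s + ennreal (q s / s) * indicator {b<..c} s" for s
    using assms by (auto simp: indicator_def)
  then show ?thesis unfolding log_integral_def by (simp add: nn_integral_add)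
qed

lemma filterlim_two_power: "filterlim (\<lambda>n. (2::real) ^ n) at_top sequentially"
proof (rule filterlim_at_top_mono[OF filterlim_real_sequentially])
  show "\<forall>\<^sub>F n in sequentially. real n \<le> 2 ^ n"
    by (intro always_eventually allI less_imp_le of_nat_less_two_power)
qed

lemma emeasure_lborel_Ioc_finite: "emeasure lborel {a<..b::real} < \<infinity>"
  by (cases "a \<le> b") auto

lemma nn_integral_Ioc_const: "(\<integral>\<^sup>+s. ennreal c * indicator {a<..b::real} s \<partial>lborel) < \<infinity>"
  using emeasure_lborel_Ioc_finite[of a b]
  by (subst nn_integral_cmult_indicator) (auto simp: ennreal_mult_less_top)

text \<open>The constant is ln 2. The crude bounds 1 and 2 for 1 / s on (1/2, 1] show that it is
  positive and finite, and nothing more is asked of it.\<close>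

lemma log_integral_const: "\<exists>c>0. \<forall>y\<ge>0. log_integral (\<lambda>_. y) (1/2) 1 = ennreal (c * y)"
proof -
  have le: "log_integral (\<lambda>_. 1) (1/2) 1 \<le> (\<integral>\<^sup>+s. ennreal 2 * indicator {1/2<..1::real} s \<partial>lborel)"
    unfolding log_integral_def
  proof (intro nn_integral_mono)
    fix s :: real
    have "ennreal (1 / s) \<le> ennreal 2" if "1/2 < s" using that by (intro ennreal_leI) (simp add: field_simps)
    then show "ennreal (1 / s) * indicator {1/2<..1} s \<le> ennreal 2 * indicator {1/2<..1} s"
      by (auto simp: indicator_def)
  qed
  have ge: "(\<integral>\<^sup>+s. 1 * indicator {1/2<..1::real} s \<partial>lborel) \<le> log_integral (\<lambda>_. 1) (1/2) 1"
    unfolding log_integral_def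
  proof (intro nn_integral_mono)
    fix s :: real
    have "ennreal 1 \<le> ennreal (1 / s)" if "1/2 < s" "s \<le> 1" using that by (intro ennreal_leI) (simp add: field_simps)
    then show "1 * indicator {1/2<..1} s \<le> ennreal (1 / s) * indicator {1/2<..1} s"
      by (auto simp: indicator_def)
  qed
  obtain c where c: "0 \<le> c" "log_integral (\<lambda>_. 1) (1/2) 1 = ennreal c"
  proof -
    have "(\<integral>\<^sup>+s. ennreal 2 * indicator {1/2<..1::real} s \<partial>lborel) < \<infinity>"
      by (rule nn_integral_Ioc_const)
    then have "log_integral (\<lambda>_. 1) (1/2) 1 < \<infinity>" using le by (rule le_less_trans[rotated])
    then show thesis using that by (cases "log_integral (\<lambda>_. 1) (1/2) 1") auto
  qed
  have "0 < c"
  proof -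
    have "ennreal (1/2) \<le> ennreal c"
      using ge unfolding c by (subst (asm) nn_integral_cmult_indicator) auto
    then have "1/2 \<le> c" using c(1) by (simp only: ennreal_le_iff)
    then show ?thesis by simp
  qed
  moreover have "log_integral (\<lambda>_. y) (1/2) 1 = ennreal (c * y)" if y: "0 \<le> y" for y
  proof -
    have "log_integral (\<lambda>_. y) (1/2) 1 = (\<integral>\<^sup>+s. ennreal y * (ennreal (1 / s) * indicator {1/2<..1} s) \<partial>lborel)"
      unfolding log_integral_def
    proof (intro nn_integral_cong)
      fix s :: real
      show "ennreal (y / s) * indicator {1/2<..1} s = ennreal y * (ennreal (1 / s) * indicator {1/2<..1} s)"
        using y by (auto simp: indicator_def ennreal_mult[symmetric])
    qed
    also have "\<dots> = ennreal y * log_integral (\<lambda>_. 1) (1/2) 1"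
      unfolding log_integral_def by (rule nn_integral_cmult) measurable
    finally show ?thesis using c y by (simp add: ennreal_mult mult.commute)
  qed
  ultimately show ?thesis by blast
qed

lemma log_integral_tendsto:
  assumes [measurable]: "\<And>n. q n \<in> borel_measurable borel"
    and b: "\<And>n s. 1/2 < s \<Longrightarrow> s \<le> 1 \<Longrightarrow> q n s \<le> K"
    and l: "\<And>s. 1/2 < s \<Longrightarrow> s \<le> 1 \<Longrightarrow> (\<lambda>n. q n s) \<longlonglongrightarrow> y"
  shows "(\<lambda>n. log_integral (q n) (1/2) 1) \<longlonglongrightarrow> log_integral (\<lambda>_. y) (1/2) 1"
  unfolding log_integral_def
proof (rule nn_integral_dominated_convergence[where w="\<lambda>s. ennreal (2 * \<bar>K\<bar>) * indicator {1/2<..1} s"])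
  show "AE s in lborel. ennreal (q n s / s) * indicator {1/2<..1} s \<le> ennreal (2 * \<bar>K\<bar>) * indicator {1/2<..1} s" for n
  proof (intro AE_I2)
    fix s :: real
    have "q n s / s \<le> 2 * \<bar>K\<bar>" if "1/2 < s" "s \<le> 1"
    proof -
      have "q n s / s \<le> \<bar>K\<bar> / s" using b[OF that, of n] that by (intro divide_right_mono) auto
      also have "\<dots> \<le> \<bar>K\<bar> / (1/2)" using that by (intro divide_left_mono) auto
      finally show ?thesis by simp
    qed
    then show "ennreal (q n s / s) * indicator {1/2<..1} s \<le> ennreal (2 * \<bar>K\<bar>) * indicator {1/2<..1} s"
      by (auto simp: indicator_def intro: ennreal_leI)
  qed
  show "(\<integral>\<^sup>+s. ennreal (2 * \<bar>K\<bar>) * indicator {1/2<..1::real} s \<partial>lborel) < \<infinity>"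
    by (rule nn_integral_Ioc_const)
  show "AE s in lborel. (\<lambda>n. ennreal (q n s / s) * indicator {1/2<..1} s) \<longlonglongrightarrow> ennreal (y / s) * indicator {1/2<..1} s"
  proof (intro AE_I2)
    fix s :: real
    show "(\<lambda>n. ennreal (q n s / s) * indicator {1/2<..1} s) \<longlonglongrightarrow> ennreal (y / s) * indicator {1/2<..1} s"
    proof (cases "1/2 < s \<and> s \<le> 1")
      case True
      then have "(\<lambda>n. ennreal (q n s / s)) \<longlonglongrightarrow> ennreal (y / s)"
        using l[of s] by (intro tendsto_ennrealI tendsto_divide tendsto_const) auto
      then show ?thesis using True by simp
    qed (auto simp: indicator_def)
  qed
qed measurable

text \<open>
  A Frullani-type evaluation: the integral of \<open>(q(s) - q(s/2))/s\<close> over \<open>(0, \<infinity>)\<close> telescopes, so that only the limits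
  of \<open>q\<close> at \<open>0\<close> and \<open>\<infinity>\<close> matter.
\<close>

lemma frullani:
  assumes [measurable]: "q \<in> borel_measurable borel" and q0: "\<And>s. 0 < s \<Longrightarrow> 0 \<le> q s"
    and mono: "\<And>s. 0 < s \<Longrightarrow> q (s / 2) \<le> q s"
    and bnd: "\<And>s. 0 < s \<Longrightarrow> q s \<le> K"
    and at0: "(q \<longlongrightarrow> 0) (at_right 0)" and top: "(q \<longlongrightarrow> y) at_top"
  shows "(\<integral>\<^sup>+s. ennreal ((q s - q (s / 2)) / s) * indicator {0<..} s \<partial>lborel) = log_integral (\<lambda>_. y) (1/2) 1"
proof -
  define A where "A n = log_integral (\<lambda>s. q s - q (s / 2)) ((1/2) ^ n) (2 ^ n)" for n
  have fin: "log_integral (\<lambda>s. q (c * s)) a b < \<infinity>" if "0 < a" "0 < c" for a b c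
  proof -
    have "log_integral (\<lambda>s. q (c * s)) a b \<le> (\<integral>\<^sup>+s. ennreal (\<bar>K\<bar> / a) * indicator {a<..b} s \<partial>lborel)"
      unfolding log_integral_def
    proof (intro nn_integral_mono)
      fix s
      have "q (c * s) / s \<le> \<bar>K\<bar> / a" if s: "a < s"
      proof -
        have "q (c * s) / s \<le> \<bar>K\<bar> / s" using bnd[of "c * s"] \<open>0 < a\<close> \<open>0 < c\<close> s by (intro divide_right_mono) auto
        also have "\<dots> \<le> \<bar>K\<bar> / a" using s \<open>0 < a\<close> by (intro divide_left_mono) auto
        finally show ?thesis .
      qed
      then show "ennreal (q (c * s) / s) * indicator {a<..b} s \<le> ennreal (\<bar>K\<bar> / a) * indicator {a<..b} s"
        by (auto simp: indicator_def intro: ennreal_leI)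
    qed
    also have "\<dots> < \<infinity>" by (rule nn_integral_Ioc_const)
    finally show ?thesis .
  qed
  \<comment> \<open>With a = 2^(-n) and b = 2^n the substitution s / 2 shifts the window to (a/2,
    b/2], which leaves the integral over (b/2, b] minus that over (a/2, a]. It is stated as a sum
    because the values are extended reals; \<open>1 \<le> n\<close> ensures a \<le> b / 2.\<close>
  have A: "A n + log_integral (\<lambda>s. q ((1/2) ^ n * s)) (1/2) 1 = log_integral (\<lambda>s. q (2 ^ n * s)) (1/2) 1" if n: "1 \<le> n" for n
  proof -
    define a where "a = (1/2 :: real) ^ n"
    define b where "b = (2 :: real) ^ n"
    have a: "0 < a" and ab: "a \<le> b / 2"
    proof -
      show "0 < a" by (simp add: a_def)
      have "a \<le> 1" by (simp add: a_def power_le_one)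
      moreover have "(2::real) ^ 1 \<le> b" unfolding b_def using n by (intro power_increasing) auto
      ultimately show "a \<le> b / 2" by simp
    qed
    have half: "log_integral (\<lambda>s. q (s / 2)) a b = log_integral q (a / 2) (b / 2)"
      using log_integral_scale[of q "1/2" a b] a by simp
    have 1: "A n + log_integral q (a / 2) (b / 2) = log_integral q a b"
    proof -
      have "A n + log_integral (\<lambda>s. q (s / 2)) a b = log_integral q a b"
        unfolding A_def a_def[symmetric] b_def[symmetric] log_integral_def
      proof (subst nn_integral_add[symmetric])
        show "(\<integral>\<^sup>+s. ennreal ((q s - q (s / 2)) / s) * indicator {a<..b} s + ennreal (q (s / 2) / s) * indicator {a<..b} s \<partial>lborel) =
            (\<integral>\<^sup>+s. ennreal (q s / s) * indicator {a<..b} s \<partial>lborel)"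
        proof (intro nn_integral_cong)
          fix s
          have "ennreal ((q s - q (s / 2)) / s) + ennreal (q (s / 2) / s) = ennreal (q s / s)" if "a < s"
            using that a mono[of s] q0[of "s / 2"] by (subst ennreal_plus[symmetric]) (auto simp: diff_divide_distrib divide_right_mono)
          then show "ennreal ((q s - q (s / 2)) / s) * indicator {a<..b} s + ennreal (q (s / 2) / s) * indicator {a<..b} s = ennreal (q s / s) * indicator {a<..b} s"
            by (auto simp: indicator_def)
        qed
      qed measurable
      then show ?thesis by (simp add: half)
    qed
    have 2: "log_integral q (a / 2) b = log_integral q (a / 2) a + log_integral q a b"
      using a ab by (intro log_integral_split) auto
    have 3: "log_integral q (a / 2) b = log_integral q (a / 2) (b / 2) + log_integral q (b / 2) b"
      using a ab by (intro log_integral_split) auto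
    have "log_integral q (a / 2) (b / 2) + (A n + log_integral q (a / 2) a) = log_integral q (a / 2) (b / 2) + log_integral q (b / 2) b"
      using 1 2 3 by (metis add.assoc add.commute)
    moreover have "log_integral q (a / 2) (b / 2) \<noteq> top"
      using fin[of "a/2" 1 "b/2"] a by (simp add: less_top)
    ultimately have "A n + log_integral q (a / 2) a = log_integral q (b / 2) b"
      by (simp add: ennreal_add_left_cancel)
    moreover have "log_integral q (a / 2) a = log_integral (\<lambda>s. q (a * s)) (1/2) 1"
      using log_integral_scale[of q a "1/2" 1] a by simp
    moreover have "log_integral q (b / 2) b = log_integral (\<lambda>s. q (b * s)) (1/2) 1"
      using log_integral_scale[of q b "1/2" 1] by (simp add: b_def)
    ultimately show ?thesis by (simp add: a_def b_def)
  qed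
  have l1: "(\<lambda>n. log_integral (\<lambda>s. q ((1/2) ^ n * s)) (1/2) 1) \<longlonglongrightarrow> log_integral (\<lambda>_. 0) (1/2) 1"
  proof (rule log_integral_tendsto[where K=K])
    show "q ((1/2) ^ n * s) \<le> K" if "1/2 < s" for n s using that by (intro bnd mult_pos_pos) auto
    show "(\<lambda>n. q ((1/2) ^ n * s)) \<longlonglongrightarrow> 0" if "1/2 < s" for s
    proof (rule filterlim_compose[OF at0])
      have "(\<lambda>n. (1/2) ^ n * s) \<longlonglongrightarrow> 0 * s" by (intro tendsto_intros LIMSEQ_power_zero) auto
      moreover have "\<forall>\<^sub>F n in sequentially. (1/2) ^ n * s \<in> {0<..} \<and> (1/2) ^ n * s \<noteq> 0"
        using that by (intro always_eventually) auto
      ultimately show "filterlim (\<lambda>n. (1/2) ^ n * s) (at_right 0) sequentially"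
        by (simp add: filterlim_at)
    qed
  qed measurable
  have l2: "(\<lambda>n. log_integral (\<lambda>s. q (2 ^ n * s)) (1/2) 1) \<longlonglongrightarrow> log_integral (\<lambda>_. y) (1/2) 1"
  proof (rule log_integral_tendsto[where K=K])
    show "q (2 ^ n * s) \<le> K" if "1/2 < s" for n s using that by (intro bnd mult_pos_pos) auto
    show "(\<lambda>n. q (2 ^ n * s)) \<longlonglongrightarrow> y" if "1/2 < s" for s
    proof (rule filterlim_compose[OF top])
      have "filterlim (\<lambda>n. s * 2 ^ n) at_top sequentially"
        using that by (intro filterlim_tendsto_pos_mult_at_top[OF tendsto_const] filterlim_two_power) auto
      then show "filterlim (\<lambda>n. 2 ^ n * s) at_top sequentially" by (simp add: mult.commute)
    qed
  qed measurable
  have zero: "log_integral (\<lambda>_. 0) (1/2) 1 = 0" by (simp add: log_integral_def)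
  have y0: "0 \<le> y"
  proof (rule tendsto_lowerbound[OF top])
    show "\<forall>\<^sub>F s in at_top. 0 \<le> q s" using eventually_gt_at_top[of 0] by eventually_elim (rule q0)
  qed simp
  then have y_fin: "log_integral (\<lambda>_. y) (1/2) 1 \<noteq> top" using log_integral_const by auto
  have "A \<longlonglongrightarrow> log_integral (\<lambda>_. y) (1/2) 1"
  proof -
    have "(\<lambda>n. log_integral (\<lambda>s. q (2 ^ n * s)) (1/2) 1 - log_integral (\<lambda>s. q ((1/2) ^ n * s)) (1/2) 1) \<longlonglongrightarrow> log_integral (\<lambda>_. y) (1/2) 1 - 0"
      using l1 l2 y_fin unfolding zero by (intro tendsto_diff_ennreal) auto
    moreover have "\<forall>\<^sub>F n in sequentially. log_integral (\<lambda>s. q (2 ^ n * s)) (1/2) 1 - log_integral (\<lambda>s. q ((1/2) ^ n * s)) (1/2) 1 = A n"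
      using eventually_ge_at_top[of 1]
    proof eventually_elim
      case (elim n)
      have "log_integral (\<lambda>s. q ((1/2) ^ n * s)) (1/2) 1 \<noteq> top" using fin[of "1/2" "(1/2) ^ n" 1] by (simp add: less_top)
      then show ?case by (simp flip: A[OF elim] add: ennreal_add_diff_cancel_right)
    qed
    ultimately show ?thesis by (simp add: tendsto_cong)
  qed
  moreover have "A \<longlonglongrightarrow> (\<integral>\<^sup>+s. ennreal ((q s - q (s / 2)) / s) * indicator {0<..} s \<partial>lborel)"
    unfolding A_def log_integral_def
  proof (rule nn_integral_LIMSEQ)
    show "incseq (\<lambda>n s. ennreal ((q s - q (s / 2)) / s) * indicator {(1/2) ^ n<..2 ^ n} s)"
    proof (rule incseq_SucI, rule le_funI)
      fix n and s :: real
      have le: "(1/2::real) ^ Suc n \<le> (1/2) ^ n" "(2::real) ^ n \<le> 2 ^ Suc n" by auto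
      have "{(1/2::real) ^ n<..2 ^ n} \<subseteq> {(1/2) ^ Suc n<..2 ^ Suc n}"
        using le by (intro subsetI, unfold greaterThanAtMost_iff) linarith
      then have "indicator {(1/2) ^ n<..2 ^ n} s \<le> (indicator {(1/2) ^ Suc n<..2 ^ Suc n} s :: ennreal)"
        by (intro indicator_leI) blast
      then show "ennreal ((q s - q (s / 2)) / s) * indicator {(1/2) ^ n<..2 ^ n} s \<le> ennreal ((q s - q (s / 2)) / s) * indicator {(1/2) ^ Suc n<..2 ^ Suc n} s"
        by (rule mult_left_mono) simp
    qed
    fix s :: real
    show "(\<lambda>n. ennreal ((q s - q (s / 2)) / s) * indicator {(1/2) ^ n<..2 ^ n} s) \<longlonglongrightarrow> ennreal ((q s - q (s / 2)) / s) * indicator {0<..} s"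
    proof (cases "0 < s")
      case True
      have e1: "\<forall>\<^sub>F n in sequentially. (1/2) ^ n < s"
        using True by (intro order_tendstoD(2)[OF LIMSEQ_power_zero]) auto
      have e2: "\<forall>\<^sub>F n in sequentially. s \<le> 2 ^ n"
        using filterlim_two_power by (simp add: filterlim_at_top)
      have "\<forall>\<^sub>F n in sequentially. ennreal ((q s - q (s / 2)) / s) * indicator {(1/2) ^ n<..2 ^ n} s = ennreal ((q s - q (s / 2)) / s) * indicator {0<..} s"
        using e1 e2 by eventually_elim (use True in \<open>simp add: indicator_def\<close>)
      then show ?thesis by (rule tendsto_eventually)
    next
      case False
      have "\<not> (1/2) ^ n < s" for n
      proof -
        have "0 < (1/2 :: real) ^ n" by simp
        then show ?thesis using False by linarith
      qed
      then show ?thesis using False by simp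
    qed
  qed measurable
  ultimately show ?thesis using LIMSEQ_unique by blast
qed

section \<open>Integrals of bounded functions with compact support\<close>

context lcsc_base
begin

lemma nn_integral_BM_finite:
  assumes "\<mu> \<in> radon_measures" "h \<in> BM"
  shows "(\<integral>\<^sup>+x. ennreal (h x) \<partial>\<mu>) < \<infinity>"
proof -
  obtain K where K: "\<And>x. h x \<le> K" using assms(2) by (fastforce simp: BM_def bounded_iff)
  have hm: "h \<in> borel_measurable borel" using assms(2) by (simp add: BM_def)
  define A where "A = {x. h x \<noteq> 0}"
  have A: "A \<in> sets borel" unfolding A_def using hm by measurable
  have "rel_compact A" using assms(2) by (simp add: BM_def rel_compact_def A_def)
  then have fin: "emeasure \<mu> A < \<infinity>" using assms(1) A by (auto simp: radon_measures_def)
  have "(\<integral>\<^sup>+x. ennreal (h x) \<partial>\<mu>) \<le> (\<integral>\<^sup>+x. ennreal K * indicator A x \<partial>\<mu>)"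
    using K by (intro nn_integral_mono) (auto simp: A_def indicator_def intro: ennreal_leI)
  also have "\<dots> = ennreal K * emeasure \<mu> A"
    using A sets_radon[OF assms(1)] by (intro nn_integral_cmult_indicator) simp
  also have "\<dots> < \<infinity>" using fin by (simp add: ennreal_mult_less_top)
  finally show ?thesis .
qed

lemma integral_BM:
  assumes "\<mu> \<in> radon_measures" "h \<in> BM"
  shows "ennreal (LINT x|\<mu>. h x) = (\<integral>\<^sup>+x. ennreal (h x) \<partial>\<mu>)" "0 \<le> (LINT x|\<mu>. h x)"
proof -
  have hm: "h \<in> borel_measurable \<mu>"
    using assms(2) by (simp add: BM_def measurable_cong_sets[OF sets_radon[OF assms(1)] refl])
  have h0: "0 \<le> h x" for x using assms(2) by (simp add: BM_def)
  have "(LINT x|\<mu>. h x) = enn2real (\<integral>\<^sup>+x. ennreal (h x) \<partial>\<mu>)"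
    using hm h0 by (intro integral_eq_nn_integral) auto
  then show "ennreal (LINT x|\<mu>. h x) = (\<integral>\<^sup>+x. ennreal (h x) \<partial>\<mu>)"
    using nn_integral_BM_finite[OF assms] by simp
  show "0 \<le> (LINT x|\<mu>. h x)" using h0 by (intro integral_nonneg_AE) auto
qed

lemma measurable_integral_BM:
  fixes h :: "'a \<Rightarrow> real"
  assumes "h \<in> BM"
  shows "(\<lambda>\<mu>. LINT x|\<mu>. h x) \<in> borel_measurable radon_algebra"
proof -
  have "(\<lambda>x. ennreal (h x)) \<in> borel_measurable borel" using assms by (simp add: BM_def)
  note [measurable] = measurable_nn_integral_radon[OF this]
  have "(\<lambda>\<mu>. enn2real (\<integral>\<^sup>+x. ennreal (h x) \<partial>\<mu>)) \<in> borel_measurable radon_algebra" by measurable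
  then show ?thesis
  proof (rule measurable_cong[THEN iffD1, rotated])
    fix \<mu> :: "'a measure" assume "\<mu> \<in> space radon_algebra"
    then show "enn2real (\<integral>\<^sup>+x. ennreal (h x) \<partial>\<mu>) = (LINT x|\<mu>. h x)"
      using integral_BM[of \<mu> h] assms by (simp flip: integral_BM(1))
  qed
qed

end

context stable_process
begin

lemma tame_BM:
  assumes "h \<in> BM"
  obtains C where "tame C h"
proof -
  obtain K where K: "\<And>x. h x \<le> K" using assms by (fastforce simp: BM_def bounded_iff)
  show thesis using tame_rcfun[OF BM_imp_rcfun[OF assms] K] that by blast
qed

end

section \<open>The \<alpha>-moments of the limit measure\<close>

context limit_law
begin

text \<open>With a = <h, \<mu>>, homogeneity turns \<psi> (s h + 2 h0) into 2^\<alpha> \<psi> (s h /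
  2 + h0), so that \<delta> E (1 - exp (- s a)) becomes s^\<alpha> (q s - q (s / 2)). Integration
  against s^(-\<alpha> - 1) ds leaves a multiple of E a^\<alpha> on one side and the Frullani
  integral of \<open>q\<close> on the other.\<close>

lemma nn_integral_powr_\<mu>:
  assumes h: "h \<in> BM"
  shows "levy_kernel \<alpha> 1 * (ennreal \<delta> * (\<integral>\<^sup>+x. ennreal ((LINT y|\<mu> x. h y) powr \<alpha>) \<partial>Q)) = log_integral (\<lambda>_. \<psi> h) (1/2) 1"
proof -
  obtain C where C: "tame C h" using tame_BM[OF h] .
  define a where "a x = (LINT y|\<mu> x. h y)" for x
  have am[measurable]: "a \<in> borel_measurable borel"
    using measurable_compose[OF measurable_\<mu> measurable_integral_BM[OF h]] by (simp add: a_def[abs_def])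
  have a0: "0 \<le> a x" for x unfolding a_def by (rule integral_BM(2)[OF \<mu>_radon h])
  have lap_a: "lap (\<lambda>y. s * h y) (\<mu> x) = exp (- (s * a x))" if "0 \<le> s" for s x
  proof -
    have "(\<integral>\<^sup>+y. ennreal (s * h y) \<partial>\<mu> x) = ennreal s * (\<integral>\<^sup>+y. ennreal (h y) \<partial>\<mu> x)"
      using that tameD(1,2)[OF C]
      by (simp add: ennreal_mult nn_integral_cmult measurable_cong_sets[OF sets_radon[OF \<mu>_radon] refl])
    also have "\<dots> = ennreal (s * a x)"
      using that a0 integral_BM(1)[OF \<mu>_radon h, of x] by (simp add: ennreal_mult a_def)
    finally show ?thesis using that a0[of x] by (simp add: lap_def exp_neg_ennreal)
  qed
  \<comment> \<open>The cut-off \<open>max 0 s\<close> makes \<open>p\<close> monotone on the whole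
    line and thereby Borel measurable.\<close>
  define p where "p s = \<psi> (\<lambda>y. max 0 s * h y + h0 y)" for s
  define q where "q s = s powr - \<alpha> * (p s - \<psi> h0)" for s
  have tp: "tame (s * C + 1) (\<lambda>y. s * h y + h0 y)" if "0 \<le> s" for s
    using that by (intro tame_add tame_scale C tame_h0)
  have pmono: "p s \<le> p t" if "s \<le> t" for s t
    unfolding p_def
  proof (rule \<psi>_mono[OF tp])
    show "max 0 s * h y + h0 y \<le> max 0 t * h y + h0 y" for y
      using that tameD(2)[OF C, of y] by (intro add_right_mono mult_right_mono) auto
    show "0 \<le> max 0 s * h y + h0 y" for y
      using tameD(2)[OF C, of y] h0_pos[of y] by (intro add_nonneg_nonneg mult_nonneg_nonneg) auto
  qed (use tameD(1)[OF C] in auto)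
  have pm[measurable]: "p \<in> borel_measurable borel"
    by (rule borel_measurable_mono) (simp add: mono_def pmono)
  have qm[measurable]: "q \<in> borel_measurable borel" unfolding q_def[abs_def] by measurable
  have p0: "p 0 = \<psi> h0" by (simp add: p_def)
  have q0: "0 \<le> q s" if "0 < s" for s
    using pmono[of 0 s] that by (simp add: q_def p0)
  have E: "\<delta> * (LINT x|Q. 1 - exp (- (s * a x))) = s powr \<alpha> * (q s - q (s / 2))" if s: "0 < s" for s
  proof -
    have ts: "tame (s * C) (\<lambda>y. s * h y)" using s C by (intro tame_scale) auto
    have "\<delta> * (LINT x|Q. 1 - exp (- (s * a x))) = \<delta> - \<delta> * (LINT x|Q. exp (- (s * a x)))"
    proof -
      have "integrable Q (\<lambda>x. exp (- (s * a x)))"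
        using s a0 by (intro Q.integrable_const_bound[of _ 1]) auto
      then show ?thesis
        by (subst Bochner_Integration.integral_diff) (auto simp: right_diff_distrib Q.prob_space[simplified])
    qed
    also have "\<delta> * (LINT x|Q. exp (- (s * a x))) = \<psi> (\<lambda>y. s * h y + 2 * h0 y) - \<psi> (\<lambda>y. s * h y + h0 y)"
      using lap_\<mu>[OF ts] s by (simp add: lap_a)
    also have "\<psi> (\<lambda>y. s * h y + 2 * h0 y) = 2 powr \<alpha> * p (s / 2)"
    proof -
      have "(\<lambda>y. s * h y + 2 * h0 y) = (\<lambda>y. 2 * (s / 2 * h y + h0 y))" by auto
      then show ?thesis using \<psi>_scale[OF tp, of "s / 2" 2] s by (simp add: p_def)
    qed
    also have "\<psi> (\<lambda>y. s * h y + h0 y) = p s" using s by (simp add: p_def)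
    finally have "\<delta> * (LINT x|Q. 1 - exp (- (s * a x))) = (p s - \<psi> h0) - 2 powr \<alpha> * (p (s / 2) - \<psi> h0)"
      by (simp add: \<delta>_def algebra_simps)
    moreover have "s powr \<alpha> * q s = p s - \<psi> h0" "s powr \<alpha> * q (s / 2) = 2 powr \<alpha> * (p (s / 2) - \<psi> h0)"
      using s by (simp_all add: q_def powr_divide powr_minus divide_simps)
    ultimately show ?thesis by (simp add: right_diff_distrib)
  qed
  \<comment> \<open>Monotonicity under halving, which \<open>frullani\<close> demands, is read off
    the sign of the left-hand side of \<open>E\<close>.\<close>
  have qmono: "q (s / 2) \<le> q s" if s: "0 < s" for s
  proof -
    have "0 \<le> (LINT x|Q. 1 - exp (- (s * a x)))" using s a0 by (intro integral_nonneg_AE AE_I2) simp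
    then have "0 \<le> s powr \<alpha> * (q s - q (s / 2))" using E[OF s] \<delta>_pos by (metis less_imp_le mult_nonneg_nonneg)
    moreover have "0 < s powr \<alpha>" using s by simp
    ultimately show ?thesis by (simp add: zero_le_mult_iff)
  qed
  have C0: "0 \<le> C" by (rule tameD(4)[OF C])
  \<comment> \<open>Pulling out the factor s shows the behaviour at infinity: the argument of \<psi>
    tends to \<open>h\<close> and the subtracted term vanishes.\<close>
  have q_eq: "q s = \<psi> (\<lambda>y. h y + (1 / s) * h0 y) - s powr - \<alpha> * \<psi> h0" if s: "0 < s" for s
  proof -
    have "(\<lambda>y. s * h y + h0 y) = (\<lambda>y. s * (h y + (1 / s) * h0 y))" using s by (auto simp: algebra_simps)
    moreover have "tame (C + 1 / s * 1) (\<lambda>y. h y + (1 / s) * h0 y)"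
      using s by (intro tame_add C tame_scale tame_h0) auto
    ultimately have "p s = s powr \<alpha> * \<psi> (\<lambda>y. h y + (1 / s) * h0 y)"
      using \<psi>_scale s by (simp add: p_def less_imp_le)
    then show ?thesis using s by (simp add: q_def right_diff_distrib powr_minus divide_simps)
  qed
  \<comment> \<open>Near 0, the domination of \<open>h\<close> by C h0 and (1 + s C)^\<alpha> \<le>
    1 + s C give a bound of order s^(1 - \<alpha>), which vanishes at 0 because \<alpha> <
    1.\<close>
  have q_small: "q s \<le> C * \<psi> h0 * s powr (1 - \<alpha>)" if s: "0 < s" for s
  proof -
    have "p s \<le> \<psi> (\<lambda>y. (s * C + 1) * h0 y)"
      unfolding p_def
    proof (rule \<psi>_mono)
      show "tame ((s * C + 1) * 1) (\<lambda>y. (s * C + 1) * h0 y)" using s C0 by (intro tame_scale tame_h0) auto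
      show "max 0 s * h y + h0 y \<le> (s * C + 1) * h0 y" for y
        using s mult_left_mono[OF tameD(3)[OF C, of y], of s] by (simp add: algebra_simps)
      show "0 \<le> max 0 s * h y + h0 y" for y
        using tameD(2)[OF C, of y] h0_pos[of y] by (intro add_nonneg_nonneg mult_nonneg_nonneg) auto
    qed (use tameD(1)[OF C] in auto)
    also have "\<dots> = (s * C + 1) powr \<alpha> * \<psi> h0" using s C0 by (intro \<psi>_scale[OF tame_h0]) auto
    also have "\<dots> \<le> (s * C + 1) * \<psi> h0"
      using s C0 \<alpha> nontrivial powr_mono[of \<alpha> 1 "s * C + 1"] by (intro mult_right_mono) auto
    finally have "p s - \<psi> h0 \<le> s * C * \<psi> h0" by (simp add: algebra_simps)
    then have "q s \<le> s powr - \<alpha> * (s * C * \<psi> h0)" unfolding q_def by (intro mult_left_mono) auto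
    also have "\<dots> = C * \<psi> h0 * s powr (1 - \<alpha>)"
      using s powr_add[of s "- \<alpha>" 1] by (simp add: mult_ac)
    finally show ?thesis .
  qed
  have q_large: "q s \<le> \<psi> (\<lambda>y. h y + h0 y)" if s: "1 \<le> s" for s
  proof -
    have "\<psi> (\<lambda>y. h y + (1 / s) * h0 y) \<le> \<psi> (\<lambda>y. h y + h0 y)"
    proof (rule \<psi>_mono)
      show "tame (C + 1) (\<lambda>y. h y + h0 y)" by (intro tame_add C tame_h0)
      show "h y + 1 / s * h0 y \<le> h y + h0 y" for y
        using s h0_pos[of y] by (simp add: field_simps)
      show "0 \<le> h y + 1 / s * h0 y" for y
        using s tameD(2)[OF C, of y] h0_pos[of y] by (intro add_nonneg_nonneg mult_nonneg_nonneg) auto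
    qed (use tameD(1)[OF C] in auto)
    moreover have "0 \<le> s powr - \<alpha> * \<psi> h0" using nontrivial by simp
    ultimately show ?thesis using q_eq[of s] s by simp
  qed
  define K where "K = max (C * \<psi> h0) (\<psi> (\<lambda>y. h y + h0 y))"
  have qK: "q s \<le> K" if s: "0 < s" for s
  proof (cases "1 \<le> s")
    case True
    then show ?thesis using q_large unfolding K_def by fastforce
  next
    case False
    then have "s powr (1 - \<alpha>) \<le> 1" using s \<alpha>1 powr_mono2[of "1 - \<alpha>" s 1] by simp
    then have "C * \<psi> h0 * s powr (1 - \<alpha>) \<le> C * \<psi> h0 * 1" using C0 nontrivial by (intro mult_left_mono) auto
    then show ?thesis using q_small[OF s] unfolding K_def by simp
  qed
  have lim0: "(q \<longlongrightarrow> 0) (at_right 0)"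
  proof (rule real_tendsto_sandwich[where f="\<lambda>_. 0"])
    show "\<forall>\<^sub>F s in at_right 0. 0 \<le> q s"
      using eventually_at_right_less[of "0::real"] by eventually_elim (rule q0)
    show "\<forall>\<^sub>F s in at_right 0. q s \<le> C * \<psi> h0 * s powr (1 - \<alpha>)"
      using eventually_at_right_less[of "0::real"] by eventually_elim (rule q_small)
    have "((\<lambda>s. s powr (1 - \<alpha>)) \<longlongrightarrow> 0 powr (1 - \<alpha>)) (at_right (0::real))"
    proof (rule tendsto_powr2)
      show "\<forall>\<^sub>F s in at_right 0. 0 \<le> (s::real)" using eventually_at_right_less[of "0::real"] by eventually_elim simp
    qed (use \<alpha>1 in \<open>auto intro: tendsto_intros\<close>)
    then have "((\<lambda>s. C * \<psi> h0 * s powr (1 - \<alpha>)) \<longlongrightarrow> C * \<psi> h0 * 0) (at_right 0)"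
      by (intro tendsto_mult tendsto_const) simp
    then show "((\<lambda>s. C * \<psi> h0 * s powr (1 - \<alpha>)) \<longlongrightarrow> 0) (at_right 0)" by simp
  qed simp
  have limtop: "(q \<longlongrightarrow> \<psi> h) at_top"
  proof (rule tendsto_at_topI_sequentially)
    fix X :: "nat \<Rightarrow> real" assume X: "filterlim X at_top sequentially"
    have Xev: "\<forall>\<^sub>F n in sequentially. 1 \<le> X n" using X by (simp add: filterlim_at_top)
    define X' where "X' n = max 1 (X n)" for n
    have X': "filterlim X' at_top sequentially"
      unfolding X'_def using X by (rule filterlim_at_top_mono) auto
    have X'1: "1 \<le> X' n" for n by (simp add: X'_def)
    have inv: "(\<lambda>n. 1 / X' n) \<longlonglongrightarrow> 0"
      using tendsto_inverse_0_at_top[OF X'] by (simp add: inverse_eq_divide)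
    have "(\<lambda>n. \<psi> (\<lambda>y. h y + (1 / X' n) * h0 y)) \<longlonglongrightarrow> \<psi> h"
    proof (rule \<psi>_tendsto[where C="C + 1"])
      show "tame (C + 1) (\<lambda>y. h y + (1 / X' n) * h0 y)" for n
      proof (rule tame_mono)
        have "0 < X' n" using X'1[of n] by simp
        then show "tame (C + 1 / X' n * 1) (\<lambda>y. h y + (1 / X' n) * h0 y)"
          by (intro tame_add C tame_scale tame_h0) auto
        show "C + 1 / X' n * 1 \<le> C + 1" using X'1[of n] by simp
      qed
      show "tame (C + 1) h" by (rule tame_mono[OF C]) simp
      have "(\<lambda>n. h y + (1 / X' n) * h0 y) \<longlonglongrightarrow> h y + 0 * h0 y" for y
        by (intro tendsto_add tendsto_mult tendsto_const inv)
      then show "AE \<omega> in P. AE y in \<Phi> \<omega>. (\<lambda>n. h y + (1 / X' n) * h0 y) \<longlonglongrightarrow> h y" by simp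
    qed
    moreover have "(\<lambda>n. X' n powr - \<alpha> * \<psi> h0) \<longlonglongrightarrow> 0 * \<psi> h0"
      using \<alpha> X' by (intro tendsto_mult tendsto_const tendsto_neg_powr) auto
    ultimately have "(\<lambda>n. \<psi> (\<lambda>y. h y + (1 / X' n) * h0 y) - X' n powr - \<alpha> * \<psi> h0) \<longlonglongrightarrow> \<psi> h - 0 * \<psi> h0"
      by (rule tendsto_diff)
    then have "(\<lambda>n. q (X' n)) \<longlonglongrightarrow> \<psi> h"
      using q_eq less_le_trans[OF zero_less_one X'1] by simp
    moreover have "\<forall>\<^sub>F n in sequentially. q (X' n) = q (X n)"
      using Xev by eventually_elim (simp add: X'_def max_absorb2)
    ultimately show "(\<lambda>n. q (X n)) \<longlonglongrightarrow> \<psi> h" by (simp add: tendsto_cong)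
  qed
  have "levy_kernel \<alpha> 1 * (ennreal \<delta> * (\<integral>\<^sup>+x. ennreal (a x powr \<alpha>) \<partial>Q)) = ennreal \<delta> * (\<integral>\<^sup>+x. levy_kernel \<alpha> (a x) \<partial>Q)"
  proof -
    have "(\<integral>\<^sup>+x. levy_kernel \<alpha> (a x) \<partial>Q) = (\<integral>\<^sup>+x. ennreal (a x powr \<alpha>) * levy_kernel \<alpha> 1 \<partial>Q)"
      using levy_kernel_scale[OF a0 \<alpha>(1)] by simp
    also have "\<dots> = (\<integral>\<^sup>+x. ennreal (a x powr \<alpha>) \<partial>Q) * levy_kernel \<alpha> 1"
      by (rule nn_integral_multc) measurable
    finally show ?thesis by (simp add: mult_ac)
  qed
  also have "(\<integral>\<^sup>+x. levy_kernel \<alpha> (a x) \<partial>Q) =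
      (\<integral>\<^sup>+s. \<integral>\<^sup>+x. ennreal ((1 - exp (- (s * a x))) * s powr (- \<alpha> - 1)) * indicator {0<..} s \<partial>Q \<partial>lborel)"
  proof -
    interpret L: pair_sigma_finite Q lborel ..
    have "(\<lambda>(x, s). ennreal ((1 - exp (- (s * a x))) * s powr (- \<alpha> - 1)) * indicator {0<..} s) \<in> borel_measurable (Q \<Otimes>\<^sub>M lborel)"
      by measurable
    from L.Fubini'[OF this] show ?thesis by (simp add: levy_kernel_def)
  qed
  also have "ennreal \<delta> * \<dots> = (\<integral>\<^sup>+s. ennreal \<delta> * (\<integral>\<^sup>+x. ennreal ((1 - exp (- (s * a x))) * s powr (- \<alpha> - 1)) * indicator {0<..} s \<partial>Q) \<partial>lborel)"
    by (rule nn_integral_cmult[symmetric]) measurable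
  also have "\<dots> = (\<integral>\<^sup>+s. ennreal ((q s - q (s / 2)) / s) * indicator {0<..} s \<partial>lborel)"
  proof (intro nn_integral_cong)
    fix s :: real
    show "ennreal \<delta> * (\<integral>\<^sup>+x. ennreal ((1 - exp (- (s * a x))) * s powr (- \<alpha> - 1)) * indicator {0<..} s \<partial>Q) =
        ennreal ((q s - q (s / 2)) / s) * indicator {0<..} s"
    proof (cases "0 < s")
      case True
      have nn: "0 \<le> 1 - exp (- (s * a x))" for x using True a0[of x] by simp
      have int: "integrable Q (\<lambda>x. 1 - exp (- (s * a x)))"
        using True a0 by (intro Q.integrable_const_bound[of _ 1]) auto
      have "(\<integral>\<^sup>+x. ennreal ((1 - exp (- (s * a x))) * s powr (- \<alpha> - 1)) \<partial>Q) = ennreal ((LINT x|Q. 1 - exp (- (s * a x))) * s powr (- \<alpha> - 1))"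
        using nn int by (subst nn_integral_eq_integral) auto
      then have "ennreal \<delta> * (\<integral>\<^sup>+x. ennreal ((1 - exp (- (s * a x))) * s powr (- \<alpha> - 1)) \<partial>Q) =
          ennreal (\<delta> * (LINT x|Q. 1 - exp (- (s * a x))) * s powr (- \<alpha> - 1))"
        using \<delta>_pos nn by (simp add: ennreal_mult'[symmetric] mult.assoc)
      also have "\<delta> * (LINT x|Q. 1 - exp (- (s * a x))) * s powr (- \<alpha> - 1) = (q s - q (s / 2)) / s"
      proof -
        have "s powr \<alpha> * s powr (- \<alpha> - 1) = 1 / s"
          using True powr_add[of s \<alpha> "- \<alpha> - 1"] by (simp add: powr_minus_divide)
        then show ?thesis unfolding E[OF True] by (metis mult.assoc mult.commute times_divide_eq_right mult_1_right)
      qed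
      finally show ?thesis using True by simp
    qed simp
  qed
  also have "\<dots> = log_integral (\<lambda>_. \<psi> h) (1/2) 1"
    by (rule frullani[OF qm q0 qmono qK lim0 limtop])
  finally show ?thesis by (simp add: a_def)
qed

end

section \<open>The spectral measure\<close>

context lcsc_process
begin

definition intensity :: "'a measure" where
  "intensity = measure_of UNIV (sets borel) (\<lambda>A. \<integral>\<^sup>+\<omega>. emeasure (\<Phi> \<omega>) A \<partial>P)"

lemma measurable_nn_integral_\<Phi>:
  "g \<in> borel_measurable borel \<Longrightarrow> (\<lambda>\<omega>. \<integral>\<^sup>+x. g x \<partial>\<Phi> \<omega>) \<in> borel_measurable P"
  by (rule measurable_compose[OF measurable_\<Phi> measurable_nn_integral_radon])

lemma sets_intensity: "sets intensity = sets borel"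
  unfolding intensity_def by (simp add: sets.sets_measure_of_eq[of borel, simplified])

lemma emeasure_intensity:
  assumes "A \<in> sets borel"
  shows "emeasure intensity A = (\<integral>\<^sup>+\<omega>. emeasure (\<Phi> \<omega>) A \<partial>P)"
proof (rule emeasure_measure_of[OF intensity_def])
  show "countably_additive (sets intensity) (\<lambda>A. \<integral>\<^sup>+\<omega>. emeasure (\<Phi> \<omega>) A \<partial>P)"
  proof (rule countably_additiveI)
    fix A :: "nat \<Rightarrow> 'a set" assume A: "range A \<subseteq> sets intensity" "disjoint_family A"
    then have [measurable]: "(\<lambda>\<omega>. emeasure (\<Phi> \<omega>) (A i)) \<in> borel_measurable P" for i
      by (intro measurable_compose[OF measurable_\<Phi> measurable_emeasure_radon]) (auto simp: sets_intensity)
    have "(\<Sum>i. \<integral>\<^sup>+\<omega>. emeasure (\<Phi> \<omega>) (A i) \<partial>P) = (\<integral>\<^sup>+\<omega>. (\<Sum>i. emeasure (\<Phi> \<omega>) (A i)) \<partial>P)"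
      by (intro nn_integral_suminf[symmetric]) measurable
    also have "\<dots> = (\<integral>\<^sup>+\<omega>. emeasure (\<Phi> \<omega>) (\<Union>i. A i) \<partial>P)"
      using A sets_radon[OF \<Phi>_radon] by (intro nn_integral_cong suminf_emeasure) (auto simp: sets_intensity)
    finally show "(\<Sum>i. \<integral>\<^sup>+\<omega>. emeasure (\<Phi> \<omega>) (A i) \<partial>P) = (\<integral>\<^sup>+\<omega>. emeasure (\<Phi> \<omega>) (\<Union>i. A i) \<partial>P)" .
  qed
qed (auto simp: positive_def assms sets_intensity)

text \<open>Campbell's formula, by induction over nonnegative measurable functions.\<close>

lemma nn_integral_intensity:
  assumes "g \<in> borel_measurable borel"
  shows "(\<integral>\<^sup>+x. g x \<partial>intensity) = (\<integral>\<^sup>+\<omega>. \<integral>\<^sup>+x. g x \<partial>\<Phi> \<omega> \<partial>P)"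
  using assms
proof (induction rule: borel_measurable_induct)
  case (cong f g)
  then have "f = g" by auto
  then show ?case using cong by simp
next
  case (set A)
  have "(\<integral>\<^sup>+\<omega>. \<integral>\<^sup>+x. indicator A x \<partial>\<Phi> \<omega> \<partial>P) = (\<integral>\<^sup>+\<omega>. emeasure (\<Phi> \<omega>) A \<partial>P)"
    using set sets_radon[OF \<Phi>_radon] by (intro nn_integral_cong) simp
  then show ?case using set by (simp add: emeasure_intensity sets_intensity)
next
  case (mult u c)
  have "(\<integral>\<^sup>+\<omega>. \<integral>\<^sup>+x. c * u x \<partial>\<Phi> \<omega> \<partial>P) = (\<integral>\<^sup>+\<omega>. c * (\<integral>\<^sup>+x. u x \<partial>\<Phi> \<omega>) \<partial>P)"
    using mult(2) by (intro nn_integral_cong nn_integral_cmult) (simp add: measurable_cong_sets[OF sets_radon[OF \<Phi>_radon] refl])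
  also have "\<dots> = c * (\<integral>\<^sup>+\<omega>. \<integral>\<^sup>+x. u x \<partial>\<Phi> \<omega> \<partial>P)"
    by (intro nn_integral_cmult measurable_nn_integral_\<Phi> mult(2))
  finally show ?case using mult by (simp add: nn_integral_cmult measurable_cong_sets[OF sets_intensity refl])
next
  case (add u v)
  have u: "u \<in> borel_measurable borel" and v: "v \<in> borel_measurable borel" using add by auto
  have "(\<integral>\<^sup>+\<omega>. \<integral>\<^sup>+x. v x + u x \<partial>\<Phi> \<omega> \<partial>P) = (\<integral>\<^sup>+\<omega>. (\<integral>\<^sup>+x. v x \<partial>\<Phi> \<omega>) + (\<integral>\<^sup>+x. u x \<partial>\<Phi> \<omega>) \<partial>P)"
    using u v by (intro nn_integral_cong nn_integral_add) (simp_all add: measurable_cong_sets[OF sets_radon[OF \<Phi>_radon] refl])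
  also have "\<dots> = (\<integral>\<^sup>+\<omega>. \<integral>\<^sup>+x. v x \<partial>\<Phi> \<omega> \<partial>P) + (\<integral>\<^sup>+\<omega>. \<integral>\<^sup>+x. u x \<partial>\<Phi> \<omega> \<partial>P)"
    by (intro nn_integral_add measurable_nn_integral_\<Phi> u v)
  finally show ?case using add by (simp add: nn_integral_add measurable_cong_sets[OF sets_intensity refl])
next
  case (seq U)
  have S: "(\<integral>\<^sup>+x. (SUP i. U i) x \<partial>M) = (SUP i. \<integral>\<^sup>+x. U i x \<partial>M)" if "sets M = sets borel" for M
  proof -
    have m: "U i \<in> borel_measurable M" for i using seq(1) by (simp add: measurable_cong_sets[OF that refl])
    have "(SUP i. U i) x = (SUP i. U i x)" for x
      unfolding Sup_apply image_image by (rule refl)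
    then show ?thesis using nn_integral_monotone_convergence_SUP[OF seq(3) m] by simp
  qed
  have "(\<integral>\<^sup>+\<omega>. \<integral>\<^sup>+x. (SUP i. U i) x \<partial>\<Phi> \<omega> \<partial>P) = (\<integral>\<^sup>+\<omega>. (SUP i. \<integral>\<^sup>+x. U i x \<partial>\<Phi> \<omega>) \<partial>P)"
    by (intro nn_integral_cong S sets_radon \<Phi>_radon)
  also have "\<dots> = (SUP i. \<integral>\<^sup>+\<omega>. \<integral>\<^sup>+x. U i x \<partial>\<Phi> \<omega> \<partial>P)"
  proof (rule nn_integral_monotone_convergence_SUP)
    show "incseq (\<lambda>i \<omega>. \<integral>\<^sup>+x. U i x \<partial>\<Phi> \<omega>)"
      using seq(3) by (auto simp: incseq_def le_fun_def intro!: nn_integral_mono)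
  qed (intro measurable_nn_integral_\<Phi> seq(1))
  also have "\<dots> = (SUP i. \<integral>\<^sup>+x. U i x \<partial>intensity)" by (simp only: seq(5))
  also have "\<dots> = (\<integral>\<^sup>+x. (SUP i. U i) x \<partial>intensity)" by (rule S[OF sets_intensity, symmetric])
  finally show ?case unfolding seq(4) by (rule sym)
qed

end

context stable_process
begin

text \<open>For \<alpha> = 1 the process is Poisson and \<psi> is integration against its intensity.
  The variables n (1 - exp (- <h, \<Phi>> / n)) tend to <h, \<Phi>> and never exceed it: Fatou's
  lemma gives one inequality, the domination gives the other.\<close>

lemma spectral_source_one:
  assumes \<alpha>1: "\<alpha> = 1" and h: "h \<in> BM"
  shows "(\<integral>\<^sup>+x. ennreal (h x) \<partial>intensity) = ennreal (\<psi> h)"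
proof -
  obtain C where C: "tame C h" using tame_BM[OF h] .
  note [measurable] = tameD(1)[OF C]
  have h0: "0 \<le> h x" for x by (rule tameD(2)[OF C])
  define a where "a \<omega> = (LINT x|\<Phi> \<omega>. h x)" for \<omega>
  have a: "ennreal (a \<omega>) = (\<integral>\<^sup>+x. ennreal (h x) \<partial>\<Phi> \<omega>)" "0 \<le> a \<omega>" if "\<omega> \<in> space P" for \<omega>
    using integral_BM[OF \<Phi>_radon[OF that] h] by (simp_all add: a_def)
  have am[measurable]: "a \<in> borel_measurable P"
    unfolding a_def[abs_def] by (rule measurable_compose[OF measurable_\<Phi> measurable_integral_BM[OF h]])
  have lap_a: "lap (\<lambda>x. h x / real n) (\<Phi> \<omega>) = exp (- (a \<omega> / real n))" if \<omega>: "\<omega> \<in> space P" for n \<omega>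
  proof -
    have "(\<integral>\<^sup>+x. ennreal (h x / real n) \<partial>\<Phi> \<omega>) = (\<integral>\<^sup>+x. ennreal (1 / real n) * ennreal (h x) \<partial>\<Phi> \<omega>)"
      using h0 by (intro nn_integral_cong) (simp add: ennreal_mult[symmetric])
    also have "\<dots> = ennreal (1 / real n) * ennreal (a \<omega>)"
      unfolding a(1)[OF \<omega>] by (rule nn_integral_cmult) (simp add: measurable_cong_sets[OF sets_radon[OF \<Phi>_radon[OF \<omega>]] refl])
    also have "\<dots> = ennreal (a \<omega> / real n)" using a(2)[OF \<omega>] by (simp add: ennreal_mult[symmetric])
    finally show ?thesis using a(2)[OF \<omega>] by (simp add: lap_def exp_neg_ennreal)
  qed
  define b where "b n \<omega> = real n * (1 - exp (- (a \<omega> / real n)))" for n \<omega>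
  have bm[measurable]: "b n \<in> borel_measurable P" for n unfolding b_def[abs_def] by measurable
  have b: "0 \<le> b n \<omega>" "b n \<omega> \<le> a \<omega>" if \<omega>: "\<omega> \<in> space P" for n \<omega>
  proof -
    show "0 \<le> b n \<omega>" using a(2)[OF \<omega>] by (simp add: b_def)
    have "1 - exp (- (a \<omega> / real n)) \<le> a \<omega> / real n" using exp_ge_add_one_self[of "- (a \<omega> / real n)"] by simp
    then have "b n \<omega> \<le> real n * (a \<omega> / real n)" unfolding b_def by (intro mult_left_mono) auto
    then show "b n \<omega> \<le> a \<omega>" using a(2)[OF \<omega>] by (cases "n = 0") auto
  qed
  have int_b: "(\<integral>\<^sup>+\<omega>. ennreal (b n \<omega>) \<partial>P) = ennreal (real n powr \<alpha> * (1 - Lf (\<lambda>x. h x / real n)))" for n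
  proof -
    have int: "integrable P (b n)"
    proof (rule integrable_const_bound[of _ "real n"])
      show "AE \<omega> in P. norm (b n \<omega>) \<le> real n"
      proof (rule AE_I2)
        fix \<omega> assume \<omega>: "\<omega> \<in> space P"
        have "b n \<omega> \<le> real n * 1" unfolding b_def by (intro mult_left_mono) auto
        then show "norm (b n \<omega>) \<le> real n" using b(1)[OF \<omega>, of n] by simp
      qed
    qed simp
    have "(LINT \<omega>|P. b n \<omega>) = (LINT \<omega>|P. real n * (1 - lap (\<lambda>x. h x / real n) (\<Phi> \<omega>)))"
      by (intro Bochner_Integration.integral_cong refl) (simp add: b_def lap_a)
    also have "\<dots> = real n * (1 - Lf (\<lambda>x. h x / real n))"
      unfolding Lf_def by (subst Bochner_Integration.integral_mult_right_zero, subst Bochner_Integration.integral_diff)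
        (auto intro!: integrable_lap simp: prob_space)
    finally show ?thesis using int b by (subst nn_integral_eq_integral) (auto simp: \<alpha>1)
  qed
  have lim: "(\<lambda>n. \<integral>\<^sup>+\<omega>. ennreal (b n \<omega>) \<partial>P) \<longlonglongrightarrow> ennreal (\<psi> h)"
    unfolding int_b by (intro tendsto_ennrealI Lf_scaling_limit[OF C])
  have b_lim: "(\<lambda>n. b n \<omega>) \<longlonglongrightarrow> a \<omega>" if \<omega>: "\<omega> \<in> space P" for \<omega>
  proof (rule real_tendsto_sandwich[OF _ _ _ tendsto_const])
    show "\<forall>\<^sub>F n in sequentially. b n \<omega> \<le> a \<omega>" using b(2)[OF \<omega>] by (intro always_eventually) simp
    show "\<forall>\<^sub>F n in sequentially. a \<omega> - a \<omega> * a \<omega> / real n \<le> b n \<omega>"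
      using eventually_gt_at_top[of 0]
    proof eventually_elim
      case (elim n)
      define y where "y = a \<omega> / real n"
      have y: "0 \<le> y" using a(2)[OF \<omega>] by (simp add: y_def)
      have "exp (-y) * (1 + y) \<le> exp (-y) * exp y" by (intro mult_left_mono exp_ge_add_one_self) auto
      then have "exp (-y) * (1 + y) \<le> 1" by (simp add: exp_add[symmetric])
      then have "exp (-y) \<le> 1 / (1 + y)" using y by (simp add: field_simps)
      also have "\<dots> \<le> 1 - y + y * y" using y by (simp add: field_simps)
      finally have "real n * (y - y * y) \<le> b n \<omega>"
        unfolding b_def y_def[symmetric] by (intro mult_left_mono) auto
      moreover have "real n * (y - y * y) = a \<omega> - a \<omega> * a \<omega> / real n"
        using elim by (simp add: y_def field_simps)
      ultimately show ?case by simp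
    qed
    have "(\<lambda>n. a \<omega> - a \<omega> * a \<omega> / real n) \<longlonglongrightarrow> a \<omega> - 0"
      by (intro tendsto_diff tendsto_const lim_const_over_n)
    then show "(\<lambda>n. a \<omega> - a \<omega> * a \<omega> / real n) \<longlonglongrightarrow> a \<omega>" by simp
  qed
  have "(\<integral>\<^sup>+\<omega>. ennreal (a \<omega>) \<partial>P) = ennreal (\<psi> h)"
  proof (rule antisym)
    have "(\<integral>\<^sup>+\<omega>. ennreal (a \<omega>) \<partial>P) = (\<integral>\<^sup>+\<omega>. liminf (\<lambda>n. ennreal (b n \<omega>)) \<partial>P)"
      using b_lim by (intro nn_integral_cong lim_imp_Liminf[symmetric] tendsto_ennrealI) auto
    also have "\<dots> \<le> liminf (\<lambda>n. \<integral>\<^sup>+\<omega>. ennreal (b n \<omega>) \<partial>P)"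
      by (rule nn_integral_liminf) measurable
    also have "\<dots> = ennreal (\<psi> h)" using lim by (intro lim_imp_Liminf) auto
    finally show "(\<integral>\<^sup>+\<omega>. ennreal (a \<omega>) \<partial>P) \<le> ennreal (\<psi> h)" .
    show "ennreal (\<psi> h) \<le> (\<integral>\<^sup>+\<omega>. ennreal (a \<omega>) \<partial>P)"
    proof (rule LIMSEQ_le_const2[OF lim])
      show "\<exists>N. \<forall>n\<ge>N. (\<integral>\<^sup>+\<omega>. ennreal (b n \<omega>) \<partial>P) \<le> (\<integral>\<^sup>+\<omega>. ennreal (a \<omega>) \<partial>P)"
        using b by (intro exI allI impI nn_integral_mono ennreal_leI) auto
    qed
  qed
  moreover have "(\<integral>\<^sup>+x. ennreal (h x) \<partial>intensity) = (\<integral>\<^sup>+\<omega>. ennreal (a \<omega>) \<partial>P)"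
    using a(1) by (subst nn_integral_intensity) (auto intro!: nn_integral_cong)
  ultimately show ?thesis by simp
qed

lemma rel_compact_indicator_BM:
  assumes "A \<in> sets borel" "rel_compact A"
  shows "indicator A \<in> BM"
  using rcfun_imp_BM[OF rcfun_indicator[OF assms], of 1] by (simp add: indicator_def)

text \<open>
  A measure on all of \<open>radon_measures\<close> representing \<open>\<psi>\<close>; normalising its points moves it to the sphere.
\<close>

lemma exists_spectral_source:
  obtains M where "sets M = sets radon_algebra"
    "\<And>h. h \<in> BM \<Longrightarrow> (\<integral>\<^sup>+\<mu>. ennreal ((LINT x|\<mu>. h x) powr \<alpha>) \<partial>M) = ennreal (\<psi> h)"
proof -
  consider "\<alpha> = 1" | "\<psi> h0 = 0" | "\<alpha> < 1" "0 < \<psi> h0"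
    using \<alpha> \<psi>_nonneg[OF tame_h0] by fastforce
  then show thesis
  proof cases
    case 1
    have rad: "intensity \<in> radon_measures"
    proof -
      have "emeasure intensity A < \<infinity>" if A: "A \<in> sets borel" "rel_compact A" for A
      proof -
        have "emeasure intensity A = (\<integral>\<^sup>+x. ennreal (indicator A x) \<partial>intensity)"
          using A(1) by (simp add: ennreal_indicator sets_intensity)
        then show ?thesis using spectral_source_one[OF 1 rel_compact_indicator_BM[OF A]] by simp
      qed
      then show ?thesis by (simp add: radon_measures_def sets_intensity)
    qed
    show thesis
    \<comment> \<open>For \<alpha> = 1 a unit mass at the intensity represents \<psi>.\<close>
    proof (rule that[of "return radon_algebra intensity"])
      fix h :: "'a \<Rightarrow> real" assume h: "h \<in> BM"
      note [measurable] = measurable_integral_BM[OF h]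
      have "(\<integral>\<^sup>+\<mu>. ennreal ((LINT x|\<mu>. h x) powr \<alpha>) \<partial>return radon_algebra intensity) = ennreal ((LINT x|intensity. h x) powr \<alpha>)"
        using rad by (intro nn_integral_return) auto
      then show "(\<integral>\<^sup>+\<mu>. ennreal ((LINT x|\<mu>. h x) powr \<alpha>) \<partial>return radon_algebra intensity) = ennreal (\<psi> h)"
        using integral_BM[OF rad h] spectral_source_one[OF 1 h] 1 by simp
    qed simp
  next
    case 2
    show thesis
    \<comment> \<open>Functions in \<open>BM\<close> are dominated by multiples of
      \<open>h0\<close>, so \<psi> vanishes on all of them.\<close>
    proof (rule that[of "null_measure radon_algebra"])
      fix h :: "'a \<Rightarrow> real" assume h: "h \<in> BM"
      obtain C where C: "tame C h" using tame_BM[OF h] .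
      have "tame (C * 1) (\<lambda>x. C * h0 x)" using tameD(4)[OF C] by (intro tame_scale tame_h0)
      then have "\<psi> h \<le> \<psi> (\<lambda>x. C * h0 x)" using tameD[OF C] by (intro \<psi>_mono) auto
      also have "\<dots> = 0" using \<psi>_scale[OF tame_h0 tameD(4)[OF C]] 2 by simp
      finally have "\<psi> h = 0" using \<psi>_nonneg[OF C] by simp
      then show "(\<integral>\<^sup>+\<mu>. ennreal ((LINT x|\<mu>. h x) powr \<alpha>) \<partial>null_measure radon_algebra) = ennreal (\<psi> h)"
        by simp
    qed simp
  next
    case 3
    obtain r :: "'a \<Rightarrow> real" and d where r: "r \<in> borel_measurable borel" "d \<in> borel_measurable borel"
      "\<And>x. d (r x) = x" "\<And>x. 1/2 \<le> r x" "\<And>x. r x \<le> 1"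
      by (rule borel_coding) (rule that)
    interpret coded_process B P \<Phi> \<alpha> h0 r d
      by unfold_locales (use r 3 in auto)
    have "\<exists>Q s. limit_law B P \<Phi> \<alpha> h0 r d Q s"
    proof (rule exists_limit_law)
      fix Q and s :: "nat \<Rightarrow> nat"
      assume Q: "real_distribution Q" "strict_mono s"
        and lim: "\<And>(f :: (rat \<times> rat \<Rightarrow> real) \<Rightarrow> real) K. continuous_on UNIV (\<lambda>x. f (\<lambda>pq. fill (to_nat pq) x)) \<Longrightarrow>
           (\<And>x. \<bar>f (\<lambda>pq. fill (to_nat pq) x)\<bar> \<le> K) \<Longrightarrow>
           (\<lambda>n. LINT \<omega>|P. w (s n) \<omega> * f (\<lambda>pq. Y (s n) pq \<omega>)) \<longlonglongrightarrow> \<delta> * (LINT x|Q. f (\<lambda>pq. fill (to_nat pq) x))"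
      have "limit_law B P \<Phi> \<alpha> h0 r d Q s"
      proof (intro limit_law.intro coded_process_axioms limit_law_axioms.intro Q)
        fix f :: "(rat \<times> rat \<Rightarrow> real) \<Rightarrow> real" and K
        assume "continuous_on UNIV (\<lambda>x. f (\<lambda>pq. fill (to_nat pq) x))" "\<And>x. \<bar>f (\<lambda>pq. fill (to_nat pq) x)\<bar> \<le> K"
        then show "(\<lambda>n. LINT \<omega>|P. w (s n) \<omega> * f (\<lambda>pq. Y (s n) pq \<omega>)) \<longlonglongrightarrow> \<delta> * (LINT x|Q. f (\<lambda>pq. fill (to_nat pq) x))"
          by (rule lim[of f K])
      qed
      then show ?thesis by blast
    qed
    then obtain Q s where "limit_law B P \<Phi> \<alpha> h0 r d Q s" by blast
    then interpret L: limit_law B P \<Phi> \<alpha> h0 r d Q s .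
    define D where "D = distr Q radon_algebra L.\<mu>"
    have sD: "sets D = sets radon_algebra" by (simp add: D_def)
    obtain c where c: "0 < c" "\<And>y. 0 \<le> y \<Longrightarrow> log_integral (\<lambda>_. y) (1/2) 1 = ennreal (c * y)"
      using log_integral_const by blast
    define I where "I h = (\<integral>\<^sup>+\<mu>. ennreal ((LINT x|\<mu>. h x) powr \<alpha>) \<partial>D)" for h :: "'a \<Rightarrow> real"
    have key: "levy_kernel \<alpha> 1 * (ennreal \<delta> * I h) = ennreal (c * \<psi> h)" if h: "h \<in> BM" for h
    proof -
      note [measurable] = measurable_integral_BM[OF h]
      have "I h = (\<integral>\<^sup>+x. ennreal ((LINT y|L.\<mu> x. h y) powr \<alpha>) \<partial>Q)"
        unfolding I_def D_def by (rule nn_integral_distr[OF L.measurable_\<mu>]) measurable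
      moreover obtain C where "tame C h" using tame_BM[OF h] .
      ultimately show ?thesis using L.nn_integral_powr_\<mu>[OF h] c(2) \<psi>_nonneg by metis
    qed
    \<comment> \<open>A function with positive \<psi> is needed to conclude from the identity
      \<open>key\<close> that the kernel constant is neither 0 nor infinite.\<close>
    have nz: "\<exists>h\<in>BM. 0 < \<psi> h"
    proof (rule ccontr)
      assume neg: "\<not> (\<exists>h\<in>BM. 0 < \<psi> h)"
      have "(\<lambda>n. \<psi> (\<lambda>x. indicator (V n) x * h0 x)) \<longlonglongrightarrow> \<psi> h0"
      proof (rule \<psi>_tendsto[where C=1])
        show "tame 1 (\<lambda>x. indicator (V n) x * h0 x)" for n
          using h0_pos unfolding tame_def by (auto simp: indicator_def less_imp_le)
        show "AE \<omega> in P. AE x in \<Phi> \<omega>. (\<lambda>n. indicator (V n) x * h0 x) \<longlonglongrightarrow> h0 x"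
          by (intro AE_I2 V_indicator_tendsto)
      qed (rule tame_h0)
      moreover have "(\<lambda>x. indicator (V n) x * h0 x) \<in> BM" for n
        using h0_pos h0_le by (intro rcfun_imp_BM[where K=1] rcfun_V) (auto simp: indicator_def less_imp_le)
      then have "\<psi> (\<lambda>x. indicator (V n) x * h0 x) \<le> 0" for n using neg not_less by blast
      ultimately have "\<psi> h0 \<le> 0" by (intro LIMSEQ_le_const2) auto
      then show False using 3 by simp
    qed
    then obtain h1 where h1: "h1 \<in> BM" "0 < \<psi> h1" by blast
    have k1: "levy_kernel \<alpha> 1 * (ennreal \<delta> * I h1) = ennreal (c * \<psi> h1)" by (rule key[OF h1(1)])
    have prod: "levy_kernel \<alpha> 1 * (ennreal \<delta> * I h1) \<noteq> 0" "levy_kernel \<alpha> 1 * (ennreal \<delta> * I h1) \<noteq> top"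
      using c(1) h1(2) unfolding k1 by auto
    then have "levy_kernel \<alpha> 1 \<noteq> 0" "levy_kernel \<alpha> 1 \<noteq> top"
      by (auto simp: ennreal_mult_eq_top_iff)
    then obtain k where k: "0 < k" "levy_kernel \<alpha> 1 = ennreal k"
      by (cases "levy_kernel \<alpha> 1") (auto simp: less_le)
    show thesis
    \<comment> \<open>The factor solves k \<delta> I h = c \<psi> h for \<psi> h.\<close>
    proof (rule that[of "scale_measure (ennreal (k * \<delta> / c)) D"])
      show "sets (scale_measure (ennreal (k * \<delta> / c)) D) = sets radon_algebra" by (simp add: sD)
      fix h :: "'a \<Rightarrow> real" assume h: "h \<in> BM"
      note [measurable] = measurable_integral_BM[OF h]
      obtain C where C: "tame C h" using tame_BM[OF h] .
      have "(\<integral>\<^sup>+\<mu>. ennreal ((LINT x|\<mu>. h x) powr \<alpha>) \<partial>scale_measure (ennreal (k * \<delta> / c)) D) = ennreal (k * \<delta> / c) * I h"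
        unfolding I_def by (rule nn_integral_scale_measure) (simp add: measurable_cong_sets[OF sD refl])
      also have "\<dots> = ennreal (1 / c) * (ennreal k * (ennreal \<delta> * I h))"
        using c k \<delta>_pos by (simp add: ennreal_mult'[symmetric] mult.assoc[symmetric])
      also have "\<dots> = ennreal (1 / c) * ennreal (c * \<psi> h)" using key[OF h] k by simp
      also have "\<dots> = ennreal (\<psi> h)"
        using c(1) \<psi>_nonneg[OF C] by (simp add: ennreal_mult[symmetric])
      finally show "(\<integral>\<^sup>+\<mu>. ennreal ((LINT x|\<mu>. h x) powr \<alpha>) \<partial>scale_measure (ennreal (k * \<delta> / c)) D) = ennreal (\<psi> h)" .
    qed
  qed
qed

end

section \<open>Normalisation of Radon measures to the sphere\<close>

context lcsc_base
begin

lemma emeasure_null: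
  assumes "\<mu> \<in> radon_measures" "emeasure \<mu> UNIV = 0"
  shows "emeasure \<mu> A = 0"
  using emeasure_space[of \<mu> A] assms space_radon[OF assms(1)] by simp

text \<open>The basic sets have finite mass and countably many of them cover the space, so a nonzero
  measure cannot vanish on all of them.\<close>

lemma exists_index:
  assumes \<mu>: "\<mu> \<in> radon_measures" "emeasure \<mu> UNIV \<noteq> 0"
  shows "\<exists>i\<ge>1. 0 < emeasure \<mu> (B i) \<and> emeasure \<mu> (B i) < \<infinity>"
proof (rule ccontr)
  assume neg: "\<not> ?thesis"
  have B: "B i \<in> sets \<mu>" for i using open_B[of i] by (simp add: sets_radon[OF \<mu>(1)])
  have "emeasure \<mu> (B (Suc i)) = 0" for i
  proof -
    have "emeasure \<mu> (B (Suc i)) < \<infinity>"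
      using \<mu>(1) rel_compact_B[of "Suc i"] borel_open[OF open_B] unfolding radon_measures_def by auto
    then show ?thesis using neg by (auto simp: zero_less_iff_neq_zero)
  qed
  then have "(\<Union>i. B (Suc i)) \<in> null_sets \<mu>" using B by (intro null_sets_UN) auto
  moreover have "(\<Union>i. B (Suc i)) = UNIV"
  proof (intro equalityI subset_UNIV subsetI)
    fix x obtain i where "1 \<le> i" "x \<in> B i" using basisE[of UNIV x] by auto
    then show "x \<in> (\<Union>i. B (Suc i))" by (intro UN_I[of "i - 1"]) auto
  qed
  ultimately show False using \<mu>(2) by auto
qed

definition mass :: "'a measure \<Rightarrow> real" where
  "mass \<mu> = measure \<mu> (B (first_index B \<mu>))"

lemma mass_first_index:
  assumes "\<mu> \<in> radon_measures" "emeasure \<mu> UNIV \<noteq> 0"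
  shows "0 < mass \<mu>" "emeasure \<mu> (B (first_index B \<mu>)) = ennreal (mass \<mu>)"
proof -
  have "0 < emeasure \<mu> (B (first_index B \<mu>)) \<and> emeasure \<mu> (B (first_index B \<mu>)) < \<infinity>"
    unfolding first_index_def using exists_index[OF assms] LeastI_ex by (metis (no_types, lifting))
  then show "0 < mass \<mu>" "emeasure \<mu> (B (first_index B \<mu>)) = ennreal (mass \<mu>)"
    unfolding mass_def measure_def by (auto simp: enn2real_positive_iff)
qed

lemma first_index_scale:
  assumes "0 < c"
  shows "first_index B (scale_measure (ennreal c) \<mu>) = first_index B \<mu>"
proof -
  have "(0 < ennreal c * e \<and> ennreal c * e < \<infinity>) \<longleftrightarrow> (0 < e \<and> e < \<infinity>)" for e
    using assms by (auto simp: ennreal_zero_less_mult_iff ennreal_mult_less_top)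
  then show ?thesis by (simp add: first_index_def)
qed

text \<open>The null measure will get density zero, so its image is arbitrary.\<close>

definition normalise :: "'a measure \<Rightarrow> 'a measure" where
  "normalise \<mu> = (if emeasure \<mu> UNIV = 0 then return borel undefined
     else scale_measure (ennreal (1 / mass \<mu>)) \<mu>)"

lemma normalise_sphere:
  assumes \<mu>: "\<mu> \<in> radon_measures"
  shows "normalise \<mu> \<in> sphere B"
proof (cases "emeasure \<mu> UNIV = 0")
  case True
  \<comment> \<open>A Dirac mass gives \<open>B 0\<close>, the whole space, mass 1; its first index
    is therefore 0 and it lies on the sphere.\<close>
  define \<rho> where "\<rho> = return borel (undefined :: 'a)"
  have B0: "B 0 = UNIV" using base by (simp add: base_seq_def)
  have e: "emeasure \<rho> UNIV = 1" by (simp add: \<rho>_def)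
  then have "first_index B \<rho> = 0" by (auto simp: first_index_def B0 intro!: Least_eq_0)
  moreover have "\<rho> \<in> radon_measures" by (simp add: radon_measures_def \<rho>_def indicator_def)
  moreover have "\<rho> \<noteq> null_measure borel" using e by auto
  ultimately have "\<rho> \<in> sphere B" using e by (simp add: sphere_def B0)
  then show ?thesis using True by (simp add: normalise_def \<rho>_def)
next
  case False
  define \<nu> where "\<nu> = scale_measure (ennreal (1 / mass \<mu>)) \<mu>"
  note m = mass_first_index[OF \<mu> False]
  have "emeasure \<nu> (B (first_index B \<nu>)) = ennreal (1 / mass \<mu>) * ennreal (mass \<mu>)"
    using m by (simp add: \<nu>_def first_index_scale)
  also have "\<dots> = 1" using m(1) by (simp add: ennreal_mult'[symmetric])
  finally have 1: "emeasure \<nu> (B (first_index B \<nu>)) = 1" .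
  then have "\<nu> \<noteq> null_measure borel" by auto
  moreover have "\<nu> \<in> radon_measures"
    using \<mu> by (auto simp: radon_measures_def \<nu>_def ennreal_mult_less_top)
  ultimately show ?thesis using 1 False by (simp add: sphere_def normalise_def \<nu>_def)
qed

text \<open>The first index takes countably many values, and for a fixed index the mass is an
  evaluation.\<close>

lemma measurable_mass: "mass \<in> borel_measurable radon_algebra"
proof -
  have e: "(\<lambda>\<mu>. emeasure \<mu> (B i)) \<in> borel_measurable radon_algebra" for i
    by (intro measurable_emeasure_radon borel_open open_B)
  have "first_index B \<in> radon_algebra \<rightarrow>\<^sub>M count_space UNIV"
    unfolding first_index_def[abs_def] using e by measurable
  moreover have "(\<lambda>\<mu>. measure \<mu> (B i)) \<in> borel_measurable radon_algebra" for i
    unfolding measure_def using e by measurable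
  ultimately show ?thesis
    unfolding mass_def[abs_def] by (rule measurable_compose_countable[where f="\<lambda>i \<mu>. measure \<mu> (B i)", rotated])
qed

lemma measurable_normalise: "normalise \<in> radon_algebra \<rightarrow>\<^sub>M restrict_space radon_algebra (sphere B)"
proof (rule measurable_restrict_space2)
  show "normalise \<in> space radon_algebra \<rightarrow> sphere B" using normalise_sphere by auto
  show "normalise \<in> radon_algebra \<rightarrow>\<^sub>M radon_algebra"
  proof (rule measurable_radonI)
    show "normalise \<mu> \<in> radon_measures" if "\<mu> \<in> space radon_algebra" for \<mu>
      using normalise_sphere[of \<mu>] that by (simp add: sphere_def)
    fix A :: "'a set" assume A: "A \<in> sets borel"
    note [measurable] = measurable_emeasure_radon[OF A] measurable_mass measurable_emeasure_radon[of UNIV]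
    have "emeasure (normalise \<mu>) A = (if emeasure \<mu> UNIV = 0 then indicator A undefined
        else ennreal (1 / mass \<mu>) * emeasure \<mu> A)" for \<mu>
      using A by (simp add: normalise_def)
    moreover have "(\<lambda>\<mu>. if emeasure \<mu> UNIV = 0 then indicator A undefined
        else ennreal (1 / mass \<mu>) * emeasure \<mu> A) \<in> borel_measurable radon_algebra"
      by measurable
    ultimately show "(\<lambda>\<mu>. emeasure (normalise \<mu>) A) \<in> borel_measurable radon_algebra" by simp
  qed
qed

text \<open>Vague neighbourhoods require continuous functions of compact support. Complete
  regularity places such a bump around each point of a basic set of positive mass; the basic sets on
  which some bump is at least 1/2 cover it, and being countably many, one of them has positive
  mass.\<close>

lemma sphere_bump:
  assumes \<mu>: "\<mu> \<in> sphere B"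
  obtains f :: "'a \<Rightarrow> real" where "continuous_on UNIV f" "f \<in> BM" "0 < (LINT x|\<mu>. f x)"
proof -
  have rad: "\<mu> \<in> radon_measures" and ne: "\<mu> \<noteq> null_measure borel" using \<mu> by (auto simp: sphere_def)
  have sets: "sets \<mu> = sets borel" by (rule sets_radon[OF rad])
  have "emeasure \<mu> UNIV \<noteq> 0"
  proof
    assume "emeasure \<mu> UNIV = 0"
    then have "\<mu> = null_measure borel"
      using emeasure_null[OF rad] by (intro measure_eqI) (auto simp: sets)
    then show False using ne by simp
  qed
  then obtain i where i: "1 \<le> i" "0 < emeasure \<mu> (B i)" using exists_index[OF rad] by blast
  define J where "J = {j. \<exists>f::'a \<Rightarrow> real. continuous_on UNIV f \<and> f \<in> BM \<and> (\<forall>x\<in>B j. 1/2 \<le> f x)}"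
  have "B i \<subseteq> (\<Union>j\<in>J. B j)"
  proof
    fix x assume x: "x \<in> B i"
    have "closedin euclidean (- B i) \<and> x \<in> topspace euclidean - (- B i)"
      using x open_B[of i] by (simp add: closed_closedin[symmetric] closed_Compl)
    then obtain g :: "'a \<Rightarrow> real" where g: "continuous_map euclidean (top_of_set {0..1}) g" "g x = 0" "g ` (- B i) \<subseteq> {1}"
      using completely_regular_euclidean unfolding completely_regular_space_def by blast
    define f where "f y = 1 - g y" for y
    have gc: "continuous_on UNIV g" and g01: "0 \<le> g y" "g y \<le> 1" for y
      using g(1) by (auto simp: continuous_map_in_subtopology Pi_iff image_subset_iff)
    have fc: "continuous_on UNIV f" unfolding f_def by (intro continuous_intros gc)
    have "{y. f y \<noteq> 0} \<subseteq> B i" using g(3) by (auto simp: f_def)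
    then have "compact (closure {y. f y \<noteq> 0})"
      using rel_compact_subset[OF rel_compact_B[OF i(1)]] by (simp add: rel_compact_def)
    then have fBM: "f \<in> BM"
      using g01 borel_measurable_continuous_onI[OF fc]
      by (auto simp: BM_def f_def bounded_iff intro!: exI[of _ 1])
    have "open {y. 1/2 < f y}" by (intro open_Collect_less continuous_intros fc)
    moreover have "x \<in> {y. 1/2 < f y}" using g(2) by (simp add: f_def)
    ultimately obtain j where j: "1 \<le> j" "x \<in> B j" "B j \<subseteq> {y. 1/2 < f y}" using basisE by blast
    then have "\<forall>x\<in>B j. 1/2 \<le> f x" by (auto intro: less_imp_le)
    then show "x \<in> (\<Union>j\<in>J. B j)" using fc fBM j(2) by (auto simp: J_def)
  qed
  moreover have "B j \<in> sets \<mu>" for j using open_B[of j] by (simp add: sets)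
  ultimately have le: "emeasure \<mu> (B i) \<le> emeasure \<mu> (\<Union>j\<in>J. B j)" by (intro emeasure_mono) auto
  have "\<exists>j\<in>J. 0 < emeasure \<mu> (B j)"
  proof (rule ccontr)
    assume "\<not> ?thesis"
    then have "(\<Union>j\<in>J. B j) \<in> null_sets \<mu>"
      using \<open>\<And>j. B j \<in> sets \<mu>\<close> by (intro null_sets_UN') (auto simp: null_sets_def)
    then show False using le i(2) by auto
  qed
  then obtain j f where f: "0 < emeasure \<mu> (B j)" "continuous_on UNIV f" "f \<in> BM" "\<And>x. x \<in> B j \<Longrightarrow> 1/2 \<le> f x"
    by (auto simp: J_def)
  have "ennreal (1/2) * emeasure \<mu> (B j) = (\<integral>\<^sup>+x. ennreal (1/2) * indicator (B j) x \<partial>\<mu>)"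
    using \<open>B j \<in> sets \<mu>\<close> by (simp add: nn_integral_cmult_indicator)
  also have "\<dots> \<le> (\<integral>\<^sup>+x. ennreal (f x) \<partial>\<mu>)"
    using f(4) by (intro nn_integral_mono) (auto simp: indicator_def intro!: ennreal_leI simp del: ennreal_half)
  also have "\<dots> = ennreal (LINT x|\<mu>. f x)" by (rule integral_BM(1)[OF rad f(3), symmetric])
  finally have le: "ennreal (1/2) * emeasure \<mu> (B j) \<le> ennreal (LINT x|\<mu>. f x)" .
  have "0 < ennreal (1/2) * emeasure \<mu> (B j)"
    using f(1) by (simp add: ennreal_zero_less_mult_iff del: ennreal_half)
  then have "0 < ennreal (LINT x|\<mu>. f x)" using le by (rule less_le_trans)
  then show thesis using that f by simp
qed

text \<open>The set of \<nu> with <f, \<nu>> > c, where f is a bump for \<mu> and c is half of <f,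
  \<mu>>, is a vague neighbourhood of \<mu>. Markov's inequality for <f, \<nu>>^\<alpha> bounds its
  measure.\<close>

lemma locally_finite_on_sphereI:
  assumes sets: "sets \<sigma> = sets (restrict_space radon_algebra (sphere B))"
    and fin: "\<And>f. f \<in> BM \<Longrightarrow> (\<integral>\<^sup>+\<mu>. ennreal ((LINT x|\<mu>. f x) powr \<alpha>) \<partial>\<sigma>) < \<infinity>"
    and \<alpha>: "0 < \<alpha>"
  shows "locally_finite_on_sphere B \<sigma>"
  unfolding locally_finite_on_sphere_def
proof (intro conjI ballI sets)
  fix \<mu> assume \<mu>: "\<mu> \<in> sphere B"
  obtain f :: "'a \<Rightarrow> real" where f: "continuous_on UNIV f" "f \<in> BM" "0 < (LINT x|\<mu>. f x)"
    using sphere_bump[OF \<mu>] .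
  define c where "c = (LINT x|\<mu>. f x) / 2"
  have c: "0 < c" "c < (LINT x|\<mu>. f x)" using f(3) by (auto simp: c_def)
  define T where "T = {\<nu> \<in> radon_measures. (LINT x|\<nu>. f x) \<in> {c<..}}"
  define U where "U = T \<inter> sphere B"
  have "openin vague_topology T"
    unfolding vague_topology_def T_def using f(1,2)
    by (intro topology_generated_by_Basis CollectI exI[of _ f] exI[of _ "{c<..}"]) (auto simp: BM_def)
  then have "openin (subtopology vague_topology (sphere B)) U"
    unfolding openin_subtopology U_def by blast
  moreover have "\<mu> \<in> U" using \<mu> c by (auto simp: U_def T_def sphere_def)
  moreover have U: "U \<in> sets \<sigma>"
  proof -
    have "T = (\<lambda>\<mu>. LINT x|\<mu>. f x) -` {c<..} \<inter> space radon_algebra" by (auto simp: T_def)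
    then have "T \<in> sets radon_algebra"
      using measurable_sets[OF measurable_integral_BM[OF f(2)], of "{c<..}"] by simp
    then show ?thesis unfolding sets U_def sets_restrict_space by auto
  qed
  moreover have "emeasure \<sigma> U < \<infinity>"
  proof -
    have "ennreal (c powr \<alpha>) * emeasure \<sigma> U = (\<integral>\<^sup>+\<nu>. ennreal (c powr \<alpha>) * indicator U \<nu> \<partial>\<sigma>)"
      using U by (simp add: nn_integral_cmult_indicator)
    also have "\<dots> \<le> (\<integral>\<^sup>+\<nu>. ennreal ((LINT x|\<nu>. f x) powr \<alpha>) \<partial>\<sigma>)"
      using c \<alpha> by (intro nn_integral_mono) (auto simp: U_def T_def indicator_def intro!: ennreal_leI powr_mono2)
    also have "\<dots> < \<infinity>" by (rule fin[OF f(2)])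
    finally show ?thesis using c by (auto simp: ennreal_mult_less_top)
  qed
  ultimately show "\<exists>U. openin (subtopology vague_topology (sphere B)) U \<and> \<mu> \<in> U \<and> U \<in> sets \<sigma> \<and> emeasure \<sigma> U < \<infinity>"
    by blast
qed

text \<open>
  The \<open>\<alpha>\<close>-homogeneity of \<open>\<mu> \<mapsto> \<langle>h, \<mu>\<rangle>\<^sup>\<alpha>\<close> turns the factor \<open>mass \<mu>\<close> lost in the normalisation into a density.
\<close>

lemma exists_spherical_measure:
  assumes M: "sets M = sets (radon_algebra :: 'a measure measure)"
  obtains \<sigma> where "sets \<sigma> = sets (restrict_space radon_algebra (sphere B))"
    "\<And>h. h \<in> BM \<Longrightarrow> (\<integral>\<^sup>+\<mu>. ennreal ((LINT x|\<mu>. h x) powr \<alpha>) \<partial>\<sigma>) = (\<integral>\<^sup>+\<mu>. ennreal ((LINT x|\<mu>. h x) powr \<alpha>) \<partial>M)"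
proof -
  let ?S = "restrict_space radon_algebra (sphere B)"
  define W where "W \<mu> = (if emeasure \<mu> UNIV = 0 then 0 else ennreal (mass \<mu> powr \<alpha>))" for \<mu> :: "'a measure"
  have Wm: "W \<in> borel_measurable M"
    using measurable_mass measurable_emeasure_radon[of "UNIV :: 'a set"]
    unfolding W_def[abs_def] measurable_cong_sets[OF M refl] by measurable
  have Nm: "normalise \<in> density M W \<rightarrow>\<^sub>M ?S" "normalise \<in> M \<rightarrow>\<^sub>M ?S"
    using measurable_normalise by (simp_all add: measurable_cong_sets[OF M refl])
  show thesis
  proof (rule that[of "distr (density M W) ?S normalise"])
    fix h :: "'a \<Rightarrow> real" assume h: "h \<in> BM"
    define F where "F \<mu> = ennreal ((LINT x|\<mu>. h x) powr \<alpha>)" for \<mu>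
    have "F \<in> borel_measurable radon_algebra"
      using measurable_integral_BM[OF h] unfolding F_def[abs_def] by measurable
    then have Fm: "F \<in> borel_measurable ?S" by (rule measurable_restrict_space1)
    have "(\<integral>\<^sup>+\<mu>. F \<mu> \<partial>distr (density M W) ?S normalise) = (\<integral>\<^sup>+\<mu>. F (normalise \<mu>) \<partial>density M W)"
      using Fm by (intro nn_integral_distr[OF Nm(1)]) simp
    also have "\<dots> = (\<integral>\<^sup>+\<mu>. W \<mu> * F (normalise \<mu>) \<partial>M)"
      by (intro nn_integral_density Wm measurable_compose[OF Nm(2) Fm])
    also have "\<dots> = (\<integral>\<^sup>+\<mu>. F \<mu> \<partial>M)"
    proof (rule nn_integral_cong)
      fix \<mu> assume "\<mu> \<in> space M"
      then have \<mu>: "\<mu> \<in> radon_measures" using sets_eq_imp_space_eq[OF M] by simp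
      have hm: "h \<in> borel_measurable \<mu>" using h by (simp add: BM_def measurable_cong_sets[OF sets_radon[OF \<mu>] refl])
      note I = integral_BM[OF \<mu> h]
      show "W \<mu> * F (normalise \<mu>) = F \<mu>"
      proof (cases "emeasure \<mu> UNIV = 0")
        case True
        then have "\<mu> = null_measure borel"
          using emeasure_null[OF \<mu> True] by (intro measure_eqI) (auto simp: sets_radon[OF \<mu>])
        then show ?thesis using True by (simp add: W_def F_def)
      next
        case False
        note m = mass_first_index[OF \<mu> False]
        have "normalise \<mu> \<in> radon_measures" using normalise_sphere[OF \<mu>] by (simp add: sphere_def)
        note I' = integral_BM[OF this h]
        have "(\<integral>\<^sup>+x. ennreal (h x) \<partial>normalise \<mu>) = ennreal (1 / mass \<mu>) * (\<integral>\<^sup>+x. ennreal (h x) \<partial>\<mu>)"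
          using False hm by (simp add: normalise_def nn_integral_scale_measure)
        then have "ennreal (LINT x|normalise \<mu>. h x) = ennreal ((LINT x|\<mu>. h x) / mass \<mu>)"
          using I m(1) unfolding I'(1) I(1)[symmetric] by (simp add: ennreal_mult[symmetric])
        then have "(LINT x|normalise \<mu>. h x) = (LINT x|\<mu>. h x) / mass \<mu>"
          using I(2) I'(2) m(1) by simp
        then have "mass \<mu> powr \<alpha> * (LINT x|normalise \<mu>. h x) powr \<alpha> = (LINT x|\<mu>. h x) powr \<alpha>"
          using I(2) m(1) by (simp add: powr_mult[symmetric])
        then show ?thesis using False by (simp add: W_def F_def ennreal_mult[symmetric])
      qed
    qed
    finally show "(\<integral>\<^sup>+\<mu>. ennreal ((LINT x|\<mu>. h x) powr \<alpha>) \<partial>distr (density M W) ?S normalise) = (\<integral>\<^sup>+\<mu>. ennreal ((LINT x|\<mu>. h x) powr \<alpha>) \<partial>M)"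
      by (simp add: F_def)
  qed simp
qed

end

context stable_process
begin

lemma exists_spectral_measure:
  obtains \<sigma> where "locally_finite_on_sphere B \<sigma>"
    "\<And>A. A \<in> sets borel \<Longrightarrow> rel_compact A \<Longrightarrow> (\<integral>\<^sup>+\<mu>. ennreal (measure \<mu> A powr \<alpha>) \<partial>\<sigma>) < \<infinity>"
    "\<And>u. (\<And>x. 0 < u x) \<Longrightarrow> (\<And>x. u x \<le> 1) \<Longrightarrow> u \<in> borel_measurable borel \<Longrightarrow> (\<lambda>x. 1 - u x) \<in> BM \<Longrightarrow>
       pgfl P \<Phi> u = exp (- (LINT \<mu>|\<sigma>. (LINT x|\<mu>. 1 - u x) powr \<alpha>))"
proof -
  obtain M where M: "sets M = sets radon_algebra"
    "\<And>h. h \<in> BM \<Longrightarrow> (\<integral>\<^sup>+\<mu>. ennreal ((LINT x|\<mu>. h x) powr \<alpha>) \<partial>M) = ennreal (\<psi> h)"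
    using exists_spectral_source by blast
  obtain \<sigma> where sets: "sets \<sigma> = sets (restrict_space radon_algebra (sphere B))"
    and "\<And>h. h \<in> BM \<Longrightarrow> (\<integral>\<^sup>+\<mu>. ennreal ((LINT x|\<mu>. h x) powr \<alpha>) \<partial>\<sigma>) = (\<integral>\<^sup>+\<mu>. ennreal ((LINT x|\<mu>. h x) powr \<alpha>) \<partial>M)"
    by (rule exists_spherical_measure[OF M(1), of \<alpha>]) (rule that)
  then have \<sigma>: "(\<integral>\<^sup>+\<mu>. ennreal ((LINT x|\<mu>. h x) powr \<alpha>) \<partial>\<sigma>) = ennreal (\<psi> h)" if "h \<in> BM" for h
    using that M(2) by metis
  have space: "\<mu> \<in> radon_measures" if "\<mu> \<in> space \<sigma>" for \<mu>
    using that sets_eq_imp_space_eq[OF sets] by (simp add: space_restrict_space)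
  show thesis
  proof (rule that[of \<sigma>])
    show "locally_finite_on_sphere B \<sigma>"
      using \<sigma> by (intro locally_finite_on_sphereI[OF sets _ \<alpha>(1)]) simp
    fix A :: "'a set" assume A: "A \<in> sets borel" "rel_compact A"
    have "(\<integral>\<^sup>+\<mu>. ennreal (measure \<mu> A powr \<alpha>) \<partial>\<sigma>) = (\<integral>\<^sup>+\<mu>. ennreal ((LINT x|\<mu>. indicator A x) powr \<alpha>) \<partial>\<sigma>)"
      using A(1) by (intro nn_integral_cong) (simp add: space_radon[OF space] sets_radon[OF space])
    then show "(\<integral>\<^sup>+\<mu>. ennreal (measure \<mu> A powr \<alpha>) \<partial>\<sigma>) < \<infinity>"
      using \<sigma>[OF rel_compact_indicator_BM[OF A]] by simp
  next
    fix u :: "'a \<Rightarrow> real"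
    assume u: "\<And>x. 0 < u x" "\<And>x. u x \<le> 1" "u \<in> borel_measurable borel" "(\<lambda>x. 1 - u x) \<in> BM"
    obtain C where C: "tame C (\<lambda>x. 1 - u x)" using tame_BM[OF u(4)] .
    have "(\<lambda>\<mu>. LINT x|\<mu>. 1 - u x) \<in> borel_measurable \<sigma>"
      using measurable_restrict_space1[OF measurable_integral_BM[OF u(4)], of "sphere B"]
      by (simp add: measurable_cong_sets[OF sets refl])
    \<comment> \<open>The extended integral is the finite number \<psi> (1 - u), so the real-valued
      integral in the representation is not a default value.\<close>
    then have "(LINT \<mu>|\<sigma>. (LINT x|\<mu>. 1 - u x) powr \<alpha>) = enn2real (\<integral>\<^sup>+\<mu>. ennreal ((LINT x|\<mu>. 1 - u x) powr \<alpha>) \<partial>\<sigma>)"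
      by (intro integral_eq_nn_integral powr_real_measurable borel_measurable_const AE_I2 powr_ge_zero)
    also have "\<dots> = \<psi> (\<lambda>x. 1 - u x)" using \<sigma>[OF u(4)] \<psi>_nonneg[OF C] by simp
    finally show "pgfl P \<Phi> u = exp (- (LINT \<mu>|\<sigma>. (LINT x|\<mu>. 1 - u x) powr \<alpha>))"
      using pgfl_\<psi>[OF u] by simp
  qed
qed

end

section \<open>Equivalence of discrete stability and the spectral representation\<close>

theorem corollary16:
  fixes P :: "'w measure"
    and \<Phi> :: "'w \<Rightarrow> 'a::{t2_space, second_countable_topology} measure"
    and B :: "nat \<Rightarrow> 'a set"
    and \<alpha> :: real
  assumes "locally_compact_space (euclidean :: 'a topology)"
    and "base_seq B"
    and "0 < \<alpha>" and "\<alpha> \<le> 1"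
    and "prob_space P"
    and "point_process P \<Phi>"
  shows "discrete_stable P \<Phi> \<alpha> \<longleftrightarrow>
    (\<exists>\<sigma> :: 'a measure measure.
       locally_finite_on_sphere B \<sigma> \<and>
       (\<forall>A\<in>sets borel. rel_compact A \<longrightarrow>
          (\<integral>\<^sup>+ \<mu>. ennreal (measure \<mu> A powr \<alpha>) \<partial>\<sigma>) < \<infinity>) \<and>
       (\<forall>u. (\<forall>x. 0 < u x \<and> u x \<le> 1) \<and> u \<in> borel_measurable borel \<and> (\<lambda>x. 1 - u x) \<in> BM \<longrightarrow>
          pgfl P \<Phi> u = exp (- (LINT \<mu>|\<sigma>. (LINT x|\<mu>. 1 - u x) powr \<alpha>))))"
proof -
  interpret prob_space P by fact
  interpret lcsc_process B P \<Phi> by unfold_locales fact+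
  show ?thesis
  proof
    assume stable: "discrete_stable P \<Phi> \<alpha>"
    obtain h0 :: "'a \<Rightarrow> real" where h0: "h0 \<in> borel_measurable borel" "\<And>x. 0 < h0 x" "\<And>x. h0 x \<le> 1"
      "AE \<omega> in P. (\<integral>\<^sup>+x. ennreal (h0 x) \<partial>\<Phi> \<omega>) < \<infinity>"
      "\<And>A. rel_compact A \<Longrightarrow> \<exists>c>0. \<forall>x\<in>A. c \<le> h0 x"
      by (rule exists_reference) (rule that)
    interpret stable_process B P \<Phi> \<alpha> h0
      by unfold_locales (use assms(3,4) stable h0 in auto)
    show "\<exists>\<sigma> :: 'a measure measure.
       locally_finite_on_sphere B \<sigma> \<and>
       (\<forall>A\<in>sets borel. rel_compact A \<longrightarrow>
          (\<integral>\<^sup>+ \<mu>. ennreal (measure \<mu> A powr \<alpha>) \<partial>\<sigma>) < \<infinity>) \<and>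
       (\<forall>u. (\<forall>x. 0 < u x \<and> u x \<le> 1) \<and> u \<in> borel_measurable borel \<and> (\<lambda>x. 1 - u x) \<in> BM \<longrightarrow>
          pgfl P \<Phi> u = exp (- (LINT \<mu>|\<sigma>. (LINT x|\<mu>. 1 - u x) powr \<alpha>)))"
      by (rule exists_spectral_measure, intro exI conjI) auto
  next
    assume "\<exists>\<sigma> :: 'a measure measure.
       locally_finite_on_sphere B \<sigma> \<and>
       (\<forall>A\<in>sets borel. rel_compact A \<longrightarrow>
          (\<integral>\<^sup>+ \<mu>. ennreal (measure \<mu> A powr \<alpha>) \<partial>\<sigma>) < \<infinity>) \<and>
       (\<forall>u. (\<forall>x. 0 < u x \<and> u x \<le> 1) \<and> u \<in> borel_measurable borel \<and> (\<lambda>x. 1 - u x) \<in> BM \<longrightarrow>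
          pgfl P \<Phi> u = exp (- (LINT \<mu>|\<sigma>. (LINT x|\<mu>. 1 - u x) powr \<alpha>)))"
    then obtain \<sigma> :: "'a measure measure" where
      "\<forall>u. (\<forall>x. 0 < u x \<and> u x \<le> 1) \<and> u \<in> borel_measurable borel \<and> (\<lambda>x. 1 - u x) \<in> BM \<longrightarrow>
          pgfl P \<Phi> u = exp (- (LINT \<mu>|\<sigma>. (LINT x|\<mu>. 1 - u x) powr \<alpha>))"
      by blast
    then show "discrete_stable P \<Phi> \<alpha>" using stable_if_pgfl[OF assms(3), of \<sigma>] by blast
  qed
qed

end
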